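(* Let $n\ge2$. For any $MOY_n$-graph diagram $\Gamma$ with no crossings, $$[\Gamma]_n=\mathcal{N}(\Gamma)\sum_{n\text{-states }s}q^{2rot(s)}\prod_{\text{vertices }v}(-q)^{\pi(s(e_1^v),s(e_2^v))},$$ where $\mathcal{N}(\Gamma)$ is the normalization factor $$\mathcal{N}(\Gamma)=\prod_e[|e|]!\cdot\prod_v q^{\frac{n(n-1)-|e_1^v|\cdot|e_2^v|}{2}}\,[n-|e_0^v|]!,$$ the first product being over all edges $e$ of $\Gamma$ and the second over all vertices $v$ of $\Gamma$. (Annuli of $\Gamma$ are not considered as edges.)
   Context: An $n$-web is an oriented surface embedded in $\mathbb{R}^3$ composed of finitely many directed annuli, directed bands and discs. A band is an embedded square $[0,1]\times[0,1]$ directed from its source $[0,1]\times\{0\}$ to its target $[0,1]\times\{1\}$. The annuli, discs and interiors of bands are disjoint; sources and targets of bands are pairwise disjoint and lie in boundaries of discs; the boundary of each disc contains either exactly $n$ sources and no targets of bands (the disc is a source of the web) or exactly $n$ targets and no sources (a sink); each disc has a marked boundary point outside the bands. An $n$-web diagram is an orientation-preserving projection to $\mathbb{R}^2$ which is an embedding except for finitely many transverse crossings (with over/under information) away from the discs. The bands at a disc are ordered $1,\dots,n$ starting at the marked point, clockwise for a sink and counter-clockwise for a source. Notation: $[k]=\frac{q^k-q^{-k}}{q-q^{-1}}$, $[k]!=[1]\cdots[k]$, $[0]!=1$; for $\sigma\in S_n$, $l(\sigma)$ is the number of inversions and $b_\sigma$ is the positive braid with $l(\sigma)$ crossings on $n$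 downward strands representing $\sigma$. $\langle\cdot\rangle_n\in\mathbb{Z}[q^{\pm1/n}]$ is the unique isotopy invariant of $n$-webs such that: (1) $q^{1/n}\langle\Gamma_+\rangle_n-q^{-1/n}\langle\Gamma_-\rangle_n=(q-q^{-1})\langle\Gamma_0\rangle_n$ for diagrams differing only by a positive crossing, negative crossing, oriented smoothing; (2) adding a small curl with a positive (negative) crossing multiplies the bracket by $q^{n-1/n}$ (by $q^{1/n-n}$); (3) if in some disc $\Gamma$ consists of $n$ parallel downward strands running from the top into a sink with marked point at its bottom, and below it a source with marked point at its top with $n$ parallel downward strands running to the bottom, then $\langle\Gamma\rangle_n=q^{n(n-1)}\sum_{\sigma\in S_n}(-q^{(1-n)/n})^{l(\sigma)}\langle\Gamma_\sigma\rangle_n$, where $\Gamma_\sigma$ has the disc content replaced by $b_\sigma$; (4) adding an unlinked trivial framed knot multiplies the bracket by $[n]$; (5) $\langle\emptyset\rangle_n=1$. An $MOY_n$-graph is a $3$-valent oriented framed graph in $\mathbb{R}^3$ (annular components allowed) whose edges and annuli $e$ are labeled by integers $1\le|e|\le n$ forming a flow: every vertex is either a merge of two edges labeled $k,l$ into one labeled $k+l$, or a split of an edge labeled $k+l$ into two labeled $k,l$. At a vertex $v$, $e_0^v$ is the edge with the largest label; drawing $v$ with all three edges pointing downwards, $e_1^v$ is the left and $e_2^v$ the right of the other two edges. So $|e_0^v|=|e_1^v|+|e_2^v|$. For a crossingless diagram $\Gamma$, the $n$-web $W(\Gamma)$ is obtained by replacing each edge (annulus) $e$ by $|e|$ parallel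 bands (annuli), and each vertex as follows, with $k=|e_1^v|$, $l=|e_2^v|$, everything drawn pointing downwards. Merge: the $k$ strands of $e_1^v$, then the $l$ strands of $e_2^v$ (left to right) are the bands $1,\dots,k+l$ of a sink; the $k+l$ strands of $e_0^v$ (left to right) are the bands $1,\dots,k+l$ of a source below it; for $k+l<i\le n$ the $i$-th band of the source is the $i$-th band of the sink, these $n-k-l$ bands being parallel and crossingless (passing to the right). Split: the $k+l$ strands of $e_0^v$ are the bands $1,\dots,k+l$ of a sink; the $k$ strands of $e_1^v$, then the $l$ strands of $e_2^v$ are the bands $1,\dots,k+l$ of a source below it; the remaining $n-k-l$ bands of the source run, parallel and crossingless, to the remaining bands of the sink in the same way. $[\Gamma]_n=\langle W(\Gamma)\rangle_n$. An $n$-state $s$ of $\Gamma$ assigns to every edge and annulus $e$ an $|e|$-element subset $s(e)\subset\{1,\dots,n\}$ such that at each vertex $s(e_1^v)\cap s(e_2^v)=\emptyset$ and $s(e_1^v)\cup s(e_2^v)=s(e_0^v)$. For each $i$, the edges and annuli $e$ with $i\in s(e)$ form simple closed loops labeled $i$; $rot(s)=\sum_C(s(C)-\frac{n+1}{2})\,rot(C)$ over all these loops $C$, with $s(C)$ the label of $C$ and $rot(C)=+1$ if $C$ is anti-clockwise, $-1$ if clockwise. $\pi(s_1,s_2)=\#\{(i_1,i_2)\in s_1\times s_2:i_1>i_2\}$.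
   Formalization: The formal statement adds that every annulus of Γ is labeled 1; otherwise the formula fails: for n=2 and one annulus labeled 2, the bracket is [2]² while the right side is 1. *)

theory Defs
  imports Complex_Main "HOL-Library.Poly_Mapping" "HOL-Library.FuncSet"
    "HOL-Combinatorics.Permutations"
begin

section \<open>Coefficients\<close>

text \<open>The group ring of the additive group of rationals: integer Laurent polynomials in all
  fractional powers of \<open>q\<close>. It contains \<open>\<int>[q\<^sup>\<plusminus>\<^sup>1\<^sup>/\<^sup>n]\<close> (for every \<open>n\<close>) and the half-integral
  powers of \<open>q\<close> that occur in the individual factors of the normalization.\<close>

type_synonym laurent = "rat \<Rightarrow>\<^sub>0 int"

definition qpow :: "rat \<Rightarrow> laurent" where
  "qpow r = Poly_Mapping.single r 1"

definition laurent_root :: "nat \<Rightarrow> laurent set" where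
  "laurent_root n = {f. Poly_Mapping.keys f \<subseteq> {of_int a / of_nat n | a. True}}"

text \<open>The quotient of \<open>q\<^sup>k - q\<^sup>-\<^sup>k\<close> by \<open>q - q\<^sup>-\<^sup>1\<close>; lemma \<open>qint_eq\<close> shows that it exists and is the
  usual sum.\<close>

definition qint :: "nat \<Rightarrow> laurent" where
  "qint k = (THE x. x * (qpow 1 - qpow (-1)) = qpow (of_nat k) - qpow (- of_nat k))"

definition qfact :: "nat \<Rightarrow> laurent" where
  "qfact k = (\<Prod>j = 1..k. qint j)"

lemma qpow_0 [simp]: "qpow 0 = 1"
  by (simp add: qpow_def)

lemma qpow_mult: "qpow r * qpow s = qpow (r + s)"
  by (simp add: qpow_def mult_single)

lemma qpow_inj: "qpow r = qpow s \<longleftrightarrow> r = s"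
  by (metis qpow_def lookup_single_eq lookup_single_not_eq zero_neq_one)

lemma qpow_step:
  "qpow (x - 1 - 2 * of_nat j) * (qpow 1 - qpow (-1)) =
   qpow (x - 2 * of_nat j) - qpow (x - 2 * of_nat (Suc j))"
proof -
  have "x - 1 - 2 * of_nat j + 1 = x - 2 * of_nat j"
    "x - 1 - 2 * of_nat j + - 1 = x - 2 * of_nat (Suc j)" by simp_all
  then show ?thesis by (simp only: right_diff_distrib qpow_mult)
qed

lemma qint_eq:
  shows "qint k = (\<Sum>j<k. qpow (of_nat k - 1 - 2 * of_nat j))"
    and "qint k * (qpow 1 - qpow (-1)) = qpow (of_nat k) - qpow (- of_nat k)"
proof -
  let ?S = "\<Sum>j<k. qpow (of_nat k - 1 - 2 * of_nat j)"
  have "?S * (qpow 1 - qpow (-1)) =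
      (\<Sum>j<k. qpow (of_nat k - 2 * of_nat j) - qpow (of_nat k - 2 * of_nat (Suc j)))"
    unfolding sum_distrib_right qpow_step ..
  also have "\<dots> = qpow (of_nat k - 2 * of_nat 0) - qpow (of_nat k - 2 * of_nat k)"
    by (rule sum_lessThan_telescope')
  finally have eq: "?S * (qpow 1 - qpow (-1)) = qpow (of_nat k) - qpow (- of_nat k)"
    by simp
  have ne: "qpow 1 - qpow (-1) \<noteq> 0"
    by (simp add: qpow_inj)
  show S: "qint k = ?S"
    unfolding qint_def
  proof (rule the_equality)
    fix x assume "x * (qpow 1 - qpow (-1)) = qpow (of_nat k) - qpow (- of_nat k)"
    then have "x * (qpow 1 - qpow (-1)) = ?S * (qpow 1 - qpow (-1))"
      using eq by (simp only:)
    then show "x = ?S" by (rule mult_right_cancel[OF ne, THEN iffD1])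
  qed (rule eq)
  from eq show "qint k * (qpow 1 - qpow (-1)) = qpow (of_nat k) - qpow (- of_nat k)"
    by (simp only: S)
qed


section \<open>Sliced planar diagrams\<close>

text \<open>A diagram in the plane, up to planar isotopy, is put in general position with respect to
  the height function and read from top to bottom as a list of layers. The layer \<open>(i, g)\<close> consists
  of vertical strands and one elementary piece \<open>g\<close>, with \<open>i\<close> strands to its left; positions are
  counted from \<open>0\<close>. A generic horizontal line meets the diagram in a list of strands, each with a
  direction (and, for MOY graphs, a label). The parameter \<open>io\<close> assigns to an elementary piece the
  strands entering it from above and those leaving it below.\<close>

datatype dir = Down | Up

fun opp :: "dir \<Rightarrow> dir" where
  "opp Down = Up"
| "opp Up = Down"

type_synonym 'g diagram = "(nat \<times> 'g) list"

fun after :: "('g \<Rightarrow> 's list \<times> 's list) \<Rightarrow> 's list \<Rightarrow> nat \<times> 'g \<Rightarrow> 's list" where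
  "after io xs (i, g) = take i xs @ snd (io g) @ drop (i + length (fst (io g))) xs"

definition slice :: "('g \<Rightarrow> 's list \<times> 's list) \<Rightarrow> 'g diagram \<Rightarrow> nat \<Rightarrow> 's list" where
  "slice io D t = foldl (after io) [] (take t D)"

fun fits :: "('g \<Rightarrow> 's list \<times> 's list) \<Rightarrow> 's list \<Rightarrow> nat \<times> 'g \<Rightarrow> bool" where
  "fits io xs (i, g) \<longleftrightarrow> i \<le> length xs \<and> take (length (fst (io g))) (drop i xs) = fst (io g)"

definition closed_diagram :: "('g \<Rightarrow> 's list \<times> 's list) \<Rightarrow> 'g diagram \<Rightarrow> bool" where
  "closed_diagram io D \<longleftrightarrow>
     (\<forall>t < length D. fits io (slice io D t) (D ! t)) \<and> slice io D (length D) = []"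


section \<open>Web diagrams and isotopy\<close>

text \<open>A web diagram is an orientation-preserving projection, so a band or annulus is determined by
  its directed core. \<open>Cap d\<close> is a local maximum whose left leg has direction \<open>d\<close>, \<open>Cup d\<close> a local
  minimum whose left leg has direction \<open>d\<close>. In \<open>Cross b x y\<close> the strand from top left to bottom
  right has direction \<open>x\<close> and lies over the other strand, of direction \<open>y\<close>, iff \<open>b\<close>. After a planar
  isotopy every disc is in the position in which a source has its marked point at the top and all
  its bands leave downwards, and a sink has its marked point at the bottom and all its bands enter
  from above; in both cases the bands \<open>1, \<dots>, n\<close> are then ordered from left to right.\<close>

datatype web_piece = Cap dir | Cup dir | Cross bool dir dir | Source | Sink

fun web_io :: "nat \<Rightarrow> web_piece \<Rightarrow> dir list \<times> dir list" where
  "web_io n (Cap d) = ([], [d, opp d])"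
| "web_io n (Cup d) = ([d, opp d], [])"
| "web_io n (Cross b x y) = ([x, y], [y, x])"
| "web_io n Source = ([], replicate n Down)"
| "web_io n Sink = (replicate n Down, [])"

definition is_web :: "nat \<Rightarrow> web_piece diagram \<Rightarrow> bool" where
  "is_web n D \<longleftrightarrow> closed_diagram (web_io n) D"

text \<open>\<open>k\<close> parallel (hence nested) maxima, respectively minima, at positions \<open>i, i + 1, \<dots>\<close>.\<close>

definition caps :: "nat \<Rightarrow> dir \<Rightarrow> nat \<Rightarrow> web_piece diagram" where
  "caps i d k = map (\<lambda>j. (i + j, Cap d)) [0..<k]"

definition cups :: "nat \<Rightarrow> dir \<Rightarrow> nat \<Rightarrow> web_piece diagram" where
  "cups i d k = map (\<lambda>j. (i + j, Cup d)) (rev [0..<k])"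

text \<open>A vertical strand of direction \<open>d\<close> at position \<open>i\<close> with a small curl on its right or left.
  The two strands of the crossing have the same direction, so the crossing is positive iff \<open>\<not> b\<close>.\<close>

definition curl_right :: "nat \<Rightarrow> dir \<Rightarrow> bool \<Rightarrow> web_piece diagram" where
  "curl_right i d b = [(Suc i, Cap d), (i, Cross b d d), (Suc i, Cup d)]"

definition curl_left :: "nat \<Rightarrow> dir \<Rightarrow> bool \<Rightarrow> web_piece diagram" where
  "curl_left i d b = [(i, Cap (opp d)), (Suc i, Cross b d d), (i, Cup (opp d))]"

text \<open>Generators of isotopy of framed webs on sliced diagrams (Reidemeister, Freyd--Yetter,
  Reshetikhin--Turaev). Planar isotopy: distant layers commute, strands are straightened, strands
  cross an extremum, and a disc is turned by a full rotation, dragging its bands along. Spatial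
  isotopy: the framed Reidemeister moves and the moves of a strand over or under a disc.\<close>

inductive move :: "nat \<Rightarrow> web_piece diagram \<Rightarrow> web_piece diagram \<Rightarrow> bool" for n :: nat where
  interchange:
    "j + length (fst (web_io n h)) \<le> i \<Longrightarrow>
     move n [(i, g), (j, h)]
            [(j, h), (i - length (fst (web_io n h)) + length (snd (web_io n h)), g)]"
| straighten_right: "move n [(i, Cap d), (Suc i, Cup (opp d))] []"
| straighten_left: "move n [(Suc i, Cap d), (i, Cup (opp d))] []"
| cap_slide:
    "move n [(Suc i, Cap d), (i, Cross b x d)] [(i, Cap d), (Suc i, Cross (\<not> b) (opp d) x)]"
| cup_slide:
    "move n [(i, Cross b d x), (Suc i, Cup d)] [(Suc i, Cross (\<not> b) x (opp d)), (i, Cup d)]"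
| turn_source: "move n (caps i Up n @ [(i + n, Source)] @ cups i Up n) [(i, Source)]"
| turn_sink: "move n (caps (i + n) Down n @ [(i + n, Sink)] @ cups i Down n) [(i, Sink)]"
| curl: "move n (curl_right i d b) (curl_left i d b)"
| reidemeister2: "move n [(i, Cross b x y), (i, Cross (\<not> b) y x)] []"
| reidemeister3: \<comment> \<open>the condition excludes the cyclic, non-realizable choice of heights\<close>
    "c = a \<or> c = b \<Longrightarrow>
     move n [(i, Cross a x y), (Suc i, Cross c x z), (i, Cross b y z)]
            [(Suc i, Cross b y z), (i, Cross c x z), (Suc i, Cross a x y)]"
| source_slide:
    "move n ((Suc i, Source) # map (\<lambda>j. (i + j, Cross b x Down)) [0..<n]) [(i, Source)]"
| sink_slide:
    "move n (map (\<lambda>j. (i + j, Cross b x Down)) [0..<n] @ [(i, Sink)]) [(Suc i, Sink)]"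

definition web_step :: "nat \<Rightarrow> web_piece diagram \<Rightarrow> web_piece diagram \<Rightarrow> bool" where
  "web_step n D E \<longleftrightarrow> is_web n D \<and> is_web n E \<and>
     (\<exists>u l r v. move n l r \<and> D = u @ l @ v \<and> E = u @ r @ v)"

definition isotopic :: "nat \<Rightarrow> web_piece diagram \<Rightarrow> web_piece diagram \<Rightarrow> bool" where
  "isotopic n = equivclp (web_step n)"


section \<open>The web bracket\<close>

definition inversions :: "nat \<Rightarrow> (nat \<Rightarrow> nat) \<Rightarrow> nat" where
  "inversions n \<sigma> = card {(a, b). a < b \<and> b < n \<and> \<sigma> b < \<sigma> a}"

text \<open>The entry \<open>j\<close> of a braid word exchanges the strands at positions \<open>j\<close> and \<open>j + 1\<close>;
  \<open>word_perm js a\<close> is the bottom position of the strand starting at the top position \<open>a\<close>.\<close>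

fun word_perm :: "nat list \<Rightarrow> nat \<Rightarrow> nat" where
  "word_perm [] = id"
| "word_perm (j # js) = word_perm js \<circ> Transposition.transpose j (Suc j)"

definition positive_word :: "nat \<Rightarrow> (nat \<Rightarrow> nat) \<Rightarrow> nat list \<Rightarrow> bool" where
  "positive_word n \<sigma> js \<longleftrightarrow>
     (\<forall>j \<in> set js. Suc j < n) \<and> word_perm js = \<sigma> \<and> length js = inversions n \<sigma>"

text \<open>On downward strands the crossing is positive iff the strand from top right to bottom left
  passes over.\<close>

definition positive_braid :: "nat \<Rightarrow> nat list \<Rightarrow> web_piece diagram" where
  "positive_braid i js = map (\<lambda>j. (i + j, Cross False Down Down)) js"

text \<open>The characterization of \<open>\<langle>\<cdot>\<rangle>\<^sub>n\<close>; that exactly one such invariant of webs exists is part of its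
  definition in the literature. Up to planar isotopy all strands in the skein relation point
  downwards. In the sink-source relation \<open>B \<sigma>\<close> is any positive word with \<open>l(\<sigma>)\<close> letters for \<open>\<sigma>\<close>;
  all of these give isotopic braids.\<close>

definition web_bracket :: "nat \<Rightarrow> (web_piece diagram \<Rightarrow> laurent) \<Rightarrow> bool" where
  "web_bracket n br \<longleftrightarrow>
     (\<forall>D. is_web n D \<longrightarrow> br D \<in> laurent_root n) \<and>
     (\<forall>D E. is_web n D \<and> isotopic n D E \<longrightarrow> br D = br E) \<and>
     (\<forall>u v i. is_web n (u @ [(i, Cross False Down Down)] @ v) \<longrightarrow>
        qpow (1 / of_nat n) * br (u @ [(i, Cross False Down Down)] @ v)
        - qpow (- 1 / of_nat n) * br (u @ [(i, Cross True Down Down)] @ v)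
        = (qpow 1 - qpow (-1)) * br (u @ v)) \<and>
     (\<forall>u v i d b c. c \<in> {curl_right i d b, curl_left i d b} \<and> is_web n (u @ c @ v) \<longrightarrow>
        br (u @ c @ v)
        = qpow (if b then 1 / of_nat n - of_nat n else of_nat n - 1 / of_nat n) * br (u @ v)) \<and>
     (\<forall>u v i B. is_web n (u @ [(i, Sink), (i, Source)] @ v) \<and>
        (\<forall>\<sigma>. \<sigma> permutes {..<n} \<longrightarrow> positive_word n \<sigma> (B \<sigma>)) \<longrightarrow>
        br (u @ [(i, Sink), (i, Source)] @ v)
        = qpow (of_nat n * (of_nat n - 1)) *
          (\<Sum>\<sigma> | \<sigma> permutes {..<n}.
             (- qpow ((1 - of_nat n) / of_nat n)) ^ inversions n \<sigma>
             * br (u @ positive_braid i (B \<sigma>) @ v))) \<and>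
     (\<forall>u v i d. is_web n (u @ [(i, Cap d), (i, Cup d)] @ v) \<longrightarrow>
        br (u @ [(i, Cap d), (i, Cup d)] @ v) = qint n * br (u @ v)) \<and>
     br [] = 1"


section \<open>Crossingless MOY graph diagrams\<close>

text \<open>All vertices are drawn with their three edges pointing downwards. \<open>Merge k l\<close> and \<open>Split k l\<close>
  have the edge labeled \<open>k\<close> on the left and the edge labeled \<open>l\<close> on the right.\<close>

datatype moy_piece = MCap dir nat | MCup dir nat | Merge nat nat | Split nat nat

fun moy_io :: "moy_piece \<Rightarrow> (dir \<times> nat) list \<times> (dir \<times> nat) list" where
  "moy_io (MCap d k) = ([], [(d, k), (opp d, k)])"
| "moy_io (MCup d k) = ([(d, k), (opp d, k)], [])"
| "moy_io (Merge k l) = ([(Down, k), (Down, l)], [(Down, k + l)])"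
| "moy_io (Split k l) = ([(Down, k + l)], [(Down, k), (Down, l)])"

definition moy_diagram :: "nat \<Rightarrow> moy_piece diagram \<Rightarrow> bool" where
  "moy_diagram n \<Gamma> \<longleftrightarrow> closed_diagram moy_io \<Gamma> \<and>
     (\<forall>t \<le> length \<Gamma>. \<forall>(d, k) \<in> set (slice moy_io \<Gamma> t). 1 \<le> k \<and> k \<le> n)"

text \<open>The web of a vertex, at position \<open>i\<close> and with \<open>s = k + l\<close>, is the same for a merge and for a
  split: \<open>n - s\<close> bands leave the source to the right of its first \<open>s\<close> bands, turn upwards, and
  enter the sink above it to the right of its first \<open>s\<close> bands.\<close>

definition vertex_web :: "nat \<Rightarrow> nat \<Rightarrow> nat \<Rightarrow> web_piece diagram" where
  "vertex_web n i s =
     caps (i + s) Down (n - s) @ [(i, Sink), (i, Source)] @ cups (i + s) Down (n - s)"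

fun piece_web :: "nat \<Rightarrow> nat \<Rightarrow> moy_piece \<Rightarrow> web_piece diagram" where
  "piece_web n i (MCap d k) = caps i d k"
| "piece_web n i (MCup d k) = cups i d k"
| "piece_web n i (Merge k l) = vertex_web n i (k + l)"
| "piece_web n i (Split k l) = vertex_web n i (k + l)"

text \<open>A strand labeled \<open>k\<close> becomes \<open>k\<close> strands, so a piece at position \<open>i\<close> moves to the position
  given by the sum of the labels of the strands on its left.\<close>

definition moy_web :: "nat \<Rightarrow> moy_piece diagram \<Rightarrow> web_piece diagram" where
  "moy_web n \<Gamma> = concat (map (\<lambda>t. case \<Gamma> ! t of (i, g) \<Rightarrow>
     piece_web n (sum_list (map snd (take i (slice moy_io \<Gamma> t)))) g) [0..<length \<Gamma>])"

definition moy_bracket ::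
    "nat \<Rightarrow> (web_piece diagram \<Rightarrow> laurent) \<Rightarrow> moy_piece diagram \<Rightarrow> laurent" where
  "moy_bracket n br \<Gamma> = br (moy_web n \<Gamma>)"


subsection \<open>Edges, annuli and vertices\<close>

text \<open>The arc \<open>(t, p)\<close> is the piece of \<open>\<Gamma>\<close> at position \<open>p\<close> between the layers \<open>t - 1\<close> and \<open>t\<close>.\<close>

type_synonym arc = "nat \<times> nat"

definition arcs :: "moy_piece diagram \<Rightarrow> arc set" where
  "arcs \<Gamma> = {(t, p). t \<le> length \<Gamma> \<and> p < length (slice moy_io \<Gamma> t)}"

definition strand_at :: "moy_piece diagram \<Rightarrow> arc \<Rightarrow> dir \<times> nat" where
  "strand_at \<Gamma> a = slice moy_io \<Gamma> (fst a) ! snd a"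

text \<open>Arcs that are continued into each other through a layer away from the vertices.\<close>

inductive joined :: "moy_piece diagram \<Rightarrow> arc \<Rightarrow> arc \<Rightarrow> bool" for \<Gamma> where
  left: "\<lbrakk>t < length \<Gamma>; \<Gamma> ! t = (i, g); p < i\<rbrakk> \<Longrightarrow> joined \<Gamma> (t, p) (Suc t, p)"
| right: "\<lbrakk>t < length \<Gamma>; \<Gamma> ! t = (i, g); i + length (fst (moy_io g)) \<le> p;
     p < length (slice moy_io \<Gamma> t)\<rbrakk> \<Longrightarrow>
     joined \<Gamma> (t, p) (Suc t, p - length (fst (moy_io g)) + length (snd (moy_io g)))"
| cap: "\<lbrakk>t < length \<Gamma>; \<Gamma> ! t = (i, MCap d k)\<rbrakk> \<Longrightarrow> joined \<Gamma> (Suc t, i) (Suc t, Suc i)"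
| cup: "\<lbrakk>t < length \<Gamma>; \<Gamma> ! t = (i, MCup d k)\<rbrakk> \<Longrightarrow> joined \<Gamma> (t, i) (t, Suc i)"

definition classes :: "arc set \<Rightarrow> (arc \<Rightarrow> arc \<Rightarrow> bool) \<Rightarrow> arc set set" where
  "classes A R = A // {(a, b). a \<in> A \<and> b \<in> A \<and> equivclp (\<lambda>x y. x \<in> A \<and> y \<in> A \<and> R x y) a b}"

text \<open>The edges and annuli, as sets of arcs.\<close>

definition components :: "moy_piece diagram \<Rightarrow> arc set set" where
  "components \<Gamma> = classes (arcs \<Gamma>) (joined \<Gamma>)"

definition component :: "moy_piece diagram \<Rightarrow> arc \<Rightarrow> arc set" where
  "component \<Gamma> a = (THE C. C \<in> components \<Gamma> \<and> a \<in> C)"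

definition label :: "moy_piece diagram \<Rightarrow> arc set \<Rightarrow> nat" where
  "label \<Gamma> C = (THE k. \<exists>a \<in> C. snd (strand_at \<Gamma> a) = k)"

text \<open>A vertex is represented by the number of its layer; \<open>vertex_arc \<Gamma> v j\<close> is the end at \<open>v\<close> of the
  edge \<open>e\<^sub>j\<^sup>v\<close>, for \<open>j = 0, 1, 2\<close>.\<close>

definition vertices :: "moy_piece diagram \<Rightarrow> nat set" where
  "vertices \<Gamma> = {v. v < length \<Gamma> \<and> (\<exists>k l. snd (\<Gamma> ! v) = Merge k l \<or> snd (\<Gamma> ! v) = Split k l)}"

definition vertex_arc :: "moy_piece diagram \<Rightarrow> nat \<Rightarrow> nat \<Rightarrow> arc" where
  "vertex_arc \<Gamma> v j = (case \<Gamma> ! v of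
       (i, Merge k l) \<Rightarrow> [(Suc v, i), (v, i), (v, Suc i)] ! j
     | (i, Split k l) \<Rightarrow> [(v, i), (Suc v, i), (Suc v, Suc i)] ! j)"

definition vertex_edge :: "moy_piece diagram \<Rightarrow> nat \<Rightarrow> nat \<Rightarrow> arc set" where
  "vertex_edge \<Gamma> v j = component \<Gamma> (vertex_arc \<Gamma> v j)"

definition edges :: "moy_piece diagram \<Rightarrow> arc set set" where
  "edges \<Gamma> = {vertex_edge \<Gamma> v j | v j. v \<in> vertices \<Gamma> \<and> j \<in> {0, 1, 2}}"

text \<open>A crossingless annulus labeled \<open>k\<close> multiplies the bracket by \<open>[n]\<^sup>k\<close>, since its web consists of
  \<open>k\<close> unlinked annuli, but it multiplies the sum over states by the balanced quantum binomial
  coefficient of \<open>n\<close> over \<open>k\<close>, and the normalization ignores it. So the state sum formula can only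
  hold if all annuli are labeled \<open>1\<close>.\<close>

definition annuli :: "moy_piece diagram \<Rightarrow> arc set set" where
  "annuli \<Gamma> = components \<Gamma> - edges \<Gamma>"


subsection \<open>States and rotation numbers\<close>

definition states :: "nat \<Rightarrow> moy_piece diagram \<Rightarrow> (arc set \<Rightarrow> nat set) set" where
  "states n \<Gamma> = {s \<in> components \<Gamma> \<rightarrow>\<^sub>E Pow {1..n}.
     (\<forall>C \<in> components \<Gamma>. card (s C) = label \<Gamma> C) \<and>
     (\<forall>v \<in> vertices \<Gamma>.
        s (vertex_edge \<Gamma> v 1) \<inter> s (vertex_edge \<Gamma> v 2) = {} \<and>
        s (vertex_edge \<Gamma> v 1) \<union> s (vertex_edge \<Gamma> v 2) = s (vertex_edge \<Gamma> v 0))}"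

text \<open>The loops labeled \<open>i\<close>: the connected components of the union of the edges and annuli whose
  state contains \<open>i\<close>.\<close>

definition loops :: "moy_piece diagram \<Rightarrow> (arc set \<Rightarrow> nat set) \<Rightarrow> nat \<Rightarrow> arc set set" where
  "loops \<Gamma> s i = classes {a \<in> arcs \<Gamma>. i \<in> s (component \<Gamma> a)}
     (\<lambda>x y. joined \<Gamma> x y \<or>
        (\<exists>v \<in> vertices \<Gamma>. y = vertex_arc \<Gamma> v 0 \<and> (\<exists>j \<in> {1, 2}. x = vertex_arc \<Gamma> v j)))"

text \<open>The highest maximum of a simple closed loop is a cap with the bounded region below it; the loop
  is anti-clockwise iff the left leg of this cap points downwards. This left leg is the leftmost arc
  of the loop in the first slice that meets the loop.\<close>

definition top_arc :: "arc set \<Rightarrow> arc" where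
  "top_arc C = (let t = Min (fst ` C) in (t, Min {p. (t, p) \<in> C}))"

definition anticlockwise :: "moy_piece diagram \<Rightarrow> arc set \<Rightarrow> bool" where
  "anticlockwise \<Gamma> C \<longleftrightarrow> fst (strand_at \<Gamma> (top_arc C)) = Down"

definition loop_rot :: "moy_piece diagram \<Rightarrow> arc set \<Rightarrow> rat" where
  "loop_rot \<Gamma> C = (if anticlockwise \<Gamma> C then 1 else - 1)"

definition rot :: "nat \<Rightarrow> moy_piece diagram \<Rightarrow> (arc set \<Rightarrow> nat set) \<Rightarrow> rat" where
  "rot n \<Gamma> s =
     (\<Sum>i \<in> {1..n}. \<Sum>C \<in> loops \<Gamma> s i. (of_nat i - (of_nat n + 1) / 2) * loop_rot \<Gamma> C)"

definition inv_pairs :: "nat set \<Rightarrow> nat set \<Rightarrow> nat" where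
  "inv_pairs A B = card {(i, j). i \<in> A \<and> j \<in> B \<and> i > j}"

definition normalization :: "nat \<Rightarrow> moy_piece diagram \<Rightarrow> laurent" where
  "normalization n \<Gamma> =
     (\<Prod>e \<in> edges \<Gamma>. qfact (label \<Gamma> e)) *
     (\<Prod>v \<in> vertices \<Gamma>.
        qpow ((of_nat n * (of_nat n - 1)
          - of_nat (label \<Gamma> (vertex_edge \<Gamma> v 1)) * of_nat (label \<Gamma> (vertex_edge \<Gamma> v 2))) / 2)
        * qfact (n - label \<Gamma> (vertex_edge \<Gamma> v 0)))"

end

theory Submission
  imports Defs "HOL-Combinatorics.Multiset_Permutations"
begin

text \<open>The bracket of a web without crossings is computed by a state sum. Colouring the strands of a
  sliced web by \<open>1, \<dots>, n\<close> gives the vector representation of quantum \<open>gl\<^sub>n\<close>, in which extrema carry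
  powers of \<open>q\<close> and a sink or a source is an antisymmetrizing tensor. On webs built from extrema,
  crossings of downward strands and sinks directly above sources, the state sum agrees with every
  invariant satisfying the axioms: the sink-source relation leaves a tangle without discs, and
  modulo isotopy, the skein relation and the removal of curls and circles, the tangles with a given
  boundary are spanned by nested maxima followed by a word in crossings. These relations hold for
  the state sum as well, so both evaluations agree on closed tangles.

  For the web of an \<open>MOY\<^sub>n\<close>-graph a colouring assigns to each edge a sequence of colours, and the two
  discs of a vertex force the sequences at the vertex to be orderings of sets that fit together. The
  sets form a state. Summing over the orderings of each edge gives \<open>q\<^sup>k\<^sup>(\<^sup>k\<^sup>-\<^sup>1\<^sup>)\<^sup>/\<^sup>2 [k]!\<close> for an edge labeled
  \<open>k\<close>, since the number of inversions is weighted at both of its ends. The extrema contribute the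
  rotation number of the loops of each colour: sweeping a family of disjoint simple closed curves
  from top to bottom, the maxima with left leg \<open>Down\<close> minus the minima with left leg \<open>Up\<close> count the
  curves with the sign of their orientation.\<close>

section \<open>Spans of functions\<close>

text \<open>The axioms constrain the bracket on closed webs only, while a web is reduced layer by
  layer through open tangles. An open upper part is therefore represented by all its values at once,
  on every closure and on every colouring of its bottom line; a reduction is a linear relation
  between such functions and holds for both evaluations simultaneously. The reduction follows the
  computation of a Markov trace: words in crossings form a Hecke algebra, and a minimum is absorbed
  after the crossings above it are rewritten so that the last generator occurs at most once. Moving
  extrema into place creates crossings of antiparallel strands. If the upward strand always passes
  over, these crossings can be undone and moved past each other, and their entries in the state sum
  are determined by sliding a strand past an extremum. On the graph side, orderings of a colour set
  enter only through inversions at discs. An edge meets discs at both ends, and the two signs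
  multiply to the terms of a Poincare polynomial; an annulus meets none, so nothing forces its
  colours to be distinct, whence the restriction to annuli labelled 1.\<close>

inductive_set lspan :: "('a \<Rightarrow> laurent) set \<Rightarrow> ('a \<Rightarrow> laurent) set" for S where
  zero: "(\<lambda>_. 0) \<in> lspan S"
| step: "f \<in> S \<Longrightarrow> g \<in> lspan S \<Longrightarrow> (\<lambda>x. c * f x + g x) \<in> lspan S"

lemma lspan_add: "f \<in> lspan S \<Longrightarrow> g \<in> lspan S \<Longrightarrow> (\<lambda>x. f x + g x) \<in> lspan S"
proof (induction f rule: lspan.induct)
  case (step f h c)
  have "(\<lambda>x. c * f x + (h x + g x)) \<in> lspan S"
    using step by (intro lspan.step) auto
  then show ?case by (simp add: add.assoc)
qed simp

lemma lspan_scale: "f \<in> lspan S \<Longrightarrow> (\<lambda>x. c * f x) \<in> lspan S"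
proof (induction f rule: lspan.induct)
  case (step f h d)
  have "(\<lambda>x. (c * d) * f x + c * h x) \<in> lspan S"
    using step by (intro lspan.step) auto
  then show ?case by (simp add: algebra_simps)
qed (simp add: lspan.zero)

lemma lspan_base: "f \<in> S \<Longrightarrow> f \<in> lspan S"
  using lspan.step[OF _ lspan.zero, of f S 1] by simp

lemma lspan_sum: "(\<And>j. j \<in> J \<Longrightarrow> f j \<in> lspan S) \<Longrightarrow> (\<lambda>x. \<Sum>j\<in>J. c j * f j x) \<in> lspan S"
  by (induction J rule: infinite_finite_induct) (auto simp: lspan.zero intro!: lspan_add lspan_scale)

text \<open>Elements of \<open>lspan\<close> are built by adding one scaled generator at a time, so
  linearity of \<open>L\<close> in exactly this shape carries the induction. \<open>L\<close> will
  be the effect of appending layers.\<close>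

lemma lspan_linear_image:
  assumes "f \<in> lspan S" "\<And>f. f \<in> S \<Longrightarrow> L f \<in> lspan T" "L (\<lambda>_. 0) = (\<lambda>_. 0)"
    "\<And>c f g. L (\<lambda>x. c * f x + g x) = (\<lambda>x. c * L f x + L g x)"
  shows "L f \<in> lspan T"
  using assms(1)
  by (induction f rule: lspan.induct) (auto simp: assms(2-) lspan.zero intro!: lspan_add lspan_scale)


section \<open>Typed words of layers\<close>

text \<open>The condition on closed diagrams, extended to tangles with a boundary word
  \<open>w\<close> above and \<open>w'\<close> below, so that it decomposes along
  \<open>@\<close>.\<close>

fun typed :: "('g \<Rightarrow> 's list \<times> 's list) \<Rightarrow> 's list \<Rightarrow> 'g diagram \<Rightarrow> 's list \<Rightarrow> bool" where
  "typed io w [] w' \<longleftrightarrow> w = w'"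
| "typed io w (l # D) w' \<longleftrightarrow> fits io w l \<and> typed io (after io w l) D w'"

lemma typed_append: "typed io w (D @ E) w'' \<longleftrightarrow> (\<exists>w'. typed io w D w' \<and> typed io w' E w'')"
  by (induction D arbitrary: w) auto

lemma typed_foldl:
  "typed io w D w' \<longleftrightarrow>
    (\<forall>t < length D. fits io (foldl (after io) w (take t D)) (D ! t)) \<and> foldl (after io) w D = w'"
proof (induction D arbitrary: w)
  case (Cons l D)
  show ?case
    by (simp add: Cons.IH All_less_Suc2 del: fits.simps after.simps)
qed simp

lemma closed_typed: "closed_diagram io D \<longleftrightarrow> typed io [] D []"
  by (simp add: closed_diagram_def slice_def typed_foldl)

lemma typed_unique: "typed io w D v \<Longrightarrow> typed io w D v' \<Longrightarrow> v = v'"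
  by (simp add: typed_foldl)

definition shift :: "nat \<Rightarrow> 'g diagram \<Rightarrow> 'g diagram" where
  "shift k D = map (\<lambda>(i, g). (k + i, g)) D"

lemma shift_simps [simp]:
  "shift k [] = []" "shift k ((i, g) # D) = (k + i, g) # shift k D"
  "shift k (D @ E) = shift k D @ shift k E" "shift 0 D = D"
  "shift k (shift m D) = shift (k + m) D"
  by (auto simp: shift_def)

text \<open>Juxtaposition with identity strands \<open>p\<close> on the left and \<open>s\<close> on
  the right; only the left ones change the positions.\<close>

lemma typed_shift: "typed io w D w' \<Longrightarrow> typed io (p @ w @ s) (shift (length p) D) (p @ w' @ s)"
proof (induction D arbitrary: w)
  case (Cons l D)
  obtain i g where l: "l = (i, g)" by fastforce
  from Cons.prems have *: "i \<le> length w" "take (length (fst (io g))) (drop i w) = fst (io g)"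
    "typed io (after io w l) D w'" by (auto simp: l)
  have len: "i + length (fst (io g)) \<le> length w"
    using arg_cong[OF *(2), of length] *(1) by (auto simp: min_def split: if_splits)
  have "after io (p @ w @ s) (length p + i, g) = p @ after io w l @ s"
    using len by (simp add: l)
  moreover have "fits io (p @ w @ s) (length p + i, g)"
    using * len by auto
  ultimately show ?case using Cons.IH[OF *(3)] by (simp add: l)
qed simp

lemma typed_layer:
  "typed io w [(i, g)] w' \<longleftrightarrow>
    (\<exists>p s. w = p @ fst (io g) @ s \<and> w' = p @ snd (io g) @ s \<and> i = length p)"
proof
  assume "typed io w [(i, g)] w'"
  then have *: "i \<le> length w" "take (length (fst (io g))) (drop i w) = fst (io g)"
    "w' = take i w @ snd (io g) @ drop (i + length (fst (io g))) w" by auto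
  have "w = take i w @ fst (io g) @ drop (i + length (fst (io g))) w"
    using *(2) by (metis add.commute append_take_drop_id drop_drop)
  with * show "\<exists>p s. w = p @ fst (io g) @ s \<and> w' = p @ snd (io g) @ s \<and> i = length p"
    by (intro exI[of _ "take i w"] exI[of _ "drop (i + length (fst (io g))) w"]) auto
qed auto


section \<open>The state sum of a sliced web\<close>

definition cols :: "nat \<Rightarrow> nat \<Rightarrow> nat list set" where
  "cols n k = {xs. length xs = k \<and> set xs \<subseteq> {1..n}}"

lemma finite_cols [simp]: "finite (cols n k)"
  using finite_lists_length_eq[of "{1..n}" k] by (simp add: cols_def conj_commute)

fun inv_list :: "nat list \<Rightarrow> nat" where
  "inv_list [] = 0"
| "inv_list (x # xs) = length (filter (\<lambda>y. y < x) xs) + inv_list xs"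

text \<open>The coefficients of the q-antisymmetric tensor spanning the top exterior power of the
  vector representation; it is the tensor attached to a disc.\<close>

definition anti :: "nat \<Rightarrow> nat list \<Rightarrow> laurent" where
  "anti n xs = (if set xs = {1..n} then (- qpow 1) ^ inv_list xs else 0)"

text \<open>Twice the factor \<open>c - (n + 1) / 2\<close> with which a loop labelled
  \<open>c\<close> enters the rotation number. The powers of q with these exponents add up to the
  quantum dimension \<open>[n]\<close>.\<close>

definition height :: "nat \<Rightarrow> nat \<Rightarrow> rat" where
  "height n c = 2 * of_nat c - of_nat n - 1"

definition zed :: laurent where
  "zed = qpow 1 - qpow (-1)"

text \<open>The exchange of two parallel strands. For downward strands the smaller colour has to be on
  the left in a diagonal term of a positive crossing, for upward strands on the right.\<close>

definition par :: "nat \<Rightarrow> bool \<Rightarrow> (nat \<Rightarrow> nat \<Rightarrow> bool) \<Rightarrow> (nat list \<Rightarrow> laurent) \<Rightarrow> nat \<Rightarrow> nat \<Rightarrow> laurent" where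
  "par n b lt G c d = qpow (if b then 1 / of_nat n else - 1 / of_nat n) *
     (if c = d then qpow (if b then - 1 else 1) * G [c, c]
      else G [d, c] + (if b then if lt d c then - zed else 0 else if lt c d then zed else 0) * G [c, d])"

text \<open>The vector representation of dimension \<open>n\<close>, in a gauge in which only maxima with left leg \<open>Down\<close>
  and minima with left leg \<open>Up\<close> carry powers of \<open>q\<close>. A downward strand never passes over an upward
  strand in the diagrams that are evaluated; the value \<open>0\<close> of such a crossing is a dummy.\<close>

fun lact :: "nat \<Rightarrow> web_piece \<Rightarrow> (nat list \<Rightarrow> laurent) \<Rightarrow> nat list \<Rightarrow> laurent" where
  "lact n (Cap d) G ys = (if ys ! 0 = ys ! 1
     then (if d = Down then qpow (height n (ys ! 0)) else 1) * G [] else 0)"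
| "lact n (Cup d) G ys = (\<Sum>a = 1..n. (if d = Up then qpow (- height n a) else 1) * G [a, a])"
| "lact n (Cross b Down Down) G ys = par n b (<) G (ys ! 0) (ys ! 1)"
| "lact n (Cross b Up Up) G ys = par n b (>) G (ys ! 0) (ys ! 1)"
| "lact n (Cross b Down Up) G ys = (if b then 0 else qpow (1 / of_nat n) *
     (if ys ! 0 \<noteq> ys ! 1 then G [ys ! 1, ys ! 0]
      else qpow (- 1) * G [ys ! 0, ys ! 0] - zed * (\<Sum>a = 1..<ys ! 0. G [a, a])))"
| "lact n (Cross b Up Down) G ys = (if \<not> b then 0 else qpow (- 1 / of_nat n) *
     (if ys ! 0 \<noteq> ys ! 1 then G [ys ! 1, ys ! 0]
      else qpow 1 * G [ys ! 0, ys ! 0]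
        + zed * (\<Sum>a = 1..<ys ! 0. qpow (2 * (of_nat (ys ! 0) - of_nat a)) * G [a, a])))"
| "lact n Source G ys = anti n ys * G []"
| "lact n Sink G ys = (\<Sum>xs \<in> cols n n. anti n xs * G xs)"

text \<open>The value of the part of a diagram above a horizontal line is a function of the colours
  on that line; a layer turns the function for the line above it into the function for the line
  below it.\<close>

fun act :: "nat \<Rightarrow> nat \<times> web_piece \<Rightarrow> (nat list \<Rightarrow> laurent) \<Rightarrow> nat list \<Rightarrow> laurent" where
  "act n (i, g) F ys = lact n g
     (\<lambda>xs. F (take i ys @ xs @ drop (i + length (snd (web_io n g))) ys))
     (take (length (snd (web_io n g))) (drop i ys))"

fun acts :: "nat \<Rightarrow> web_piece diagram \<Rightarrow> (nat list \<Rightarrow> laurent) \<Rightarrow> nat list \<Rightarrow> laurent" where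
  "acts n [] F = F"
| "acts n (l # D) F = acts n D (act n l F)"

lemma acts_append: "acts n (D @ E) F = acts n E (acts n D F)"
  by (induction D arbitrary: F) auto

definition delta_nil :: "nat list \<Rightarrow> laurent" where
  "delta_nil ys = (if ys = [] then 1 else 0)"

lemma lact_linear:
  "lact n g (\<lambda>xs. c * F xs + G xs) a = c * lact n g F a + lact n g G a"
proof (induction n g F a rule: lact.induct)
  case (3 n b F ys)
  show ?case by (auto simp: par_def algebra_simps)
next
  case (4 n b F ys)
  show ?case by (auto simp: par_def algebra_simps)
next
  case (5 n b F ys)
  have "(\<Sum>a = 1..<ys ! 0. c * F [a, a] + G [a, a])
      = c * (\<Sum>a = 1..<ys ! 0. F [a, a]) + (\<Sum>a = 1..<ys ! 0. G [a, a])"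
    by (simp only: sum.distrib sum_distrib_left)
  then show ?case by (simp only: lact.simps) (simp add: algebra_simps)
next
  case (6 n b F ys)
  let ?m = "\<lambda>a. qpow (2 * (of_nat (ys ! 0) - of_nat a))"
  have "(\<Sum>a = 1..<ys ! 0. ?m a * (c * F [a, a] + G [a, a]))
      = c * (\<Sum>a = 1..<ys ! 0. ?m a * F [a, a]) + (\<Sum>a = 1..<ys ! 0. ?m a * G [a, a])"
    by (simp only: sum.distrib sum_distrib_left distrib_left mult.left_commute)
  then show ?case by (simp only: lact.simps) (simp add: algebra_simps)
qed (simp_all add: algebra_simps sum.distrib sum_distrib_left)

lemma lact_zero: "lact n g (\<lambda>xs. 0) a = 0"
  using lact_linear[of n g "- 1" "\<lambda>_. 0" "\<lambda>_. 0" a] by simp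

text \<open>At fixed bottom colours the action is a fixed finite combination of values of its
  argument, so it commutes with every linear functional. With \<open>L\<close> the action of another
  piece this becomes the commutation of distant layers.\<close>

lemma lact_functional:
  fixes L :: "(nat list \<Rightarrow> laurent) \<Rightarrow> laurent"
  assumes "\<And>c F G. L (\<lambda>xs. c * F xs + G xs) = c * L F + L G"
  shows "lact n g (\<lambda>xs. L (F xs)) a = L (\<lambda>zs. lact n g (\<lambda>xs. F xs zs) a)"
proof -
  have zero: "L (\<lambda>_. 0) = 0"
    using assms[of "- 1" "\<lambda>_. 0" "\<lambda>_. 0"] by simp
  have add: "L (\<lambda>z. F z + G z) = L F + L G" for F G
    using assms[of 1 F G] by simp
  have scale: "L (\<lambda>z. c * F z) = c * L F" for F c
    using assms[of c F "\<lambda>_. 0"] zero by simp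
  have diff: "L (\<lambda>z. F z - c * G z) = L F - c * L G" for F G c
    using assms[of "- c" G F] by simp
  have sum: "L (\<lambda>z. \<Sum>j\<in>J. F j z) = (\<Sum>j\<in>J. L (F j))" for J :: "'x set" and F
    by (induction J rule: infinite_finite_induct) (simp_all add: zero add)
  have par: "par n b lt (\<lambda>xs. L (F xs)) c d = L (\<lambda>zs. par n b lt (\<lambda>xs. F xs zs) c d)" for n b lt c d
    by (cases "c = d") (simp_all only: par_def scale add if_True if_False simp_thms)
  show ?thesis
  proof (induction n g "\<lambda>xs. L (F xs)" a rule: lact.induct)
    case (1 n d ys)
    show ?case by (cases "ys ! 0 = ys ! 1") (simp_all only: lact.simps scale zero if_True if_False simp_thms)
  next
    case (5 n b ys)
    show ?case
      by (cases b; cases "ys ! 0 = ys ! 1")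
        (simp_all only: lact.simps scale zero diff sum if_True if_False simp_thms)
  next
    case (6 n b ys)
    show ?case
      by (cases b; cases "ys ! 0 = ys ! 1")
        (simp_all only: lact.simps scale zero add sum if_True if_False simp_thms)
  qed (simp_all only: lact.simps scale sum par)
qed

lemma lact_commute:
  "lact n g (\<lambda>xs. lact n h (\<lambda>zs. F xs zs) b) a = lact n h (\<lambda>zs. lact n g (\<lambda>xs. F xs zs) a) b"
  by (rule lact_functional) (rule lact_linear)

lemma act_linear:
  "act n l (\<lambda>xs. c * F xs + G xs) = (\<lambda>ys. c * act n l F ys + act n l G ys)" "act n l (\<lambda>_. 0) = (\<lambda>_. 0)"
  by (cases l, auto simp: fun_eq_iff lact_linear lact_zero)+

lemma acts_linear:
  "acts n D (\<lambda>xs. c * F xs + G xs) = (\<lambda>ys. c * acts n D F ys + acts n D G ys)" "acts n D (\<lambda>_. 0) = (\<lambda>_. 0)"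
  by (induction D arbitrary: F G) (simp_all only: acts.simps act_linear)

lemma acts_scale: "acts n D (\<lambda>xs. c * F xs) = (\<lambda>ys. c * acts n D F ys)"
  using acts_linear(1)[of n D c F "\<lambda>_. 0"] by (simp add: acts_linear(2))

lemma acts_sum: "acts n D (\<lambda>xs. \<Sum>j\<in>J. c j * F j xs) = (\<lambda>ys. \<Sum>j\<in>J. c j * acts n D (F j) ys)"
  by (induction J rule: infinite_finite_induct) (simp_all add: acts_linear)

text \<open>The action of a piece never leaves the colours \<open>1..n\<close>: even the sums in the
  mixed crossings run over smaller colours only. Functions that agree on admissible colourings may
  therefore be exchanged.\<close>

lemma lact_cong:
  assumes "\<And>xs. length xs = length (fst (web_io n g)) \<Longrightarrow> set xs \<subseteq> {1..n} \<Longrightarrow> G xs = H xs"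
    "length ys = length (snd (web_io n g))" "set ys \<subseteq> {1..n}"
  shows "lact n g G ys = lact n g H ys"
  using assms
proof (induction n g G ys rule: lact.induct)
  case (3 n b G ys)
  then have *: "ys ! 0 \<in> {1..n}" "ys ! 1 \<in> {1..n}" by (auto simp: subset_iff)
  then have "G [ys ! i, ys ! j] = H [ys ! i, ys ! j]" if "i \<in> {0, 1}" "j \<in> {0, 1}" for i j
    using that by (intro 3(1)) auto
  then have G: "G [ys ! 0, ys ! 0] = H [ys ! 0, ys ! 0]" "G [ys ! 0, ys ! 1] = H [ys ! 0, ys ! 1]"
    "G [ys ! 1, ys ! 0] = H [ys ! 1, ys ! 0]" by simp_all
  show ?case unfolding lact.simps par_def G ..
next
  case (4 n b G ys)
  then have *: "ys ! 0 \<in> {1..n}" "ys ! 1 \<in> {1..n}" by (auto simp: subset_iff)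
  then have "G [ys ! i, ys ! j] = H [ys ! i, ys ! j]" if "i \<in> {0, 1}" "j \<in> {0, 1}" for i j
    using that by (intro 4(1)) auto
  then have G: "G [ys ! 0, ys ! 0] = H [ys ! 0, ys ! 0]" "G [ys ! 0, ys ! 1] = H [ys ! 0, ys ! 1]"
    "G [ys ! 1, ys ! 0] = H [ys ! 1, ys ! 0]" by simp_all
  show ?case unfolding lact.simps par_def G ..
next
  case (5 n b G ys)
  then have *: "ys ! 0 \<in> {1..n}" "ys ! 1 \<in> {1..n}" by (auto simp: subset_iff)
  then have "G [ys ! i, ys ! j] = H [ys ! i, ys ! j]" if "i \<in> {0, 1}" "j \<in> {0, 1}" for i j
    using that by (intro 5(1)) auto
  then have G: "G [ys ! 0, ys ! 0] = H [ys ! 0, ys ! 0]" "G [ys ! 0, ys ! 1] = H [ys ! 0, ys ! 1]"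
    "G [ys ! 1, ys ! 0] = H [ys ! 1, ys ! 0]" by simp_all
  have S: "(\<Sum>a = 1..<ys ! 0. G [a, a]) = (\<Sum>a = 1..<ys ! 0. H [a, a])"
    using 5 * by (intro sum.cong) auto
  show ?case unfolding lact.simps G S ..
next
  case (6 n b G ys)
  then have *: "ys ! 0 \<in> {1..n}" "ys ! 1 \<in> {1..n}" by (auto simp: subset_iff)
  then have "G [ys ! i, ys ! j] = H [ys ! i, ys ! j]" if "i \<in> {0, 1}" "j \<in> {0, 1}" for i j
    using that by (intro 6(1)) auto
  then have G: "G [ys ! 0, ys ! 0] = H [ys ! 0, ys ! 0]" "G [ys ! 0, ys ! 1] = H [ys ! 0, ys ! 1]"
    "G [ys ! 1, ys ! 0] = H [ys ! 1, ys ! 0]" by simp_all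
  have S: "(\<Sum>a = 1..<ys ! 0. qpow (2 * (of_nat (ys ! 0) - of_nat a)) * G [a, a])
      = (\<Sum>a = 1..<ys ! 0. qpow (2 * (of_nat (ys ! 0) - of_nat a)) * H [a, a])"
    using 6 * by (intro sum.cong) auto
  show ?case unfolding lact.simps G S ..
qed (auto simp: cols_def intro!: sum.cong)

lemma acts_cong:
  assumes "typed (web_io n) w D w'" "length ys = length w'" "set ys \<subseteq> {1..n}"
    "\<And>zs. length zs = length w \<Longrightarrow> set zs \<subseteq> {1..n} \<Longrightarrow> G zs = H zs"
  shows "acts n D G ys = acts n D H ys"
  using assms(1,4)
proof (induction D arbitrary: w G H)
  case (Cons l D)
  obtain i g where l: "l = (i, g)" by fastforce
  obtain w1 where w1: "typed (web_io n) w [l] w1" "typed (web_io n) w1 D w'"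
    using Cons.prems(1) by auto
  obtain p s where ps: "w = p @ fst (web_io n g) @ s" "w1 = p @ snd (web_io n g) @ s" "i = length p"
    using w1(1) unfolding l typed_layer by auto
  have "act n (i, g) G zs = act n (i, g) H zs" if zs: "length zs = length w1" "set zs \<subseteq> {1..n}" for zs
  proof -
    have "set (take k (drop m zs)) \<subseteq> {1..n}" "set (take m zs) \<subseteq> {1..n}" "set (drop m zs) \<subseteq> {1..n}" for k m
      using zs(2) by (meson order_trans set_take_subset set_drop_subset)+
    then show ?thesis unfolding act.simps
      by (intro lact_cong Cons.prems(2)) (use zs in \<open>auto simp: ps\<close>)
  qed
  then show ?case unfolding acts.simps l
    by (intro Cons.IH[OF w1(2)]) auto
qed (use assms(2,3) in simp)

lemma acts_shift:
  assumes "typed (web_io n) w D w'" "length ys = length w'" "length py = k" "set ys \<subseteq> {1..n}"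
  shows "acts n (shift k D) F (py @ ys @ sy) = acts n D (\<lambda>zs. F (py @ zs @ sy)) ys"
  using assms(1)
proof (induction D arbitrary: w F)
  case (Cons l D)
  obtain i g where l: "l = (i, g)" by fastforce
  obtain w1 where w1: "typed (web_io n) w [l] w1" "typed (web_io n) w1 D w'"
    using Cons.prems(1) by auto
  obtain p s where ps: "w = p @ fst (web_io n g) @ s" "w1 = p @ snd (web_io n g) @ s" "i = length p"
    using w1(1) unfolding l typed_layer by auto
  have "acts n (shift k (l # D)) F (py @ ys @ sy)
      = acts n D (\<lambda>zs. act n (k + i, g) F (py @ zs @ sy)) ys"
    by (simp add: l Cons.IH[OF w1(2)])
  also have "\<dots> = acts n D (act n (i, g) (\<lambda>zs. F (py @ zs @ sy))) ys"
    by (rule acts_cong[OF w1(2) assms(2,4)]) (use assms(3) ps in simp)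
  finally show ?case by (simp add: l)
qed simp

section \<open>Local relations between webs\<close>

text \<open>Both evaluations of the upper part \<open>u\<close> of a diagram at once: \<open>Inl v\<close> closes \<open>u\<close> with \<open>v\<close> and
  takes the bracket, \<open>Inr ys\<close> takes the state sum with the colours \<open>ys\<close> at the bottom. So a linear
  relation between functions \<open>ev n br u\<close> holds for the bracket and for the state sum.\<close>

definition ev :: "nat \<Rightarrow> (web_piece diagram \<Rightarrow> laurent) \<Rightarrow> web_piece diagram
    \<Rightarrow> web_piece diagram + nat list \<Rightarrow> laurent" where
  "ev n br u x = (case x of
     Inl v \<Rightarrow> if is_web n (u @ v) then br (u @ v) else 0
   | Inr ys \<Rightarrow> if length ys = length (foldl (after (web_io n)) [] u) \<and> set ys \<subseteq> {1..n}
       then acts n u delta_nil ys else 0)"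

text \<open>The local relation \<open>l = c r\<close> between diagrams with top \<open>w\<close> and bottom \<open>w'\<close>.\<close>

definition leq :: "nat \<Rightarrow> (web_piece diagram \<Rightarrow> laurent) \<Rightarrow> laurent \<Rightarrow> dir list
    \<Rightarrow> web_piece diagram \<Rightarrow> web_piece diagram \<Rightarrow> dir list \<Rightarrow> bool" where
  "leq n br c w l r w' \<longleftrightarrow> typed (web_io n) w l w' \<and> typed (web_io n) w r w' \<and>
     (\<forall>p s u x. typed (web_io n) [] u (p @ w @ s) \<longrightarrow>
        ev n br (u @ shift (length p) l) x = c * ev n br (u @ shift (length p) r) x)"

lemma is_web_typed: "is_web n D \<longleftrightarrow> typed (web_io n) [] D []"
  by (simp add: is_web_def closed_typed)

lemma typed_foldl_eq: "typed io w D w' \<Longrightarrow> foldl (after io) w D = w'"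
  by (simp add: typed_foldl)

text \<open>In the premise on states the arbitrary \<open>G\<close> stands for the upper part
  together with the fixed colours beside the relation, so that one local check covers every
  context.\<close>

lemma leqI:
  assumes t: "typed (web_io n) w l w'" "typed (web_io n) w r w'"
    and b: "\<And>p s u v. typed (web_io n) [] u (p @ w @ s) \<Longrightarrow>
        is_web n (u @ shift (length p) l @ v) \<Longrightarrow> is_web n (u @ shift (length p) r @ v) \<Longrightarrow>
        br (u @ shift (length p) l @ v) = c * br (u @ shift (length p) r @ v)"
    and z: "\<And>G ys. length ys = length w' \<Longrightarrow> set ys \<subseteq> {1..n} \<Longrightarrow> acts n l G ys = c * acts n r G ys"
  shows "leq n br c w l r w'"
  unfolding leq_def
proof (intro conjI allI impI t)
  fix p s u x assume u: "typed (web_io n) [] u (p @ w @ s)"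
  have ul: "typed (web_io n) [] (u @ shift (length p) l) (p @ w' @ s)"
    and ur: "typed (web_io n) [] (u @ shift (length p) r) (p @ w' @ s)"
    using u typed_shift[OF t(1)] typed_shift[OF t(2)] by (auto simp: typed_append)
  show "ev n br (u @ shift (length p) l) x = c * ev n br (u @ shift (length p) r) x"
  proof (cases x)
    case (Inl v)
    have "is_web n ((u @ shift (length p) l) @ v) \<longleftrightarrow> is_web n ((u @ shift (length p) r) @ v)"
      unfolding is_web_typed typed_append[of _ _ "u @ _"] using ul ur typed_unique by metis
    then show ?thesis using b[OF u] by (simp add: Inl ev_def)
  next
    case (Inr Ys)
    show ?thesis
    proof (cases "length Ys = length (p @ w' @ s) \<and> set Ys \<subseteq> {1..n}")
      case True
      define py ys sy where "py = take (length p) Ys" "ys = take (length w') (drop (length p) Ys)"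
        "sy = drop (length w') (drop (length p) Ys)"
      have Ys: "Ys = py @ ys @ sy" unfolding py_ys_sy_def append_take_drop_id ..
      have len: "length py = length p" "length ys = length w'"
        using True by (auto simp: py_ys_sy_def)
      have sub: "set ys \<subseteq> {1..n}" using True Ys by auto
      have "acts n (u @ shift (length p) l) delta_nil Ys = c * acts n (u @ shift (length p) r) delta_nil Ys"
        unfolding acts_append Ys
        by (simp only: acts_shift[OF t(1) len(2,1) sub] acts_shift[OF t(2) len(2,1) sub] z[OF len(2) sub])
      then show ?thesis using True by (simp add: Inr ev_def typed_foldl_eq[OF ul, unfolded foldl_append] typed_foldl_eq[OF ur, unfolded foldl_append])
    next
      case False
      then show ?thesis by (auto simp: Inr ev_def typed_foldl_eq[OF ul, unfolded foldl_append] typed_foldl_eq[OF ur, unfolded foldl_append])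
    qed
  qed
qed

lemma leq_typed: "leq n br c w l r w' \<Longrightarrow> typed (web_io n) w l w'"
  "leq n br c w l r w' \<Longrightarrow> typed (web_io n) w r w'"
  by (simp_all add: leq_def)

lemma leq_ev:
  assumes "leq n br c w l r w'" "typed (web_io n) [] u w"
  shows "ev n br (u @ l) = (\<lambda>x. c * ev n br (u @ r) x)"
proof
  fix x show "ev n br (u @ l) x = c * ev n br (u @ r) x"
  proof -
    have "typed (web_io n) [] u ([] @ w @ [])" using assms(2) by simp
    then have "ev n br (u @ shift (length ([] :: dir list)) l) x
        = c * ev n br (u @ shift (length ([] :: dir list)) r) x"
      using assms(1) unfolding leq_def by blast
    then show ?thesis by simp
  qed
qed

lemma leq_refl: "typed (web_io n) w l w' \<Longrightarrow> leq n br 1 w l l w'"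
  by (simp add: leq_def)

lemma leq_trans: "leq n br c w l m w' \<Longrightarrow> leq n br d w m r w' \<Longrightarrow> leq n br (c * d) w l r w'"
  unfolding leq_def by (simp add: mult.assoc)

lemma leq_trans1: "leq n br 1 w l m w' \<Longrightarrow> leq n br 1 w m r w' \<Longrightarrow> leq n br 1 w l r w'"
  using leq_trans[of n br 1 w l m w' 1 r] by simp

lemma leq_inverse: "leq n br c w l r w' \<Longrightarrow> d * c = 1 \<Longrightarrow> leq n br d w r l w'"
  unfolding leq_def by (simp flip: mult.assoc)

lemma leq_sym: "leq n br 1 w l r w' \<Longrightarrow> leq n br 1 w r l w'"
  by (rule leq_inverse) auto

text \<open>A closure of \<open>u @ b\<close> is also a closure of \<open>u\<close>, and the state
  sum of \<open>b\<close> is linear in the function that it receives from above.\<close>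

lemma ev_append_cong:
  assumes "\<And>x. ev n br u x = c * ev n br u' x" "typed (web_io n) [] u w" "typed (web_io n) [] u' w"
    "typed (web_io n) w b w'"
  shows "ev n br (u @ b) x = c * ev n br (u' @ b) x"
proof (cases x)
  case (Inl v)
  then show ?thesis using assms(1)[of "Inl (b @ v)"] by (simp add: ev_def split: if_splits)
next
  case (Inr ys)
  have *: "acts n u delta_nil zs = c * acts n u' delta_nil zs"
    if "length zs = length w" "set zs \<subseteq> {1..n}" for zs
    using assms(1)[of "Inr zs"] that
    by (simp add: ev_def typed_foldl_eq[OF assms(2)] typed_foldl_eq[OF assms(3)])
  have "acts n b (acts n u delta_nil) ys = acts n b (\<lambda>zs. c * acts n u' delta_nil zs) ys"
    if "length ys = length w'" "set ys \<subseteq> {1..n}"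
    by (rule acts_cong[OF assms(4) that *])
  then show ?thesis using typed_foldl_eq[OF assms(4)]
    by (simp add: Inr ev_def typed_foldl_eq[OF assms(2)] typed_foldl_eq[OF assms(3)] acts_append acts_scale)
qed

text \<open>Together with \<open>leq_app\<close> this makes local relations applicable anywhere
  inside a tangle: horizontally between further strands and vertically between further
  layers.\<close>

lemma leq_ctx:
  assumes "leq n br c w l r w'"
  shows "leq n br c (p @ w @ s) (shift (length p) l) (shift (length p) r) (p @ w' @ s)"
  unfolding leq_def
proof (intro conjI allI impI)
  fix q t u x assume "typed (web_io n) [] u (q @ (p @ w @ s) @ t)"
  then have "typed (web_io n) [] u ((q @ p) @ w @ (s @ t))" by simp
  then show "ev n br (u @ shift (length q) (shift (length p) l)) x
      = c * ev n br (u @ shift (length q) (shift (length p) r)) x"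
    using assms unfolding leq_def by (simp only: shift_simps(5) length_append[symmetric])
qed (use assms in \<open>auto simp: leq_def intro: typed_shift\<close>)

lemma leq_app:
  assumes l: "leq n br c w l r w'" and a: "typed (web_io n) w0 a w" and b: "typed (web_io n) w' b w1"
  shows "leq n br c w0 (a @ l @ b) (a @ r @ b) w1"
  unfolding leq_def
proof (intro conjI allI impI)
  show "typed (web_io n) w0 (a @ l @ b) w1" "typed (web_io n) w0 (a @ r @ b) w1"
    using a b leq_typed[OF l] by (auto simp: typed_append)
  fix p s u x assume u: "typed (web_io n) [] u (p @ w0 @ s)"
  let ?k = "length p"
  have ua: "typed (web_io n) [] (u @ shift ?k a) (p @ w @ s)"
    using u typed_shift[OF a] by (auto simp: typed_append)
  have "ev n br ((u @ shift ?k a) @ shift ?k l) y = c * ev n br ((u @ shift ?k a) @ shift ?k r) y" for y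
    using l ua unfolding leq_def by blast
  moreover have "typed (web_io n) [] ((u @ shift ?k a) @ shift ?k l) (p @ w' @ s)"
    "typed (web_io n) [] ((u @ shift ?k a) @ shift ?k r) (p @ w' @ s)"
    unfolding typed_append[of _ _ "u @ _"] using ua typed_shift leq_typed[OF l] by blast+
  ultimately have "ev n br (((u @ shift ?k a) @ shift ?k l) @ shift ?k b) x
      = c * ev n br (((u @ shift ?k a) @ shift ?k r) @ shift ?k b) x"
    by (rule ev_append_cong) (rule typed_shift[OF b])
  then show "ev n br (u @ shift ?k (a @ l @ b)) x = c * ev n br (u @ shift ?k (a @ r @ b)) x"
    by simp
qed

lemma leq_step:
  assumes "leq n br c w l r w'" "W = p @ w @ s" "V = p @ w' @ s"
    "typed (web_io n) W0 a W" "typed (web_io n) V b W1"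
    "L = a @ shift (length p) l @ b" "R = a @ shift (length p) r @ b"
  shows "leq n br c W0 L R W1"
  using leq_app[OF leq_ctx[OF assms(1), of p s]] assms(2-) by simp

section \<open>Generating relations\<close>

lemma br_move:
  assumes "web_bracket n br" "move n l r" "is_web n (u @ l @ v)" "is_web n (u @ r @ v)"
  shows "br (u @ l @ v) = br (u @ r @ v)"
proof -
  have "web_step n (u @ l @ v) (u @ r @ v)"
    using assms(2-) unfolding web_step_def by blast
  then have "isotopic n (u @ l @ v) (u @ r @ v)"
    unfolding isotopic_def by (rule r_into_equivclp)
  with assms(1,3) show ?thesis unfolding web_bracket_def by blast
qed

text \<open>A move may be listed in one direction only; isotopy is the generated equivalence, so
  either direction serves.\<close>

lemma leq_moveI:
  assumes "web_bracket n br" "typed (web_io n) w l w'" "typed (web_io n) w r w'"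
    "\<And>k. move n (shift k l) (shift k r) \<or> move n (shift k r) (shift k l)"
    "\<And>G ys. length ys = length w' \<Longrightarrow> set ys \<subseteq> {1..n} \<Longrightarrow> acts n l G ys = acts n r G ys"
  shows "leq n br 1 w l r w'"
proof (rule leqI[OF assms(2,3)])
  fix p s :: "dir list" and u v
  assume w: "is_web n (u @ shift (length p) l @ v)" "is_web n (u @ shift (length p) r @ v)"
  show "br (u @ shift (length p) l @ v) = 1 * br (u @ shift (length p) r @ v)"
    using assms(4)[of "length p"] br_move[OF assms(1) _ w] br_move[OF assms(1) _ w(2,1)] by auto
qed (use assms(5) in simp)

section \<open>Commutation of distant pieces\<close>

lemma interchange_leq:
  assumes "web_bracket n br"
  shows "leq n br 1 (fst (web_io n g) @ m @ fst (web_io n h))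
     [(0, g), (length (snd (web_io n g) @ m), h)] [(length (fst (web_io n g) @ m), h), (0, g)]
     (snd (web_io n g) @ m @ snd (web_io n h))"
proof (rule leq_moveI[OF assms])
  fix k
  show "move n (shift k [(0, g), (length (snd (web_io n g) @ m), h)])
       (shift k [(length (fst (web_io n g) @ m), h), (0, g)]) \<or>
     move n (shift k [(length (fst (web_io n g) @ m), h), (0, g)])
       (shift k [(0, g), (length (snd (web_io n g) @ m), h)])"
    using interchange[of k n g "k + length (fst (web_io n g)) + length m" h]
    by (simp add: algebra_simps)
next
  fix G and ys :: "nat list"
  assume ys: "length ys = length (snd (web_io n g) @ m @ snd (web_io n h))"
  define a c b where "a = take (length (snd (web_io n g))) ys"
    "c = take (length m) (drop (length (snd (web_io n g))) ys)"
    "b = drop (length m) (drop (length (snd (web_io n g))) ys)"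
  have len: "length a = length (snd (web_io n g))" "length c = length m" "length b = length (snd (web_io n h))"
    using ys by (auto simp: a_c_b_def)
  have eq: "ys = a @ c @ b" unfolding a_c_b_def append_take_drop_id ..
  have 1: "act n (0, g) F (a @ zs) = lact n g (\<lambda>xs. F (xs @ zs)) a" for F zs
    by (simp add: len)
  have 2: "act n (k, h) F (a' @ c @ b) = lact n h (\<lambda>zs. F (a' @ c @ zs)) b"
    if "k = length a' + length m" for F k a'
    using that len by simp
  have 3: "act n (length (snd (web_io n g)) + length m, h) (act n (0, g) G) (a @ c @ b)
      = lact n h (\<lambda>zs. lact n g (\<lambda>xs. G (xs @ c @ zs)) a) b"
    by (subst 2) (simp_all only: 1 len)
  have 4: "act n (0, g) (act n (length (fst (web_io n g)) + length m, h) G) (a @ c @ b)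
      = lact n g (\<lambda>xs. act n (length (fst (web_io n g)) + length m, h) G (xs @ c @ b)) a"
    by (simp only: 1)
  \<comment> \<open>The position of \<open>h\<close> is correct only when \<open>xs\<close> has the
    length of the upper boundary of \<open>g\<close>; these are the lists on which the action of
    \<open>g\<close> depends, hence a congruence instead of rewriting.\<close>
  have ne: "lact n g (\<lambda>xs. act n (length (fst (web_io n g)) + length m, h) G (xs @ c @ b)) a
      = lact n g (\<lambda>xs. lact n h (\<lambda>zs. G (xs @ c @ zs)) b) a"
    if "set ys \<subseteq> {1..n}"
    by (rule lact_cong) (use that eq len 2 in auto)
  show "acts n [(0, g), (length (snd (web_io n g) @ m), h)] G ys
      = acts n [(length (fst (web_io n g) @ m), h), (0, g)] G ys" if "set ys \<subseteq> {1..n}"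
    unfolding eq acts.simps length_append 3 4 ne[OF that] by (rule lact_commute)
qed auto

lemma commute_layers:
  assumes "web_bracket n br" "typed (web_io n) w [(i, g)] w'" "typed (web_io n) v [(j, h)] v'"
  shows "leq n br 1 (w @ m @ v) [(i, g), (length (w' @ m) + j, h)] [(length (w @ m) + j, h), (i, g)] (w' @ m @ v')"
proof -
  obtain p s where 1: "w = p @ fst (web_io n g) @ s" "w' = p @ snd (web_io n g) @ s" "i = length p"
    using assms(2) unfolding typed_layer by auto
  obtain q t where 2: "v = q @ fst (web_io n h) @ t" "v' = q @ snd (web_io n h) @ t" "j = length q"
    using assms(3) unfolding typed_layer by auto
  show ?thesis
    using leq_ctx[OF interchange_leq[OF assms(1), of g "s @ m @ q" h], of p t] 1 2
    by (simp add: algebra_simps)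
qed

lemma commute_layer_word:
  assumes wb: "web_bracket n br" and l: "typed (web_io n) w l w'" and k: "typed (web_io n) v [(j, h)] v'"
  shows "leq n br 1 (w @ m @ v) (l @ [(length (w' @ m) + j, h)]) ((length (w @ m) + j, h) # l) (w' @ m @ v')"
  using l
proof (induction l arbitrary: w)
  case Nil
  have "typed (web_io n) ((w @ m) @ v @ []) (shift (length (w @ m)) [(j, h)]) ((w @ m) @ v' @ [])"
    by (rule typed_shift[OF k])
  with Nil show ?case by (simp add: leq_refl)
next
  case (Cons x l)
  obtain i g where x: "x = (i, g)" by fastforce
  obtain w1 where w1: "typed (web_io n) w [x] w1" "typed (web_io n) w1 l w'"
    using Cons.prems by auto
  have wx: "typed (web_io n) (w @ m @ v) [x] (w1 @ m @ v)"
    using typed_shift[OF w1(1), of "[]" "m @ v"] by simp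
  have wl: "typed (web_io n) (w1 @ m @ v') l (w' @ m @ v')"
    using typed_shift[OF w1(2), of "[]" "m @ v'"] by simp
  have "leq n br 1 (w @ m @ v) (x # l @ [(length (w' @ m) + j, h)]) (x # (length (w1 @ m) + j, h) # l) (w' @ m @ v')"
    using leq_app[OF Cons.IH[OF w1(2)] wx, of "[]"] by simp
  moreover have "leq n br 1 (w @ m @ v) (x # (length (w1 @ m) + j, h) # l) ((length (w @ m) + j, h) # x # l) (w' @ m @ v')"
    using leq_app[OF commute_layers[OF wb w1(1)[unfolded x] k, of m] _ wl, of _ "[]"] by (simp add: x)
  ultimately show ?case using leq_trans1 by fastforce
qed

text \<open>The interchange law for tangles side by side. It brings two pieces into consecutive
  layers before a local relation is applied to them.\<close>

lemma commute_words:
  assumes wb: "web_bracket n br" and l: "typed (web_io n) w l w'" and k: "typed (web_io n) v k v'"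
  shows "leq n br 1 (w @ m @ v) (l @ shift (length (w' @ m)) k) (shift (length (w @ m)) k @ l) (w' @ m @ v')"
  using k
proof (induction k arbitrary: v)
  case Nil
  then show ?case using typed_shift[OF l, of "[]" "m @ v"] by (auto intro: leq_refl)
next
  case (Cons x k)
  obtain j h where x: "x = (j, h)" by fastforce
  obtain v1 where v1: "typed (web_io n) v [x] v1" "typed (web_io n) v1 k v'"
    using Cons.prems by auto
  have a: "typed (web_io n) (w' @ m @ v1) (shift (length (w' @ m)) k) (w' @ m @ v')"
    using typed_shift[OF v1(2), of "w' @ m" "[]"] by simp
  have b: "typed (web_io n) (w @ m @ v) [(length (w @ m) + j, h)] (w @ m @ v1)"
    using typed_shift[OF v1(1), of "w @ m" "[]"] by (simp add: x)
  have "leq n br 1 (w @ m @ v) (l @ [(length (w' @ m) + j, h)] @ shift (length (w' @ m)) k)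
      ((length (w @ m) + j, h) # l @ shift (length (w' @ m)) k) (w' @ m @ v')"
    using leq_app[OF commute_layer_word[OF wb l v1(1)[unfolded x], of m] _ a, of _ "[]"] by simp
  moreover have "leq n br 1 (w @ m @ v) ((length (w @ m) + j, h) # l @ shift (length (w' @ m)) k)
      ((length (w @ m) + j, h) # shift (length (w @ m)) k @ l) (w' @ m @ v')"
    using leq_app[OF Cons.IH[OF v1(2)] b, of "[]"] by simp
  ultimately show ?case using leq_trans1 by (fastforce simp: x)
qed

text \<open>A telescoping sum: \<open>zed\<close> times q^(2a) equals q^(2a + 1) - q^(2a -
  1).\<close>

lemma zed_sum:
  "k \<le> m \<Longrightarrow> zed * (\<Sum>a = k..<m. qpow (2 * of_nat a + r)) = qpow (2 * of_nat m - 1 + r) - qpow (2 * of_nat k - 1 + r)"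
proof (induction m rule: dec_induct)
  case (step m)
  have "zed * qpow (2 * of_nat m + r) = qpow (2 * of_nat (Suc m) - 1 + r) - qpow (2 * of_nat m - 1 + r)"
    by (simp add: zed_def qpow_mult algebra_simps)
  with step show ?case by (simp add: distrib_left)
qed simp

section \<open>Relations verified colour by colour\<close>

lemma leq_moveI1:
  assumes "web_bracket n br" "typed (web_io n) w l [d]" "typed (web_io n) w r [d]"
    "\<And>k. move n (shift k l) (shift k r) \<or> move n (shift k r) (shift k l)"
    "\<And>G a. a \<in> {1..n} \<Longrightarrow> acts n l G [a] = acts n r G [a]"
  shows "leq n br 1 w l r [d]"
  by (rule leq_moveI[OF assms(1-4)]) (use assms(5) in \<open>auto simp: length_Suc_conv\<close>)

lemma leq_moveI2:
  assumes "web_bracket n br" "typed (web_io n) w l [d, e]" "typed (web_io n) w r [d, e]"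
    "\<And>k. move n (shift k l) (shift k r) \<or> move n (shift k r) (shift k l)"
    "\<And>G a b. a \<in> {1..n} \<Longrightarrow> b \<in> {1..n} \<Longrightarrow> acts n l G [a, b] = acts n r G [a, b]"
  shows "leq n br 1 w l r [d, e]"
  by (rule leq_moveI[OF assms(1-4)]) (use assms(5) in \<open>auto simp: length_Suc_conv\<close>)

lemma leq_moveI3:
  assumes "web_bracket n br" "typed (web_io n) w l [d, e, f]" "typed (web_io n) w r [d, e, f]"
    "\<And>k. move n (shift k l) (shift k r) \<or> move n (shift k r) (shift k l)"
    "\<And>G a b c. a \<in> {1..n} \<Longrightarrow> b \<in> {1..n} \<Longrightarrow> c \<in> {1..n} \<Longrightarrow> acts n l G [a, b, c] = acts n r G [a, b, c]"
  shows "leq n br 1 w l r [d, e, f]"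
  by (rule leq_moveI[OF assms(1-4)]) (use assms(5) in \<open>auto simp: length_Suc_conv\<close>)

lemma qpow_cancel [simp]: "qpow r * qpow (- r) = 1" "qpow (- r) * qpow r = 1"
  "qpow r * (qpow (- r) * x) = x" "qpow (- r) * (qpow r * x) = x"
  by (simp_all add: qpow_mult flip: mult.assoc)

lemma sum_delta_interval:
  fixes f :: "nat \<Rightarrow> laurent"
  assumes "c \<in> {1..n}"
  shows "(\<Sum>a = 1..n. if a = c then f a else 0) = f c"
  using assms by simp

lemma straighten_right_leq:
  assumes "web_bracket n br"
  shows "leq n br 1 [d] [(0, Cap d), (1, Cup (opp d))] [] [d]"
proof (rule leq_moveI1[OF assms])
  fix k
  show "move n (shift k [(0, Cap d), (1, Cup (opp d))]) (shift k []) \<or>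
     move n (shift k []) (shift k [(0, Cap d), (1, Cup (opp d))])"
    using straighten_right[of n k d] by simp
next
  fix G a assume a: "a \<in> {1..n}"
  then show "acts n [(0, Cap d), (1, Cup (opp d))] G [a] = acts n [] G [a]"
    by (cases d) (simp_all add: if_distrib sum_delta_interval[OF a] cong: if_cong)
qed (cases d; simp)+

lemma straighten_left_leq:
  assumes "web_bracket n br"
  shows "leq n br 1 [opp d] [(1, Cap d), (0, Cup (opp d))] [] [opp d]"
proof (rule leq_moveI1[OF assms])
  fix k
  show "move n (shift k [(1, Cap d), (0, Cup (opp d))]) (shift k []) \<or>
     move n (shift k []) (shift k [(1, Cap d), (0, Cup (opp d))])"
    using straighten_left[of n k d] by simp
next
  fix G a assume a: "a \<in> {1..n}"
  then show "acts n [(1, Cap d), (0, Cup (opp d))] G [a] = acts n [] G [a]"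
    by (cases d) (simp_all add: if_distrib sum_delta_interval[OF a] cong: if_cong)
qed (cases d; simp)+

lemma reidemeister2_DD:
  assumes "web_bracket n br"
  shows "leq n br 1 [Down, Down] [(0, Cross b Down Down), (0, Cross (\<not> b) Down Down)] [] [Down, Down]"
proof (rule leq_moveI2[OF assms])
  fix k
  show "move n (shift k [(0, Cross b Down Down), (0, Cross (\<not> b) Down Down)]) (shift k []) \<or>
     move n (shift k []) (shift k [(0, Cross b Down Down), (0, Cross (\<not> b) Down Down)])"
    using reidemeister2[of n k b Down Down] by simp
next
  fix G a c assume "a \<in> {1..n}" "c \<in> {1..n}"
  show "acts n [(0, Cross b Down Down), (0, Cross (\<not> b) Down Down)] G [a, c] = acts n [] G [a, c]"
    by (cases b; cases a c rule: linorder_cases) (simp_all add: par_def algebra_simps)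
qed simp_all

lemma reidemeister2_UU:
  assumes "web_bracket n br"
  shows "leq n br 1 [Up, Up] [(0, Cross b Up Up), (0, Cross (\<not> b) Up Up)] [] [Up, Up]"
proof (rule leq_moveI2[OF assms])
  fix k
  show "move n (shift k [(0, Cross b Up Up), (0, Cross (\<not> b) Up Up)]) (shift k []) \<or>
     move n (shift k []) (shift k [(0, Cross b Up Up), (0, Cross (\<not> b) Up Up)])"
    using reidemeister2[of n k b Up Up] by simp
next
  fix G a c assume "a \<in> {1..n}" "c \<in> {1..n}"
  show "acts n [(0, Cross b Up Up), (0, Cross (\<not> b) Up Up)] G [a, c] = acts n [] G [a, c]"
    by (cases b; cases a c rule: linorder_cases) (simp_all add: par_def algebra_simps)
qed simp_all

lemma mixed_sum_Suc:
  assumes "c \<noteq> 0"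
  shows "(\<Sum>a = 1..<Suc c. qpow (2 * (of_nat (Suc c) - of_nat a)) * f a)
    = qpow 1 * qpow 1 * ((\<Sum>a = 1..<c. qpow (2 * (of_nat c - of_nat a)) * f a) + f c)"
proof -
  have m: "qpow (2 * (of_nat (Suc c) - of_nat a)) = qpow 1 * qpow 1 * qpow (2 * (of_nat c - of_nat a))" for a
    by (simp add: qpow_mult algebra_simps)
  have "(\<Sum>a = 1..<Suc c. qpow 1 * qpow 1 * qpow (2 * (of_nat c - of_nat a)) * f a)
      = qpow 1 * qpow 1 * (\<Sum>a = 1..<Suc c. qpow (2 * (of_nat c - of_nat a)) * f a)"
    by (simp only: sum_distrib_left mult.assoc)
  then show ?thesis unfolding m using assms by simp
qed

text \<open>On equal colours the two mixed crossings act by triangular matrices, one with constant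
  entries and one with weights q^(2(c - a)) below the diagonal. This identity and the next one say
  that the two matrices are inverse to each other.\<close>

lemma mixed_sum1:
  "zed * (\<Sum>a = 1..<c. qpow (2 * (of_nat c - of_nat a)) * (qpow (- 1) * g a - zed * (\<Sum>e = 1..<a. g e)))
    = qpow 1 * zed * (\<Sum>e = 1..<c. g e)"
proof (induction c)
  case (Suc c)
  show ?case
  proof (cases "c = 0")
    case False
    let ?f = "\<lambda>a. qpow (- 1) * g a - zed * (\<Sum>e = 1..<a. g e)"
    have "zed * (\<Sum>a = 1..<Suc c. qpow (2 * (of_nat (Suc c) - of_nat a)) * ?f a)
        = qpow 1 * qpow 1 * (zed * (\<Sum>a = 1..<c. qpow (2 * (of_nat c - of_nat a)) * ?f a))
          + zed * (qpow 1 * qpow 1) * ?f c"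
      unfolding mixed_sum_Suc[OF False] by (simp only: algebra_simps)
    also have "\<dots> = qpow 1 * qpow 1 * (qpow 1 * zed * (\<Sum>e = 1..<c. g e)) + zed * (qpow 1 * qpow 1) * ?f c"
      by (simp only: Suc)
    also have "\<dots> = qpow 1 * zed * ((\<Sum>e = 1..<c. g e) + g c)"
      by (simp add: zed_def algebra_simps)
    finally show ?thesis using False by simp
  qed simp
qed simp

lemma mixed_sum2:
  "zed * (\<Sum>a = 1..<c. qpow 1 * g a + zed * (\<Sum>e = 1..<a. qpow (2 * (of_nat a - of_nat e)) * g e))
    = qpow (- 1) * zed * (\<Sum>e = 1..<c. qpow (2 * (of_nat c - of_nat e)) * g e)"
proof (induction c)
  case (Suc c)
  show ?case
  proof (cases "c = 0")
    case False
    let ?T = "\<Sum>e = 1..<c. qpow (2 * (of_nat c - of_nat e)) * g e"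
    have T: "(\<Sum>e = 1..<Suc c. qpow (2 * (of_nat (Suc c) - of_nat e)) * g e) = qpow 1 * qpow 1 * (?T + g c)"
      by (rule mixed_sum_Suc[OF False])
    have "zed * (\<Sum>a = 1..<Suc c. qpow 1 * g a + zed * (\<Sum>e = 1..<a. qpow (2 * (of_nat a - of_nat e)) * g e))
        = qpow (- 1) * zed * ?T + zed * (qpow 1 * g c + zed * ?T)"
      using False Suc by (simp add: distrib_left)
    also have "\<dots> = qpow (- 1) * zed * (qpow 1 * qpow 1 * (?T + g c))"
      by (simp add: zed_def algebra_simps)
    finally show ?thesis by (simp only: T)
  qed simp
qed simp

lemma qpow_cancel_sum:
  "qpow (- r) * (a * (qpow r * x) + b * (qpow r * y)) = a * x + b * y"
  "qpow r * (a * (qpow (- r) * x) - b * (qpow (- r) * y)) = a * x - b * y"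
  by (simp_all add: algebra_simps)

lemma reidemeister2_DU:
  assumes "web_bracket n br"
  shows "leq n br 1 [Down, Up] [(0, Cross False Down Up), (0, Cross True Up Down)] [] [Down, Up]"
proof (rule leq_moveI2[OF assms])
  fix k
  show "move n (shift k [(0, Cross False Down Up), (0, Cross True Up Down)]) (shift k []) \<or>
     move n (shift k []) (shift k [(0, Cross False Down Up), (0, Cross True Up Down)])"
    using reidemeister2[of n k False Down Up] by simp
next
  fix G a c assume "a \<in> {1..n}" "c \<in> {1..n}"
  have "qpow 1 * (qpow (- 1) * G [c, c] - zed * (\<Sum>e = 1..<c. G [e, e]))
     + zed * (\<Sum>a = 1..<c. qpow (2 * (of_nat c - of_nat a)) * (qpow (- 1) * G [a, a] - zed * (\<Sum>e = 1..<a. G [e, e])))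
     = G [c, c]"
    unfolding mixed_sum1 by (simp add: algebra_simps)
  then show "acts n [(0, Cross False Down Up), (0, Cross True Up Down)] G [a, c] = acts n [] G [a, c]"
    by (cases "a = c") (simp_all add: mult.left_commute qpow_cancel_sum flip: sum_distrib_left)
qed simp_all

lemma reidemeister2_UD:
  assumes "web_bracket n br"
  shows "leq n br 1 [Up, Down] [(0, Cross True Up Down), (0, Cross False Down Up)] [] [Up, Down]"
proof (rule leq_moveI2[OF assms])
  fix k
  show "move n (shift k [(0, Cross True Up Down), (0, Cross False Down Up)]) (shift k []) \<or>
     move n (shift k []) (shift k [(0, Cross True Up Down), (0, Cross False Down Up)])"
    using reidemeister2[of n k True Up Down] by simp
next
  fix G a c assume "a \<in> {1..n}" "c \<in> {1..n}"
  have "qpow (- 1) * (qpow 1 * G [c, c] + zed * (\<Sum>e = 1..<c. qpow (2 * (of_nat c - of_nat e)) * G [e, e]))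
     - zed * (\<Sum>a = 1..<c. qpow 1 * G [a, a] + zed * (\<Sum>e = 1..<a. qpow (2 * (of_nat a - of_nat e)) * G [e, e]))
     = G [c, c]"
    unfolding mixed_sum2 by (simp add: algebra_simps)
  then show "acts n [(0, Cross True Up Down), (0, Cross False Down Up)] G [a, c] = acts n [] G [a, c]"
    by (cases "a = c") (simp_all add: mult.left_commute qpow_cancel_sum flip: sum_distrib_left)
qed simp_all

text \<open>The scalar of a parallel crossing. Both sides of a braid relation carry its third power,
  so it may stay unevaluated there.\<close>

definition kap :: "nat \<Rightarrow> bool \<Rightarrow> laurent" where
  "kap n b = qpow (if b then 1 / of_nat n else - 1 / of_nat n)"

lemma par_kap: "par n b lt G c d = kap n b *
     (if c = d then qpow (if b then - 1 else 1) * G [c, c]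
      else G [d, c] + (if b then if lt d c then - zed else 0 else if lt c d then zed else 0) * G [c, d])"
  by (simp add: par_def kap_def)

text \<open>The Yang-Baxter equation. The entries depend only on the relative order of the colours,
  so finitely many order types of three colours have to be compared.\<close>

lemma reidemeister3_DDD:
  assumes "web_bracket n br"
  shows "leq n br 1 [Down, Down, Down]
     [(0, Cross True Down Down), (1, Cross True Down Down), (0, Cross True Down Down)]
     [(1, Cross True Down Down), (0, Cross True Down Down), (1, Cross True Down Down)] [Down, Down, Down]"
    (is "leq _ _ _ _ ?l ?r _")
proof (rule leq_moveI3[OF assms])
  fix k
  show "move n (shift k ?l) (shift k ?r) \<or> move n (shift k ?r) (shift k ?l)"
    using reidemeister3[of True True True n k Down Down Down] by simp
next
  fix G x y w
  show "acts n ?l G [x, y, w] = acts n ?r G [x, y, w]"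
    by (cases x y rule: linorder_cases; cases y w rule: linorder_cases; cases x w rule: linorder_cases)
      (simp_all add: par_kap, (simp add: zed_def algebra_simps)+)
qed simp_all

lemma reidemeister3_UUU:
  assumes "web_bracket n br"
  shows "leq n br 1 [Up, Up, Up]
     [(0, Cross True Up Up), (1, Cross True Up Up), (0, Cross True Up Up)]
     [(1, Cross True Up Up), (0, Cross True Up Up), (1, Cross True Up Up)] [Up, Up, Up]"
    (is "leq _ _ _ _ ?l ?r _")
proof (rule leq_moveI3[OF assms])
  fix k
  show "move n (shift k ?l) (shift k ?r) \<or> move n (shift k ?r) (shift k ?l)"
    using reidemeister3[of True True True n k Up Up Up] by simp
next
  fix G x y w
  show "acts n ?l G [x, y, w] = acts n ?r G [x, y, w]"
    by (cases x y rule: linorder_cases; cases y w rule: linorder_cases; cases x w rule: linorder_cases)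
      (simp_all add: par_kap, (simp add: zed_def algebra_simps)+)
qed simp_all

text \<open>The strand \<open>x\<close> passes over the leg if it points up and under it if it
  points down. Exactly one of the two crossings is mixed, and the identity expresses its entries by
  those of the parallel one: turning the R-matrix at a maximum yields the sum over smaller colours,
  and the weights q^(2(c - a)) are quotients of the powers q^height.\<close>

lemma cap_slide_leq:
  assumes "web_bracket n br"
  shows "leq n br 1 [x] [(1, Cap d), (0, Cross (x = Up) x d)]
     [(0, Cap d), (1, Cross (x \<noteq> Up) (opp d) x)] [d, x, opp d]" (is "leq _ _ _ _ ?l ?r _")
proof (rule leq_moveI3[OF assms])
  fix k
  show "move n (shift k ?l) (shift k ?r) \<or> move n (shift k ?r) (shift k ?l)"
    using cap_slide[of n k d "x = Up" x] by simp
next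
  fix G a b c
  have m: "qpow (height n a) * qpow (of_nat c * 2 - of_nat a * 2) = qpow (height n c)" for a c
    by (simp add: height_def qpow_mult algebra_simps)
  have s: "(\<Sum>e = Suc 0..<c. if a = e then f e else 0) = (if 1 \<le> a \<and> a < c then f a else 0)" for f :: "nat \<Rightarrow> laurent"
    by simp
  show "acts n ?l G [a, b, c] = acts n ?r G [a, b, c]" if "a \<in> {1..n}" "c \<in> {1..n}"
    using that
    by (cases x; cases d) (auto simp: par_def s m if_distrib[of "\<lambda>x. _ * x"] algebra_simps cong: if_cong)
qed (cases x; cases d; simp)+

text \<open>Below a minimum, a parallel crossing spreads its off-diagonal terms over the colours
  \<open>a\<close>, whereas a mixed crossing keeps the same terms in the single summand
  \<open>a = c\<close>.\<close>

lemma slide_sum: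
  fixes A :: laurent and c n :: nat
  assumes "c \<in> {1..n}"
  shows "(\<Sum>a = 1..n. if a = c then A else B a + (if a < c then C a else 0))
    = (\<Sum>a = 1..n. if a = c then A + (\<Sum>e = 1..<c. C e) else B a)"
proof -
  have "(\<Sum>a \<in> {1..n} - {c}. if a < c then C a else 0) = (\<Sum>e = 1..<c. C e)"
    using assms by (intro sum.mono_neutral_cong_right) auto
  moreover have "(\<Sum>a \<in> {1..n} - {c}. if a = c then A else B a + (if a < c then C a else 0))
      = (\<Sum>a \<in> {1..n} - {c}. B a) + (\<Sum>a \<in> {1..n} - {c}. if a < c then C a else 0)"
    unfolding sum.distrib[symmetric] by (intro sum.cong) auto
  moreover have "(\<Sum>a \<in> {1..n} - {c}. if a = c then A + (\<Sum>e = 1..<c. C e) else B a)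
      = (\<Sum>a \<in> {1..n} - {c}. B a)"
    by (intro sum.cong) auto
  ultimately show ?thesis
    unfolding sum.remove[OF finite_atLeastAtMost assms] by simp
qed

lemma cup_slide_leq:
  assumes "web_bracket n br"
  shows "leq n br 1 [d, x, opp d] [(0, Cross (x = Down) d x), (1, Cup d)]
     [(1, Cross (x \<noteq> Down) x (opp d)), (0, Cup d)] [x]" (is "leq _ _ _ _ ?l ?r _")
proof (rule leq_moveI1[OF assms])
  fix k
  show "move n (shift k ?l) (shift k ?r) \<or> move n (shift k ?r) (shift k ?l)"
    using cup_slide[of n k "x = Down" d x] by simp
next
  fix G c assume c: "c \<in> {1..n}"
  have m: "qpow (- height n c) * qpow (of_nat c * 2 - of_nat e * 2) = qpow (- height n e)" for e
    by (simp add: height_def qpow_mult algebra_simps)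
  have m': "qpow (- height n c) * (qpow (of_nat c * 2 - of_nat e * 2) * X) = qpow (- height n e) * X" for e X
    by (simp only: m flip: mult.assoc)
  consider "x = Down \<and> d = Down" | "x = Up \<and> d = Up" | "x = Up \<and> d = Down" | "x = Down \<and> d = Up"
    by (cases x; cases d) auto
  then show "acts n ?l G [c] = acts n ?r G [c]"
  proof cases
    case 1
    \<comment> \<open>In each case \<open>k\<close> is the scalar of the crossings and
      \<open>w\<close> the weight of the minimum, while \<open>A\<close>, \<open>B\<close> and
      \<open>C\<close> are the diagonal, the exchanging and the off-diagonal terms of the parallel
      crossing.\<close>
    define k :: laurent where "k = qpow (1 / of_nat n)"
    define w :: "nat \<Rightarrow> laurent" where "w a = 1" for a
    define A where "A = w c * (k * (qpow (- 1) * G [c, c, c]))"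
    define B where "B a = w a * (k * G [a, c, a])" for a
    define C where "C a = w a * (k * (- zed * G [c, a, a]))" for a
    have "acts n ?l G [c] = (\<Sum>a = 1..n. if a = c then A else B a + (if a < c then C a else 0))"
      using 1 by (auto simp: par_def A_def B_def C_def k_def w_def algebra_simps intro!: sum.cong)
    moreover have "acts n ?r G [c] = (\<Sum>a = 1..n. if a = c then A + (\<Sum>e = 1..<c. C e) else B a)"
      using 1 by (auto simp: A_def B_def C_def k_def w_def m m' algebra_simps sum_distrib_left sum_negf
          intro!: sum.cong)
    ultimately show ?thesis unfolding slide_sum[OF c] by simp
  next
    case 2
    define k :: laurent where "k = qpow (- 1 / of_nat n)"
    define w :: "nat \<Rightarrow> laurent" where "w a = qpow (- height n a)" for a
    define A where "A = w c * (k * (qpow 1 * G [c, c, c]))"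
    define B where "B a = w a * (k * G [a, c, a])" for a
    define C where "C a = w a * (k * (zed * G [c, a, a]))" for a
    have "acts n ?l G [c] = (\<Sum>a = 1..n. if a = c then A else B a + (if a < c then C a else 0))"
      using 2 by (auto simp: par_def A_def B_def C_def k_def w_def algebra_simps intro!: sum.cong)
    moreover have "acts n ?r G [c] = (\<Sum>a = 1..n. if a = c then A + (\<Sum>e = 1..<c. C e) else B a)"
      using 2 by (auto simp: A_def B_def C_def k_def w_def m m' algebra_simps sum_distrib_left sum_negf
          intro!: sum.cong)
    ultimately show ?thesis unfolding slide_sum[OF c] by simp
  next
    case 3
    define k :: laurent where "k = qpow (1 / of_nat n)"
    define w :: "nat \<Rightarrow> laurent" where "w a = 1" for a
    define A where "A = w c * (k * (qpow (- 1) * G [c, c, c]))"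
    define B where "B a = w a * (k * G [a, c, a])" for a
    define C where "C a = w a * (k * (- zed * G [a, a, c]))" for a
    have "acts n ?r G [c] = (\<Sum>a = 1..n. if a = c then A else B a + (if a < c then C a else 0))"
      using 3 by (auto simp: par_def A_def B_def C_def k_def w_def algebra_simps intro!: sum.cong)
    moreover have "acts n ?l G [c] = (\<Sum>a = 1..n. if a = c then A + (\<Sum>e = 1..<c. C e) else B a)"
      using 3 by (auto simp: A_def B_def C_def k_def w_def m m' algebra_simps sum_distrib_left sum_negf
          intro!: sum.cong)
    ultimately show ?thesis unfolding slide_sum[OF c] by simp
  next
    case 4
    define k :: laurent where "k = qpow (- 1 / of_nat n)"
    define w :: "nat \<Rightarrow> laurent" where "w a = qpow (- height n a)" for a
    define A where "A = w c * (k * (qpow 1 * G [c, c, c]))"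
    define B where "B a = w a * (k * G [a, c, a])" for a
    define C where "C a = w a * (k * (zed * G [a, a, c]))" for a
    have "acts n ?r G [c] = (\<Sum>a = 1..n. if a = c then A else B a + (if a < c then C a else 0))"
      using 4 by (auto simp: par_def A_def B_def C_def k_def w_def algebra_simps intro!: sum.cong)
    moreover have "acts n ?l G [c] = (\<Sum>a = 1..n. if a = c then A + (\<Sum>e = 1..<c. C e) else B a)"
      using 4 by (auto simp: A_def B_def C_def k_def w_def m m' algebra_simps sum_distrib_left sum_negf
          intro!: sum.cong)
    ultimately show ?thesis unfolding slide_sum[OF c] by simp
  qed
qed (cases x; cases d; simp)+

lemma circle_leq:
  assumes "web_bracket n br"
  shows "leq n br (qint n) [] [(0, Cap Down), (0, Cup Down)] [] []"
proof (rule leqI)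
  fix p s :: "dir list" and u v
  assume "is_web n (u @ shift (length p) [(0, Cap Down), (0, Cup Down)] @ v)"
  then show "br (u @ shift (length p) [(0, Cap Down), (0, Cup Down)] @ v) = qint n * br (u @ shift (length p) [] @ v)"
    using assms unfolding web_bracket_def by simp
next
  fix G and ys :: "nat list" assume ys: "length ys = length ([] :: dir list)"
  \<comment> \<open>After multiplication by \<open>zed\<close>, which can be cancelled, the sum of
    the circle weights telescopes.\<close>
  have "zed * (\<Sum>a = 1..<Suc n. qpow (2 * of_nat a + (- of_nat n - 1))) = zed * qint n"
    by (subst zed_sum) (simp_all add: qint_eq(2)[of n, folded zed_def, simplified mult.commute[of _ zed]])
  moreover have "zed \<noteq> 0" by (simp add: zed_def qpow_inj)
  ultimately have "(\<Sum>a = 1..<Suc n. qpow (2 * of_nat a + (- of_nat n - 1))) = qint n" by simp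
  then have "(\<Sum>a = 1..n. qpow (height n a)) = qint n"
    by (simp add: height_def atLeastLessThanSuc_atLeastAtMost algebra_simps)
  then show "acts n [(0, Cap Down), (0, Cup Down)] G ys = qint n * acts n [] G ys"
    using ys by (simp flip: sum_distrib_right)
qed simp_all

lemma bracket_curl:
  assumes "web_bracket n br" "is_web n (u @ curl_right i d b @ v)"
  shows "br (u @ curl_right i d b @ v)
    = qpow (if b then 1 / of_nat n - of_nat n else of_nat n - 1 / of_nat n) * br (u @ v)"
  using assms unfolding web_bracket_def by blast

text \<open>The off-diagonal terms that survive in the trace run over the colours on one side of
  \<open>c\<close> only; weighted with q^height they telescope to q^n or q^(-n), and the scalar of
  the crossing contributes the fractional exponent.\<close>

lemma curl_leq:
  assumes "web_bracket n br"
  shows "leq n br (qpow (if b then 1 / of_nat n - of_nat n else of_nat n - 1 / of_nat n))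
    [Down] (curl_right 0 Down b) [] [Down]"
proof (rule leqI)
  fix p s :: "dir list" and u v
  have sh: "shift (length p) (curl_right 0 Down b) = curl_right (length p) Down b"
    by (simp add: curl_right_def)
  assume "is_web n (u @ shift (length p) (curl_right 0 Down b) @ v)"
  then show "br (u @ shift (length p) (curl_right 0 Down b) @ v)
      = qpow (if b then 1 / of_nat n - of_nat n else of_nat n - 1 / of_nat n) * br (u @ shift (length p) [] @ v)"
    using bracket_curl[OF assms] unfolding sh by simp
next
  fix G and ys :: "nat list" assume ys: "length ys = length [Down]" "set ys \<subseteq> {1..n}"
  then obtain c where c: "ys = [c]" "c \<in> {1..n}" by (auto simp: length_Suc_conv)
  let ?r = "- of_nat n - 1 :: rat"
  have h: "qpow (height n a) = qpow (2 * of_nat a + ?r)" for a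
    by (simp add: height_def algebra_simps)
  show "acts n (curl_right 0 Down b) G ys
      = qpow (if b then 1 / of_nat n - of_nat n else of_nat n - 1 / of_nat n) * acts n [] G ys"
  proof (cases b)
    case True
    have "(\<Sum>a = 1..n. if a = c then qpow (- 1) * qpow (height n c) else if a < c then - zed * qpow (height n a) else 0)
        = (\<Sum>a = 1..n. if a = c then qpow (- 1) * qpow (height n c) else 0 + (if a < c then - zed * qpow (height n a) else 0))"
      by (intro sum.cong) auto
    also have "\<dots> = (\<Sum>a = 1..n. if a = c then qpow (- 1) * qpow (height n c) - zed * (\<Sum>e = 1..<c. qpow (2 * of_nat e + ?r)) else 0)"
      unfolding slide_sum[OF c(2)] by (simp add: h sum_distrib_left sum_negf)
    also have "\<dots> = qpow (- of_nat n)"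
      using c(2) by (subst zed_sum) (auto simp: h qpow_mult algebra_simps)
    finally have S: "(\<Sum>a = 1..n. if a = c then qpow (- 1) * qpow (height n c) else if a < c then - zed * qpow (height n a) else 0)
      = qpow (- of_nat n)" .
    have "acts n (curl_right 0 Down b) G ys = qpow (1 / of_nat n) * (\<Sum>a = 1..n.
        if a = c then qpow (- 1) * qpow (height n c) else if a < c then - zed * qpow (height n a) else 0) * G [c]"
      using True c by (auto simp: curl_right_def par_def sum_distrib_left sum_distrib_right algebra_simps intro!: sum.cong)
    then show ?thesis using True c unfolding S by (simp add: qpow_mult algebra_simps)
  next
    case False
    have "(\<Sum>a = 1..n. if a = c then qpow 1 * qpow (height n c) else if c < a then zed * qpow (height n a) else 0)
        = qpow 1 * qpow (height n c) + zed * (\<Sum>e = Suc c..<Suc n. qpow (2 * of_nat e + ?r))"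
    proof -
      have "(\<Sum>a \<in> {1..n} - {c}. if a = c then qpow 1 * qpow (height n c) else if c < a then zed * qpow (height n a) else 0)
          = (\<Sum>e = Suc c..<Suc n. zed * qpow (2 * of_nat e + ?r))"
        using c(2) by (intro sum.mono_neutral_cong_right) (auto simp: h)
      then show ?thesis
        unfolding sum.remove[OF finite_atLeastAtMost c(2)] sum_distrib_left by (simp del: sum.op_ivl_Suc)
    qed
    also have "\<dots> = qpow (of_nat n)"
      using c(2) by (subst zed_sum) (auto simp: h qpow_mult algebra_simps)
    finally have S: "(\<Sum>a = 1..n. if a = c then qpow 1 * qpow (height n c) else if c < a then zed * qpow (height n a) else 0)
        = qpow (of_nat n)" .
    have "acts n (curl_right 0 Down b) G ys = qpow (- 1 / of_nat n) * (\<Sum>a = 1..n.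
        if a = c then qpow 1 * qpow (height n c) else if c < a then zed * qpow (height n a) else 0) * G [c]"
      using False c by (auto simp: curl_right_def par_def sum_distrib_left sum_distrib_right algebra_simps intro!: sum.cong)
    then show ?thesis using False c unfolding S by (simp add: qpow_mult algebra_simps)
  qed
qed (simp_all add: curl_right_def)

lemma par_hecke:
  "par n False (<) G c d = qpow (- 2 / of_nat n) * par n True (<) G c d + qpow (- 1 / of_nat n) * zed * G [c, d]"
proof -
  define X where "X b = (if c = d then qpow (if b then - 1 else 1) * G [c, c]
      else G [d, c] + (if b then if d < c then - zed else 0 else if c < d then zed else 0) * G [c, d])" for b
  have "X False = X True + zed * G [c, d]"
    by (auto simp: X_def zed_def algebra_simps)
  moreover have "qpow (- 2 / of_nat n) * (qpow (1 / of_nat n) * X True) = qpow (- 1 / of_nat n) * X True"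
    by (simp add: qpow_mult flip: mult.assoc)
  moreover have "par n b (<) G c d = qpow (if b then 1 / of_nat n else - 1 / of_nat n) * X b" for b
    by (simp add: par_def X_def)
  ultimately show ?thesis by (simp only: distrib_left mult.assoc if_True if_False)
qed

text \<open>The skein relation, solved for the positive crossing. It has three terms and so is
  stated for \<open>ev\<close> itself, since \<open>leq\<close> compares only two diagrams.\<close>

lemma hecke_ev:
  assumes wb: "web_bracket n br" and u: "typed (web_io n) [] u w"
    and ty: "typed (web_io n) w [(i, Cross False Down Down)] w'"
  shows "ev n br (u @ [(i, Cross False Down Down)]) x
    = qpow (- 2 / of_nat n) * ev n br (u @ [(i, Cross True Down Down)]) x + qpow (- 1 / of_nat n) * zed * ev n br u x"
proof -
  obtain p s where ps: "w = p @ [Down, Down] @ s" "w' = p @ [Down, Down] @ s" "i = length p"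
    using ty unfolding typed_layer by auto
  have uF: "typed (web_io n) [] (u @ [(i, Cross b Down Down)]) w" for b
    unfolding typed_append typed_layer using u ps by auto
  show ?thesis
  proof (cases x)
    case (Inl v)
    have w: "is_web n (u @ [(i, Cross b Down Down)] @ v) \<longleftrightarrow> is_web n (u @ v)" for b
      using uF[of b] u unfolding is_web_typed append_assoc[symmetric] typed_append[of _ _ _ v]
      using typed_unique by metis
    have "br (u @ [(i, Cross False Down Down)] @ v)
      = qpow (- 2 / of_nat n) * br (u @ [(i, Cross True Down Down)] @ v) + qpow (- 1 / of_nat n) * zed * br (u @ v)"
      if "is_web n (u @ v)"
    proof -
      have "qpow (1 / of_nat n) * br (u @ [(i, Cross False Down Down)] @ v)
          - qpow (- 1 / of_nat n) * br (u @ [(i, Cross True Down Down)] @ v) = zed * br (u @ v)"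
        using wb w[of False] that unfolding web_bracket_def zed_def by blast
      then have "qpow (- 1 / of_nat n) * (qpow (1 / of_nat n) * br (u @ [(i, Cross False Down Down)] @ v))
          = qpow (- 1 / of_nat n) * (qpow (- 1 / of_nat n) * br (u @ [(i, Cross True Down Down)] @ v) + zed * br (u @ v))"
        by (simp add: algebra_simps)
      then show ?thesis
        by (simp add: qpow_mult distrib_left flip: mult.assoc)
    qed
    then show ?thesis using w by (simp add: Inl ev_def)
  next
    case (Inr ys)
    show ?thesis
    proof (cases "length ys = length w \<and> set ys \<subseteq> {1..n}")
      case True
      then have "length (drop i ys) = Suc (Suc (length s))" using ps by simp
      then obtain c d sy where "drop i ys = c # d # sy" unfolding length_Suc_conv by blast
      then have ys: "ys = take i ys @ c # d # sy" using append_take_drop_id[of i ys] by simp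
      obtain py where py: "ys = py @ c # d # sy" "length py = i"
        using ys True ps by (metis (no_types, lifting) length_append length_take min.absorb2 le_add1)
      have "act n (i, Cross False Down Down) F ys = qpow (- 2 / of_nat n) * act n (i, Cross True Down Down) F ys
          + qpow (- 1 / of_nat n) * zed * F ys" for F
        using py(2) par_hecke[of n "\<lambda>xs. F (py @ xs @ sy)" c d] unfolding py(1) by simp
      then show ?thesis
        using True typed_foldl_eq[OF uF, unfolded foldl_append] typed_foldl_eq[OF u]
        by (simp add: Inr ev_def acts_append del: act.simps)
    next
      case False
      then show ?thesis
        by (auto simp: Inr ev_def typed_foldl_eq[OF uF] typed_foldl_eq[OF u] simp del: foldl_append)
    qed
  qed
qed

section \<open>Crossings in which upward strands pass over downward strands\<close>

fun good :: "nat \<times> web_piece \<Rightarrow> bool" where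
  "good (i, Cross b x y) \<longleftrightarrow> x = y \<or> b = (x = Up)"
| "good _ \<longleftrightarrow> False"

definition xword :: "web_piece diagram \<Rightarrow> bool" where
  "xword D \<longleftrightarrow> list_all good D"

lemma xword_simps [simp]: "xword []" "xword (l # D) \<longleftrightarrow> good l \<and> xword D"
  "xword (D @ E) \<longleftrightarrow> xword D \<and> xword E"
  by (auto simp: xword_def)

lemma good_shift [simp]: "good (k + i, g) = good (i, g)" "good (Suc i, g) = good (i, g)"
  by (cases g; simp)+

lemma xword_shift [simp]: "xword (shift k D) = xword D"
  by (induction D) auto

fun flip :: "nat \<times> web_piece \<Rightarrow> nat \<times> web_piece" where
  "flip (i, Cross b x y) = (i, Cross (\<not> b) y x)"
| "flip l = l"

text \<open>The inverse tangle of a word in crossings, letter by letter as in the second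
  Reidemeister move.\<close>

definition winv :: "web_piece diagram \<Rightarrow> web_piece diagram" where
  "winv D = rev (map flip D)"

lemma flip_flip: "flip (flip l) = l"
  by (induction l rule: flip.induct) auto

lemma good_flip: "good l \<Longrightarrow> good (flip l)"
proof (induction l rule: good.induct)
  case (1 i b x y)
  then show ?case by (cases x; cases y) auto
qed auto

lemma opp_opp [simp]: "opp (opp d) = d"
  by (cases d) auto

lemma leq_step':
  assumes "leq n br c w l r w'" "typed (web_io n) W0 a (p @ w @ s)" "typed (web_io n) (p @ w' @ s) b W1"
    "L = a @ shift (length p) l @ b" "R = a @ shift (length p) r @ b"
  shows "leq n br c W0 L R W1"
  using leq_step[OF assms(1) refl refl assms(2-)] .

locale web_invariant =
  fixes n :: nat and br :: "web_piece diagram \<Rightarrow> laurent"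
  assumes wb: "web_bracket n br"
begin

abbreviation "eqv \<equiv> leq n br 1"
abbreviation "ty \<equiv> typed (web_io n)"

lemma R2:
  assumes "good (0, Cross b x y)"
  shows "eqv [x, y] [(0, Cross b x y), (0, Cross (\<not> b) y x)] [] [x, y]"
  using assms reidemeister2_DD[OF wb, of b] reidemeister2_UU[OF wb, of b]
    reidemeister2_DU[OF wb] reidemeister2_UD[OF wb]
  by (cases x; cases y; cases b) simp_all

lemma winv_layer:
  assumes "good l" "ty w [l] v"
  shows "eqv w [l, flip l] [] w" "ty v [flip l] w"
proof -
  obtain i b x y where l: "l = (i, Cross b x y)" using assms(1) by (cases l rule: good.cases) auto
  obtain p s where ps: "w = p @ [x, y] @ s" "v = p @ [y, x] @ s" "i = length p"
    using assms(2) unfolding l typed_layer by auto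
  have "good (0, Cross b x y)" using assms(1) by (simp add: l)
  from leq_ctx[OF R2[OF this], of p s] show "eqv w [l, flip l] [] w" by (simp add: l ps)
  show "ty v [flip l] w" unfolding l flip.simps typed_layer using ps by auto
qed

lemma winv_word:
  assumes "xword D" "ty w D v"
  shows "eqv w (D @ winv D) [] w" "ty v (winv D) w" "xword (winv D)"
proof -
  have "eqv w (D @ winv D) [] w \<and> ty v (winv D) w \<and> xword (winv D)"
    using assms
  proof (induction D arbitrary: w)
    case (Cons l D)
    obtain w1 where w1: "ty w [l] w1" "ty w1 D v" using Cons.prems by auto
    note IH = Cons.IH[OF _ w1(2)]
    have g: "good l" "xword D" using Cons.prems by auto
    have inv: "winv (l # D) = winv D @ [flip l]" by (simp add: winv_def)
    have "eqv w (l # D @ winv D @ [flip l]) [l, flip l] w"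
      using leq_app[of n br 1 w1 "D @ winv D" "[]" w1 w "[l]" "[flip l]" w] IH g w1 winv_layer[OF g(1) w1(1)]
      by simp
    then have "eqv w (l # D @ winv D @ [flip l]) [] w"
      using winv_layer[OF g(1) w1(1)] leq_trans1 by blast
    then show ?case using IH g winv_layer(2)[OF g(1) w1(1)] good_flip[OF g(1)] inv
      by (auto simp: typed_append simp del: typed.simps(2))
  qed (auto simp: winv_def leq_refl)
  then show "eqv w (D @ winv D) [] w" "ty v (winv D) w" "xword (winv D)" by auto
qed

lemma winv_winv: "winv (winv D) = D"
  by (induction D) (auto simp: winv_def rev_map flip_flip)

lemma winv_word': "xword D \<Longrightarrow> ty w D v \<Longrightarrow> eqv v (winv D @ D) [] v"
  using winv_word(1)[of "winv D" v w] winv_word(2,3)[of D w v] winv_winv[of D] by simp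

abbreviation "DU \<equiv> Cross False Down Up"
abbreviation "UD \<equiv> Cross True Up Down"
abbreviation "DD b \<equiv> Cross b Down Down"
abbreviation "UU b \<equiv> Cross b Up Up"

section \<open>Braid relations and turns with antiparallel strands\<close>

lemma pass_under_DDU:
  "eqv [Down, Down, Up] [(1, DU), (0, DU)] [(0, Cap Up), (1, DD True), (2, DD True), (3, Cup Down)] [Up, Down, Down]"
proof -
  have 1: "eqv [Down, Down, Up] [(1, DU), (0, DU)] [(2, Cap Up), (3, Cup Down), (1, DU), (0, DU)] [Up, Down, Down]"
    by (rule leq_step'[OF leq_sym[OF straighten_right_leq[OF wb, of Up]], where p = "[Down, Down]" and s = "[]"
          and a = "[]" and b = "[(1, DU), (0, DU)]"]) simp_all
  have "ty [Down, Down, Up] [(1, DU), (0, DU)] [Up, Down, Down]" "ty [Down, Up] [(0, Cup Down)] []" by simp_all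
  note c = commute_words[OF wb this, of "[]"]
  have 2: "eqv [Down, Down, Up] [(2, Cap Up), (3, Cup Down), (1, DU), (0, DU)]
      [(2, Cap Up), (1, DU), (0, DU), (3, Cup Down)] [Up, Down, Down]"
    by (rule leq_step'[OF leq_sym[OF c], where p = "[]" and s = "[]" and a = "[(2, Cap Up)]" and b = "[]"]) simp_all
  have 3: "eqv [Down, Down, Up] [(2, Cap Up), (1, DU), (0, DU), (3, Cup Down)]
      [(1, Cap Up), (2, DD True), (0, DU), (3, Cup Down)] [Up, Down, Down]"
    by (rule leq_step'[OF cap_slide_leq[OF wb, of Down Up], where p = "[Down]" and s = "[Up]" and a = "[]"
          and b = "[(0, DU), (3, Cup Down)]"]) simp_all
  have "ty [Down, Up] [(0, DU)] [Up, Down]" "ty [Down, Down] [(0, DD True)] [Down, Down]" by simp_all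
  note c = commute_words[OF wb this, of "[]"]
  have 4: "eqv [Down, Down, Up] [(1, Cap Up), (2, DD True), (0, DU), (3, Cup Down)]
      [(1, Cap Up), (0, DU), (2, DD True), (3, Cup Down)] [Up, Down, Down]"
    by (rule leq_step'[OF leq_sym[OF c], where p = "[]" and s = "[Up]" and a = "[(1, Cap Up)]" and b = "[(3, Cup Down)]"]) simp_all
  have 5: "eqv [Down, Down, Up] [(1, Cap Up), (0, DU), (2, DD True), (3, Cup Down)]
      [(0, Cap Up), (1, DD True), (2, DD True), (3, Cup Down)] [Up, Down, Down]"
    by (rule leq_step'[OF cap_slide_leq[OF wb, of Down Up], where p = "[]" and s = "[Down, Up]" and a = "[]"
          and b = "[(2, DD True), (3, Cup Down)]"]) simp_all
  show ?thesis by (rule leq_trans1[OF 1 leq_trans1[OF 2 leq_trans1[OF 3 leq_trans1[OF 4 5]]]])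
qed

text \<open>The downward strand is bent by a zigzag, so that it points up where it meets the other
  two. In \<open>pass_under_DDU\<close> the upward strand is bent instead. Both rewritings trade
  mixed crossings for parallel ones, where the braid relation is available.\<close>

lemma pass_over_DUU:
  "eqv [Down, Up, Up] [(0, DU), (1, DU)] [(3, Cap Up), (2, UU True), (1, UU True), (0, Cup Down)] [Up, Up, Down]"
proof -
  have 1: "eqv [Down, Up, Up] [(0, DU), (1, DU)] [(1, Cap Up), (0, Cup Down), (0, DU), (1, DU)] [Up, Up, Down]"
    by (rule leq_step'[OF leq_sym[OF straighten_left_leq[OF wb, of Up]], where p = "[]" and s = "[Up, Up]"
          and a = "[]" and b = "[(0, DU), (1, DU)]"]) simp_all
  have "ty [Down, Up] [(0, Cup Down)] []" "ty [Down, Up, Up] [(0, DU), (1, DU)] [Up, Up, Down]" by simp_all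
  note c = commute_words[OF wb this, of "[]"]
  have 2: "eqv [Down, Up, Up] [(1, Cap Up), (0, Cup Down), (0, DU), (1, DU)]
      [(1, Cap Up), (2, DU), (3, DU), (0, Cup Down)] [Up, Up, Down]"
    by (rule leq_step'[OF c, where p = "[]" and s = "[]" and a = "[(1, Cap Up)]" and b = "[]"]) simp_all
  have 3: "eqv [Down, Up, Up] [(1, Cap Up), (2, DU), (3, DU), (0, Cup Down)]
      [(2, Cap Up), (1, UU True), (3, DU), (0, Cup Down)] [Up, Up, Down]"
    by (rule leq_step'[OF leq_sym[OF cap_slide_leq[OF wb, of Up Up]], where p = "[Down]" and s = "[Up]" and a = "[]"
          and b = "[(3, DU), (0, Cup Down)]"]) simp_all
  have "ty [Up, Up] [(0, UU True)] [Up, Up]" "ty [Down, Up] [(0, DU)] [Up, Down]" by simp_all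
  note c = commute_words[OF wb this, of "[]"]
  have 4: "eqv [Down, Up, Up] [(2, Cap Up), (1, UU True), (3, DU), (0, Cup Down)]
      [(2, Cap Up), (3, DU), (1, UU True), (0, Cup Down)] [Up, Up, Down]"
    by (rule leq_step'[OF c, where p = "[Down]" and s = "[]" and a = "[(2, Cap Up)]" and b = "[(0, Cup Down)]"]) simp_all
  have 5: "eqv [Down, Up, Up] [(2, Cap Up), (3, DU), (1, UU True), (0, Cup Down)]
      [(3, Cap Up), (2, UU True), (1, UU True), (0, Cup Down)] [Up, Up, Down]"
    by (rule leq_step'[OF leq_sym[OF cap_slide_leq[OF wb, of Up Up]], where p = "[Down, Up]" and s = "[]" and a = "[]"
          and b = "[(1, UU True), (0, Cup Down)]"]) simp_all
  show ?thesis by (rule leq_trans1[OF 1 leq_trans1[OF 2 leq_trans1[OF 3 leq_trans1[OF 4 5]]]])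
qed

text \<open>If \<open>S\<close> carries \<open>A\<close> to \<open>B\<close>, it carries the inverse
  of \<open>A\<close> to the inverse of \<open>B\<close>. So a slide proved for one sign of a
  crossing holds for the other.\<close>

lemma slide_conjugate:
  assumes s: "eqv w (A @ S) (S @ B) v" and S: "ty w S v" and A: "xword A" "ty w A w" and B: "xword B" "ty v B v"
  shows "eqv w (winv A @ S) (S @ winv B) v"
proof -
  note Ai = winv_word[OF A] and Bi = winv_word[OF B]
  have 1: "eqv w (winv A @ S) (winv A @ S @ B @ winv B) v"
    using leq_app[OF leq_sym[OF Bi(1)], of w "winv A @ S" "[]" v] Ai S by (auto simp: typed_append)
  have 2: "eqv w (winv A @ S @ B @ winv B) (winv A @ A @ S @ winv B) v"
    using leq_app[OF leq_sym[OF s] Ai(2) Bi(2)] by simp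
  have 3: "eqv w (winv A @ A @ S @ winv B) (S @ winv B) v"
    using leq_app[OF winv_word'[OF A], of w "[]" "S @ winv B" v] S Bi by (auto simp: typed_append)
  show ?thesis by (rule leq_trans1[OF 1 leq_trans1[OF 2 3]])
qed

lemma R3_DDU:
  "eqv [Down, Down, Up] [(0, DD b), (1, DU), (0, DU)] [(1, DU), (0, DU), (1, DD b)] [Up, Down, Down]"
proof -
  have 1: "eqv [Down, Down, Up] [(0, DD True), (1, DU), (0, DU)]
      [(0, DD True), (0, Cap Up), (1, DD True), (2, DD True), (3, Cup Down)] [Up, Down, Down]"
    by (rule leq_step'[OF pass_under_DDU, where p = "[]" and s = "[]" and a = "[(0, DD True)]" and b = "[]"]) simp_all
  have "ty [] [(0, Cap Up)] [Up, Down]" "ty [Down, Down] [(0, DD True)] [Down, Down]" by simp_all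
  note c = commute_words[OF wb this, of "[]"]
  have 2: "eqv [Down, Down, Up] [(0, DD True), (0, Cap Up), (1, DD True), (2, DD True), (3, Cup Down)]
      [(0, Cap Up), (2, DD True), (1, DD True), (2, DD True), (3, Cup Down)] [Up, Down, Down]"
    by (rule leq_step'[OF leq_sym[OF c], where p = "[]" and s = "[Up]" and a = "[]"
          and b = "[(1, DD True), (2, DD True), (3, Cup Down)]"]) simp_all
  have 3: "eqv [Down, Down, Up] [(0, Cap Up), (2, DD True), (1, DD True), (2, DD True), (3, Cup Down)]
      [(0, Cap Up), (1, DD True), (2, DD True), (1, DD True), (3, Cup Down)] [Up, Down, Down]"
    by (rule leq_step'[OF leq_sym[OF reidemeister3_DDD[OF wb]], where p = "[Up]" and s = "[Up]" and a = "[(0, Cap Up)]"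
          and b = "[(3, Cup Down)]"]) simp_all
  have "ty [Down, Down] [(0, DD True)] [Down, Down]" "ty [Down, Up] [(0, Cup Down)] []" by simp_all
  note c = commute_words[OF wb this, of "[]"]
  have 4: "eqv [Down, Down, Up] [(0, Cap Up), (1, DD True), (2, DD True), (1, DD True), (3, Cup Down)]
      [(0, Cap Up), (1, DD True), (2, DD True), (3, Cup Down), (1, DD True)] [Up, Down, Down]"
    by (rule leq_step'[OF c, where p = "[Up]" and s = "[]" and a = "[(0, Cap Up), (1, DD True), (2, DD True)]"
          and b = "[]"]) simp_all
  have 5: "eqv [Down, Down, Up] [(0, Cap Up), (1, DD True), (2, DD True), (3, Cup Down), (1, DD True)]
      [(1, DU), (0, DU), (1, DD True)] [Up, Down, Down]"
    by (rule leq_step'[OF leq_sym[OF pass_under_DDU], where p = "[]" and s = "[]" and a = "[]" and b = "[(1, DD True)]"]) simp_all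
  have T: "eqv [Down, Down, Up] [(0, DD True), (1, DU), (0, DU)] [(1, DU), (0, DU), (1, DD True)] [Up, Down, Down]"
    by (rule leq_trans1[OF 1 leq_trans1[OF 2 leq_trans1[OF 3 leq_trans1[OF 4 5]]]])
  show ?thesis
  proof (cases b)
    case False
    show ?thesis
      using slide_conjugate[of "[Down, Down, Up]" "[(0, DD True)]" "[(1, DU), (0, DU)]" "[(1, DD True)]" "[Up, Down, Down]"]
        T False by (simp add: winv_def)
  qed (use T in simp)
qed

lemma R3_DUU:
  "eqv [Down, Up, Up] [(1, UU b), (0, DU), (1, DU)] [(0, DU), (1, DU), (0, UU b)] [Up, Up, Down]"
proof -
  have 1: "eqv [Down, Up, Up] [(1, UU True), (0, DU), (1, DU)]
      [(1, UU True), (3, Cap Up), (2, UU True), (1, UU True), (0, Cup Down)] [Up, Up, Down]"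
    by (rule leq_step'[OF pass_over_DUU, where p = "[]" and s = "[]" and a = "[(1, UU True)]" and b = "[]"]) simp_all
  have "ty [Up, Up] [(0, UU True)] [Up, Up]" "ty [] [(0, Cap Up)] [Up, Down]" by simp_all
  note c = commute_words[OF wb this, of "[]"]
  have 2: "eqv [Down, Up, Up] [(1, UU True), (3, Cap Up), (2, UU True), (1, UU True), (0, Cup Down)]
      [(3, Cap Up), (1, UU True), (2, UU True), (1, UU True), (0, Cup Down)] [Up, Up, Down]"
    by (rule leq_step'[OF c, where p = "[Down]" and s = "[]" and a = "[]"
          and b = "[(2, UU True), (1, UU True), (0, Cup Down)]"]) simp_all
  have 3: "eqv [Down, Up, Up] [(3, Cap Up), (1, UU True), (2, UU True), (1, UU True), (0, Cup Down)]
      [(3, Cap Up), (2, UU True), (1, UU True), (2, UU True), (0, Cup Down)] [Up, Up, Down]"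
    by (rule leq_step'[OF reidemeister3_UUU[OF wb], where p = "[Down]" and s = "[Down]" and a = "[(3, Cap Up)]"
          and b = "[(0, Cup Down)]"]) simp_all
  have "ty [Down, Up] [(0, Cup Down)] []" "ty [Up, Up] [(0, UU True)] [Up, Up]" by simp_all
  note c = commute_words[OF wb this, of "[]"]
  have 4: "eqv [Down, Up, Up] [(3, Cap Up), (2, UU True), (1, UU True), (2, UU True), (0, Cup Down)]
      [(3, Cap Up), (2, UU True), (1, UU True), (0, Cup Down), (0, UU True)] [Up, Up, Down]"
    by (rule leq_step'[OF leq_sym[OF c], where p = "[]" and s = "[Down]" and a = "[(3, Cap Up), (2, UU True), (1, UU True)]"
          and b = "[]"]) simp_all
  have 5: "eqv [Down, Up, Up] [(3, Cap Up), (2, UU True), (1, UU True), (0, Cup Down), (0, UU True)]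
      [(0, DU), (1, DU), (0, UU True)] [Up, Up, Down]"
    by (rule leq_step'[OF leq_sym[OF pass_over_DUU], where p = "[]" and s = "[]" and a = "[]" and b = "[(0, UU True)]"]) simp_all
  have T: "eqv [Down, Up, Up] [(1, UU True), (0, DU), (1, DU)] [(0, DU), (1, DU), (0, UU True)] [Up, Up, Down]"
    by (rule leq_trans1[OF 1 leq_trans1[OF 2 leq_trans1[OF 3 leq_trans1[OF 4 5]]]])
  show ?thesis
  proof (cases b)
    case False
    show ?thesis
      using slide_conjugate[of "[Down, Up, Up]" "[(1, UU True)]" "[(0, DU), (1, DU)]" "[(0, UU True)]" "[Up, Up, Down]"]
        T False by (simp add: winv_def)
  qed (use T in simp)
qed

text \<open>Pulling a zigzag of the right leg tight exposes a negative curl; the coefficient is the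
  inverse of its framing factor. Thus maxima with left leg \<open>Down\<close> suffice up to scalars
  and crossings.\<close>

lemma cap_turn:
  "leq n br (qpow (of_nat n - 1 / of_nat n)) [] [(0, Cap Up)] [(0, Cap Down), (0, DU)] [Up, Down]"
proof -
  have 1: "eqv [] [(0, Cap Down), (0, DU)] [(0, Cap Down), (1, Cap Up), (2, Cup Down), (0, DU)] [Up, Down]"
    by (rule leq_step'[OF leq_sym[OF straighten_right_leq[OF wb, of Up]], where p = "[Down]" and s = "[]"
          and a = "[(0, Cap Down)]" and b = "[(0, DU)]"]) simp_all
  have "ty [Down, Up] [(0, DU)] [Up, Down]" "ty [Down, Up] [(0, Cup Down)] []" by simp_all
  note c = commute_words[OF wb this, of "[]"]
  have 2: "eqv [] [(0, Cap Down), (1, Cap Up), (2, Cup Down), (0, DU)]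
      [(0, Cap Down), (1, Cap Up), (0, DU), (2, Cup Down)] [Up, Down]"
    by (rule leq_step'[OF leq_sym[OF c], where p = "[]" and s = "[]" and a = "[(0, Cap Down), (1, Cap Up)]" and b = "[]"]) simp_all
  have 3: "eqv [] [(0, Cap Down), (1, Cap Up), (0, DU), (2, Cup Down)]
      [(0, Cap Down), (0, Cap Up), (1, DD True), (2, Cup Down)] [Up, Down]"
    by (rule leq_step'[OF cap_slide_leq[OF wb, of Down Up], where p = "[]" and s = "[Up]" and a = "[(0, Cap Down)]"
          and b = "[(2, Cup Down)]"]) simp_all
  have "ty [] [(0, Cap Up)] [Up, Down]" "ty [] [(0, Cap Down)] [Down, Up]" by simp_all
  note c = commute_words[OF wb this, of "[]"]
  have 4: "eqv [] [(0, Cap Down), (0, Cap Up), (1, DD True), (2, Cup Down)]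
      [(0, Cap Up), (2, Cap Down), (1, DD True), (2, Cup Down)] [Up, Down]"
    by (rule leq_step'[OF leq_sym[OF c], where p = "[]" and s = "[]" and a = "[]"
          and b = "[(1, DD True), (2, Cup Down)]"]) simp_all
  have 5: "leq n br (qpow (1 / of_nat n - of_nat n)) [] [(0, Cap Up), (2, Cap Down), (1, DD True), (2, Cup Down)]
      [(0, Cap Up)] [Up, Down]"
    using leq_step'[OF curl_leq[OF wb, of True], where p = "[Up]" and s = "[]" and a = "[(0, Cap Up)]" and b = "[]"]
    by (simp add: curl_right_def numeral_2_eq_2)
  have "leq n br (qpow (1 / of_nat n - of_nat n)) [] [(0, Cap Down), (0, DU)] [(0, Cap Up)] [Up, Down]"
    using leq_trans[OF leq_trans1[OF 1 leq_trans1[OF 2 leq_trans1[OF 3 4]]] 5] by simp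
  then show ?thesis by (rule leq_inverse) (simp add: qpow_mult)
qed

lemma cup_turn:
  "leq n br (qpow (1 / of_nat n - of_nat n)) [Up, Down] [(0, Cup Up)] [(0, UD), (0, Cup Down)] []"
proof -
  have 1: "eqv [Up, Down] [(0, UD), (0, Cup Down)] [(1, Cap Down), (0, Cup Up), (0, UD), (0, Cup Down)] []"
    by (rule leq_step'[OF leq_sym[OF straighten_left_leq[OF wb, of Down]], where p = "[]" and s = "[Down]"
          and a = "[]" and b = "[(0, UD), (0, Cup Down)]"]) simp_all
  have "ty [Up, Down] [(0, Cup Up)] []" "ty [Up, Down] [(0, UD)] [Down, Up]" by simp_all
  note c = commute_words[OF wb this, of "[]"]
  have 2: "eqv [Up, Down] [(1, Cap Down), (0, Cup Up), (0, UD), (0, Cup Down)]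
      [(1, Cap Down), (2, UD), (0, Cup Up), (0, Cup Down)] []"
    by (rule leq_step'[OF c, where p = "[]" and s = "[]" and a = "[(1, Cap Down)]" and b = "[(0, Cup Down)]"]) simp_all
  have 3: "eqv [Up, Down] [(1, Cap Down), (2, UD), (0, Cup Up), (0, Cup Down)]
      [(2, Cap Down), (1, DD False), (0, Cup Up), (0, Cup Down)] []"
    by (rule leq_step'[OF leq_sym[OF cap_slide_leq[OF wb, of Down Down]], where p = "[Up]" and s = "[]" and a = "[]"
          and b = "[(0, Cup Up), (0, Cup Down)]"]) simp_all
  have "ty [Up, Down] [(0, Cup Up)] []" "ty [Down, Up] [(0, Cup Down)] []" by simp_all
  note c = commute_words[OF wb this, of "[]"]
  have 4: "eqv [Up, Down] [(2, Cap Down), (1, DD False), (0, Cup Up), (0, Cup Down)]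
      [(2, Cap Down), (1, DD False), (2, Cup Down), (0, Cup Up)] []"
    by (rule leq_step'[OF c, where p = "[]" and s = "[]" and a = "[(2, Cap Down), (1, DD False)]" and b = "[]"]) simp_all
  have 5: "leq n br (qpow (of_nat n - 1 / of_nat n)) [Up, Down] [(2, Cap Down), (1, DD False), (2, Cup Down), (0, Cup Up)]
      [(0, Cup Up)] []"
    using leq_step'[OF curl_leq[OF wb, of False], where p = "[Up]" and s = "[]" and a = "[]" and b = "[(0, Cup Up)]"]
    by (simp add: curl_right_def numeral_2_eq_2)
  have "leq n br (qpow (of_nat n - 1 / of_nat n)) [Up, Down] [(0, UD), (0, Cup Down)] [(0, Cup Up)] []"
    using leq_trans[OF leq_trans1[OF 1 leq_trans1[OF 2 leq_trans1[OF 3 4]]] 5] by simp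
  then show ?thesis by (rule leq_inverse) (simp add: qpow_mult)
qed

end

context web_invariant begin

section \<open>Moving extrema past other strands\<close>

lemma cap_right_one:
  "eqv [x] [(0, Cap d)] [(1, Cap d), (0, Cross (x = Up) x d), (1, Cross (x = Up) x (opp d))] [d, opp d, x]"
proof -
  have g: "good (0, Cross (x \<noteq> Up) (opp d) x)" by (cases x; cases d) auto
  have 1: "eqv [x] [(0, Cap d)] [(0, Cap d), (1, Cross (x \<noteq> Up) (opp d) x), (1, Cross (x = Up) x (opp d))] [d, opp d, x]"
    by (rule leq_step'[OF leq_sym[OF R2[OF g]], where p = "[d]" and s = "[]" and a = "[(0, Cap d)]" and b = "[]"]) simp_all
  have 2: "eqv [x] [(0, Cap d), (1, Cross (x \<noteq> Up) (opp d) x), (1, Cross (x = Up) x (opp d))]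
      [(1, Cap d), (0, Cross (x = Up) x d), (1, Cross (x = Up) x (opp d))] [d, opp d, x]"
    by (rule leq_step'[OF leq_sym[OF cap_slide_leq[OF wb, of x d]], where p = "[]" and s = "[]" and a = "[]"
          and b = "[(1, Cross (x = Up) x (opp d))]"]) simp_all
  show ?thesis by (rule leq_trans1[OF 1 2])
qed

lemma cap_left_one:
  "eqv [x] [(1, Cap d)] [(0, Cap d), (1, Cross (x \<noteq> Up) (opp d) x), (0, Cross (x \<noteq> Up) d x)] [x, d, opp d]"
proof -
  have g: "good (0, Cross (x = Up) x d)" by (cases x; cases d) auto
  have 1: "eqv [x] [(1, Cap d)] [(1, Cap d), (0, Cross (x = Up) x d), (0, Cross (x \<noteq> Up) d x)] [x, d, opp d]"
    by (rule leq_step'[OF leq_sym[OF R2[OF g]], where p = "[]" and s = "[opp d]" and a = "[(1, Cap d)]" and b = "[]"]) simp_all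
  have 2: "eqv [x] [(1, Cap d), (0, Cross (x = Up) x d), (0, Cross (x \<noteq> Up) d x)]
      [(0, Cap d), (1, Cross (x \<noteq> Up) (opp d) x), (0, Cross (x \<noteq> Up) d x)] [x, d, opp d]"
    by (rule leq_step'[OF cap_slide_leq[OF wb, of x d], where p = "[]" and s = "[]" and a = "[]"
          and b = "[(0, Cross (x \<noteq> Up) d x)]"]) simp_all
  show ?thesis by (rule leq_trans1[OF 1 2])
qed

lemma cup_right_one:
  "eqv [d, opp d, x] [(0, Cup d)] [(1, Cross (x = Down) (opp d) x), (0, Cross (x = Down) d x), (1, Cup d)] [x]"
proof -
  have g: "good (0, Cross (x = Down) (opp d) x)" by (cases x; cases d) auto
  have 1: "eqv [d, opp d, x] [(0, Cup d)]
      [(1, Cross (x = Down) (opp d) x), (1, Cross (x \<noteq> Down) x (opp d)), (0, Cup d)] [x]"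
    by (rule leq_step'[OF leq_sym[OF R2[OF g]], where p = "[d]" and s = "[]" and a = "[]" and b = "[(0, Cup d)]"]) simp_all
  have 2: "eqv [d, opp d, x] [(1, Cross (x = Down) (opp d) x), (1, Cross (x \<noteq> Down) x (opp d)), (0, Cup d)]
      [(1, Cross (x = Down) (opp d) x), (0, Cross (x = Down) d x), (1, Cup d)] [x]"
    by (rule leq_step'[OF leq_sym[OF cup_slide_leq[OF wb, of d x]], where p = "[]" and s = "[]"
          and a = "[(1, Cross (x = Down) (opp d) x)]" and b = "[]"]) simp_all
  show ?thesis by (rule leq_trans1[OF 1 2])
qed

lemma cup_left_one:
  "eqv [x, d, opp d] [(1, Cup d)] [(0, Cross (x \<noteq> Down) x d), (1, Cross (x \<noteq> Down) x (opp d)), (0, Cup d)] [x]"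
proof -
  have g: "good (0, Cross (x \<noteq> Down) x d)" by (cases x; cases d) auto
  have 1: "eqv [x, d, opp d] [(1, Cup d)]
      [(0, Cross (x \<noteq> Down) x d), (0, Cross (x = Down) d x), (1, Cup d)] [x]"
    by (rule leq_step'[OF leq_sym[OF R2[OF g]], where p = "[]" and s = "[opp d]" and a = "[]" and b = "[(1, Cup d)]"]) simp_all
  have 2: "eqv [x, d, opp d] [(0, Cross (x \<noteq> Down) x d), (0, Cross (x = Down) d x), (1, Cup d)]
      [(0, Cross (x \<noteq> Down) x d), (1, Cross (x \<noteq> Down) x (opp d)), (0, Cup d)] [x]"
    by (rule leq_step'[OF cup_slide_leq[OF wb, of d x], where p = "[]" and s = "[]"
          and a = "[(0, Cross (x \<noteq> Down) x d)]" and b = "[]"]) simp_all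
  show ?thesis by (rule leq_trans1[OF 1 2])
qed

lemma good_over: "good (i, Cross (x = Up) x d)" "good (i, Cross (x \<noteq> Up) d x)"
  "good (i, Cross (x = Down) d x)" "good (i, Cross (x \<noteq> Down) x d)"
  by (cases x; cases d; simp)+

text \<open>Each strand is passed by one slide, after the second Reidemeister move has created the
  crossings it needs. At the right end a maximum commutes with all earlier crossings and can be
  lifted above them.\<close>

lemma cap_right: "\<exists>\<theta>. xword \<theta> \<and> eqv w [(0, Cap d)] ((length w, Cap d) # \<theta>) ([d, opp d] @ w)"
proof (induction w)
  case Nil
  show ?case by (rule exI[of _ "[]"]) (simp add: leq_refl)
next
  case (Cons x w)
  then obtain \<theta> where \<theta>: "xword \<theta>" "eqv w [(0, Cap d)] ((length w, Cap d) # \<theta>) ([d, opp d] @ w)" by auto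
  let ?b = "[(0, Cross (x = Up) x d), (1, Cross (x = Up) x (opp d))]"
  have 1: "eqv (x # w) [(0, Cap d)] ((1, Cap d) # ?b) ([d, opp d] @ x # w)"
    by (rule leq_step'[OF cap_right_one, where p = "[]" and s = w and a = "[]" and b = "[]"]) simp_all
  have 2: "eqv (x # w) ((1, Cap d) # ?b) ((length (x # w), Cap d) # shift 1 \<theta> @ ?b) ([d, opp d] @ x # w)"
    by (rule leq_step'[OF \<theta>(2), where p = "[x]" and s = "[]" and a = "[]" and b = ?b]) simp_all
  show ?case
    by (rule exI[of _ "shift 1 \<theta> @ ?b"]) (use leq_trans1[OF 1 2] \<theta>(1) good_over in simp)
qed

text \<open>Used after the lift: the maximum travels back over the upward strands of a sorted word
  and becomes the innermost one of a nested family.\<close>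

lemma cap_left: "\<exists>\<theta>. xword \<theta> \<and> eqv w [(length w, Cap d)] ((0, Cap d) # \<theta>) (w @ [d, opp d])"
proof (induction w rule: rev_induct)
  case Nil
  show ?case by (rule exI[of _ "[]"]) (simp add: leq_refl)
next
  case (snoc x w)
  then obtain \<theta> where \<theta>: "xword \<theta>" "eqv w [(length w, Cap d)] ((0, Cap d) # \<theta>) (w @ [d, opp d])" by auto
  let ?b = "[(Suc (length w), Cross (x \<noteq> Up) (opp d) x), (length w, Cross (x \<noteq> Up) d x)]"
  have b: "ty (w @ [d, opp d, x]) ?b (w @ [x, d, opp d])"
    using typed_shift[of "web_io n" "[d, opp d, x]" "[(1, Cross (x \<noteq> Up) (opp d) x), (0, Cross (x \<noteq> Up) d x)]" "[x, d, opp d]" w "[]"]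
    by (simp del: typed.simps(2)) simp
  have 1: "eqv (w @ [x]) [(length (w @ [x]), Cap d)] ((length w, Cap d) # ?b) ((w @ [x]) @ [d, opp d])"
    by (rule leq_step'[OF cap_left_one, where p = w and s = "[]" and a = "[]" and b = "[]"]) simp_all
  have 2: "eqv (w @ [x]) ((length w, Cap d) # ?b) ((0, Cap d) # \<theta> @ ?b) ((w @ [x]) @ [d, opp d])"
    by (rule leq_step'[OF \<theta>(2), where p = "[]" and s = "[x]" and a = "[]" and b = ?b]) (use b in simp_all)
  show ?case
    by (rule exI[of _ "\<theta> @ ?b"]) (use leq_trans1[OF 1 2] \<theta>(1) good_over in simp)
qed

lemma cup_right: "\<exists>\<theta>. xword \<theta> \<and> eqv ([d, opp d] @ w) [(0, Cup d)] (\<theta> @ [(length w, Cup d)]) w"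
proof (induction w)
  case Nil
  show ?case by (rule exI[of _ "[]"]) (simp add: leq_refl)
next
  case (Cons x w)
  then obtain \<theta> where \<theta>: "xword \<theta>" "eqv ([d, opp d] @ w) [(0, Cup d)] (\<theta> @ [(length w, Cup d)]) w" by auto
  let ?a = "[(1, Cross (x = Down) (opp d) x), (0, Cross (x = Down) d x)]"
  have 1: "eqv ([d, opp d] @ x # w) [(0, Cup d)] (?a @ [(1, Cup d)]) (x # w)"
    by (rule leq_step'[OF cup_right_one, where p = "[]" and s = w and a = "[]" and b = "[]"]) simp_all
  have 2: "eqv ([d, opp d] @ x # w) (?a @ [(1, Cup d)]) (?a @ shift 1 \<theta> @ [(length (x # w), Cup d)]) (x # w)"
    by (rule leq_step'[OF \<theta>(2), where p = "[x]" and s = "[]" and a = ?a and b = "[]"]) simp_all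
  show ?case
    by (rule exI[of _ "?a @ shift 1 \<theta>"]) (use leq_trans1[OF 1 2] \<theta>(1) good_over in simp)
qed

lemma cup_left: "\<exists>\<theta>. xword \<theta> \<and> eqv (w @ [d, opp d]) [(length w, Cup d)] (\<theta> @ [(0, Cup d)]) w"
proof (induction w rule: rev_induct)
  case Nil
  show ?case by (rule exI[of _ "[]"]) (simp add: leq_refl)
next
  case (snoc x w)
  then obtain \<theta> where \<theta>: "xword \<theta>" "eqv (w @ [d, opp d]) [(length w, Cup d)] (\<theta> @ [(0, Cup d)]) w" by auto
  let ?a = "[(length w, Cross (x \<noteq> Down) x d), (Suc (length w), Cross (x \<noteq> Down) x (opp d))]"
  have a: "ty (w @ [x, d, opp d]) ?a (w @ [d, opp d, x])"
    using typed_shift[of "web_io n" "[x, d, opp d]" "[(0, Cross (x \<noteq> Down) x d), (1, Cross (x \<noteq> Down) x (opp d))]" "[d, opp d, x]" w "[]"]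
    by (simp del: typed.simps(2)) simp
  have 1: "eqv ((w @ [x]) @ [d, opp d]) [(length (w @ [x]), Cup d)] (?a @ [(length w, Cup d)]) (w @ [x])"
    by (rule leq_step'[OF cup_left_one, where p = w and s = "[]" and a = "[]" and b = "[]"]) simp_all
  have 2: "eqv ((w @ [x]) @ [d, opp d]) (?a @ [(length w, Cup d)]) (?a @ \<theta> @ [(0, Cup d)]) (w @ [x])"
    by (rule leq_step'[OF \<theta>(2), where p = "[]" and s = "[x]" and a = ?a and b = "[]"]) (use a in simp_all)
  show ?case
    by (rule exI[of _ "?a @ \<theta>"]) (use leq_trans1[OF 1 2] \<theta>(1) good_over in simp)
qed

end

section \<open>Sorting the strands by direction\<close>

primrec pass :: "nat \<Rightarrow> web_piece diagram" where
  "pass 0 = []"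
| "pass (Suc a) = (a, Cross False Down Up) # pass a"

text \<open>The shuffle leading from the sorted word to \<open>w\<close> in which no two parallel
  strands cross. It serves as a canonical tangle: any other good tangle with the same ends differs
  from it by parallel crossings at the top.\<close>

fun sorting :: "dir list \<Rightarrow> web_piece diagram" where
  "sorting [] = []"
| "sorting (Down # w) = shift 1 (sorting w)"
| "sorting (Up # w) = pass (count_list w Down) @ shift 1 (sorting w)"

definition sorted_dirs :: "nat \<Rightarrow> nat \<Rightarrow> dir list" where
  "sorted_dirs a b = replicate a Down @ replicate b Up"

abbreviation srt :: "dir list \<Rightarrow> dir list" where
  "srt w \<equiv> sorted_dirs (count_list w Down) (count_list w Up)"

definition sword :: "web_piece diagram \<Rightarrow> bool" where
  "sword D \<longleftrightarrow> (\<forall>l \<in> set D. \<exists>i b x. l = (i, Cross b x x))"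

lemma sword_simps [simp]: "sword []" "sword ((i, Cross b x y) # D) \<longleftrightarrow> x = y \<and> sword D"
  "sword (D @ E) \<longleftrightarrow> sword D \<and> sword E" "sword (shift k D) = sword D"
  by (auto simp: sword_def shift_def split: prod.splits)

lemma pass_snoc: "pass (Suc a) = shift 1 (pass a) @ [(0, Cross False Down Up)]"
proof (induction a)
  case (Suc a)
  have "pass (Suc (Suc a)) = (Suc a, Cross False Down Up) # pass (Suc a)" by (rule pass.simps)
  also have "\<dots> = shift 1 (pass (Suc a)) @ [(0, Cross False Down Up)]" by (subst Suc.IH) simp
  finally show ?case .
qed simp

lemma xword_pass [simp]: "xword (pass a)"
  by (induction a) auto

lemma xword_sorting: "xword (sorting w)"
  by (induction w rule: sorting.induct) auto

lemma sorting_sorted: "sorting (sorted_dirs a b) = []"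
proof -
  have "sorting (replicate b Up) = []"
    by (induction b) (auto simp: count_list_0_iff)
  then show ?thesis by (induction a) (auto simp: sorted_dirs_def)
qed

lemma srt_sorted: "srt (sorted_dirs a b) = sorted_dirs a b"
proof -
  have "count_list (sorted_dirs a b) Down = a" "count_list (sorted_dirs a b) Up = b"
    by (induction a; induction b; auto simp: sorted_dirs_def count_list_0_iff)+
  then show ?thesis by simp
qed

lemma typed_pass: "typed (web_io n) (replicate a Down @ [Up]) (pass a) (Up # replicate a Down)"
proof (induction a)
  case (Suc a)
  have "typed (web_io n) (replicate a Down @ [Down, Up]) [(a, Cross False Down Up)] (replicate a Down @ [Up, Down])"
    unfolding typed_layer by (intro exI[of _ "replicate a Down"] exI[of _ "[]"]) simp
  then have "typed (web_io n) (replicate (Suc a) Down @ [Up]) [(a, Cross False Down Up)] ((replicate a Down @ [Up]) @ [Down])"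
    by (simp add: replicate_app_Cons_same del: typed.simps(2))
  moreover have "typed (web_io n) ((replicate a Down @ [Up]) @ [Down]) (pass a) ((Up # replicate a Down) @ [Down])"
    using typed_shift[OF Suc, of "[]" "[Down]"] by simp
  moreover have "(Up # replicate a Down) @ [Down] = Up # replicate (Suc a) Down"
    by (simp add: replicate_append_same)
  ultimately show ?case
    using typed_append[of "web_io n" _ "[(a, Cross False Down Up)]" "pass a"] by auto
qed simp

lemma typed_pass':
  "typed (web_io n) (sorted_dirs a (Suc b)) (pass a) (Up # sorted_dirs a b)"
  using typed_shift[OF typed_pass[of n a], of "[]" "replicate b Up"] by (simp add: sorted_dirs_def)

lemma typed_sorting: "typed (web_io n) (srt w) (sorting w) w"
proof (induction w rule: sorting.induct)
  case (2 w)
  then show ?case using typed_shift[OF 2, of "[Down]" "[]"] by (simp add: sorted_dirs_def)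
next
  case (3 w)
  then show ?case using typed_shift[OF 3, of "[Up]" "[]"] typed_pass'[of n "count_list w Down" "count_list w Up"]
    by (auto simp: typed_append)
qed (simp add: sorted_dirs_def)

context web_invariant begin

text \<open>Where the upward strand passes over the two crossing strands this is the braid relation;
  elsewhere layers commute. The position drops from \<open>Suc i\<close> to \<open>i\<close> because
  above \<open>pass a\<close> the upward strand is still on the right.\<close>

lemma pass_DD:
  assumes "i + 2 \<le> a"
  shows "eqv (replicate a Down @ [Up]) (pass a @ [(Suc i, DD b)]) ((i, DD b) # pass a) (Up # replicate a Down)"
  using assms
proof (induction a)
  case (Suc a)
  let ?D = "\<lambda>k. replicate k Down"
  have tDD: "ty [Down, Down] [(0, DD b)] [Down, Down]" by simp
  have eqs: "?D (Suc a) @ [Up] = ?D a @ [Down, Up]" "Up # ?D (Suc a) = Up # ?D a @ [Down]"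
    by (simp_all add: replicate_app_Cons_same)
  have tX: "ty (?D a @ [Down, Up]) [(a, DU)] (?D a @ [Up, Down])"
    unfolding typed_layer by (intro exI[of _ "?D a"] exI[of _ "[]"]) simp
  show ?case
  proof (cases "i + 2 \<le> a")
    case True
    then obtain k where k: "a = i + 2 + k" by (metis le_iff_add)
    have da: "?D a = ?D i @ [Down, Down] @ ?D k" by (simp add: k replicate_add replicate_app_Cons_same)
    have 1: "eqv (?D (Suc a) @ [Up]) ((a, DU) # pass a @ [(Suc i, DD b)]) ((a, DU) # (i, DD b) # pass a) (Up # ?D (Suc a))"
      unfolding eqs by (rule leq_step'[OF Suc.IH[OF True], where p = "[]" and s = "[Down]" and a = "[(a, DU)]" and b = "[]"])
        (use tX in simp_all)
    have c: "eqv ([Down, Down] @ ?D k @ [Down, Up]) [(0, DD b), (2 + k, DU)] [(2 + k, DU), (0, DD b)] ([Down, Down] @ ?D k @ [Up, Down])"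
      using commute_words[OF wb tDD, of "[Down, Up]" "[(0, DU)]" "[Up, Down]" "?D k"] by simp
    have tp: "ty ((?D a @ [Up]) @ [Down]) (pass a) ((Up # ?D a) @ [Down])"
      using typed_shift[OF typed_pass[of n a], of "[]" "[Down]"] by simp
    have 2: "eqv (?D (Suc a) @ [Up]) ((a, DU) # (i, DD b) # pass a) ((i, DD b) # (a, DU) # pass a) (Up # ?D (Suc a))"
      unfolding eqs
      by (rule leq_step'[OF leq_sym[OF c], where p = "?D i" and s = "[]" and a = "[]" and b = "pass a"])
        (use tp in \<open>simp_all add: da, simp_all add: k\<close>)
    show ?thesis using leq_trans1[OF 1 2] by simp
  next
    case False
    then have a: "a = Suc i" using Suc.prems by simp
    have eqs: "?D (Suc a) @ [Up] = ?D i @ [Down, Down, Up]" "Up # ?D (Suc a) = (Up # ?D i) @ [Down, Down]"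
      by (simp_all add: a replicate_app_Cons_same)
    have c: "eqv ((?D i @ [Up]) @ [Down, Down]) (pass i @ [(Suc i, DD b)]) ((Suc i, DD b) # pass i) ((Up # ?D i) @ [Down, Down])"
      using commute_words[OF wb typed_pass[of n i] tDD, of "[]"] by simp
    have tX: "ty (?D i @ [Down, Down, Up]) [(Suc i, DU), (i, DU)] ((?D i @ [Up]) @ [Down, Down])"
      using typed_shift[of "web_io n" "[Down, Down, Up]" "[(1, DU), (0, DU)]" "[Up, Down, Down]" "?D i" "[]"]
      by (simp del: typed.simps(2)) simp
    have tp: "ty ((?D i @ [Up]) @ [Down, Down]) (pass i) ((Up # ?D i) @ [Down, Down])"
      using typed_shift[OF typed_pass[of n i], of "[]" "[Down, Down]"] by simp
    have 1: "eqv (?D i @ [Down, Down, Up]) ([(Suc i, DU), (i, DU)] @ pass i @ [(Suc i, DD b)])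
        ([(Suc i, DU), (i, DU)] @ (Suc i, DD b) # pass i) ((Up # ?D i) @ [Down, Down])"
      by (rule leq_step'[OF c, where p = "[]" and s = "[]" and a = "[(Suc i, DU), (i, DU)]" and b = "[]"])
        (use tX in simp_all)
    have 2: "eqv (?D i @ [Down, Down, Up]) ([(Suc i, DU), (i, DU)] @ (Suc i, DD b) # pass i)
        ((i, DD b) # [(Suc i, DU), (i, DU)] @ pass i) ((Up # ?D i) @ [Down, Down])"
      by (rule leq_step'[OF leq_sym[OF R3_DDU], where p = "?D i" and s = "[]" and a = "[]" and b = "pass i"])
        (use tp in simp_all)
    show ?thesis unfolding eqs using leq_trans1[OF 1 2] by (simp add: a)
  qed
qed simp

text \<open>Two upward strands pass the same block of downward strands one after the other; their
  crossing moves through the block one downward strand at a time.\<close>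

lemma pass_UU:
  "eqv (replicate a Down @ [Up, Up]) (pass a @ shift 1 (pass a) @ [(0, UU b)])
     ((a, UU b) # pass a @ shift 1 (pass a)) ([Up, Up] @ replicate a Down)"
proof (induction a)
  case (Suc a)
  let ?D = "\<lambda>k. replicate k Down" and ?p = "pass a" and ?q = "shift 1 (pass a)"
  have tX: "ty [Down, Up] [(0, DU)] [Up, Down]" by simp
  have eqs: "?D (Suc a) @ [Up, Up] = ?D a @ [Down, Up, Up]" "[Up, Up] @ ?D (Suc a) = ([Up, Up] @ ?D a) @ [Down]"
    by (simp_all add: replicate_app_Cons_same)
  have tp: "ty (?D a @ Up # s) ?p ([Up] @ ?D a @ s)" for s
    using typed_shift[OF typed_pass[of n a], of "[]" s] by simp
  have tq: "ty ([Up] @ ?D a @ Up # s) ?q (([Up, Up] @ ?D a) @ s)" for s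
    using typed_shift[OF typed_pass[of n a], of "[Up]" s] by simp
  have t2: "ty (?D a @ [Down, Up, Up]) [(a, DU), (Suc a, DU)] ((?D a @ [Up, Up]) @ [Down])"
    using typed_shift[of "web_io n" "[Down, Up, Up]" "[(0, DU), (1, DU)]" "[Up, Up, Down]" "?D a" "[]"]
    by (simp del: typed.simps(2)) simp
  have t1: "ty (?D a @ [Down, Up, Up]) [(a, DU)] (?D a @ [Up, Down, Up])"
    using typed_shift[of "web_io n" "[Down, Up]" "[(0, DU)]" "[Up, Down]" "?D a" "[Up]"]
    by (simp del: typed.simps(2)) simp
  have tu: "ty (([Up, Up] @ ?D a) @ [Down]) [(0, UU b)] (([Up, Up] @ ?D a) @ [Down])" by simp
  have c: "eqv ((?D a @ [Up]) @ [Down, Up]) (?p @ [(Suc a, DU)]) ((Suc a, DU) # ?p) ((Up # ?D a) @ [Up, Down])"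
    using commute_words[OF wb typed_pass[of n a] tX, of "[]"] by simp
  have 1: "eqv (?D a @ [Down, Up, Up]) ((a, DU) # ?p @ (Suc a, DU) # ?q @ [(0, UU b)])
      ((a, DU) # (Suc a, DU) # ?p @ ?q @ [(0, UU b)]) (([Up, Up] @ ?D a) @ [Down])"
    by (rule leq_step'[OF c, where p = "[]" and s = "[]" and a = "[(a, DU)]" and b = "?q @ [(0, UU b)]"])
      (use t1 tq[of "[Down]"] tu in \<open>auto simp: typed_append simp del: typed.simps(2)\<close>)
  have 2: "eqv (?D a @ [Down, Up, Up]) ((a, DU) # (Suc a, DU) # ?p @ ?q @ [(0, UU b)])
      ((a, DU) # (Suc a, DU) # (a, UU b) # ?p @ ?q) (([Up, Up] @ ?D a) @ [Down])"
    by (rule leq_step'[OF Suc.IH, where p = "[]" and s = "[Down]" and a = "[(a, DU), (Suc a, DU)]" and b = "[]"])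
      (use t2 in simp_all)
  have 3: "eqv (?D a @ [Down, Up, Up]) ((a, DU) # (Suc a, DU) # (a, UU b) # ?p @ ?q)
      ((Suc a, UU b) # (a, DU) # (Suc a, DU) # ?p @ ?q) (([Up, Up] @ ?D a) @ [Down])"
    by (rule leq_step'[OF leq_sym[OF R3_DUU], where p = "?D a" and s = "[]" and a = "[]" and b = "?p @ ?q"])
      (use tp[of "[Up, Down]"] tq[of "[Down]"] in \<open>auto simp: typed_append\<close>)
  have tuu: "ty (?D a @ [Down, Up, Up]) [(Suc a, UU b)] (?D a @ [Down, Up, Up])"
    unfolding typed_layer by (intro exI[of _ "?D a @ [Down]"] exI[of _ "[]"]) simp
  have 4: "eqv (?D a @ [Down, Up, Up]) ((Suc a, UU b) # (a, DU) # (Suc a, DU) # ?p @ ?q)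
      ((Suc a, UU b) # (a, DU) # ?p @ (Suc a, DU) # ?q) (([Up, Up] @ ?D a) @ [Down])"
    by (rule leq_step'[OF leq_sym[OF c], where p = "[]" and s = "[]" and a = "[(Suc a, UU b), (a, DU)]" and b = ?q])
      (use tuu t1 tq[of "[Down]"] in \<open>auto simp del: fits.simps after.simps\<close>)
  show ?case
    unfolding eqs using leq_trans1[OF 1 leq_trans1[OF 2 leq_trans1[OF 3 4]]] by simp
qed (simp add: leq_refl)

lemma sword_layer:
  assumes "ty (sorted_dirs a b) [(i, Cross c x x)] w"
  shows "w = sorted_dirs a b" "x = Down \<and> i + 2 \<le> a \<or> x = Up \<and> a \<le> i"
proof -
  obtain p s where ps: "sorted_dirs a b = p @ [x, x] @ s" "w = p @ [x, x] @ s" "i = length p"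
    using assms unfolding typed_layer by auto
  then show "w = sorted_dirs a b" by simp
  have x: "sorted_dirs a b ! i = x" "sorted_dirs a b ! Suc i = x" "Suc i < length (sorted_dirs a b)"
    unfolding ps(1) by (simp_all add: ps(3) nth_append)
  show "x = Down \<and> i + 2 \<le> a \<or> x = Up \<and> a \<le> i"
    using x by (cases x; cases "i < a"; cases "Suc i < a") (auto simp: sorted_dirs_def nth_append)
qed

text \<open>On a sorted word a parallel crossing involves two downward or two upward strands. The
  first kind slides under the passing strand by \<open>pass_DD\<close>, the second is disjoint from
  it.\<close>

lemma pass_slide:
  assumes "sword \<eta>" "ty (sorted_dirs a b) \<eta> w"
  shows "\<exists>\<eta>'. sword \<eta>' \<and> ty (sorted_dirs a (Suc b)) \<eta>' (sorted_dirs a (Suc b)) \<and>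
    eqv (sorted_dirs a (Suc b)) (pass a @ shift 1 \<eta>) (\<eta>' @ pass a) (Up # sorted_dirs a b)"
  using assms
proof (induction \<eta> arbitrary: w rule: rev_induct)
  case Nil
  show ?case by (rule exI[of _ "[]"]) (use typed_pass' in \<open>simp add: leq_refl\<close>)
next
  case (snoc l \<eta>)
  obtain i c x where l: "l = (i, Cross c x x)" using snoc.prems by (auto simp: sword_def)
  obtain v where v: "ty (sorted_dirs a b) \<eta> v" "ty v [l] w" using snoc.prems by (auto simp: typed_append)
  obtain \<eta>' where \<eta>': "sword \<eta>'" "ty (sorted_dirs a (Suc b)) \<eta>' (sorted_dirs a (Suc b))"
    "eqv (sorted_dirs a (Suc b)) (pass a @ shift 1 \<eta>) (\<eta>' @ pass a) (Up # sorted_dirs a b)"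
    using snoc.IH[OF _ v(1)] snoc.prems by auto
  have "ty (sorted_dirs a (Suc b)) (pass a @ shift 1 \<eta>) (Up # v)"
    using typed_pass'[of n a b] typed_shift[OF v(1), of "[Up]" "[]"] by (auto simp: typed_append)
  then have vs: "v = sorted_dirs a b"
    using typed_unique leq_typed(1)[OF \<eta>'(3)] by blast
  note ly = sword_layer[OF v(2)[unfolded vs l]]
  have tl: "ty (Up # sorted_dirs a b) [(Suc i, Cross c x x)] (Up # sorted_dirs a b)"
    using typed_shift[OF v(2), of "[Up]" "[]"] by (simp add: l vs ly(1) del: typed.simps(2))
  have 1: "eqv (sorted_dirs a (Suc b)) (pass a @ shift 1 \<eta> @ [(Suc i, Cross c x x)])
      (\<eta>' @ pass a @ [(Suc i, Cross c x x)]) (Up # sorted_dirs a b)"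
    by (rule leq_step'[OF \<eta>'(3), where p = "[]" and s = "[]" and a = "[]" and b = "[(Suc i, Cross c x x)]"])
      (use tl in simp_all)
  consider "x = Down" "i + 2 \<le> a" | "x = Up" "a \<le> i" using ly(2) by auto
  then obtain j where j: "ty (sorted_dirs a (Suc b)) [(j, Cross c x x)] (sorted_dirs a (Suc b))"
    "eqv (sorted_dirs a (Suc b)) (pass a @ [(Suc i, Cross c x x)]) ((j, Cross c x x) # pass a) (Up # sorted_dirs a b)"
  proof cases
    case 1
    then obtain k where k: "a = i + 2 + k" by (metis le_iff_add)
    have eq: "sorted_dirs a (Suc b) = replicate i Down @ [Down, Down] @ (replicate k Down @ replicate (Suc b) Up)"
      by (simp add: k sorted_dirs_def replicate_add replicate_app_Cons_same)
    have "ty (sorted_dirs a (Suc b)) [(i, Cross c x x)] (sorted_dirs a (Suc b))"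
      unfolding typed_layer eq using 1 by (intro exI[of _ "replicate i Down"] exI[of _ "replicate k Down @ replicate (Suc b) Up"]) simp
    moreover have "eqv (sorted_dirs a (Suc b)) (pass a @ [(Suc i, Cross c x x)]) ((i, Cross c x x) # pass a) (Up # sorted_dirs a b)"
      using leq_ctx[OF pass_DD[OF 1(2), of c], of "[]" "replicate b Up"] 1 by (simp add: sorted_dirs_def)
    ultimately show thesis by (rule that)
  next
    case 2
    obtain p s where ps: "sorted_dirs a b = p @ [x, x] @ s" "i = length p"
      using v(2) unfolding l typed_layer vs by auto
    have dr: "replicate b Up = drop a (p @ [x, x] @ s)"
      unfolding ps(1)[symmetric] by (simp add: sorted_dirs_def)
    have tb: "ty (replicate b Up) [(i - a, Cross c x x)] (replicate b Up)"
      unfolding typed_layer dr using 2 ps(2) by (intro exI[of _ "drop a p"] exI[of _ s]) simp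
    have "ty (sorted_dirs a (Suc b)) [(Suc i, Cross c x x)] (sorted_dirs a (Suc b))"
      using typed_shift[OF tb, of "replicate a Down @ [Up]" "[]"] 2 by (simp add: sorted_dirs_def del: typed.simps(2))
    moreover have "eqv (sorted_dirs a (Suc b)) (pass a @ [(Suc i, Cross c x x)]) ((Suc i, Cross c x x) # pass a) (Up # sorted_dirs a b)"
      using commute_words[OF wb typed_pass[of n a] tb, of "[]"] 2 by (simp add: sorted_dirs_def)
    ultimately show thesis by (rule that)
  qed
  have 2: "eqv (sorted_dirs a (Suc b)) (\<eta>' @ pass a @ [(Suc i, Cross c x x)])
      (\<eta>' @ (j, Cross c x x) # pass a) (Up # sorted_dirs a b)"
    by (rule leq_step'[OF j(2), where p = "[]" and s = "[]" and a = \<eta>' and b = "[]"]) (use \<eta>'(2) in simp_all)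
  show ?case
    by (rule exI[of _ "\<eta>' @ [(j, Cross c x x)]"])
      (use leq_trans1[OF 1 2] \<eta>'(1,2) j(1) in \<open>auto simp: l typed_append simp del: typed.simps(2)\<close>)
qed

text \<open>By induction on the length of \<open>w\<close> the crossing may be taken at the left
  end. There a parallel crossing moves up through the shuffle, and a mixed one either is the missing
  crossing of the shuffle for \<open>w'\<close> or cancels the one present in the shuffle for
  \<open>w\<close>.\<close>

lemma sorting_slide:
  assumes "good (i, g)" "ty w [(i, g)] w'"
  shows "\<exists>\<eta>. sword \<eta> \<and> ty (srt w) \<eta> (srt w) \<and> eqv (srt w) (sorting w @ [(i, g)]) (\<eta> @ sorting w') w'"
  using assms
proof (induction w arbitrary: i w' rule: length_induct)
  case (1 w)
  obtain b x y where g: "g = Cross b x y" using 1(2) by (cases g) auto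
  obtain p s where ps: "w = p @ [x, y] @ s" "w' = p @ [y, x] @ s" "i = length p"
    using 1(3) unfolding g typed_layer by auto
  show ?case
  proof (cases p)
    case (Cons c p')
    define v v' where "v = p' @ [x, y] @ s" "v' = p' @ [y, x] @ s"
    have tv: "ty v [(length p', g)] v'"
      unfolding typed_layer g by (intro exI[of _ p'] exI[of _ s]) (simp add: v_v'_def)
    have w: "w = c # v" "w' = c # v'" "i = Suc (length p')" using ps Cons by (simp_all add: v_v'_def)
    have cnt: "count_list v' = count_list v" by (rule ext) (simp add: v_v'_def)
    obtain \<eta> where \<eta>: "sword \<eta>" "ty (srt v) \<eta> (srt v)"
      "eqv (srt v) (sorting v @ [(length p', g)]) (\<eta> @ sorting v') v'"
      using 1(1)[rule_format, of v "length p'" v'] tv 1(2) w by (auto simp: g)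
    show ?thesis
    proof (cases c)
      case Down
      have "ty (srt w) (shift 1 \<eta>) (srt w)"
        using typed_shift[OF \<eta>(2), of "[Down]" "[]"] by (simp add: w Down sorted_dirs_def)
      moreover have "eqv (srt w) (sorting w @ [(i, g)]) (shift 1 \<eta> @ sorting w') w'"
        using leq_ctx[OF \<eta>(3), of "[Down]" "[]"] by (simp add: w Down sorted_dirs_def)
      ultimately show ?thesis using \<eta>(1) by (intro exI[of _ "shift 1 \<eta>"]) simp
    next
      case Up
      let ?a = "count_list v Down" and ?b = "count_list v Up"
      have sw: "srt w = sorted_dirs ?a (Suc ?b)" by (simp add: w Up)
      obtain \<eta>' where \<eta>': "sword \<eta>'" "ty (srt w) \<eta>' (srt w)"
        "eqv (srt w) (pass ?a @ shift 1 \<eta>) (\<eta>' @ pass ?a) (Up # srt v)"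
        using pass_slide[OF \<eta>(1,2)] unfolding sw by auto
      have tp: "ty (srt w) (pass ?a) (Up # srt v)" unfolding sw by (rule typed_pass')
      have A: "eqv (srt w) (pass ?a @ shift 1 (sorting v @ [(length p', g)])) (pass ?a @ shift 1 (\<eta> @ sorting v')) w'"
        by (rule leq_step'[OF \<eta>(3), where p = "[Up]" and s = "[]" and a = "pass ?a" and b = "[]"])
          (use tp in \<open>simp_all add: w Up\<close>)
      have ts: "ty (Up # srt v) (shift 1 (sorting v')) w'"
        using typed_shift[OF typed_sorting[of n v'], of "[Up]" "[]"] by (simp add: w Up cnt)
      have B: "eqv (srt w) (pass ?a @ shift 1 (\<eta> @ sorting v')) (\<eta>' @ pass ?a @ shift 1 (sorting v')) w'"
        by (rule leq_step'[OF \<eta>'(3), where p = "[]" and s = "[]" and a = "[]" and b = "shift 1 (sorting v')"])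
          (use ts in simp_all)
      show ?thesis
        by (rule exI[of _ \<eta>']) (use leq_trans1[OF A B] \<eta>'(1,2) in \<open>simp add: w Up cnt\<close>)
    qed
  next
    case Nil
    then have w: "w = x # y # s" "w' = y # x # s" "i = 0" using ps by simp_all
    let ?a = "count_list s Down" and ?b = "count_list s Up"
    have gt: "ty [x, y] [(0, g)] [y, x]" by (simp add: g)
    note c = commute_words[OF wb gt typed_sorting[of n s], of "[]"]
    have c': "eqv ([x, y] @ srt s) (shift (Suc (Suc 0)) (sorting s) @ [(0, g)]) ((0, g) # shift (Suc (Suc 0)) (sorting s)) ([y, x] @ s)"
      using leq_sym[OF c] by (simp add: numeral_2_eq_2)
    have t2: "ty ([y, x] @ srt s) (shift (Suc (Suc 0)) (sorting s)) ([y, x] @ s)"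
      using typed_shift[OF typed_sorting[of n s], of "[y, x]" "[]"] by (simp add: numeral_2_eq_2)
    have tp: "ty (replicate ?a Down @ Up # z) (pass ?a) (Up # replicate ?a Down @ z)" for z
      using typed_shift[OF typed_pass[of n ?a], of "[]" z] by simp
    consider "x = Down" "y = Down" | "x = Down" "y = Up" "\<not> b" | "x = Up" "y = Down" b | "x = Up" "y = Up"
      using 1(2) g by (cases x; cases y) auto
    then show ?thesis
    proof cases
      case 1
      have "ty (srt w) [(0, g)] (srt w)" by (simp add: w 1 g sorted_dirs_def)
      with c' show ?thesis
        by (intro exI[of _ "[(0, g)]"]) (simp add: w 1 g sorted_dirs_def numeral_2_eq_2 del: typed.simps(2))
    next
      case 2
      have a: "ty (srt w) (shift 1 (pass ?a)) ([Down, Up] @ srt s)"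
        using typed_shift[OF tp, of "[Down]" "[]" "replicate ?b Up"] by (simp add: w 2 sorted_dirs_def)
      have "eqv (srt w) (shift 1 (pass ?a) @ shift (Suc (Suc 0)) (sorting s) @ [(0, g)])
          (shift 1 (pass ?a) @ (0, g) # shift (Suc (Suc 0)) (sorting s)) w'"
        by (rule leq_step'[OF c', where p = "[]" and s = "[]" and a = "shift 1 (pass ?a)" and b = "[]"])
          (use a in \<open>simp_all add: w 2\<close>)
      moreover have "sorting w' = shift 1 (pass ?a) @ (0, g) # shift (Suc (Suc 0)) (sorting s)"
        unfolding w 2 sorting.simps using 2 pass_snoc[of ?a] by (simp add: g numeral_2_eq_2 del: pass.simps)
      moreover have "sorting w = shift 1 (pass ?a) @ shift (Suc (Suc 0)) (sorting s)"
        by (simp add: w 2 numeral_2_eq_2)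
      ultimately show ?thesis by (intro exI[of _ "[]"]) (simp add: w(3))
    next
      case 3
      have a: "ty (srt w) (shift 1 (pass ?a)) ([Down, Up] @ srt s)"
        using typed_shift[OF tp, of "[Down]" "[]" "replicate ?b Up"] by (simp add: w 3 sorted_dirs_def)
      have sw: "sorting w = shift 1 (pass ?a) @ (0, DU) # shift (Suc (Suc 0)) (sorting s)"
        unfolding w 3 sorting.simps using 3 pass_snoc[of ?a] by (simp add: numeral_2_eq_2 del: pass.simps)
      have A: "eqv (srt w) (shift 1 (pass ?a) @ (0, DU) # shift (Suc (Suc 0)) (sorting s) @ [(0, g)])
          (shift 1 (pass ?a) @ (0, DU) # (0, g) # shift (Suc (Suc 0)) (sorting s)) w'"
        by (rule leq_step'[OF c', where p = "[]" and s = "[]" and a = "shift 1 (pass ?a) @ [(0, DU)]" and b = "[]"])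
          (use a in \<open>auto simp: w 3 typed_append\<close>)
      have B: "eqv (srt w) (shift 1 (pass ?a) @ (0, DU) # (0, g) # shift (Suc (Suc 0)) (sorting s))
          (shift 1 (pass ?a) @ shift (Suc (Suc 0)) (sorting s)) w'"
        by (rule leq_step'[OF R2[of False Down Up], where p = "[]" and s = "srt s" and a = "shift 1 (pass ?a)"
              and b = "shift (Suc (Suc 0)) (sorting s)"])
          (use a t2 3 in \<open>simp_all add: w g\<close>)
      have "sorting w' = shift 1 (pass ?a) @ shift (Suc (Suc 0)) (sorting s)"
        by (simp add: w 3 numeral_2_eq_2)
      then show ?thesis using leq_trans1[OF A B] by (intro exI[of _ "[]"]) (simp add: sw w(3))
    next
      case 4
      have sw: "sorting w = pass ?a @ shift 1 (pass ?a) @ shift (Suc (Suc 0)) (sorting s)"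
        by (simp add: w 4 numeral_2_eq_2)
      have sr: "srt w = (replicate ?a Down @ [Up, Up]) @ replicate ?b Up"
        by (simp add: w 4 sorted_dirs_def)
      have a: "ty (srt w) (pass ?a @ shift 1 (pass ?a)) ([Up, Up] @ srt s)"
        using typed_shift[OF tp[of "replicate ?b Up"], of "[Up]" "[]"] tp[of "Up # replicate ?b Up"]
        unfolding sr by (auto simp: sorted_dirs_def typed_append)
      have t2': "ty ([Up, Up] @ srt s) (shift (Suc (Suc 0)) (sorting s)) w'"
        using t2 by (simp add: 4 w)
      have A: "eqv (srt w) (pass ?a @ shift 1 (pass ?a) @ shift (Suc (Suc 0)) (sorting s) @ [(0, g)])
          (pass ?a @ shift 1 (pass ?a) @ (0, g) # shift (Suc (Suc 0)) (sorting s)) w'"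
        by (rule leq_step'[OF c', where p = "[]" and s = "[]" and a = "pass ?a @ shift 1 (pass ?a)" and b = "[]"])
          (use a in \<open>simp_all add: w 4\<close>)
      have B: "eqv (srt w) (pass ?a @ shift 1 (pass ?a) @ (0, g) # shift (Suc (Suc 0)) (sorting s))
          ((?a, g) # pass ?a @ shift 1 (pass ?a) @ shift (Suc (Suc 0)) (sorting s)) w'"
        unfolding sr by (rule leq_step'[OF pass_UU[of ?a b], where p = "[]" and s = "replicate ?b Up" and a = "[]"
              and b = "shift (Suc (Suc 0)) (sorting s)"])
          (use t2' in \<open>simp_all add: g 4 sorted_dirs_def\<close>)
      have "ty (srt w) [(?a, g)] (srt w)"
        unfolding sr typed_layer g 4 by (intro exI[of _ "replicate ?a Down"] exI[of _ "replicate ?b Up"]) simp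
      then show ?thesis
        using leq_trans1[OF A B] sw by (intro exI[of _ "[(?a, g)]"]) (simp add: w 4 g del: typed.simps(2))
    qed
  qed
qed

text \<open>The normal form of good tangles starting from a sorted word: all choice lies in the
  parallel crossings \<open>\<eta>\<close>. If the lower end is sorted too, the shuffle is
  empty.\<close>

lemma sorting_word:
  assumes "xword \<theta>" "ty (sorted_dirs a b) \<theta> w"
  shows "\<exists>\<eta>. sword \<eta> \<and> ty (sorted_dirs a b) \<eta> (sorted_dirs a b) \<and> srt w = sorted_dirs a b \<and>
    eqv (sorted_dirs a b) \<theta> (\<eta> @ sorting w) w"
  using assms
proof (induction \<theta> arbitrary: w rule: rev_induct)
  case Nil
  then have "w = sorted_dirs a b" by simp
  then show ?case by (intro exI[of _ "[]"]) (simp add: sorting_sorted leq_refl srt_sorted)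
next
  case (snoc l \<theta>)
  obtain v where v: "ty (sorted_dirs a b) \<theta> v" "ty v [l] w" using snoc.prems by (auto simp: typed_append)
  obtain i g where l: "l = (i, g)" by fastforce
  have gd: "good (i, g)" using snoc.prems by (simp add: l)
  obtain \<eta> where \<eta>: "sword \<eta>" "ty (sorted_dirs a b) \<eta> (sorted_dirs a b)" "srt v = sorted_dirs a b"
    "eqv (sorted_dirs a b) \<theta> (\<eta> @ sorting v) v"
    using snoc.IH[OF _ v(1)] snoc.prems by auto
  obtain \<eta>' where \<eta>': "sword \<eta>'" "ty (srt v) \<eta>' (srt v)"
    "eqv (srt v) (sorting v @ [(i, g)]) (\<eta>' @ sorting w) w"
    using sorting_slide[OF gd v(2)[unfolded l]] by auto
  have "srt w = srt v"
    using v(2) gd unfolding l by (cases g) (auto simp: typed_layer simp del: typed.simps(2))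
  moreover have A: "eqv (sorted_dirs a b) (\<theta> @ [l]) (\<eta> @ sorting v @ [l]) w"
    by (rule leq_step'[OF \<eta>(4), where p = "[]" and s = "[]" and a = "[]" and b = "[l]"]) (use v in simp_all)
  have B: "eqv (sorted_dirs a b) (\<eta> @ sorting v @ [l]) (\<eta> @ \<eta>' @ sorting w) w"
    by (rule leq_step'[OF \<eta>'(3), where p = "[]" and s = "[]" and a = \<eta> and b = "[]"]) (use \<eta> in \<open>simp_all add: l\<close>)
  ultimately show ?case
    using leq_trans1[OF A B] \<eta> \<eta>' by (intro exI[of _ "\<eta> @ \<eta>'"]) (auto simp: typed_append)
qed

end

section \<open>Nested caps and the Hecke algebra\<close>

lemma caps_0 [simp]: "caps i d 0 = []"
  by (simp add: caps_def)

lemma caps_Suc: "caps i d (Suc k) = caps i d k @ [(i + k, Cap d)]"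
  by (simp add: caps_def)

lemma caps_shift: "caps i d k = shift i (caps 0 d k)"
  by (simp add: caps_def shift_def)

lemma caps_add: "caps i d (k + m) = caps i d k @ shift k (caps i d m)"
  by (induction m) (simp_all add: caps_Suc add.left_commute)

lemma typed_caps: "typed (web_io n) [] (caps 0 d k) (replicate k d @ replicate k (opp d))"
proof (induction k)
  case (Suc k)
  have "typed (web_io n) (replicate k d @ replicate k (opp d)) [(k, Cap d)]
      (replicate (Suc k) d @ replicate (Suc k) (opp d))"
    unfolding typed_layer
    by (intro exI[of _ "replicate k d"] exI[of _ "replicate k (opp d)"]) (simp add: replicate_app_Cons_same)
  with Suc show ?case by (auto simp: caps_Suc typed_append simp del: typed.simps(2))
qed simp

definition dword :: "nat \<Rightarrow> web_piece diagram \<Rightarrow> bool" where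
  "dword m D \<longleftrightarrow> (\<forall>l \<in> set D. \<exists>i b. l = (i, Cross b Down Down) \<and> i + 2 \<le> m)"

lemma dword_simps [simp]: "dword m []" "dword m ((i, Cross b x y) # D) \<longleftrightarrow> x = Down \<and> y = Down \<and> i + 2 \<le> m \<and> dword m D"
  "dword m (D @ E) \<longleftrightarrow> dword m D \<and> dword m E"
  by (auto simp: dword_def)

lemma dword_mono: "dword m D \<Longrightarrow> m \<le> k \<Longrightarrow> dword k D"
  by (fastforce simp: dword_def)

lemma typed_DD: "i + 2 \<le> m \<Longrightarrow>
  typed (web_io n) (replicate m Down @ s) [(i, Cross b Down Down)] (replicate m Down @ s)"
proof -
  assume "i + 2 \<le> m"
  then obtain k where k: "m = i + 2 + k" by (metis le_iff_add)
  have "replicate m Down @ s = replicate i Down @ [Down, Down] @ replicate k Down @ s"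
    by (simp add: k replicate_add replicate_app_Cons_same)
  then show ?thesis unfolding typed_layer by (intro exI[of _ "replicate i Down"] exI[of _ "replicate k Down @ s"]) simp
qed

lemma typed_dword: "dword m D \<Longrightarrow> typed (web_io n) (replicate m Down @ s) D (replicate m Down @ s)"
proof (induction D)
  case (Cons l D)
  then obtain i b where l: "l = (i, Cross b Down Down)" "i + 2 \<le> m" by (auto simp: dword_def)
  with Cons have "typed (web_io n) (replicate m Down @ s) [l] (replicate m Down @ s)"
    "typed (web_io n) (replicate m Down @ s) D (replicate m Down @ s)"
    using typed_DD by (auto simp: dword_def simp del: typed.simps(2))
  then show ?case by auto
qed simp

lemma xword_dword: "dword m D \<Longrightarrow> xword D"
  by (auto simp: dword_def xword_def list_all_iff)

context web_invariant begin

text \<open>Sliding one maximum replaces the crossing of the right legs by a mixed crossing; the two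
  maxima are then side by side and exchange their heights, and the reverse slide yields a crossing
  of the left legs.\<close>

lemma caps_UU_False:
  "eqv [] [(0, Cap Down), (1, Cap Down), (2, UU False)] [(0, Cap Down), (1, Cap Down), (0, DD False)] [Down, Down, Up, Up]"
proof -
  have 1: "eqv [] [(0, Cap Down), (1, Cap Down), (2, UU False)] [(0, Cap Down), (2, Cap Down), (1, UD)] [Down, Down, Up, Up]"
    by (rule leq_step'[OF leq_sym[OF cap_slide_leq[OF wb, of Up Down]], where p = "[Down]" and s = "[]"
          and a = "[(0, Cap Down)]" and b = "[]"]) simp_all
  have "ty [] [(0, Cap Down)] [Down, Up]" by simp
  note c = commute_words[OF wb this this, of "[]"]
  have 2: "eqv [] [(0, Cap Down), (2, Cap Down), (1, UD)] [(0, Cap Down), (0, Cap Down), (1, UD)] [Down, Down, Up, Up]"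
    by (rule leq_step'[OF c, where p = "[]" and s = "[]" and a = "[]" and b = "[(1, UD)]"]) simp_all
  have 3: "eqv [] [(0, Cap Down), (0, Cap Down), (1, UD)] [(0, Cap Down), (1, Cap Down), (0, DD False)] [Down, Down, Up, Up]"
    by (rule leq_step'[OF leq_sym[OF cap_slide_leq[OF wb, of Down Down]], where p = "[]" and s = "[Up]"
          and a = "[(0, Cap Down)]" and b = "[]"]) simp_all
  show ?thesis by (rule leq_trans1[OF 1 leq_trans1[OF 2 3]])
qed

lemma caps_UU_base:
  "eqv [] [(0, Cap Down), (1, Cap Down), (2, UU b)] [(0, Cap Down), (1, Cap Down), (0, DD b)] [Down, Down, Up, Up]"
proof (cases b)
  case True
  let ?c = "[(0, Cap Down), (1, Cap Down)]"
  \<comment> \<open>The other sign follows formally: a cancelling pair is inserted on the left legs,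
    and one half of it is carried to the right legs by the case already known.\<close>
  have 1: "eqv [] (?c @ [(2, UU True)]) (?c @ [(0, DD False), (0, DD True), (2, UU True)]) [Down, Down, Up, Up]"
    by (rule leq_step'[OF leq_sym[OF R2[of False Down Down]], where p = "[]" and s = "[Up, Up]"
          and a = ?c and b = "[(2, UU True)]"]) simp_all
  have "ty [Down, Down] [(0, DD True)] [Down, Down]" "ty [Up, Up] [(0, UU True)] [Up, Up]" by simp_all
  note c = commute_words[OF wb this, of "[]"]
  have 2: "eqv [] (?c @ [(0, DD False), (0, DD True), (2, UU True)]) (?c @ [(0, DD False), (2, UU True), (0, DD True)]) [Down, Down, Up, Up]"
    by (rule leq_step'[OF c, where p = "[]" and s = "[]" and a = "?c @ [(0, DD False)]" and b = "[]"]) simp_all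
  have 3: "eqv [] (?c @ [(0, DD False), (2, UU True), (0, DD True)]) (?c @ [(2, UU False), (2, UU True), (0, DD True)]) [Down, Down, Up, Up]"
    by (rule leq_step'[OF leq_sym[OF caps_UU_False], where p = "[]" and s = "[]" and a = "[]"
          and b = "[(2, UU True), (0, DD True)]"]) simp_all
  have 4: "eqv [] (?c @ [(2, UU False), (2, UU True), (0, DD True)]) (?c @ [(0, DD True)]) [Down, Down, Up, Up]"
    by (rule leq_step'[OF R2[of False Up Up], where p = "[Down, Down]" and s = "[]" and a = ?c and b = "[(0, DD True)]"]) simp_all
  show ?thesis using leq_trans1[OF 1 leq_trans1[OF 2 leq_trans1[OF 3 4]]] True by simp
qed (use caps_UU_False in simp)

text \<open>Of the nested maxima, \<open>c\<close> lie outside and \<open>j\<close> inside the two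
  whose legs cross. The inner ones are created later and are moved out of the way.\<close>

lemma caps_UU:
  assumes m: "m = c + 2 + j"
  shows "eqv [] (caps 0 Down m @ [(m + j, UU b)]) (caps 0 Down m @ [(c, DD b)]) (sorted_dirs m m)"
proof -
  let ?D = "\<lambda>k. replicate k Down" and ?U = "\<lambda>k. replicate k Up"
  let ?q = "shift (c + 2) (caps 0 Down j)"
  have split1: "caps 0 Down m = caps 0 Down (c + 2) @ ?q"
    unfolding m by (rule caps_add)
  have split2: "caps 0 Down (c + 2) = caps 0 Down c @ [(c, Cap Down), (Suc c, Cap Down)]"
    using caps_Suc[of 0 Down c] caps_Suc[of 0 Down "Suc c"] by simp
  have sr: "sorted_dirs m m = (?D c @ [Down, Down] @ ?D j) @ (?U j @ [Up, Up] @ ?U c)"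
    "sorted_dirs (c + 2) (c + 2) = ?D c @ [Down, Down] @ [Up, Up] @ ?U c"
  proof -
    have "replicate m Down = ?D c @ [Down, Down] @ ?D j"
      unfolding m replicate_add by (simp add: numeral_2_eq_2)
    moreover have "m = j + 2 + c" by (simp add: m)
    then have "replicate m Up = ?U j @ [Up, Up] @ ?U c"
      by (simp only: replicate_add) (simp add: numeral_2_eq_2)
    ultimately show "sorted_dirs m m = (?D c @ [Down, Down] @ ?D j) @ (?U j @ [Up, Up] @ ?U c)"
      by (simp add: sorted_dirs_def)
  qed (simp add: sorted_dirs_def replicate_app_Cons_same)
  have tc: "ty [] (caps 0 Down k) (sorted_dirs k k)" for k
    using typed_caps[of n Down k] by (simp add: sorted_dirs_def)
  have tq: "ty (?D c @ [Down, Down] @ [Up, Up] @ ?U c) ?q (sorted_dirs m m)"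
    using typed_shift[OF tc[of j], of "?D c @ [Down, Down]" "[Up, Up] @ ?U c"] unfolding sr by (simp add: sorted_dirs_def)
  have tU: "ty [Up, Up] [(0, UU b)] [Up, Up]" "ty [Down, Down] [(0, DD b)] [Down, Down]" by simp_all
  have c1: "eqv ([Up, Up]) (caps 0 Down j @ [(2 * j, UU b)]) ((0, UU b) # caps 0 Down j) (sorted_dirs j j @ [Up, Up])"
    using commute_words[OF wb tc[of j] tU(1), of "[]"] by (simp add: sorted_dirs_def mult_2)
  have c2: "eqv ([Down, Down]) ((0, DD b) # shift 2 (caps 0 Down j)) (shift 2 (caps 0 Down j) @ [(0, DD b)]) ([Down, Down] @ sorted_dirs j j)"
    using commute_words[OF wb tU(2) tc[of j], of "[]"] by (simp add: numeral_2_eq_2)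
  have t2: "ty [] (caps 0 Down (c + 2)) (?D c @ [Down, Down] @ [Up, Up] @ ?U c)" using tc[of "c + 2"] by (simp only: sr)
  have v1: "(?D c @ [Down, Down]) @ (sorted_dirs j j @ [Up, Up]) @ ?U c = sorted_dirs m m"
    "?D c @ ([Down, Down] @ sorted_dirs j j) @ [Up, Up] @ ?U c = sorted_dirs m m"
    unfolding sr(1) by (simp_all add: sorted_dirs_def)
  have 1: "eqv [] (caps 0 Down (c + 2) @ ?q @ [(m + j, UU b)]) (caps 0 Down (c + 2) @ (c + 2, UU b) # ?q) (sorted_dirs m m)"
    by (rule leq_step'[OF c1, where p = "?D c @ [Down, Down]" and s = "?U c" and a = "caps 0 Down (c + 2)" and b = "[]"])
      (use t2 v1 in \<open>simp_all add: m\<close>)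
  have t0: "ty [] (caps 0 Down c) (?D c @ ?U c)" using tc[of c] by (simp add: sorted_dirs_def)
  have 2: "eqv [] (caps 0 Down (c + 2) @ (c + 2, UU b) # ?q) (caps 0 Down (c + 2) @ (c, DD b) # ?q) (sorted_dirs m m)"
    unfolding split2
    by (rule leq_step'[OF caps_UU_base[of b], where p = "?D c" and s = "?U c" and a = "caps 0 Down c" and b = ?q])
      (use t0 tq in simp_all)
  have 3: "eqv [] (caps 0 Down (c + 2) @ (c, DD b) # ?q) (caps 0 Down (c + 2) @ ?q @ [(c, DD b)]) (sorted_dirs m m)"
    by (rule leq_step'[OF c2, where p = "?D c" and s = "[Up, Up] @ ?U c" and a = "caps 0 Down (c + 2)" and b = "[]"])
      (use t2 v1 in simp_all)
  show ?thesis unfolding split1 using leq_trans1[OF 1 leq_trans1[OF 2 3]] by simp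
qed

text \<open>Below nested maxima every crossing of upward strands can be carried to the downward
  strands, so one Hecke algebra acts instead of two.\<close>

lemma caps_sword:
  assumes "sword \<eta>" "ty (sorted_dirs m m) \<eta> w"
  shows "\<exists>\<beta>. dword m \<beta> \<and> eqv [] (caps 0 Down m @ \<eta>) (caps 0 Down m @ \<beta>) (sorted_dirs m m)"
  using assms
proof (induction \<eta> arbitrary: w rule: rev_induct)
  case Nil
  show ?case using typed_caps[of n Down m] by (intro exI[of _ "[]"]) (simp add: sorted_dirs_def leq_refl)
next
  case (snoc l \<eta>)
  obtain i c x where l: "l = (i, Cross c x x)" using snoc.prems by (auto simp: sword_def)
  obtain v where v: "ty (sorted_dirs m m) \<eta> v" "ty v [l] w" using snoc.prems by (auto simp: typed_append)
  obtain \<beta> where \<beta>: "dword m \<beta>" "eqv [] (caps 0 Down m @ \<eta>) (caps 0 Down m @ \<beta>) (sorted_dirs m m)"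
    using snoc.IH[OF _ v(1)] snoc.prems by auto
  have tc: "ty [] (caps 0 Down m) (sorted_dirs m m)"
    using typed_caps[of n Down m] by (simp add: sorted_dirs_def)
  have "ty [] (caps 0 Down m @ \<eta>) v" using tc v by (auto simp: typed_append)
  then have vs: "v = sorted_dirs m m" using typed_unique leq_typed(1)[OF \<beta>(2)] by blast
  note ly = sword_layer[OF v(2)[unfolded vs l]]
  have ws: "w = sorted_dirs m m" by (rule ly(1))
  have A: "eqv [] (caps 0 Down m @ \<eta> @ [l]) (caps 0 Down m @ \<beta> @ [l]) (sorted_dirs m m)"
    by (rule leq_step'[OF \<beta>(2), where p = "[]" and s = "[]" and a = "[]" and b = "[l]"])
      (use v(2) in \<open>simp_all add: vs ws\<close>)
  from ly(2) show ?case
  proof (elim disjE conjE)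
    assume "x = Down" "i + 2 \<le> m"
    then show ?thesis using A \<beta>(1) by (intro exI[of _ "\<beta> @ [l]"]) (simp add: l)
  next
    assume x: "x = Up" "m \<le> i"
    have "i + 2 \<le> 2 * m"
    proof -
      obtain p s where "sorted_dirs m m = p @ [x, x] @ s" "i = length p"
        using v(2) unfolding l typed_layer vs by auto
      from arg_cong[OF this(1), of length] this(2) show ?thesis by (simp add: sorted_dirs_def)
    qed
    define j where "j = i - m"
    have j: "i = m + j" "j + 2 \<le> m" using x \<open>i + 2 \<le> 2 * m\<close> by (auto simp: j_def)
    \<comment> \<open>The maxima with right legs \<open>j\<close> and \<open>j + 1\<close> in the
      upward block have their left legs at \<open>m - 1 - j\<close> and
      \<open>m - 2 - j\<close>.\<close>
    define c' where "c' = m - 2 - j"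
    have c': "m = c' + 2 + j" using j by (simp add: c'_def)
    have tb: "ty (replicate m Down) \<beta> (replicate m Down)" using typed_dword[OF \<beta>(1), of n "[]"] by simp
    have tU: "ty (replicate m Up) [(j, UU c)] (replicate m Up)"
      unfolding typed_layer using c' by (intro exI[of _ "replicate j Up"] exI[of _ "replicate c' Up"])
        (simp add: replicate_add[symmetric] add_ac replicate_app_Cons_same flip: replicate.simps(2))
    have c1: "eqv (sorted_dirs m m) (\<beta> @ [(m + j, UU c)]) ((m + j, UU c) # \<beta>) (sorted_dirs m m)"
      using commute_words[OF wb tb tU, of "[]"] by (simp add: sorted_dirs_def)
    have B: "eqv [] (caps 0 Down m @ \<beta> @ [l]) (caps 0 Down m @ (m + j, UU c) # \<beta>) (sorted_dirs m m)"
      by (rule leq_step'[OF c1, where p = "[]" and s = "[]" and a = "caps 0 Down m" and b = "[]"])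
        (use tc in \<open>simp_all add: l x j\<close>)
    have tb': "ty (sorted_dirs m m) \<beta> (sorted_dirs m m)"
      using typed_dword[OF \<beta>(1)] by (simp add: sorted_dirs_def)
    have C: "eqv [] (caps 0 Down m @ (m + j, UU c) # \<beta>) (caps 0 Down m @ (c', DD c) # \<beta>) (sorted_dirs m m)"
      by (rule leq_step'[OF caps_UU[OF c', of c], where p = "[]" and s = "[]" and a = "[]" and b = \<beta>])
        (use tb' in simp_all)
    show ?thesis
      using leq_trans1[OF A leq_trans1[OF B C]] \<beta>(1) c' by (intro exI[of _ "(c', DD c) # \<beta>"]) simp
  qed
qed

end

section \<open>The spanning set\<close>

text \<open>Appending \<open>b\<close> as a linear operation on evaluations: closures are extended
  by \<open>b\<close>, colourings are acted on by \<open>b\<close>. Spans of open tangles can be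
  transported through it.\<close>

definition push :: "nat \<Rightarrow> dir list \<Rightarrow> web_piece diagram \<Rightarrow> (web_piece diagram + nat list \<Rightarrow> laurent)
    \<Rightarrow> web_piece diagram + nat list \<Rightarrow> laurent" where
  "push n w b f x = (case x of Inl v \<Rightarrow> f (Inl (b @ v))
     | Inr ys \<Rightarrow> if length ys = length w \<and> set ys \<subseteq> {1..n} then acts n b (\<lambda>zs. f (Inr zs)) ys else 0)"

text \<open>The recursive structure of the Hecke algebra, H_m = H_(m-1) + H_(m-1) T H_(m-1) with
  \<open>T\<close> the last generator.\<close>

definition reduced_words :: "nat \<Rightarrow> web_piece diagram set" where
  "reduced_words m = {\<beta>. dword (m - 1) \<beta>} \<union>
     {\<beta> @ [(m - 2, Cross True Down Down)] @ \<beta>' | \<beta> \<beta>'. dword (m - 1) \<beta> \<and> dword (m - 1) \<beta>' \<and> 2 \<le> m}"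

lemma reduced_dword: "\<rho> \<in> reduced_words m \<Longrightarrow> dword m \<rho>"
  using dword_mono[of "m - 1" _ m] by (auto simp: reduced_words_def)

context web_invariant begin

lemma ev_push:
  assumes "ty [] u w" "ty w b w'"
  shows "ev n br (u @ b) = push n w' b (ev n br u)"
proof
  fix x
  show "ev n br (u @ b) x = push n w' b (ev n br u) x"
  proof (cases x)
    case (Inr ys)
    have t: "ty [] (u @ b) w'" using assms by (auto simp: typed_append)
    have "acts n b (acts n u delta_nil) ys = acts n b (\<lambda>zs. ev n br u (Inr zs)) ys"
      if "length ys = length w'" "set ys \<subseteq> {1..n}"
      by (rule acts_cong[OF assms(2) that]) (simp add: ev_def typed_foldl_eq[OF assms(1)])
    then show ?thesis
      by (auto simp: Inr push_def ev_def typed_foldl_eq[OF t] acts_append simp del: foldl_append)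
  qed (simp add: ev_def push_def)
qed

lemma span_append:
  assumes "ev n br u \<in> lspan (ev n br ` A)" "\<And>a. a \<in> A \<Longrightarrow> ty [] a w" "ty [] u w" "ty w b w'"
    "\<And>a. a \<in> A \<Longrightarrow> ev n br (a @ b) \<in> lspan T"
  shows "ev n br (u @ b) \<in> lspan T"
  unfolding ev_push[OF assms(3,4)]
proof (rule lspan_linear_image[OF assms(1)])
  fix f assume "f \<in> ev n br ` A"
  then obtain a where a: "a \<in> A" "f = ev n br a" by auto
  then show "push n w' b f \<in> lspan T"
    using ev_push[OF assms(2)[OF a(1)] assms(4)] assms(5)[OF a(1)] by simp
next
  show "push n w' b (\<lambda>_. 0) = (\<lambda>_. 0)"
    by (auto simp: push_def fun_eq_iff acts_linear(2) split: sum.splits)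
  show "push n w' b (\<lambda>x. c * f x + g x) = (\<lambda>x. c * push n w' b f x + push n w' b g x)" for c f g
    by (auto simp: push_def fun_eq_iff acts_linear(1) split: sum.splits)
qed

lemma ev_leq_span:
  assumes "leq n br c w l r w'" "ty [] u w" "ev n br (u @ r) \<in> lspan T"
  shows "ev n br (u @ l) \<in> lspan T"
  unfolding leq_ev[OF assms(1,2)] by (rule lspan_scale[OF assms(3)])

section \<open>Reduction of braid words in the Hecke algebra\<close>

lemma hecke_span:
  assumes "ty [] u (replicate m Down @ s)" "i + 2 \<le> m"
    "ev n br (u @ [(i, DD True)]) \<in> lspan T" "ev n br u \<in> lspan T"
  shows "ev n br (u @ [(i, DD b)]) \<in> lspan T"
proof (cases b)
  case False
  have "ev n br (u @ [(i, DD False)]) = (\<lambda>x. qpow (- 2 / of_nat n) * ev n br (u @ [(i, DD True)]) x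
      + (qpow (- 1 / of_nat n) * zed) * ev n br u x)"
    using hecke_ev[OF wb assms(1) typed_DD[OF assms(2)]] by auto
  then show ?thesis using False lspan_add[OF lspan_scale[OF assms(3)] lspan_scale[OF assms(4)]] by simp
qed (use assms in simp)

text \<open>The skein relation writes the inverse of a generator T as a combination of T and 1;
  multiplying by T solves for the square.\<close>

lemma hecke_square:
  assumes u: "ty [] u (replicate m Down @ s)" and i: "i + 2 \<le> m"
    and T: "ev n br (u @ [(i, DD True)]) \<in> lspan T" "ev n br u \<in> lspan T"
  shows "ev n br (u @ [(i, DD True), (i, DD True)]) \<in> lspan T"
proof -
  have ut: "ty [] (u @ [(i, DD True)]) (replicate m Down @ s)"
    using u typed_DD[OF i] by (auto simp: typed_append simp del: typed.simps(2))
  have "eqv (replicate m Down @ s) [(i, DD True), (i, DD False)] [] (replicate m Down @ s)"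
    using winv_layer(1)[OF _ typed_DD[OF i, of n s True]] by simp
  from leq_ev[OF this u] have 1: "ev n br (u @ [(i, DD True), (i, DD False)]) = ev n br u" by simp
  have "ev n br (u @ [(i, DD True), (i, DD True)])
      = (\<lambda>x. qpow (2 / of_nat n) * ev n br u x + (- qpow (2 / of_nat n) * qpow (- 1 / of_nat n) * zed) * ev n br (u @ [(i, DD True)]) x)"
  proof
    fix x
    have "ev n br u x = qpow (- 2 / of_nat n) * ev n br (u @ [(i, DD True), (i, DD True)]) x
        + qpow (- 1 / of_nat n) * zed * ev n br (u @ [(i, DD True)]) x"
      using hecke_ev[OF wb ut typed_DD[OF i], of x] 1 by simp
    then show "ev n br (u @ [(i, DD True), (i, DD True)]) x = qpow (2 / of_nat n) * ev n br u x
        + (- qpow (2 / of_nat n) * qpow (- 1 / of_nat n) * zed) * ev n br (u @ [(i, DD True)]) x"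
      by (simp add: distrib_left mult.assoc)
  qed
  then show ?thesis using lspan_add[OF lspan_scale[OF T(2)] lspan_scale[OF T(1)]] by (simp only:)
qed

lemma top_letter:
  assumes "dword m \<beta>"
  shows "eqv (replicate (Suc (Suc m)) Down @ s) ([(m, DD b)] @ \<beta>) (\<beta> @ [(m, DD b)]) (replicate (Suc (Suc m)) Down @ s)"
proof -
  have "ty (replicate m Down) \<beta> (replicate m Down)" using typed_dword[OF assms, of n "[]"] by simp
  moreover have "ty [Down, Down] [(0, DD b)] [Down, Down]" by simp
  ultimately have "eqv (replicate m Down @ [Down, Down]) ([(m, DD b)] @ \<beta>) (\<beta> @ [(m, DD b)]) (replicate m Down @ [Down, Down])"
    using leq_sym[OF commute_words[OF wb, of "replicate m Down" \<beta> "replicate m Down" "[Down, Down]" "[(0, DD b)]" "[Down, Down]" "[]"]]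
    by simp
  from leq_ctx[OF this, of "[]" s] show ?thesis by (simp add: replicate_app_Cons_same)
qed

text \<open>Letters are appended one by one. The only critical case is a second occurrence of the
  last generator. The word between the two is itself reduced for one strand less: either it commutes
  with the generator and a square remains, or it contains the preceding generator once and the braid
  relation leaves a single last generator.\<close>

lemma hecke_reduce:
  assumes "dword m \<beta>" "ty [] u (replicate m Down @ s)"
  shows "ev n br (u @ \<beta>) \<in> lspan (ev n br ` (@) u ` reduced_words m)"
  using assms
proof (induction m arbitrary: \<beta> u s)
  case 0
  then show ?case by (auto intro!: lspan_base simp: reduced_words_def)
next
  case (Suc m)
  let ?w = "replicate (Suc m) Down @ s" and ?R = "ev n br ` (@) u ` reduced_words (Suc m)"
  have base: "ev n br (u @ \<rho>) \<in> lspan ?R" if "\<rho> \<in> reduced_words (Suc m)" for \<rho>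
    using that by (intro lspan_base) auto
  have base1: "ev n br (u @ \<rho>) \<in> lspan ?R" if "dword m \<rho>" for \<rho>
    using that by (intro base) (simp add: reduced_words_def)
  have base2: "ev n br (u @ \<rho> @ [(k, DD True)] @ \<rho>') \<in> lspan ?R" if "dword m \<rho>" "dword m \<rho>'" "m = Suc k" for \<rho> \<rho>' k
    using that by (intro base) (auto simp: reduced_words_def)
  have tu: "ty [] (u @ \<rho>) ?w" if "dword (Suc m) \<rho>" for \<rho>
    using Suc.prems(2) typed_dword[OF that] typed_append by blast
  show ?case
    using Suc.prems(1)
  proof (induction \<beta> rule: rev_induct)
    case Nil
    show ?case using base1[of "[]"] by simp
  next
    case (snoc l \<beta>)
    obtain i b where l: "l = (i, DD b)" "i + 2 \<le> Suc m"
      using snoc.prems by (auto simp: dword_def)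
    have dw: "dword (Suc m) \<beta>" using snoc.prems by simp
    have "ev n br ((u @ \<beta>) @ [l]) \<in> lspan ?R"
    proof (rule span_append[OF snoc.IH[OF dw]])
      show "ty [] (u @ \<beta>) ?w" by (rule tu[OF dw])
      show "ty ?w [l] ?w" unfolding l by (rule typed_DD[OF l(2)])
      fix a assume "a \<in> (@) u ` reduced_words (Suc m)"
      then obtain \<rho> where a: "a = u @ \<rho>" and \<rho>: "\<rho> \<in> reduced_words (Suc m)" by auto
      show "ty [] a ?w" unfolding a by (rule tu[OF reduced_dword[OF \<rho>]])
      show "ev n br (a @ [l]) \<in> lspan ?R"
      proof (cases "i + 2 \<le> m")
        case True
        from \<rho> consider "dword m \<rho>" | \<beta>1 \<beta>2 where "\<rho> = \<beta>1 @ [(m - 1, DD True)] @ \<beta>2" "dword m \<beta>1" "dword m \<beta>2" "1 \<le> m"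
          by (auto simp: reduced_words_def)
        then show ?thesis
        proof cases
          case 1
          then show ?thesis using base1[of "\<rho> @ [l]"] True by (simp add: a l)
        next
          case 2
          then show ?thesis using base2[of \<beta>1 "\<beta>2 @ [l]" "m - 1"] True by (simp add: a l)
        qed
      next
        case False
        then obtain k where m: "m = Suc k" and i: "i = k" using l(2) by (cases m) auto
        \<comment> \<open>The sign \<open>True\<close> is enough; the other sign follows from the
          skein relation.\<close>
        have tr: "ev n br (a @ [(k, DD True)]) \<in> lspan ?R"
        proof -
          from \<rho> consider "dword m \<rho>" | \<beta>1 \<beta>2 where "\<rho> = \<beta>1 @ [(k, DD True)] @ \<beta>2" "dword m \<beta>1" "dword m \<beta>2"
            by (auto simp: reduced_words_def m)
          then show ?thesis
          proof cases
            case 1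
            then show ?thesis using base2[of \<rho> "[]" k] by (simp add: a m)
          next
            case 2
            \<comment> \<open>The induction hypothesis is applied to the word
              \<open>\<beta>2\<close> between the two occurrences, everything before it being the
              new upper part; the last downward strand joins the side strands. For this the
              induction keeps \<open>u\<close> and \<open>s\<close> arbitrary.\<close>
            let ?u = "u @ \<beta>1 @ [(k, DD True)]"
            have tk: "ty ?w [(k, DD True)] ?w" by (rule typed_DD) (simp add: m)
            have tu1: "ty [] (u @ \<beta>1) ?w" by (rule tu) (use 2 in \<open>auto intro: dword_mono\<close>)
            have tu': "ty [] ?u ?w"
              using tu1 tk typed_append[of "web_io n" "[]" "u @ \<beta>1"] by auto
            have tu'': "ty [] ?u (replicate m Down @ Down # s)"
              using tu' by (simp add: replicate_app_Cons_same)
            have t\<rho>: "ty [] (?u @ \<rho>') ?w" if "dword m \<rho>'" for \<rho>'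
            proof -
              have "dword (Suc m) \<rho>'" using dword_mono[OF that, of "Suc m"] by simp
              from typed_dword[OF this] tu' show ?thesis
                unfolding typed_append[of "web_io n" "[]" ?u] by blast
            qed
            have "ev n br ((?u @ \<beta>2) @ [(k, DD True)]) \<in> lspan ?R"
            proof (rule span_append[OF Suc.IH[OF 2(3) tu'']])
              show "ty [] (?u @ \<beta>2) ?w" by (rule t\<rho>[OF 2(3)])
              show "ty ?w [(k, DD True)] ?w" by (rule tk)
              fix a' assume "a' \<in> (@) ?u ` reduced_words m"
              then obtain \<rho>' where a': "a' = ?u @ \<rho>'" and \<rho>': "\<rho>' \<in> reduced_words m" by auto
              show "ty [] a' ?w" unfolding a' by (rule t\<rho>[OF reduced_dword[OF \<rho>']])
              from \<rho>' consider "dword k \<rho>'" | \<beta>3 \<beta>4 j where "\<rho>' = \<beta>3 @ [(j, DD True)] @ \<beta>4" "dword k \<beta>3" "dword k \<beta>4" "k = Suc j"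
                by (cases k) (auto simp: reduced_words_def m)
              then show "ev n br (a' @ [(k, DD True)]) \<in> lspan ?R"
              proof cases
                case 1
                have tt: "eqv ?w ([(k, DD True)] @ \<rho>') (\<rho>' @ [(k, DD True)]) ?w"
                  using top_letter[OF 1, of s True] by (simp add: m)
                have A: "eqv ?w ([(k, DD True)] @ \<rho>' @ [(k, DD True)]) (\<rho>' @ [(k, DD True)] @ [(k, DD True)]) ?w"
                  by (rule leq_step'[OF tt, where p = "[]" and s = "[]" and a = "[]" and b = "[(k, DD True)]"])
                    (use tk in simp_all)
                have dm: "dword m (\<beta>1 @ \<rho>')" using 1 2 dword_mono[OF 1, of m] by (simp add: m)
                have "ev n br ((u @ \<beta>1 @ \<rho>') @ [(k, DD True), (k, DD True)]) \<in> lspan ?R"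
                proof (rule hecke_square)
                  show "ty [] (u @ \<beta>1 @ \<rho>') ?w" by (rule tu) (use dm in \<open>auto intro: dword_mono\<close>)
                  show "k + 2 \<le> Suc m" by (simp add: m)
                  show "ev n br ((u @ \<beta>1 @ \<rho>') @ [(k, DD True)]) \<in> lspan ?R"
                    using base2[of "\<beta>1 @ \<rho>'" "[]" k] dm by (simp add: m)
                  show "ev n br (u @ \<beta>1 @ \<rho>') \<in> lspan ?R" using base1[OF dm] .
                qed
                then show ?thesis
                  using ev_leq_span[OF A tu1, of ?R] by (simp add: a')
              next
                case 2
                have k: "k = Suc j" by (rule 2(4))
                have t3: "eqv ?w ([(k, DD True)] @ \<beta>3) (\<beta>3 @ [(k, DD True)]) ?w"
                  and t4: "eqv ?w ([(k, DD True)] @ \<beta>4) (\<beta>4 @ [(k, DD True)]) ?w"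
                  using top_letter[OF 2(2), of s True] top_letter[OF 2(3), of s True] by (simp_all add: m)
                have tj: "ty ?w [(j, DD True)] ?w" by (rule typed_DD) (simp add: m k)
                have w34: "ty ?w \<beta>3 ?w" "ty ?w \<beta>4 ?w"
                  using 2(2,3) dword_mono[of k _ "Suc m"] by (intro typed_dword; simp add: m)+
                have ta: "ty ?w ([(j, DD True)] @ \<beta>4 @ [(k, DD True)]) ?w"
                  "ty ?w (\<beta>3 @ [(k, DD True)] @ [(j, DD True)]) ?w"
                  unfolding typed_append using tk tj w34 by blast+
                have A: "eqv ?w ([(k, DD True)] @ \<beta>3 @ [(j, DD True)] @ \<beta>4 @ [(k, DD True)])
                    (\<beta>3 @ [(k, DD True)] @ [(j, DD True)] @ \<beta>4 @ [(k, DD True)]) ?w"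
                  by (rule leq_step'[OF t3, where p = "[]" and s = "[]" and a = "[]"
                        and b = "[(j, DD True)] @ \<beta>4 @ [(k, DD True)]"])
                    (use ta in \<open>simp_all del: typed.simps(2)\<close>)
                have B: "eqv ?w (\<beta>3 @ [(k, DD True)] @ [(j, DD True)] @ \<beta>4 @ [(k, DD True)])
                    (\<beta>3 @ [(k, DD True)] @ [(j, DD True)] @ [(k, DD True)] @ \<beta>4) ?w"
                  by (rule leq_step'[OF leq_sym[OF t4], where p = "[]" and s = "[]"
                        and a = "\<beta>3 @ [(k, DD True)] @ [(j, DD True)]" and b = "[]"])
                    (use ta in \<open>simp_all del: typed.simps(2)\<close>)
                have w: "?w = replicate j Down @ [Down, Down, Down] @ s"
                  by (simp add: m k replicate_app_Cons_same)
                have C: "eqv ?w (\<beta>3 @ [(k, DD True)] @ [(j, DD True)] @ [(k, DD True)] @ \<beta>4)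
                    (\<beta>3 @ [(j, DD True)] @ [(k, DD True)] @ [(j, DD True)] @ \<beta>4) ?w"
                  by (rule leq_step'[OF leq_sym[OF reidemeister3_DDD[OF wb]], where p = "replicate j Down" and s = s
                        and a = \<beta>3 and b = \<beta>4])
                    (use w34 in \<open>simp_all only: w, simp_all add: k\<close>)
                have "ev n br ((u @ \<beta>1) @ \<beta>3 @ [(j, DD True)] @ [(k, DD True)] @ [(j, DD True)] @ \<beta>4) \<in> lspan ?R"
                proof -
                  have "dword m (\<beta>1 @ \<beta>3 @ [(j, DD True)])" "dword m ([(j, DD True)] @ \<beta>4)"
                    using \<open>dword m \<beta>1\<close> 2(2,3) dword_mono[of k _ m] by (simp_all add: m k)
                  from base2[OF this m] show ?thesis by simp
                qed
                then show ?thesis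
                  using ev_leq_span[OF leq_trans1[OF A leq_trans1[OF B C]] tu1, of ?R] by (simp add: a' 2(1))
              qed
            qed
            then show ?thesis by (simp add: a 2(1))
          qed
        qed
        show ?thesis unfolding l i
        proof (rule hecke_span[OF _ _ tr])
          show "ty [] a (replicate (Suc m) Down @ s)" unfolding a by (rule tu[OF reduced_dword[OF \<rho>]])
          show "ev n br a \<in> lspan ?R" unfolding a by (rule base[OF \<rho>])
        qed (simp add: m)
      qed
    qed
    then show ?case by simp
  qed
qed

end

section \<open>Standard tangles and extrema below them\<close>

definition standard :: "nat \<Rightarrow> dir list \<Rightarrow> web_piece diagram set" where
  "standard n w = {caps 0 Down m @ \<theta> | m \<theta>. xword \<theta> \<and> typed (web_io n) (sorted_dirs m m) \<theta> w}"

lemma typed_caps_sorted: "typed (web_io n) [] (caps 0 Down m) (sorted_dirs m m)"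
  using typed_caps[of n Down m] by (simp add: sorted_dirs_def)

lemma standard_typed: "u \<in> standard n w \<Longrightarrow> typed (web_io n) [] u w"
  using typed_caps_sorted by (fastforce simp: standard_def typed_append)

context web_invariant begin

text \<open>The minimum closes the strand of the innermost maximum. If the last generator is absent
  a circle splits off, if it occurs once a curl appears; these are the two rules of a Markov
  trace.\<close>

lemma cup_reduced:
  assumes \<rho>: "\<rho> \<in> reduced_words (Suc k)"
  shows "ev n br (caps 0 Down (Suc k) @ \<rho> @ [(k, Cup Down)])
    \<in> lspan (ev n br ` {caps 0 Down k @ \<beta> | \<beta>. dword k \<beta>})" (is "_ \<in> lspan ?T")
proof -
  let ?D = "replicate k Down" and ?U = "replicate k Up"
  let ?v = "?D @ [Down, Up] @ ?U"
  have u: "ty [] (caps 0 Down k) (?D @ ?U)" using typed_caps_sorted[of n k] by (simp add: sorted_dirs_def)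
  have v: "replicate (Suc k) Down @ replicate (Suc k) Up = ?v"
    by (simp add: replicate_app_Cons_same)
  have tD: "ty ?D \<beta> ?D" if "dword k \<beta>" for \<beta>
    using typed_dword[OF that, of n "[]"] by simp
  have tDs: "ty (?D @ s) \<beta> (?D @ s)" if "dword k \<beta>" for \<beta> s
    using typed_dword[OF that] .
  have cc: "ty [] [(0, Cap Down)] [Down, Up]" "ty [Down, Up] [(0, Cup Down)] []" by simp_all
  have cap: "eqv ?D ((k, Cap Down) # \<beta>) (\<beta> @ [(k, Cap Down)]) (?D @ [Down, Up])" if "dword k \<beta>" for \<beta>
    using leq_sym[OF commute_words[OF wb tD[OF that] cc(1), of "[]"]] by simp
  have cup: "eqv (?D @ [Down, Up]) (\<beta> @ [(k, Cup Down)]) ((k, Cup Down) # \<beta>) ?D" if "dword k \<beta>" for \<beta>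
    using commute_words[OF wb tD[OF that] cc(2), of "[]"] by simp
  have tcup: "ty ?v [(k, Cup Down)] (?D @ ?U)"
    unfolding typed_layer by (intro exI[of _ ?D] exI[of _ ?U]) simp
  from \<rho> consider "dword k \<rho>" | \<beta> \<beta>' j where "\<rho> = \<beta> @ [(j, DD True)] @ \<beta>'" "dword k \<beta>" "dword k \<beta>'" "k = Suc j"
    by (cases k) (auto simp: reduced_words_def)
  then show ?thesis
  proof cases
    case 1
    have A: "eqv (?D @ ?U) ([(k, Cap Down)] @ \<rho> @ [(k, Cup Down)]) (\<rho> @ [(k, Cap Down), (k, Cup Down)]) (?D @ ?U)"
      by (rule leq_step'[OF cap[OF 1], where p = "[]" and s = ?U and a = "[]" and b = "[(k, Cup Down)]"])
        (use tcup in \<open>simp_all del: typed.simps(2)\<close>)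
    have B: "leq n br (qint n) (?D @ ?U) (\<rho> @ [(k, Cap Down), (k, Cup Down)]) \<rho> (?D @ ?U)"
      by (rule leq_step'[OF circle_leq[OF wb], where p = ?D and s = ?U and a = \<rho> and b = "[]"])
        (use tDs[OF 1] in simp_all)
    have "ev n br (caps 0 Down k @ [(k, Cap Down)] @ \<rho> @ [(k, Cup Down)]) \<in> lspan ?T"
      by (rule ev_leq_span[OF leq_trans[OF A B] u]) (use 1 in \<open>auto intro!: lspan_base\<close>)
    then show ?thesis by (simp add: caps_Suc)
  next
    case 2
    have tj: "ty ?v [(j, DD True)] ?v"
      using typed_DD[of j k n "[Down, Up] @ ?U"] typed_DD[of j "Suc k" n "Up # ?U"] 2(4)
      by (simp add: replicate_app_Cons_same del: typed.simps(2))
    have t1: "ty ?v ([(j, DD True)] @ \<beta>' @ [(k, Cup Down)]) (?D @ ?U)"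
      using tj tDs[OF 2(3)] tcup unfolding typed_append by blast
    have A: "eqv (?D @ ?U) ([(k, Cap Down)] @ \<beta> @ [(j, DD True)] @ \<beta>' @ [(k, Cup Down)])
        (\<beta> @ [(k, Cap Down)] @ [(j, DD True)] @ \<beta>' @ [(k, Cup Down)]) (?D @ ?U)"
      by (rule leq_step'[OF cap[OF 2(2)], where p = "[]" and s = ?U and a = "[]"
            and b = "[(j, DD True)] @ \<beta>' @ [(k, Cup Down)]"])
        (use t1 in \<open>simp_all del: typed.simps(2)\<close>)
    have tcap: "ty (?D @ ?U) [(k, Cap Down)] ?v"
      unfolding typed_layer by (intro exI[of _ ?D] exI[of _ ?U]) simp
    have t2: "ty (?D @ ?U) (\<beta> @ [(k, Cap Down)] @ [(j, DD True)]) ?v"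
      using tj tDs[OF 2(2)] tcap unfolding typed_append by blast
    have B: "eqv (?D @ ?U) (\<beta> @ [(k, Cap Down)] @ [(j, DD True)] @ \<beta>' @ [(k, Cup Down)])
        (\<beta> @ [(k, Cap Down)] @ [(j, DD True)] @ [(k, Cup Down)] @ \<beta>') (?D @ ?U)"
      by (rule leq_step'[OF cup[OF 2(3)], where p = "[]" and s = ?U and a = "\<beta> @ [(k, Cap Down)] @ [(j, DD True)]" and b = "[]"])
        (use t2 in \<open>simp_all del: typed.simps(2)\<close>)
    have w: "?D @ ?U = replicate j Down @ [Down] @ ?U" by (simp add: 2(4) replicate_app_Cons_same)
    have C: "leq n br (qpow (1 / of_nat n - of_nat n)) (?D @ ?U)
        (\<beta> @ [(k, Cap Down)] @ [(j, DD True)] @ [(k, Cup Down)] @ \<beta>') (\<beta> @ \<beta>') (?D @ ?U)"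
      using leq_step'[OF curl_leq[OF wb, of True], where p = "replicate j Down" and s = ?U and a = \<beta> and b = \<beta>',
          unfolded w[symmetric], OF tDs[OF 2(2)] tDs[OF 2(3)] refl refl]
      by (simp add: curl_right_def 2(4))
    have "ev n br (caps 0 Down k @ [(k, Cap Down)] @ \<beta> @ [(j, DD True)] @ \<beta>' @ [(k, Cup Down)]) \<in> lspan ?T"
      by (rule ev_leq_span[OF leq_trans[OF A leq_trans[OF B C]] u]) (use 2 in \<open>auto intro!: lspan_base\<close>)
    then show ?thesis by (simp add: caps_Suc 2(1))
  qed
qed

lemma cup_dword:
  assumes "dword (Suc k) \<beta>"
  shows "ev n br (caps 0 Down (Suc k) @ \<beta> @ [(k, Cup Down)])
    \<in> lspan (ev n br ` {caps 0 Down k @ \<beta> | \<beta>. dword k \<beta>})"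
proof -
  let ?s = "replicate (Suc k) Up"
  let ?w = "replicate (Suc k) Down @ ?s"
  have u: "ty [] (caps 0 Down (Suc k)) ?w" using typed_caps[of n Down "Suc k"] by simp
  have t: "ty [] (caps 0 Down (Suc k) @ \<beta>') ?w" if "dword (Suc k) \<beta>'" for \<beta>'
    using u typed_dword[OF that] unfolding typed_append by blast
  have "ev n br ((caps 0 Down (Suc k) @ \<beta>) @ [(k, Cup Down)])
    \<in> lspan (ev n br ` {caps 0 Down k @ \<beta> | \<beta>. dword k \<beta>})"
  proof (rule span_append[OF hecke_reduce[OF assms u]])
    show "ty [] (caps 0 Down (Suc k) @ \<beta>) ?w" by (rule t[OF assms])
    show "ty ?w [(k, Cup Down)] (replicate k Down @ replicate k Up)"
      unfolding typed_layer
      by (intro exI[of _ "replicate k Down"] exI[of _ "replicate k Up"]) (simp add: replicate_app_Cons_same)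
  qed (use t reduced_dword cup_reduced in auto)
  then show ?thesis by simp
qed

lemma xword_count:
  assumes "xword \<theta>" "ty w \<theta> v"
  shows "count_list v = count_list w"
  using assms
proof (induction \<theta> arbitrary: w)
  case (Cons l \<theta>)
  obtain w1 where w1: "ty w [l] w1" "ty w1 \<theta> v" using Cons.prems by auto
  obtain i b x y where l: "l = (i, Cross b x y)" using Cons.prems by (cases l rule: good.cases) auto
  obtain p s where "w = p @ [x, y] @ s" "w1 = p @ [y, x] @ s" using w1(1) unfolding l typed_layer by auto
  then have "count_list w1 = count_list w" by (auto simp: fun_eq_iff)
  then show ?case using Cons.IH[OF _ w1(2)] Cons.prems by simp
qed simp

text \<open>The maximum is moved to the right end, lifted above all crossings, turned until its left
  leg points down, and moved over the upward strands into the middle of the sorted word. There it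
  extends the nested family by a new innermost maximum.\<close>

lemma standard_cap:
  assumes "u \<in> standard n w" "ty w [(i, Cap d)] w'"
  shows "ev n br (u @ [(i, Cap d)]) \<in> lspan (ev n br ` standard n w')"
proof -
  obtain m \<theta> where u: "u = caps 0 Down m @ \<theta>" "xword \<theta>" "ty (sorted_dirs m m) \<theta> w"
    using assms(1) by (auto simp: standard_def)
  obtain w1 w2 where w: "w = w1 @ w2" "w' = w1 @ [d, opp d] @ w2" "i = length w1"
    using assms(2) unfolding typed_layer by auto
  let ?S = "sorted_dirs m m"
  obtain \<theta>1 where \<theta>1: "xword \<theta>1" "eqv w2 [(0, Cap d)] ((length w2, Cap d) # \<theta>1) ([d, opp d] @ w2)"
    using cap_right by blast
  have A: "eqv ?S (\<theta> @ [(i, Cap d)]) (\<theta> @ (length w, Cap d) # shift i \<theta>1) w'"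
    by (rule leq_step'[OF \<theta>1(2), where p = w1 and s = "[]" and a = \<theta> and b = "[]"])
      (use u in \<open>simp_all add: w\<close>)
  have tcap: "ty [] [(0, Cap d)] [d, opp d]" by simp
  have c: "eqv ?S (\<theta> @ [(length w, Cap d)]) ((2 * m, Cap d) # \<theta>) (w @ [d, opp d])"
    using commute_words[OF wb u(3) tcap, of "[]"] by (simp add: sorted_dirs_def mult_2)
  have "ty (w @ [d, opp d]) (shift i \<theta>1) w'"
    using typed_shift[OF leq_typed(2)[OF \<theta>1(2), simplified], of w1 "[]"] by (simp add: w)
  then have B: "eqv ?S (\<theta> @ (length w, Cap d) # shift i \<theta>1) ((2 * m, Cap d) # \<theta> @ shift i \<theta>1) w'"
    by (intro leq_step'[OF c, where p = "[]" and s = "[]" and a = "[]" and b = "shift i \<theta>1"]) simp_all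
  have "\<exists>c \<theta>2. xword \<theta>2 \<and> leq n br c ?S [(2 * m, Cap d)] ((2 * m, Cap Down) # \<theta>2) (?S @ [d, opp d])"
  proof (cases d)
    case Down
    show ?thesis by (rule exI[of _ 1], rule exI[of _ "[]"]) (simp add: Down leq_refl sorted_dirs_def)
  next
    case Up
    show ?thesis
      using leq_ctx[OF cap_turn, of ?S "[]"]
      by (intro exI[of _ "qpow (of_nat n - 1 / of_nat n)"] exI[of _ "[(2 * m, DU)]"])
        (simp add: Up sorted_dirs_def mult_2)
  qed
  then obtain cc \<theta>2 where \<theta>2: "xword \<theta>2" "leq n br cc ?S [(2 * m, Cap d)] ((2 * m, Cap Down) # \<theta>2) (?S @ [d, opp d])"
    by blast
  have t3: "ty (?S @ [d, opp d]) (\<theta> @ shift i \<theta>1) w'"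
    using leq_typed(2)[OF B] leq_typed(1)[OF \<theta>2(2)] typed_append[of "web_io n" ?S "[(2 * m, Cap d)]" "\<theta> @ shift i \<theta>1"]
    by (metis append_Cons append_Nil typed_unique)
  have C: "leq n br cc ?S ((2 * m, Cap d) # \<theta> @ shift i \<theta>1) ((2 * m, Cap Down) # \<theta>2 @ \<theta> @ shift i \<theta>1) w'"
    by (rule leq_step'[OF \<theta>2(2), where p = "[]" and s = "[]" and a = "[]" and b = "\<theta> @ shift i \<theta>1"])
      (use t3 in simp_all)
  obtain \<theta>3 where \<theta>3: "xword \<theta>3" "eqv (replicate m Up) [(length (replicate m Up), Cap Down)] ((0, Cap Down) # \<theta>3) (replicate m Up @ [Down, opp Down])"
    using cap_left by blast
  have D: "eqv ?S ((2 * m, Cap Down) # \<theta>2 @ \<theta> @ shift i \<theta>1) ((m, Cap Down) # shift m \<theta>3 @ \<theta>2 @ \<theta> @ shift i \<theta>1) w'"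
  proof (rule leq_step'[OF \<theta>3(2), where p = "replicate m Down" and s = "[]" and a = "[]" and b = "\<theta>2 @ \<theta> @ shift i \<theta>1"])
    have "ty ?S [(2 * m, Cap Down)] (?S @ [Down, Up])" by (simp add: sorted_dirs_def)
    then show "ty (replicate m Down @ (replicate m Up @ [Down, opp Down]) @ []) (\<theta>2 @ \<theta> @ shift i \<theta>1) w'"
      using leq_typed(2)[OF C] typed_append[of "web_io n" ?S "[(2 * m, Cap Down)]" "\<theta>2 @ \<theta> @ shift i \<theta>1"]
        typed_unique by (fastforce simp: sorted_dirs_def)
  qed (simp_all add: sorted_dirs_def mult_2)
  let ?\<theta> = "shift m \<theta>3 @ \<theta>2 @ \<theta> @ shift i \<theta>1"
  have "ty ?S [(m, Cap Down)] (sorted_dirs (Suc m) (Suc m))"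
    unfolding typed_layer
    by (intro exI[of _ "replicate m Down"] exI[of _ "replicate m Up"]) (simp add: sorted_dirs_def replicate_app_Cons_same)
  then have tf: "ty (sorted_dirs (Suc m) (Suc m)) ?\<theta> w'"
    using leq_typed(2)[OF D] typed_append[of "web_io n" ?S "[(m, Cap Down)]" ?\<theta>]
      typed_unique by fastforce
  have "caps 0 Down m @ (m, Cap Down) # ?\<theta> \<in> standard n w'"
    unfolding standard_def using tf u(2) \<theta>1(1) \<theta>2(1) \<theta>3(1)
    by (intro CollectI exI[of _ "Suc m"] exI[of _ ?\<theta>]) (simp add: caps_Suc)
  then have "ev n br (caps 0 Down m @ \<theta> @ [(i, Cap d)]) \<in> lspan (ev n br ` standard n w')"
    by (intro ev_leq_span[OF leq_trans[OF A leq_trans[OF B leq_trans[OF C D]]] typed_caps_sorted] lspan_base) auto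
  then show ?thesis by (simp add: u)
qed

text \<open>The minimum is brought to the middle of a sorted word and turned, so that it meets the
  innermost maximum through a word that can be made to involve downward strands only. Then
  \<open>cup_dword\<close> absorbs it.\<close>

lemma standard_cup:
  assumes "u \<in> standard n w" "ty w [(i, Cup d)] w'"
  shows "ev n br (u @ [(i, Cup d)]) \<in> lspan (ev n br ` standard n w')"
proof -
  obtain m \<theta> where u: "u = caps 0 Down m @ \<theta>" "xword \<theta>" "ty (sorted_dirs m m) \<theta> w"
    using assms(1) by (auto simp: standard_def)
  obtain w1 w2 where w: "w = w1 @ [d, opp d] @ w2" "w' = w1 @ w2" "i = length w1"
    using assms(2) unfolding typed_layer by auto
  let ?S = "sorted_dirs m m"
  have cnt: "count_list w = count_list ?S" by (rule xword_count[OF u(2,3)])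
  have cS: "count_list ?S Down = m" "count_list ?S Up = m"
    by (auto simp: sorted_dirs_def count_list_0_iff count_list_append) (induction m; simp)+
  have "count_list w Down = Suc (count_list w' Down)" "count_list w Up = Suc (count_list w' Up)"
    by (cases d; simp add: w)+
  then obtain k where k: "m = Suc k" "count_list w' Down = k" "count_list w' Up = k"
    using cS cnt by (metis nat.inject)
  let ?S' = "sorted_dirs k k"
  have sh: "ty ?S' (sorting w') w'" using typed_sorting[of n w'] k by simp
  note ish = winv_word(2,3)[OF xword_sorting sh] winv_word'[OF xword_sorting sh]
  obtain \<theta>1 where \<theta>1: "xword \<theta>1" "eqv ([d, opp d] @ w2) [(0, Cup d)] (\<theta>1 @ [(length w2, Cup d)]) w2"
    using cup_right by blast
  have A: "eqv ?S (\<theta> @ [(i, Cup d)]) (\<theta> @ shift i \<theta>1 @ [(length w', Cup d)]) w'"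
    by (rule leq_step'[OF \<theta>1(2), where p = w1 and s = "[]" and a = \<theta> and b = "[]"])
      (use u in \<open>simp_all add: w\<close>)
  have t1: "ty ?S (\<theta> @ shift i \<theta>1) (w' @ [d, opp d])"
  proof -
    have "ty (w' @ [d, opp d]) [(length w', Cup d)] w'" by simp
    obtain z where z: "ty ?S (\<theta> @ shift i \<theta>1) z" "ty z [(length w', Cup d)] w'"
      using leq_typed(2)[OF A] unfolding append_assoc[symmetric] typed_append by blast
    have "z = w' @ [d, opp d]" using z(2) unfolding typed_layer by auto
    with z show ?thesis by simp
  qed
  \<comment> \<open>The inserted shuffle and its inverse make the strands beside the minimum sorted;
    the inverse moves above the minimum and the shuffle stays below as the final part of the
    answer.\<close>
  have B: "eqv ?S (\<theta> @ shift i \<theta>1 @ [(length w', Cup d)])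
      (\<theta> @ shift i \<theta>1 @ [(length w', Cup d)] @ winv (sorting w') @ sorting w') w'"
    using leq_app[OF leq_sym[OF ish(3)] leq_typed(2)[OF A], of "[]" w'] by simp
  have tcup: "ty [d, opp d] [(0, Cup d)] []" by simp
  have c: "eqv (w' @ [d, opp d]) ([(length w', Cup d)] @ winv (sorting w')) (winv (sorting w') @ [(2 * k, Cup d)]) ?S'"
    using leq_sym[OF commute_words[OF wb ish(1) tcup, of "[]"]] by (simp add: sorted_dirs_def mult_2)
  have C: "eqv ?S (\<theta> @ shift i \<theta>1 @ [(length w', Cup d)] @ winv (sorting w') @ sorting w')
      (\<theta> @ shift i \<theta>1 @ winv (sorting w') @ [(2 * k, Cup d)] @ sorting w') w'"
    by (rule leq_step'[OF c, where p = "[]" and s = "[]" and a = "\<theta> @ shift i \<theta>1" and b = "sorting w'"])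
      (use t1 sh in simp_all)
  obtain \<theta>2 where \<theta>2: "xword \<theta>2" "eqv (replicate k Up @ [d, opp d]) [(length (replicate k Up), Cup d)] (\<theta>2 @ [(0, Cup d)]) (replicate k Up)"
    using cup_left by blast
  have ti: "ty (w' @ [d, opp d]) (winv (sorting w')) (?S' @ [d, opp d])"
    using typed_shift[OF ish(1), of "[]" "[d, opp d]"] by simp
  have t2: "ty ?S (\<theta> @ shift i \<theta>1 @ winv (sorting w')) (?S' @ [d, opp d])"
    using t1 ti unfolding append_assoc[symmetric] typed_append[of _ _ "\<theta> @ shift i \<theta>1"] by blast
  let ?a = "\<theta> @ shift i \<theta>1 @ winv (sorting w')"
  have D: "eqv ?S (?a @ [(2 * k, Cup d)] @ sorting w') (?a @ shift k \<theta>2 @ [(k, Cup d)] @ sorting w') w'"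
    by (rule leq_step'[OF \<theta>2(2), where p = "replicate k Down" and s = "[]" and a = ?a and b = "sorting w'"])
      (use t2 sh in \<open>simp_all add: sorted_dirs_def mult_2\<close>)
  let ?c = "replicate k Down @ [d, opp d] @ replicate k Up"
  have "\<exists>c \<theta>3. xword \<theta>3 \<and> leq n br c ?c [(k, Cup d)] (\<theta>3 @ [(k, Cup Down)]) ?S'"
  proof (cases d)
    case Down
    show ?thesis by (rule exI[of _ 1], rule exI[of _ "[]"]) (simp add: Down leq_refl sorted_dirs_def)
  next
    case Up
    show ?thesis
      using leq_ctx[OF cup_turn, of "replicate k Down" "replicate k Up"]
      by (intro exI[of _ "qpow (1 / of_nat n - of_nat n)"] exI[of _ "[(k, UD)]"])
        (simp add: Up sorted_dirs_def)
  qed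
  then obtain cc \<theta>3 where \<theta>3: "xword \<theta>3" "leq n br cc ?c [(k, Cup d)] (\<theta>3 @ [(k, Cup Down)]) ?S'"
    by blast
  have t3: "ty ?S (?a @ shift k \<theta>2) ?c"
  proof -
    have "ty ?S ((?a @ shift k \<theta>2) @ ([(k, Cup d)] @ sorting w')) w'"
      using leq_typed(2)[OF D] by (simp only: append_assoc)
    then obtain z where z: "ty ?S (?a @ shift k \<theta>2) z" "ty z ([(k, Cup d)] @ sorting w') w'"
      using typed_append[of "web_io n" ?S "?a @ shift k \<theta>2"] by blast
    have "ty (?S' @ [d, opp d]) (shift k \<theta>2) z"
      using z(1) t2 typed_unique unfolding typed_append[of _ _ ?a] by blast
    moreover obtain y where y: "ty (replicate k Up @ [d, opp d]) \<theta>2 y" "ty y [(0, Cup d)] (replicate k Up)"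
      using leq_typed(2)[OF \<theta>2(2)] unfolding typed_append by blast
    moreover have "y = [d, opp d] @ replicate k Up" using y(2) unfolding typed_layer by auto
    ultimately have "z = ?c"
      using typed_shift[OF y(1), of "replicate k Down" "[]"] typed_unique by (fastforce simp: sorted_dirs_def)
    with z show ?thesis by simp
  qed
  have E: "leq n br cc ?S (?a @ shift k \<theta>2 @ [(k, Cup d)] @ sorting w')
      ((?a @ shift k \<theta>2 @ \<theta>3) @ [(k, Cup Down)] @ sorting w') w'"
    by (rule leq_step'[OF \<theta>3(2), where p = "[]" and s = "[]" and a = "?a @ shift k \<theta>2" and b = "sorting w'"])
      (use t3 sh in simp_all)
  let ?\<theta> = "?a @ shift k \<theta>2 @ \<theta>3"
  have x: "xword ?\<theta>" using u(2) \<theta>1(1) \<theta>2(1) \<theta>3(1) ish(2) by simp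
  have t4: "ty ?S ?\<theta> ?S"
  proof -
    obtain z where z: "ty ?c \<theta>3 z" "ty z [(k, Cup Down)] ?S'"
      using leq_typed(2)[OF \<theta>3(2)] unfolding typed_append by blast
    obtain p s where ps: "z = p @ [Down, Up] @ s" "?S' = p @ s" "length p = k"
      using z(2) unfolding typed_layer by auto
    have "p = replicate k Down" "s = replicate k Up"
      using ps(2,3) by (auto simp: sorted_dirs_def append_eq_append_conv)
    then have "z = ?S" using ps(1) by (simp add: k(1) sorted_dirs_def replicate_app_Cons_same)
    then show ?thesis using z(1) t3 unfolding append_assoc[symmetric] typed_append[of _ _ _ \<theta>3] by blast
  qed
  \<comment> \<open>Both ends of the word above the minimum are sorted now, so its normal form has
    no shuffle, and its remaining crossings can be collected on the downward strands.\<close>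
  obtain \<eta> where \<eta>: "sword \<eta>" "ty ?S \<eta> ?S" "eqv ?S ?\<theta> (\<eta> @ sorting ?S) ?S"
    using sorting_word[OF x t4] by blast
  obtain \<beta> where \<beta>: "dword m \<beta>" "eqv [] (caps 0 Down m @ \<eta>) (caps 0 Down m @ \<beta>) ?S"
    using caps_sword[OF \<eta>(1,2)] by blast
  have tl: "ty ?S [(k, Cup Down)] ?S'"
    unfolding typed_layer k(1)
    by (intro exI[of _ "replicate k Down"] exI[of _ "replicate k Up"]) (simp add: sorted_dirs_def replicate_app_Cons_same)
  have tl': "ty ?S ([(k, Cup Down)] @ sorting w') w'" using tl sh unfolding typed_append by blast
  have F: "eqv ?S (?\<theta> @ [(k, Cup Down)] @ sorting w') (\<eta> @ [(k, Cup Down)] @ sorting w') w'"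
    by (rule leq_step'[OF \<eta>(3), where p = "[]" and s = "[]" and a = "[]" and b = "[(k, Cup Down)] @ sorting w'"])
      (use tl' in \<open>simp_all add: sorting_sorted del: typed.simps(2)\<close>)
  have G: "eqv [] ((caps 0 Down m @ \<eta>) @ [(k, Cup Down)] @ sorting w') (caps 0 Down m @ \<beta> @ [(k, Cup Down)] @ sorting w') w'"
    by (rule leq_step'[OF \<beta>(2), where p = "[]" and s = "[]" and a = "[]" and b = "[(k, Cup Down)] @ sorting w'"])
      (use tl' in \<open>simp_all del: typed.simps(2)\<close>)
  have t\<beta>: "ty [] (caps 0 Down m @ \<beta> @ [(k, Cup Down)]) ?S'"
    using leq_typed(2)[OF \<beta>(2)] tl unfolding append_assoc[symmetric] typed_append[of _ _ "caps 0 Down m @ \<beta>"] by blast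
  have "ev n br ((caps 0 Down m @ \<beta> @ [(k, Cup Down)]) @ sorting w') \<in> lspan (ev n br ` standard n w')"
  proof (rule span_append[OF cup_dword[of k \<beta>, folded k(1)]])
    show "dword m \<beta>" by (rule \<beta>(1))
    show "ty [] (caps 0 Down m @ \<beta> @ [(k, Cup Down)]) ?S'" by (rule t\<beta>)
    show "ty ?S' (sorting w') w'" by (rule sh)
    fix a assume "a \<in> {caps 0 Down k @ \<beta> | \<beta>. dword k \<beta>}"
    then obtain \<beta>' where a: "a = caps 0 Down k @ \<beta>'" "dword k \<beta>'" by auto
    have tb: "ty ?S' \<beta>' ?S'" using typed_dword[OF a(2)] by (simp add: sorted_dirs_def)
    then show "ty [] a ?S'" unfolding a using typed_caps_sorted[of n k] unfolding typed_append by blast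
    have "ty ?S' (\<beta>' @ sorting w') w'" using tb sh unfolding typed_append by blast
    then have "a @ sorting w' \<in> standard n w'"
      unfolding standard_def a using xword_dword[OF a(2)] xword_sorting
      by (intro CollectI exI[of _ k] exI[of _ "\<beta>' @ sorting w'"]) simp
    then show "ev n br (a @ sorting w') \<in> lspan (ev n br ` standard n w')" by (intro lspan_base) auto
  qed
  then have "ev n br ([] @ caps 0 Down m @ \<beta> @ [(k, Cup Down)] @ sorting w') \<in> lspan (ev n br ` standard n w')" by simp
  then have "ev n br ([] @ (caps 0 Down m @ \<eta>) @ [(k, Cup Down)] @ sorting w') \<in> lspan (ev n br ` standard n w')"
    by (rule ev_leq_span[OF G, rotated]) simp
  then have H: "ev n br (caps 0 Down m @ \<eta> @ [(k, Cup Down)] @ sorting w') \<in> lspan (ev n br ` standard n w')" by simp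
  note chain = leq_trans[OF A leq_trans[OF B leq_trans[OF C[unfolded append_assoc]
    leq_trans[OF D[unfolded append_assoc] leq_trans[OF E[unfolded append_assoc] F[unfolded append_assoc]]]]]]
  from ev_leq_span[OF chain typed_caps_sorted H] show ?thesis by (simp add: u)
qed

end

section \<open>Reduced words for all permutations\<close>

text \<open>In one-line notation: the values of \<open>\<tau>\<close> are raised by one and a 0 is
  inserted at position \<open>j\<close>.\<close>

fun insert_zero :: "nat \<Rightarrow> (nat \<Rightarrow> nat) \<Rightarrow> nat \<Rightarrow> nat" where
  "insert_zero j \<tau> i = (if i < j then Suc (\<tau> i) else if i = j then 0 else Suc (\<tau> (i - 1)))"

definition down_word :: "nat \<Rightarrow> nat list" where
  "down_word j = rev [0..<j]"

text \<open>One reduced word for each permutation. The words \<open>down_word j\<close> bring the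
  strand at position \<open>j\<close> to the left end; they are the shortest representatives of the
  cosets of the subgroup that fixes the left end.\<close>

fun red_words :: "nat \<Rightarrow> nat list set" where
  "red_words 0 = {[]}"
| "red_words (Suc m) = (\<lambda>(j, w). down_word j @ map Suc w) ` ({..m} \<times> red_words m)"

lemma word_perm_append: "word_perm (u @ v) = word_perm v \<circ> word_perm u"
  by (induction u) (auto simp: comp_assoc)

lemma word_perm_map_Suc: "word_perm (map Suc w) 0 = 0" "word_perm (map Suc w) (Suc i) = Suc (word_perm w i)"
proof (induction w arbitrary: i)
  case (Cons j w)
  { case 1 show ?case using Cons by (simp add: transpose_def) }
  { case 2 show ?case using Cons by (simp add: transpose_def) }
qed simp_all

lemma word_perm_down: "word_perm (down_word j) i = (if i < j then Suc i else if i = j then 0 else i)"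
proof (induction j arbitrary: i)
  case (Suc j)
  have "down_word (Suc j) = j # down_word j" by (simp add: down_word_def)
  then show ?case by (auto simp: Suc transpose_def)
qed (simp add: down_word_def)

lemma word_perm_red: "word_perm (down_word j @ map Suc w) = insert_zero j (word_perm w)"
proof
  fix i show "word_perm (down_word j @ map Suc w) i = insert_zero j (word_perm w) i"
    by (cases i) (auto simp: word_perm_append word_perm_down word_perm_map_Suc)
qed

lemma insert_zero_inj:
  assumes "insert_zero j \<tau> = insert_zero j' \<tau>'"
  shows "j = j'" "\<tau> = \<tau>'"
proof -
  show j: "j = j'"
    using fun_cong[OF assms, of j] fun_cong[OF assms, of j'] by (auto split: if_splits)
  show "\<tau> = \<tau>'"
  proof
    fix i show "\<tau> i = \<tau>' i"
      using fun_cong[OF assms, of i] fun_cong[OF assms, of "Suc i"] j by (auto split: if_splits)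
  qed
qed

text \<open>The inserted smallest value is inverted with exactly the \<open>j\<close> positions
  before it; all other inversions are those of \<open>\<tau>\<close> with the position
  \<open>j\<close> skipped.\<close>

lemma inversions_insert_zero:
  assumes "j \<le> m"
  shows "inversions (Suc m) (insert_zero j \<tau>) = j + inversions m \<tau>"
proof -
  let ?s = "\<lambda>i. if i < j then i else Suc i"
  have "{(a, b). a < b \<and> b < Suc m \<and> insert_zero j \<tau> b < insert_zero j \<tau> a}
      = (\<lambda>a. (a, j)) ` {..<j} \<union> (\<lambda>(a, b). (?s a, ?s b)) ` {(a, b). a < b \<and> b < m \<and> \<tau> b < \<tau> a}"
    (is "?L = ?A \<union> ?B")
  proof (intro equalityI subsetI)
    fix p assume "p \<in> ?L"
    then obtain a b where p: "p = (a, b)" "a < b" "b < Suc m" "insert_zero j \<tau> b < insert_zero j \<tau> a" by auto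
    show "p \<in> ?A \<union> ?B"
    proof (cases "b = j")
      case False
      \<comment> \<open>The positions after deletion of \<open>j\<close>.\<close>
      define a' b' where "a' = (if a < j then a else a - 1)" "b' = (if b < j then b else b - 1)"
      have "a \<noteq> j" using p(4) by auto
      then have "a = ?s a'" "b = ?s b'" "a' < b'" "b' < m" "\<tau> b' < \<tau> a'"
        using p False assms by (auto simp: a'_b'_def split: if_splits)
      then show ?thesis unfolding p(1) by (intro UnI2 image_eqI[of _ _ "(a', b')"]) auto
    qed (use p in auto)
  qed (use assms in \<open>auto split: if_splits\<close>)
  moreover have "card (?A \<union> ?B) = card ?A + card ?B"
  proof (rule card_Un_disjoint)
    have "finite {(a, b). a < b \<and> b < m \<and> \<tau> b < \<tau> a}"
      by (rule finite_subset[of _ "{..<m} \<times> {..<m}"]) auto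
    then show "finite ?B" by (rule finite_imageI)
  qed (auto split: if_splits)
  moreover have "card ?A = j" by (simp add: card_image inj_on_def)
  moreover have "card ?B = inversions m \<tau>"
    unfolding inversions_def by (rule card_image) (auto simp: inj_on_def split: if_splits)
  ultimately show ?thesis unfolding inversions_def[of "Suc m"] by simp
qed

lemma red_words_length_inversions:
  "w \<in> red_words m \<Longrightarrow> length w = inversions m (word_perm w) \<and> (\<forall>j \<in> set w. Suc j < m)"
proof (induction m arbitrary: w)
  case 0
  then show ?case by (simp add: inversions_def)
next
  case (Suc m)
  then obtain j v where w: "w = down_word j @ map Suc v" "j \<le> m" "v \<in> red_words m" by auto
  show ?case unfolding w(1) word_perm_red inversions_insert_zero[OF w(2)]
    using Suc.IH[OF w(3)] w(2) by (auto simp: down_word_def)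
qed

lemma word_perm_permutes: "(\<forall>j \<in> set w. Suc j < m) \<Longrightarrow> word_perm w permutes {..<m}"
proof (induction w)
  case (Cons j w)
  then have "Transposition.transpose j (Suc j) permutes {..<m}"
    by (intro permutes_swap_id) auto
  moreover have "word_perm w permutes {..<m}" using Cons by simp
  ultimately show ?case unfolding word_perm.simps by (rule permutes_compose)
qed (simp add: permutes_id)

lemma red_words_inj: "inj_on word_perm (red_words m)"
proof (induction m)
  case (Suc m)
  show ?case
  proof (rule inj_onI)
    fix x y assume "x \<in> red_words (Suc m)" "y \<in> red_words (Suc m)" and eq: "word_perm x = word_perm y"
    then obtain j w j' w' where xy: "x = down_word j @ map Suc w" "w \<in> red_words m"
      "y = down_word j' @ map Suc w'" "w' \<in> red_words m" by auto
    from eq have "j = j'" "word_perm w = word_perm w'"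
      unfolding xy word_perm_red by (auto dest: insert_zero_inj)
    with Suc xy show "x = y" by (auto dest: inj_onD)
  qed
qed simp

lemma red_words_param_inj: "inj_on (\<lambda>(j, w). down_word j @ map Suc w) ({..m} \<times> red_words m)"
proof (rule inj_onI, clarify)
  fix j w j' w' assume w: "w \<in> red_words m" "w' \<in> red_words m"
    and eq: "down_word j @ map Suc w = down_word j' @ map Suc w'"
  from arg_cong[OF eq, of word_perm] have "j = j'" "word_perm w = word_perm w'"
    unfolding word_perm_red by (auto dest: insert_zero_inj)
  then show "j = j' \<and> w = w'" using inj_onD[OF red_words_inj _ w] by simp
qed

lemma card_red_words: "finite (red_words m) \<and> card (red_words m) = fact m"
  by (induction m) (auto simp: card_image[OF red_words_param_inj] card_cartesian_product)

text \<open>Injectivity together with equality of the cardinalities, both \<open>fact m\<close>,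
  gives surjectivity.\<close>

lemma red_words_bij: "bij_betw word_perm (red_words m) {\<sigma>. \<sigma> permutes {..<m}}"
proof -
  have sub: "word_perm ` red_words m \<subseteq> {\<sigma>. \<sigma> permutes {..<m}}"
    using red_words_length_inversions word_perm_permutes by auto
  moreover have "card (word_perm ` red_words m) = card {\<sigma>. \<sigma> permutes {..<m}}"
    using card_red_words[of m] by (simp add: card_image[OF red_words_inj] card_permutations[of "{..<m}" m])
  ultimately have "word_perm ` red_words m = {\<sigma>. \<sigma> permutes {..<m}}"
    by (intro card_subset_eq) (auto simp: finite_permutations)
  then show ?thesis using red_words_inj by (simp add: bij_betw_def)
qed


section \<open>The antisymmetrizer\<close>

definition asum :: "nat set \<Rightarrow> (nat list \<Rightarrow> laurent) \<Rightarrow> laurent" where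
  "asum S F = (\<Sum>x \<in> permutations_of_set S. (- qpow 1) ^ inv_list x * F x)"

definition below :: "nat set \<Rightarrow> nat \<Rightarrow> nat" where
  "below S a = card {s \<in> S. s < a}"

lemma length_filter_below: "distinct x \<Longrightarrow> length (filter (\<lambda>y. y < a) x) = below (set x) a"
  by (simp add: below_def distinct_length_filter Int_def conj_commute)

lemma asum_empty [simp]: "asum {} F = F []"
  by (simp add: asum_def)

text \<open>Expansion along the first entry, as for a determinant: putting \<open>a\<close> first
  costs one inversion for each smaller element of \<open>S\<close>.\<close>

lemma asum_rec:
  assumes "finite S" "S \<noteq> {}"
  shows "asum S F = (\<Sum>a\<in>S. (- qpow 1) ^ below S a * asum (S - {a}) (\<lambda>x. F (a # x)))"
proof -
  have "asum S F = (\<Sum>a\<in>S. \<Sum>x\<in>(#) a ` permutations_of_set (S - {a}). (- qpow 1) ^ inv_list x * F x)"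
    unfolding asum_def permutations_of_set_nonempty[OF assms(2)]
    using assms(1) by (intro sum.UNION_disjoint) auto
  also have "\<dots> = (\<Sum>a\<in>S. \<Sum>x\<in>permutations_of_set (S - {a}). (- qpow 1) ^ inv_list (a # x) * F (a # x))"
    by (simp add: sum.reindex)
  also have "\<dots> = (\<Sum>a\<in>S. (- qpow 1) ^ below S a * asum (S - {a}) (\<lambda>x. F (a # x)))"
  proof (rule sum.cong[OF refl])
    fix a
    have "inv_list (a # x) = below S a + inv_list x" if "x \<in> permutations_of_set (S - {a})" for x
    proof -
      have "below (set x) a = below S a"
        using that unfolding below_def by (intro arg_cong[of _ _ card]) (auto simp: permutations_of_set_def)
      then show ?thesis using that length_filter_below[of x a] by (simp add: permutations_of_set_def)
    qed
    then show "(\<Sum>x\<in>permutations_of_set (S - {a}). (- qpow 1) ^ inv_list (a # x) * F (a # x))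
        = (- qpow 1) ^ below S a * asum (S - {a}) (\<lambda>x. F (a # x))"
      unfolding asum_def sum_distrib_left by (intro sum.cong) (simp_all add: power_add mult.assoc)
  qed
  finally show ?thesis .
qed

lemma asum_linear: "asum S (\<lambda>x. c * F x + G x) = c * asum S F + asum S G" "asum S (\<lambda>x. c * F x) = c * asum S F"
  by (simp_all add: asum_def algebra_simps sum.distrib sum_distrib_left)

text \<open>The signed sum over the coset representatives \<open>down_word j\<close>, in recursive
  form. The factor \<open>- qpow (- 1)\<close> is the product of the coefficient in the sink-source
  relation and the scalar of a positive crossing.\<close>

fun cosets :: "(nat list \<Rightarrow> laurent) \<Rightarrow> nat \<Rightarrow> nat list \<Rightarrow> laurent" where
  "cosets G y [] = G [y]"
| "cosets G y (x # xs) = G (y # x # xs) - qpow (- 1) *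
     (if y = x then qpow 1 * cosets (\<lambda>l. G (y # l)) y xs
      else cosets (\<lambda>l. G (x # l)) y xs + (if y < x then zed * cosets (\<lambda>l. G (y # l)) x xs else 0))"

lemma below_less: "finite S \<Longrightarrow> a \<in> S \<Longrightarrow> a < b \<Longrightarrow> below S a < below S b"
  unfolding below_def by (intro psubset_card_mono) (auto intro: order.strict_trans)

lemma below_bij:
  assumes "finite S"
  shows "bij_betw (below S) S {..<card S}"
proof -
  have "inj_on (below S) S"
    using below_less[OF assms] by (metis inj_onI linorder_neqE_nat nat_less_le)
  moreover have "below S ` S \<subseteq> {..<card S}"
    using assms by (auto simp: below_def intro!: psubset_card_mono)
  moreover have "card (below S ` S) = card S" using calculation(1) by (rule card_image)
  ultimately show ?thesis by (simp add: bij_betw_def card_subset_eq)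
qed

lemma sum_above:
  assumes "finite S"
  shows "(\<Sum>a\<in>S. if y < a then f (below S a) else 0) = (\<Sum>t = (if y \<in> S then Suc (below S y) else below S y)..<card S. f t)"
    (is "_ = sum f {?r..<_}")
proof -
  have iff: "y < a \<longleftrightarrow> ?r \<le> below S a" if "a \<in> S" for a
  proof
    assume ya: "y < a"
    show "?r \<le> below S a"
    proof (cases "y \<in> S")
      case False
      have "{s \<in> S. s < y} \<subseteq> {s \<in> S. s < a}" using ya by auto
      then show ?thesis using False assms by (simp add: below_def card_mono)
    qed (use below_less[OF assms _ ya] in auto)
  next
    assume r: "?r \<le> below S a"
    show "y < a"
    proof (rule ccontr)
      assume "\<not> y < a"
      then show False using below_less[OF assms that, of y] r that by (cases "a = y") (auto split: if_splits)
    qed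
  qed
  have "(\<Sum>a\<in>S. if y < a then f (below S a) else 0) = (\<Sum>a\<in>S. if ?r \<le> below S a then f (below S a) else 0)"
    using iff by (intro sum.cong) auto
  also have "\<dots> = (\<Sum>t<card S. if ?r \<le> t then f t else 0)"
    by (rule sum.reindex_bij_betw[OF below_bij[OF assms]])
  also have "\<dots> = sum f {?r..<card S}"
    by (rule sum.mono_neutral_cong_right) auto
  finally show ?thesis .
qed

lemma zed_power_sum: "r \<le> m \<Longrightarrow> qpow 1 * zed * (\<Sum>t = r..<m. qpow 1 ^ (2 * t)) = qpow 1 ^ (2 * m) - qpow 1 ^ (2 * r)"
proof (induction m rule: dec_induct)
  case (step m)
  have "qpow 1 * zed * qpow 1 ^ (2 * m) = qpow 1 ^ (2 * Suc m) - qpow 1 ^ (2 * m)"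
    by (simp add: zed_def algebra_simps)
  with step show ?case by (simp add: distrib_left)
qed simp

text \<open>One step of antisymmetrization: antisymmetrizing over \<open>S\<close> after inserting a
  further colour \<open>y\<close> by the coset sum antisymmetrizes over \<open>insert y S\<close>,
  and gives zero if \<open>y\<close> is repeated. Both sides are expanded along the first entry; the
  factor q^(2 card S) clears the negative powers, and the terms with \<open>zed\<close> telescope
  along the ranks of the elements of \<open>S\<close>.\<close>

lemma cosets_asum:
  assumes "finite S"
  shows "qpow 1 ^ (2 * card S) * asum S (cosets G y)
    = (if y \<in> S then 0 else (- qpow 1) ^ below S y * asum (insert y S) G)"
  using assms
proof (induction "card S" arbitrary: S y G)
  case 0
  then have "S = {}" by simp
  moreover have "below {y} y = 0" by (auto simp: below_def card_eq_0_iff)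
  then have "asum {y} G = G [y]" by (simp add: asum_rec)
  ultimately show ?case by (simp add: below_def)
next
  case (Suc m)
  let ?v = "qpow 1 :: laurent"
  have ne: "S \<noteq> {}" using Suc.hyps(2) by auto
  have card: "card (S - {a}) = m" "finite (S - {a})" if "a \<in> S" for a
    using that Suc.hyps(2) Suc.prems by auto
  \<comment> \<open>The left side of the induction hypothesis for \<open>S\<close> without
    \<open>a\<close>.\<close>
  define I where "I a b H = ?v ^ (2 * m) * asum (S - {a}) (cosets H b)" for a b H
  have IH: "I a b H = (if b \<in> S - {a} then 0 else (- ?v) ^ below (S - {a}) b * asum (insert b (S - {a})) H)"
    if "a \<in> S" for a b H
    using Suc.hyps(1)[OF _ card(2)[OF that], of H b] card(1)[OF that] by (simp add: I_def)
  define g where "g = asum S (\<lambda>x. G (y # x))"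
  define r where "r = below S y"
  have rm: "r \<le> card S" unfolding r_def below_def using Suc.prems by (auto intro: card_mono)
  have bel: "below (S - {a}) a = below S a" for a
    unfolding below_def by (rule arg_cong[of _ _ card]) auto
  have "?v ^ (2 * card S) * asum S (cosets G y)
    = ?v ^ (2 * card S) * g - (\<Sum>a\<in>S. (- ?v) ^ below S a * ?v *
        (if y = a then ?v * I a y (\<lambda>l. G (y # l)) else I a y (\<lambda>l. G (a # l)) + (if y < a then zed * I a a (\<lambda>l. G (y # l)) else 0)))"
  proof -
    have exp: "asum (S - {a}) (\<lambda>x. cosets G y (a # x)) = asum (S - {a}) (\<lambda>x. G (y # a # x)) - qpow (- 1) *
        (if y = a then ?v * asum (S - {a}) (cosets (\<lambda>l. G (y # l)) y)
         else asum (S - {a}) (cosets (\<lambda>l. G (a # l)) y) + (if y < a then zed * asum (S - {a}) (cosets (\<lambda>l. G (y # l)) a) else 0))" for a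
      by (simp add: asum_def algebra_simps sum.distrib sum_distrib_left sum_subtractf)
    have vv: "?v ^ (2 * card S) * (X * (qpow (- 1) * Y)) = X * ?v * (?v ^ (2 * m) * Y)" for X Y
      using Suc.hyps(2) by (simp add: Suc.hyps(2)[symmetric] algebra_simps)
    have "?v ^ (2 * card S) * asum S (cosets G y)
      = ?v ^ (2 * card S) * (\<Sum>a\<in>S. (- ?v) ^ below S a * asum (S - {a}) (\<lambda>x. G (y # a # x)))
        - (\<Sum>a\<in>S. ?v ^ (2 * card S) * ((- ?v) ^ below S a * (qpow (- 1) *
        (if y = a then ?v * asum (S - {a}) (cosets (\<lambda>l. G (y # l)) y)
         else asum (S - {a}) (cosets (\<lambda>l. G (a # l)) y) + (if y < a then zed * asum (S - {a}) (cosets (\<lambda>l. G (y # l)) a) else 0)))))"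
      unfolding asum_rec[OF Suc.prems ne, of "cosets G y"] exp
      by (simp only: right_diff_distrib sum_subtractf sum_distrib_left)
    then show ?thesis
      unfolding vv g_def asum_rec[OF Suc.prems ne, of "\<lambda>x. G (y # x)"] I_def
      by (simp add: if_distrib[of "\<lambda>x. _ * x"] algebra_simps cong: if_cong)
  qed
  also have "\<dots> = (if y \<in> S then 0 else (- qpow 1) ^ below S y * asum (insert y S) G)"
  proof (cases "y \<in> S")
    case True
    \<comment> \<open>For a repeated \<open>y\<close> the exchange terms vanish by the induction
      hypothesis. What remains, the term \<open>a = y\<close> and the elements above
      \<open>y\<close>, telescopes to the first summand and cancels it.\<close>
    have "(\<Sum>a\<in>S. (- ?v) ^ below S a * ?v *
        (if y = a then ?v * I a y (\<lambda>l. G (y # l)) else I a y (\<lambda>l. G (a # l)) + (if y < a then zed * I a a (\<lambda>l. G (y # l)) else 0)))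
      = (\<Sum>a\<in>S. (if a = y then ?v * ?v * ?v ^ (2 * r) * g else 0) + (if y < a then ?v * zed * ?v ^ (2 * below S a) * g else 0))"
    proof (rule sum.cong[OF refl])
      fix a assume a: "a \<in> S"
      have "insert a (S - {a}) = S" using a by auto
      then have "I a a (\<lambda>l. G (y # l)) = (- ?v) ^ below S a * g"
        using IH[OF a, of a] by (simp add: bel g_def)
      moreover have "I a y (\<lambda>l. G (a # l)) = 0" if "a \<noteq> y"
        using IH[OF a, of y] True that by simp
      moreover have "(- ?v) ^ k * (- ?v) ^ k = ?v ^ (2 * k)" for k
        by (simp add: power_mult power2_eq_square flip: power_mult_distrib)
      ultimately show "(- ?v) ^ below S a * ?v *
        (if y = a then ?v * I a y (\<lambda>l. G (y # l)) else I a y (\<lambda>l. G (a # l)) + (if y < a then zed * I a a (\<lambda>l. G (y # l)) else 0))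
        = (if a = y then ?v * ?v * ?v ^ (2 * r) * g else 0) + (if y < a then ?v * zed * ?v ^ (2 * below S a) * g else 0)"
        by (auto simp: r_def mult_ac)
    qed
    also have "\<dots> = ?v * ?v * ?v ^ (2 * r) * g + ?v * zed * (\<Sum>t = Suc r..<card S. ?v ^ (2 * t)) * g"
    proof -
      have "(\<Sum>a\<in>S. if y < a then ?v * zed * ?v ^ (2 * below S a) * g else 0) = ?v * zed * (\<Sum>t = Suc r..<card S. ?v ^ (2 * t)) * g"
        unfolding sum_above[OF Suc.prems, of y "\<lambda>t. ?v * zed * ?v ^ (2 * t) * g"]
        using True by (simp add: r_def sum_distrib_left sum_distrib_right mult.assoc)
      then show ?thesis using True Suc.prems by (simp add: sum.distrib)
    qed
    also have "\<dots> = ?v ^ (2 * card S) * g"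
    proof -
      have "r < card S" unfolding r_def below_def using True Suc.prems by (intro psubset_card_mono) auto
      then show ?thesis by (subst zed_power_sum) (auto simp: algebra_simps)
    qed
    finally show ?thesis using True by simp
  next
    case False
    have "(\<Sum>a\<in>S. (- ?v) ^ below S a * ?v *
        (if y = a then ?v * I a y (\<lambda>l. G (y # l)) else I a y (\<lambda>l. G (a # l)) + (if y < a then zed * I a a (\<lambda>l. G (y # l)) else 0)))
      = (\<Sum>a\<in>S. (if y < a then ?v * zed * ?v ^ (2 * below S a) * g else 0)
          - (- ?v) ^ r * ((- ?v) ^ below (insert y S) a * asum (insert y S - {a}) (\<lambda>l. G (a # l))))"
    proof (rule sum.cong[OF refl])
      fix a assume a: "a \<in> S"
      then have ya: "y \<noteq> a" using False by auto
      have "insert a (S - {a}) = S" using a by auto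
      then have 1: "I a a (\<lambda>l. G (y # l)) = (- ?v) ^ below S a * g"
        using IH[OF a, of a] by (simp add: bel g_def)
      have "insert y (S - {a}) = insert y S - {a}" using ya by auto
      then have 2: "I a y (\<lambda>l. G (a # l)) = (- ?v) ^ below (S - {a}) y * asum (insert y S - {a}) (\<lambda>l. G (a # l))"
        using IH[OF a, of y] False by simp
      \<comment> \<open>Removing \<open>a\<close> before \<open>y\<close> or \<open>y\<close> before
        \<open>a\<close> compares the same pairs, except that the pair of \<open>a\<close> and
        \<open>y\<close> itself is counted on the right only.\<close>
      have 3: "below S a + Suc (below (S - {a}) y) = r + below (insert y S) a"
      proof (cases "a < y")
        case True
        have "{s \<in> S. s < y} = insert a {s \<in> S - {a}. s < y}" using True a by auto
        then have "r = Suc (below (S - {a}) y)" unfolding r_def below_def using Suc.prems by simp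
        moreover have "{s \<in> insert y S. s < a} = {s \<in> S. s < a}" using True by auto
        ultimately show ?thesis by (simp add: below_def)
      next
        case ay: False
        then have ay: "y < a" using ya by simp
        have "{s \<in> insert y S. s < a} = insert y {s \<in> S. s < a}" using ay by auto
        then have "below (insert y S) a = Suc (below S a)" unfolding below_def using False Suc.prems by simp
        moreover have "{s \<in> S - {a}. s < y} = {s \<in> S. s < y}" using ay by auto
        ultimately show ?thesis by (simp add: below_def r_def)
      qed
      have sq: "(- ?v) ^ k * (- ?v) ^ k = ?v ^ (2 * k)" for k
        by (simp add: power_mult power2_eq_square flip: power_mult_distrib)
      have "(- ?v) ^ below S a * ?v * ((- ?v) ^ below (S - {a}) y * X) = - ((- ?v) ^ (below S a + Suc (below (S - {a}) y)) * X)" for X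
        by (simp add: power_add algebra_simps)
      then have 4: "(- ?v) ^ below S a * ?v * I a y (\<lambda>l. G (a # l))
          = - ((- ?v) ^ r * ((- ?v) ^ below (insert y S) a * asum (insert y S - {a}) (\<lambda>l. G (a # l))))"
        unfolding 2 3 by (simp add: power_add mult.assoc)
      have 5: "(- ?v) ^ below S a * ?v * (zed * I a a (\<lambda>l. G (y # l))) = ?v * zed * ?v ^ (2 * below S a) * g"
        unfolding 1 sq[symmetric] by (simp add: mult_ac)
      show "(- ?v) ^ below S a * ?v *
        (if y = a then ?v * I a y (\<lambda>l. G (y # l)) else I a y (\<lambda>l. G (a # l)) + (if y < a then zed * I a a (\<lambda>l. G (y # l)) else 0))
        = (if y < a then ?v * zed * ?v ^ (2 * below S a) * g else 0)
          - (- ?v) ^ r * ((- ?v) ^ below (insert y S) a * asum (insert y S - {a}) (\<lambda>l. G (a # l)))"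
        using ya 4 5 by (simp add: distrib_left)
    qed
    also have "\<dots> = ?v * zed * (\<Sum>t = r..<card S. ?v ^ (2 * t)) * g
        - (- ?v) ^ r * (\<Sum>a\<in>S. (- ?v) ^ below (insert y S) a * asum (insert y S - {a}) (\<lambda>l. G (a # l)))"
    proof -
      have "(\<Sum>a\<in>S. if y < a then ?v * zed * ?v ^ (2 * below S a) * g else 0) = ?v * zed * (\<Sum>t = r..<card S. ?v ^ (2 * t)) * g"
        unfolding sum_above[OF Suc.prems, of y "\<lambda>t. ?v * zed * ?v ^ (2 * t) * g"]
        using False by (simp add: r_def sum_distrib_left sum_distrib_right mult.assoc)
      then show ?thesis by (simp add: sum_subtractf sum_distrib_left)
    qed
    also have "\<dots> = ?v ^ (2 * card S) * g - (- ?v) ^ r * asum (insert y S) G"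
    proof -
      have "below (insert y S) y = r"
        unfolding below_def r_def by (rule arg_cong[of _ _ card]) auto
      moreover have "insert y S - {y} = S" using False by auto
      moreover have "(- ?v) ^ r * (- ?v) ^ r = ?v ^ (2 * r)"
        by (simp add: power_mult power2_eq_square flip: power_mult_distrib)
      ultimately have "(- ?v) ^ r * asum (insert y S) G = ?v ^ (2 * r) * g
          + (- ?v) ^ r * (\<Sum>a\<in>S. (- ?v) ^ below (insert y S) a * asum (insert y S - {a}) (\<lambda>l. G (a # l)))"
        using False Suc.prems by (subst asum_rec) (simp_all add: g_def distrib_left flip: mult.assoc)
      then show ?thesis unfolding zed_power_sum[OF rm] by (simp add: algebra_simps)
    qed
    finally show ?thesis using False by (simp add: r_def)
  qed
  finally show ?case .
qed

lemma qpow_power: "qpow r ^ k = qpow (of_nat k * r)"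
  by (induction k) (simp_all add: qpow_mult algebra_simps)

lemma positive_braid_simps:
  "positive_braid i (u @ v) = positive_braid i u @ positive_braid i v"
  "positive_braid (Suc 0) w = shift 1 (positive_braid 0 w)" "positive_braid 0 (map Suc w) = shift 1 (positive_braid 0 w)"
  "positive_braid i w = shift i (positive_braid 0 w)"
  by (auto simp: positive_braid_def shift_def)

lemma dword_positive_braid: "(\<forall>j \<in> set w. Suc j < m) \<Longrightarrow> dword m (positive_braid 0 w)"
  by (force simp: dword_def positive_braid_def)

lemma typed_positive_braid:
  "(\<forall>j \<in> set w. Suc j < m) \<Longrightarrow> typed (web_io n) (replicate m Down) (positive_braid 0 w) (replicate m Down)"
  using typed_dword[OF dword_positive_braid, of w m n "[]"] by simp

lemma acts_braid_Cons:
  assumes "\<forall>j \<in> set w. Suc j < length ys" "set ys \<subseteq> {1..n}"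
  shows "acts n (shift 1 (positive_braid 0 w)) G (a # ys) = acts n (positive_braid 0 w) (\<lambda>l. G (a # l)) ys"
  using acts_shift[OF typed_positive_braid[OF assms(1)], of ys "[a]" 1 n G "[]"] assms(2) by simp

lemma par_sum:
  "(\<Sum>j\<in>J. c j * par n b lt (F j) x y) = par n b lt (\<lambda>l. \<Sum>j\<in>J. c j * F j l) x y"
  by (simp add: par_def sum_distrib_left algebra_simps sum.distrib sum_negf)

lemma down_word_cosets:
  assumes n: "n > 0"
  defines "c \<equiv> - qpow ((1 - of_nat n) / of_nat n)"
  shows "set (y # xs) \<subseteq> {1..n} \<Longrightarrow>
    (\<Sum>j\<le>length xs. c ^ j * acts n (positive_braid 0 (down_word j)) G (y # xs)) = cosets G y xs"
proof (induction xs arbitrary: y G)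
  case Nil
  show ?case by (simp add: down_word_def positive_braid_def)
next
  case (Cons x xs)
  have ds: "down_word (Suc j) = map Suc (down_word j) @ [0]" for j
    by (simp add: down_word_def map_Suc_upt[symmetric] rev_map upt_conv_Cons del: upt_Suc map_Suc_upt)
  let ?H = "\<lambda>j l. acts n (shift 1 (positive_braid 0 (down_word j))) G (l @ xs)"
  have H: "(\<Sum>j\<le>length xs. c ^ j * ?H j [a, b]) = cosets (\<lambda>l. G (a # l)) b xs"
    if "a \<in> {1..n}" "b \<in> {1..n}" for a b
  proof -
    have "?H j [a, b] = acts n (positive_braid 0 (down_word j)) (\<lambda>l. G (a # l)) (b # xs)" if "j \<le> length xs" for j
      using acts_braid_Cons[of "down_word j" "b # xs" n G a] that \<open>b \<in> {1..n}\<close> Cons.prems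
      by (auto simp: down_word_def)
    then show ?thesis using Cons.IH[of b "\<lambda>l. G (a # l)"] that Cons.prems by simp
  qed
  have DS: "acts n (positive_braid 0 (down_word (Suc j))) G (y # x # xs) = par n False (<) (?H j) y x" for j
    unfolding ds positive_braid_simps(1,3) acts_append
    by (simp add: positive_braid_def)
  have "(\<Sum>j\<le>length (x # xs). c ^ j * acts n (positive_braid 0 (down_word j)) G (y # x # xs))
      = acts n (positive_braid 0 (down_word 0)) G (y # x # xs)
      + (\<Sum>j\<le>length xs. c ^ Suc j * acts n (positive_braid 0 (down_word (Suc j))) G (y # x # xs))"
    by (simp only: list.size sum.atMost_Suc_shift power_0 mult_1 add_Suc_right add_0_right)
  also have "acts n (positive_braid 0 (down_word 0)) G (y # x # xs) = G (y # x # xs)"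
    by (simp add: down_word_def positive_braid_def)
  also have "(\<Sum>j\<le>length xs. c ^ Suc j * acts n (positive_braid 0 (down_word (Suc j))) G (y # x # xs))
      = c * par n False (<) (\<lambda>l. \<Sum>j\<le>length xs. c ^ j * ?H j l) y x"
    unfolding DS par_sum[symmetric] by (simp add: sum_distrib_left mult.assoc)
  also have "\<dots> = - qpow (- 1) * (if y = x then qpow 1 * cosets (\<lambda>l. G (y # l)) y xs
      else cosets (\<lambda>l. G (x # l)) y xs + (if y < x then zed * cosets (\<lambda>l. G (y # l)) x xs else 0))"
  proof -
    \<comment> \<open>The fractional exponents cancel: (1 - n)/n - 1/n = -1.\<close>
    have "c * qpow (- 1 / of_nat n) = - qpow (- 1)"
      using n by (simp add: c_def qpow_mult diff_divide_distrib)
    then have cc: "c * (qpow (- 1 / of_nat n) * X) = - qpow (- 1) * X" for X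
      by (simp flip: mult.assoc)
    have "x \<in> {1..n}" "y \<in> {1..n}" using Cons.prems by auto
    then show ?thesis unfolding par_def if_False cc using H by simp
  qed
  finally show ?case by simp
qed

lemma sum_red_words_Suc:
  "(\<Sum>w\<in>red_words (Suc m). f w) = (\<Sum>w\<in>red_words m. \<Sum>j\<le>m. f (down_word j @ map Suc w))"
proof -
  have "(\<Sum>w\<in>red_words (Suc m). f w) = (\<Sum>(j, w)\<in>{..m} \<times> red_words m. f (down_word j @ map Suc w))"
    unfolding red_words.simps sum.reindex[OF red_words_param_inj] by (simp add: case_prod_beta)
  then show ?thesis by (simp add: sum.cartesian_product[symmetric] sum.swap[of _ "{..m}"])
qed

text \<open>Summing over the coset representatives of \<open>red_words (Suc m)\<close> reduces to
  \<open>m\<close> strands with \<open>cosets G y\<close> in place of \<open>G\<close>; then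
  \<open>cosets_asum\<close> adds the first colour.\<close>

lemma antisymmetrizer:
  assumes n: "n > 0"
  defines "c \<equiv> - qpow ((1 - of_nat n) / of_nat n)"
  shows "length ys = m \<Longrightarrow> set ys \<subseteq> {1..n} \<Longrightarrow>
    qpow 1 ^ (m * (m - 1)) * (\<Sum>w\<in>red_words m. c ^ length w * acts n (positive_braid 0 w) G ys)
    = (if distinct ys then (- qpow 1) ^ inv_list ys * asum (set ys) G else 0)"
proof (induction m arbitrary: ys G)
  case 0
  then show ?case by (simp add: positive_braid_def)
next
  case (Suc m)
  then obtain y zs where ys: "ys = y # zs" "length zs = m" by (cases ys) auto
  have zs: "set zs \<subseteq> {1..n}" using Suc.prems ys by simp
  have rw: "\<forall>j \<in> set w. Suc j < m" if "w \<in> red_words m" for w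
    using red_words_length_inversions[OF that] by simp
  have "(\<Sum>w\<in>red_words (Suc m). c ^ length w * acts n (positive_braid 0 w) G ys)
      = (\<Sum>w\<in>red_words m. c ^ length w * (\<Sum>j\<le>m. c ^ j *
          acts n (positive_braid 0 w) (\<lambda>l. acts n (positive_braid 0 (down_word j)) G (y # l)) zs))"
    unfolding sum_red_words_Suc sum_distrib_left
  proof (intro sum.cong refl)
    fix w j assume "w \<in> red_words m"
    then show "c ^ length (down_word j @ map Suc w) * acts n (positive_braid 0 (down_word j @ map Suc w)) G ys
      = c ^ length w * (c ^ j * acts n (positive_braid 0 w) (\<lambda>l. acts n (positive_braid 0 (down_word j)) G (y # l)) zs)"
      using acts_braid_Cons[of w zs n] rw zs ys
      by (simp add: positive_braid_simps(1,3) acts_append power_add down_word_def mult_ac)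
  qed
  also have "\<dots> = (\<Sum>w\<in>red_words m. c ^ length w * acts n (positive_braid 0 w) (cosets G y) zs)"
  proof (intro sum.cong refl arg_cong2[where f = "(*)"])
    fix w assume w: "w \<in> red_words m"
    have "acts n (positive_braid 0 w) (\<lambda>l. \<Sum>j\<le>m. c ^ j * acts n (positive_braid 0 (down_word j)) G (y # l)) zs
        = acts n (positive_braid 0 w) (cosets G y) zs"
    proof (rule acts_cong[OF typed_positive_braid[OF rw[OF w]]])
      fix l :: "nat list" assume "length l = length (replicate m Down)" "set l \<subseteq> {1..n}"
      then show "(\<Sum>j\<le>m. c ^ j * acts n (positive_braid 0 (down_word j)) G (y # l)) = cosets G y l"
        using down_word_cosets[OF n, of y l G] Suc.prems ys by (simp add: c_def)
    qed (use ys zs in auto)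
    then show "(\<Sum>j\<le>m. c ^ j * acts n (positive_braid 0 w) (\<lambda>l. acts n (positive_braid 0 (down_word j)) G (y # l)) zs)
        = acts n (positive_braid 0 w) (cosets G y) zs"
      by (simp only: acts_sum)
  qed
  finally have eq: "(\<Sum>w\<in>red_words (Suc m). c ^ length w * acts n (positive_braid 0 w) G ys)
      = (\<Sum>w\<in>red_words m. c ^ length w * acts n (positive_braid 0 w) (cosets G y) zs)" .
  \<comment> \<open>The prefactor is the product of the factors q^(2m) consumed by the successive
    coset steps.\<close>
  have "Suc m * (Suc m - 1) = 2 * m + m * (m - 1)"
    by (cases m) (auto simp: algebra_simps)
  then have "qpow 1 ^ (Suc m * (Suc m - 1)) * (\<Sum>w\<in>red_words (Suc m). c ^ length w * acts n (positive_braid 0 w) G ys)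
      = qpow 1 ^ (2 * m) * (qpow 1 ^ (m * (m - 1)) * (\<Sum>w\<in>red_words m. c ^ length w * acts n (positive_braid 0 w) (cosets G y) zs))"
    by (simp only: eq power_add mult.assoc)
  also have "\<dots> = (if distinct zs then (- qpow 1) ^ inv_list zs * (qpow 1 ^ (2 * m) * asum (set zs) (cosets G y)) else 0)"
    unfolding Suc.IH[OF ys(2) zs] by (simp add: mult_ac)
  also have "\<dots> = (if distinct ys then (- qpow 1) ^ inv_list ys * asum (set ys) G else 0)"
  proof (cases "distinct zs")
    case True
    then have "card (set zs) = m" using ys(2) distinct_card by metis
    with True show ?thesis
      using cosets_asum[of "set zs" G y] length_filter_below[OF True, of y]
      by (simp add: ys(1) power_add)
  qed (simp add: ys(1))
  finally show ?case .
qed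

lemma set_full_iff: "length ys = n \<Longrightarrow> set ys \<subseteq> {1..n} \<Longrightarrow> distinct ys \<longleftrightarrow> set ys = {1..n}"
  by (metis card_atLeastAtMost card_distinct card_subset_eq diff_Suc_1 distinct_card finite_atLeastAtMost)

lemma sink_sum: "(\<Sum>xs \<in> cols n n. anti n xs * G xs) = asum {1..n} G"
  unfolding asum_def
proof (rule sum.mono_neutral_cong_right)
  show "permutations_of_set {1..n} \<subseteq> cols n n"
    by (auto simp: permutations_of_set_def cols_def distinct_card[symmetric])
  show "\<forall>xs\<in>cols n n - permutations_of_set {1..n}. anti n xs * G xs = 0"
    using set_full_iff by (auto simp: permutations_of_set_def cols_def anti_def)
qed (auto simp: permutations_of_set_def anti_def)

text \<open>A sequence of \<open>n\<close> distinct colours uses all of them, so on \<open>n\<close>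
  strands the antisymmetrizer has rank one and factors into the tensors of a sink and a
  source.\<close>

lemma sink_source_acts:
  assumes "n > 0" "length ys = n" "set ys \<subseteq> {1..n}"
  shows "qpow (of_nat n * (of_nat n - 1)) * (\<Sum>w\<in>red_words n.
      (- qpow ((1 - of_nat n) / of_nat n)) ^ length w * acts n (positive_braid 0 w) G ys)
    = acts n [(0, Sink), (0, Source)] G ys"
proof -
  have "qpow (of_nat n * (of_nat n - 1)) = qpow 1 ^ (n * (n - 1))"
    using assms(1) by (simp add: qpow_power of_nat_diff)
  moreover have "acts n [(0, Sink), (0, Source)] G ys = anti n ys * asum {1..n} G"
    using assms(2) by (simp add: sink_sum)
  ultimately show ?thesis
    using antisymmetrizer[OF assms(1-3), of G] set_full_iff[OF assms(2,3)]
    by (simp add: anti_def)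
qed

section \<open>The bracket of planar webs as a state sum\<close>

inductive planar :: "web_piece diagram \<Rightarrow> bool" where
  Nil: "planar []"
| Cap: "planar D \<Longrightarrow> planar (D @ [(i, Cap d)])"
| Cup: "planar D \<Longrightarrow> planar (D @ [(i, Cup d)])"
| Cross: "planar D \<Longrightarrow> planar (D @ [(i, Cross b Down Down)])"
| Discs: "planar D \<Longrightarrow> planar (D @ [(i, Sink), (i, Source)])"

context web_invariant begin

lemma sink_source_ev:
  assumes n: "n > 0" and u: "ty [] u w" and t: "ty w [(i, Sink), (i, Source)] w'"
  shows "w' = w" "\<And>v. v \<in> red_words n \<Longrightarrow> ty w (positive_braid i v) w"
    "ev n br (u @ [(i, Sink), (i, Source)]) x = qpow (of_nat n * (of_nat n - 1)) *
      (\<Sum>v\<in>red_words n. (- qpow ((1 - of_nat n) / of_nat n)) ^ length v * ev n br (u @ positive_braid i v) x)"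
proof -
  have "ty w ([(i, Sink)] @ [(i, Source)]) w'" using t by (simp only: append.simps)
  then obtain w1 where w1: "ty w [(i, Sink)] w1" "ty w1 [(i, Source)] w'" unfolding typed_append by blast
  obtain p s where 1: "w = p @ replicate n Down @ s" "w1 = p @ s" "i = length p"
    using w1(1) unfolding typed_layer by auto
  obtain p' s' where 2: "w1 = p' @ s'" "w' = p' @ replicate n Down @ s'" "i = length p'"
    using w1(2) unfolding typed_layer by auto
  have "p' = p" "s' = s" using 1 2 by (metis append_eq_append_conv)+
  with 1 2 have ps: "w = p @ replicate n Down @ s" "w' = p @ replicate n Down @ s" "i = length p"
    by simp_all
  then show w': "w' = w" by simp
  show tb: "ty w (positive_braid i v) w" if "v \<in> red_words n" for v
    using typed_shift[OF typed_positive_braid, of v n n p s] red_words_length_inversions[OF that]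
    unfolding positive_braid_simps(4)[of i] by (simp add: ps)
  have tl: "ty [] (u @ [(i, Sink), (i, Source)]) w"
    using u t unfolding typed_append w' by blast
  have tr: "ty [] (u @ positive_braid i v) w" if "v \<in> red_words n" for v
    using u tb[OF that] unfolding typed_append by blast
  show "ev n br (u @ [(i, Sink), (i, Source)]) x = qpow (of_nat n * (of_nat n - 1)) *
      (\<Sum>v\<in>red_words n. (- qpow ((1 - of_nat n) / of_nat n)) ^ length v * ev n br (u @ positive_braid i v) x)"
  proof (cases x)
    case (Inl z)
    \<comment> \<open>The axiom asks for a word for every permutation; inverting the bijection
      selects the one in \<open>red_words n\<close>.\<close>
    define B where "B = inv_into (red_words n) word_perm"
    have wr: "is_web n (u @ positive_braid i v @ z) \<longleftrightarrow> ty w z []" if "v \<in> red_words n" for v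
      using tr[OF that] unfolding is_web_typed append_assoc[symmetric] typed_append[of _ _ "u @ _" z]
      by (blast dest: typed_unique)
    have wl: "is_web n (u @ [(i, Sink), (i, Source)] @ z) \<longleftrightarrow> ty w z []"
      using tl unfolding is_web_typed append_assoc[symmetric] typed_append[of _ _ "u @ _" z]
      by (blast dest: typed_unique)
    show ?thesis
    proof (cases "ty w z []")
      case True
      have Bw: "B (word_perm v) = v" if "v \<in> red_words n" for v
        unfolding B_def by (rule inv_into_f_f[OF red_words_inj that])
      have BR: "positive_word n \<sigma> (B \<sigma>)" if "\<sigma> permutes {..<n}" for \<sigma>
      proof -
        have "\<sigma> \<in> word_perm ` red_words n"
          unfolding bij_betw_imp_surj_on[OF red_words_bij] using that by simp
        then obtain v where v: "v \<in> red_words n" "\<sigma> = word_perm v" by (elim imageE)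
        then show ?thesis using red_words_length_inversions[OF v(1)] by (simp add: Bw positive_word_def)
      qed
      have "is_web n (u @ [(i, Sink), (i, Source)] @ z)" using wl True by simp
      then have "br (u @ [(i, Sink), (i, Source)] @ z) = qpow (of_nat n * (of_nat n - 1)) *
          (\<Sum>\<sigma> | \<sigma> permutes {..<n}. (- qpow ((1 - of_nat n) / of_nat n)) ^ inversions n \<sigma>
             * br (u @ positive_braid i (B \<sigma>) @ z))"
        using wb BR unfolding web_bracket_def by blast
      also have "(\<Sum>\<sigma> | \<sigma> permutes {..<n}. (- qpow ((1 - of_nat n) / of_nat n)) ^ inversions n \<sigma>
             * br (u @ positive_braid i (B \<sigma>) @ z))
          = (\<Sum>v\<in>red_words n. (- qpow ((1 - of_nat n) / of_nat n)) ^ inversions n (word_perm v)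
             * br (u @ positive_braid i (B (word_perm v)) @ z))"
        by (rule sum.reindex_bij_betw[OF red_words_bij, symmetric])
      also have "\<dots> = (\<Sum>v\<in>red_words n. (- qpow ((1 - of_nat n) / of_nat n)) ^ length v
             * br (u @ positive_braid i v @ z))"
        using red_words_length_inversions by (intro sum.cong) (auto simp: Bw)
      finally show ?thesis using True wl wr by (simp add: Inl ev_def)
    next
      case False
      then show ?thesis using wl wr by (simp add: Inl ev_def)
    qed
  next
    case (Inr Ys)
    show ?thesis
    proof (cases "length Ys = length w \<and> set Ys \<subseteq> {1..n}")
      case True
      define py ys sy where "py = take i Ys" "ys = take n (drop i Ys)" "sy = drop n (drop i Ys)"
      have Ys: "Ys = py @ ys @ sy" unfolding py_ys_sy_def append_take_drop_id ..
      have len: "length py = i" "length ys = n" using True by (auto simp: py_ys_sy_def ps)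
      have sub: "set ys \<subseteq> {1..n}" using True Ys by auto
      let ?F = "\<lambda>zs. acts n u delta_nil (py @ zs @ sy)"
      have 1: "acts n (positive_braid i v) (acts n u delta_nil) Ys = acts n (positive_braid 0 v) ?F ys" if "v \<in> red_words n" for v
        unfolding positive_braid_simps(4)[of i] Ys
        by (rule acts_shift[OF typed_positive_braid _ len(1) sub])
          (use red_words_length_inversions[OF that] len in auto)
      have "ty (replicate n Down) [(0, Sink), (0, Source)] (replicate n Down)" by simp
      from acts_shift[OF this _ len(1) sub, of "acts n u delta_nil" sy]
      have 2: "acts n [(i, Sink), (i, Source)] (acts n u delta_nil) Ys = acts n [(0, Sink), (0, Source)] ?F ys"
        using len unfolding Ys by (simp del: acts.simps)
      show ?thesis
        unfolding Inr ev_def sum.case using True 1 2 sink_source_acts[OF n len(2) sub, of ?F]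
        by (simp add: typed_foldl_eq[OF tl] typed_foldl_eq[OF tr] acts_append del: acts.simps foldl_append cong: sum.cong)
    next
      case False
      have "ev n br z (Inr Ys) = 0" if "ty [] z w" for z
        using False typed_foldl_eq[OF that] by (auto simp: ev_def)
      then show ?thesis using tl tr by (simp add: Inr)
    qed
  qed
qed

lemma planar_span:
  assumes n: "n > 0"
  shows "planar D \<Longrightarrow> ty [] D w \<Longrightarrow> ev n br D \<in> lspan (ev n br ` standard n w)"
proof (induction arbitrary: w rule: planar.induct)
  case Nil
  then have "[] \<in> standard n w"
    by (auto simp: standard_def sorted_dirs_def intro!: exI[of _ 0])
  then show ?case by (intro lspan_base) auto
next
  case (Cap D i d)
  then obtain v where v: "ty [] D v" "ty v [(i, Cap d)] w" by (auto simp: typed_append)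
  show ?case
    by (rule span_append[OF Cap.IH[OF v(1)] _ v]) (use standard_typed standard_cap[OF _ v(2)] in auto)
next
  case (Cup D i d)
  then obtain v where v: "ty [] D v" "ty v [(i, Cup d)] w" by (auto simp: typed_append)
  show ?case
    by (rule span_append[OF Cup.IH[OF v(1)] _ v]) (use standard_typed standard_cup[OF _ v(2)] in auto)
next
  case (Cross D i b)
  then obtain v where v: "ty [] D v" "ty v [(i, DD b)] w" by (auto simp: typed_append)
  show ?case
  proof (rule span_append[OF Cross.IH[OF v(1)] _ v])
    fix a assume a: "a \<in> standard n v"
    show "ty [] a v" by (rule standard_typed[OF a])
    obtain m \<theta> where "a = caps 0 Down m @ \<theta>" "xword \<theta>" "ty (sorted_dirs m m) \<theta> v"
      using a by (auto simp: standard_def)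
    then have "a @ [(i, DD b)] \<in> standard n w"
      using v(2) unfolding standard_def typed_append
      by (intro CollectI exI[of _ m] exI[of _ "\<theta> @ [(i, DD b)]"]) (auto simp: typed_append simp del: typed.simps(2))
    then show "ev n br (a @ [(i, DD b)]) \<in> lspan (ev n br ` standard n w)" by (intro lspan_base) auto
  qed
next
  case (Discs D i)
  then obtain v where v: "ty [] D v" "ty v [(i, Sink), (i, Source)] w" unfolding typed_append by blast
  show ?case
  proof (rule span_append[OF Discs.IH[OF v(1)] _ v])
    fix a assume a: "a \<in> standard n v"
    show ta: "ty [] a v" by (rule standard_typed[OF a])
    note ss = sink_source_ev[OF n ta v(2)]
    obtain m \<theta> where th: "a = caps 0 Down m @ \<theta>" "xword \<theta>" "ty (sorted_dirs m m) \<theta> v"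
      using a by (auto simp: standard_def)
    have st: "a @ positive_braid i u \<in> standard n w" if "u \<in> red_words n" for u
    proof -
      have "xword (positive_braid i u)" by (auto simp: positive_braid_def xword_def list_all_iff)
      moreover have "ty (sorted_dirs m m) (\<theta> @ positive_braid i u) w"
        using th(3) ss(1) ss(2)[OF that] unfolding typed_append by blast
      ultimately show ?thesis
        unfolding standard_def th(1) using th(2)
        by (intro CollectI exI[of _ m] exI[of _ "\<theta> @ positive_braid i u"]) simp
    qed
    have "ev n br (a @ [(i, Sink), (i, Source)]) = (\<lambda>x. qpow (of_nat n * (of_nat n - 1)) *
      (\<Sum>u\<in>red_words n. (- qpow ((1 - of_nat n) / of_nat n)) ^ length u * ev n br (a @ positive_braid i u) x))"
      using ss(3) by auto
    also have "\<dots> \<in> lspan (ev n br ` standard n w)"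
      using st by (intro lspan_scale lspan_sum lspan_base) auto
    finally show "ev n br (a @ [(i, Sink), (i, Source)]) \<in> lspan (ev n br ` standard n w)" .
  qed
qed

text \<open>Without strands at the bottom the evaluation of \<open>D\<close> is a multiple of that
  of the empty diagram. The closure \<open>Inl []\<close> reads the multiple off the bracket and the
  colouring \<open>Inr []\<close> off the state sum.\<close>

theorem planar_bracket:
  assumes "n > 0" "planar D" "is_web n D"
  shows "br D = acts n D delta_nil []"
proof -
  have t: "ty [] D []" using assms(3) by (simp add: is_web_typed)
  \<comment> \<open>Crossings preserve the number of strands, so an empty lower boundary leaves no
    maxima and no crossings.\<close>
  have st: "standard n [] = {[]}"
  proof (intro equalityI subsetI)
    fix u assume "u \<in> standard n []"
    then obtain m \<theta> where u: "u = caps 0 Down m @ \<theta>" "xword \<theta>" "ty (sorted_dirs m m) \<theta> []"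
      by (auto simp: standard_def)
    have "count_list (sorted_dirs m m) Down = 0" by (simp flip: xword_count[OF u(2,3)])
    then have "m = 0" by (cases m) (auto simp: sorted_dirs_def)
    moreover have "\<theta> = []"
      using u(2,3) \<open>m = 0\<close> by (cases \<theta> rule: list.exhaust; cases "hd \<theta>" rule: good.cases) (auto simp: sorted_dirs_def)
    ultimately show "u \<in> {[]}" using u(1) by simp
  qed (auto simp: standard_def sorted_dirs_def intro!: exI[of _ 0])
  have "\<exists>c. \<forall>x. f x = c * ev n br [] x" if "f \<in> lspan {ev n br []}" for f
    using that
  proof (induction f rule: lspan.induct)
    case zero
    show ?case by (intro exI[of _ 0]) simp
  next
    case (step f g c)
    then obtain c' where "\<forall>x. g x = c' * ev n br [] x" by auto
    then show ?case using step by (intro exI[of _ "c + c'"]) (simp add: distrib_right)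
  qed
  then obtain c where c: "ev n br D x = c * ev n br [] x" for x
    using planar_span[OF assms(1,2) t] by (auto simp: st)
  have nil: "is_web n []" by (simp add: is_web_typed)
  have "br [] = 1" using wb by (simp add: web_bracket_def)
  then have "br D = c" using c[of "Inl []"] assms(3) nil by (simp add: ev_def)
  moreover have "acts n D delta_nil [] = c"
    using c[of "Inr []"] typed_foldl_eq[OF t] by (simp add: ev_def delta_nil_def)
  ultimately show ?thesis by simp
qed

end

section \<open>State sums of the webs of vertices\<close>

lemma cups_0 [simp]: "cups i d 0 = []"
  by (simp add: cups_def)

lemma cups_Suc: "cups i d (Suc k) = (i + k, Cup d) # cups i d k"
  by (simp add: cups_def)

lemma cups_shift: "cups i d k = shift i (cups 0 d k)"
  by (simp add: cups_def shift_def)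

lemma typed_cups: "typed (web_io n) (replicate k d @ replicate k (opp d)) (cups 0 d k) []"
proof (induction k)
  case (Suc k)
  have "typed (web_io n) (replicate (Suc k) d @ replicate (Suc k) (opp d)) [(k, Cup d)]
      (replicate k d @ replicate k (opp d))"
    unfolding typed_layer
    by (intro exI[of _ "replicate k d"] exI[of _ "replicate k (opp d)"]) (simp add: replicate_app_Cons_same)
  with Suc show ?case
    unfolding cups_Suc using typed_append[of "web_io n" _ "[(0 + k, Cup d)]" "cups 0 d k"] by auto
qed simp

lemma typed_vertex_web:
  assumes "s \<le> n"
  shows "typed (web_io n) (replicate s Down) (vertex_web n 0 s) (replicate s Down)"
proof -
  let ?D = "\<lambda>k. replicate k Down" and ?U = "replicate (n - s) Up"
  have n: "?D s @ ?D (n - s) = ?D n" using assms by (simp flip: replicate_add)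
  have "typed (web_io n) (?D s) (caps s Down (n - s)) (?D n @ ?U)"
    using typed_shift[OF typed_caps[of n Down "n - s"], of "?D s" "[]"] by (simp add: caps_shift[symmetric] n flip: append_assoc)
  moreover have "typed (web_io n) (?D n @ ?U) [(0, Sink), (0, Source)] (?D n @ ?U)"
    by simp
  moreover have "typed (web_io n) (?D n @ ?U) (cups s Down (n - s)) (?D s)"
    using typed_shift[OF typed_cups[of n "n - s" Down], of "?D s" "[]"] by (simp add: cups_shift[symmetric] n flip: append_assoc)
  ultimately show ?thesis unfolding vertex_web_def typed_append by auto
qed

definition cap_wt :: "nat \<Rightarrow> dir \<Rightarrow> nat list \<Rightarrow> laurent" where
  "cap_wt n d x = (if d = Down then qpow (\<Sum>c\<leftarrow>x. height n c) else 1)"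

definition cup_wt :: "nat \<Rightarrow> dir \<Rightarrow> nat list \<Rightarrow> laurent" where
  "cup_wt n d x = (if d = Up then qpow (- (\<Sum>c\<leftarrow>x. height n c)) else 1)"

lemma cols_Suc: "cols n (Suc k) = (\<lambda>(x, a). x @ [a]) ` (cols n k \<times> {1..n})"
proof (intro equalityI subsetI)
  fix y assume y: "y \<in> cols n (Suc k)"
  then obtain x a where "y = x @ [a]" by (cases y rule: rev_cases) (auto simp: cols_def)
  with y show "y \<in> (\<lambda>(x, a). x @ [a]) ` (cols n k \<times> {1..n})"
    by (intro image_eqI[of _ _ "(x, a)"]) (auto simp: cols_def)
qed (auto simp: cols_def)

lemma sum_cols_Suc: "(\<Sum>y\<in>cols n (Suc k). f y) = (\<Sum>x\<in>cols n k. \<Sum>a = 1..n. f (x @ [a]))"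
  unfolding cols_Suc by (subst sum.reindex) (auto simp: inj_on_def sum.cartesian_product case_prod_beta)

text \<open>The right legs of nested maxima occur in the reverse order of the left legs.\<close>

lemma acts_caps:
  "length y1 = k \<Longrightarrow> length y2 = k \<Longrightarrow>
    acts n (caps 0 d k) G (y1 @ y2) = (if y2 = rev y1 then cap_wt n d y1 * G [] else 0)"
proof (induction k arbitrary: y1 y2)
  case 0
  then show ?case by (simp add: cap_wt_def)
next
  case (Suc k)
  obtain x a where y1: "y1 = x @ [a]" "length x = k" using Suc.prems by (cases y1 rule: rev_cases) auto
  obtain b z where y2: "y2 = b # z" "length z = k" using Suc.prems by (cases y2) auto
  have "acts n (caps 0 d (Suc k)) G (y1 @ y2)
      = (if a = b then (if d = Down then qpow (height n a) else 1) * acts n (caps 0 d k) G (x @ z) else 0)"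
    using y1 y2 by (simp add: caps_Suc acts_append nth_append)
  also have "acts n (caps 0 d k) G (x @ z) = (if z = rev x then cap_wt n d x * G [] else 0)"
    by (rule Suc.IH[OF y1(2) y2(2)])
  finally show ?case by (auto simp: y1 y2 cap_wt_def qpow_mult add.commute simp flip: mult.assoc)
qed

lemma acts_cups:
  "acts n (cups 0 d k) G [] = (\<Sum>x\<in>cols n k. cup_wt n d x * G (x @ rev x))"
proof (induction k arbitrary: G)
  case 0
  have "cols n 0 = {[]}" by (auto simp: cols_def)
  then show ?case by (simp add: cup_wt_def)
next
  case (Suc k)
  have "acts n (cups 0 d (Suc k)) G [] = (\<Sum>x\<in>cols n k. cup_wt n d x * act n (k, Cup d) G (x @ rev x))"
    by (simp add: cups_Suc Suc del: act.simps)
  also have "\<dots> = (\<Sum>x\<in>cols n k. \<Sum>a = 1..n. cup_wt n d (x @ [a]) * G ((x @ [a]) @ rev (x @ [a])))"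
  proof (intro sum.cong refl)
    fix x assume "x \<in> cols n k"
    then have "act n (k, Cup d) G (x @ rev x) = (\<Sum>a = 1..n. (if d = Up then qpow (- height n a) else 1) * G (x @ [a, a] @ rev x))"
      by (simp add: cols_def)
    moreover have "cup_wt n d (x @ [a]) = cup_wt n d x * (if d = Up then qpow (- height n a) else 1)" for a
      by (simp add: cup_wt_def qpow_mult)
    ultimately show "cup_wt n d x * act n (k, Cup d) G (x @ rev x)
        = (\<Sum>a = 1..n. cup_wt n d (x @ [a]) * G ((x @ [a]) @ rev (x @ [a])))"
      by (simp only: sum_distrib_left mult.assoc) simp
  qed
  finally show ?case by (simp add: sum_cols_Suc)
qed

text \<open>The matrix of a vertex web between the colours \<open>x\<close> above and
  \<open>y\<close> below. \<open>z\<close> colours the bands returning from the source to the sink;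
  their maxima have left leg \<open>Down\<close> and carry weights, their minima do not.\<close>

definition vertex_kernel :: "nat \<Rightarrow> nat \<Rightarrow> nat list \<Rightarrow> nat list \<Rightarrow> laurent" where
  "vertex_kernel n s x y = (\<Sum>z\<in>cols n (n - s). anti n (x @ z) * anti n (y @ z) * qpow (\<Sum>c\<leftarrow>z. height n c))"

lemma acts_vertex_web:
  assumes s: "s \<le> n" and y: "length y = s" "set y \<subseteq> {1..n}"
  shows "acts n (vertex_web n 0 s) G y = (\<Sum>x\<in>cols n s. vertex_kernel n s x y * G x)"
proof -
  let ?k = "n - s"
  let ?F = "acts n (caps s Down ?k) G"
  let ?H = "acts n [(0, Sink), (0, Source)] ?F"
  have F: "?F (x @ z' @ rev z) = (if z' = z then qpow (\<Sum>c\<leftarrow>z. height n c) * G x else 0)"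
    if "length x = s" "length z = ?k" "length z' = ?k" "set z \<subseteq> {1..n}" "set z' \<subseteq> {1..n}" for x z z'
    using acts_shift[OF typed_caps[of n Down ?k], of "z' @ rev z" x s G "[]"] acts_caps[of z' ?k "rev z" n Down "\<lambda>zs. G (x @ zs)"] that
    by (auto simp: caps_shift[of s] cap_wt_def)
  have H: "?H (y @ z @ rev z) = anti n (y @ z) * (\<Sum>x\<in>cols n s. anti n (x @ z) * qpow (\<Sum>c\<leftarrow>z. height n c) * G x)"
    if z: "z \<in> cols n ?k" for z
  proof -
    have len: "length (y @ z) = n" using z y s by (simp add: cols_def)
    have "?H ((y @ z) @ rev z) = anti n (y @ z) * (\<Sum>xs\<in>cols n n. anti n xs * ?F (xs @ rev z))"
      using len by simp
    also have "(\<Sum>xs\<in>cols n n. anti n xs * ?F (xs @ rev z))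
        = (\<Sum>(x, z')\<in>cols n s \<times> cols n ?k. anti n (x @ z') * ?F ((x @ z') @ rev z))"
    proof (rule sum.reindex_bij_witness[of _ "\<lambda>(x, z'). x @ z'" "\<lambda>xs. (take s xs, drop s xs)"])
      fix xs assume "xs \<in> cols n n"
      then show "(take s xs, drop s xs) \<in> cols n s \<times> cols n ?k"
        using s set_take_subset[of s xs] set_drop_subset[of s xs] by (auto simp: cols_def)
    next
      fix xs assume "xs \<in> cols n n"
      show "(case (take s xs, drop s xs) of (x, z') \<Rightarrow> anti n (x @ z') * ?F ((x @ z') @ rev z)) = anti n xs * ?F (xs @ rev z)"
        by (simp only: prod.case append_take_drop_id)
    qed (use s in \<open>auto simp: cols_def\<close>)
    also have "\<dots> = (\<Sum>x\<in>cols n s. \<Sum>z'\<in>cols n ?k. if z' = z then anti n (x @ z) * qpow (\<Sum>c\<leftarrow>z. height n c) * G x else 0)"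
      unfolding sum.cartesian_product[symmetric] using F z
      by (intro sum.cong) (auto simp: cols_def mult.assoc)
    also have "\<dots> = (\<Sum>x\<in>cols n s. anti n (x @ z) * qpow (\<Sum>c\<leftarrow>z. height n c) * G x)"
      using z by (simp add: sum.delta)
    finally show ?thesis by simp
  qed
  have "acts n (vertex_web n 0 s) G y = acts n (shift s (cups 0 Down ?k)) ?H (y @ [] @ [])"
    by (simp only: vertex_web_def acts_append cups_shift[of s] append_Nil2 add_0)
  also have "\<dots> = acts n (cups 0 Down ?k) (\<lambda>zs. ?H (y @ zs @ [])) []"
    by (rule acts_shift[OF typed_cups]) (use y in auto)
  also have "\<dots> = (\<Sum>z\<in>cols n ?k. ?H (y @ z @ rev z))"
    unfolding acts_cups by (simp add: cup_wt_def del: acts.simps)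
  also have "\<dots> = (\<Sum>z\<in>cols n ?k. \<Sum>x\<in>cols n s. anti n (x @ z) * anti n (y @ z) * qpow (\<Sum>c\<leftarrow>z. height n c) * G x)"
    by (intro sum.cong) (simp_all only: H, simp_all add: sum_distrib_left mult_ac)
  also have "\<dots> = (\<Sum>x\<in>cols n s. vertex_kernel n s x y * G x)"
    unfolding vertex_kernel_def sum_distrib_right by (rule sum.swap)
  finally show ?thesis .
qed

section \<open>Inversions, Poincare polynomials and heights\<close>

lemma inv_list_append:
  "inv_list (x @ z) = inv_list x + inv_list z + (\<Sum>a\<leftarrow>x. length (filter (\<lambda>c. c < a) z))"
  by (induction x) auto

lemma inv_pairs_sum:
  assumes "finite A" "finite B"
  shows "inv_pairs A B = (\<Sum>a\<in>A. below B a)"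
proof -
  have "{(i, j). i \<in> A \<and> j \<in> B \<and> i > j} = Sigma A (\<lambda>a. {s \<in> B. s < a})" by auto
  then show ?thesis unfolding inv_pairs_def below_def using assms by simp
qed

lemma inv_list_append_distinct:
  assumes "distinct x" "distinct z"
  shows "inv_list (x @ z) = inv_list x + inv_list z + inv_pairs (set x) (set z)"
proof -
  have "(\<Sum>a\<leftarrow>x. length (filter (\<lambda>c. c < a) z)) = (\<Sum>a\<in>set x. below (set z) a)"
    using assms by (simp add: sum_list_distinct_conv_sum_set length_filter_below)
  then show ?thesis by (simp add: inv_list_append inv_pairs_sum)
qed

lemma qfact_Suc: "qfact (Suc k) = qint (Suc k) * qfact k"
  by (simp add: qfact_def mult.commute)

lemma qint_power_sum: "(\<Sum>t<m. qpow 1 ^ (2 * t)) * qpow 1 = qpow (of_nat m) * qint m"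
proof -
  have "zed \<noteq> 0" by (simp add: zed_def qpow_inj)
  moreover have "zed * ((\<Sum>t<m. qpow 1 ^ (2 * t)) * qpow 1) = zed * (qpow (of_nat m) * qint m)"
  proof -
    have "zed * ((\<Sum>t<m. qpow 1 ^ (2 * t)) * qpow 1) = qpow 1 ^ (2 * m) - 1"
      using zed_power_sum[of 0 m] by (simp add: mult_ac lessThan_atLeast0)
    also have "\<dots> = qpow (of_nat m) * (qint m * zed)"
      unfolding qint_eq(2)[of m, folded zed_def] by (simp add: qpow_power qpow_mult right_diff_distrib)
    finally show ?thesis by (simp add: mult_ac)
  qed
  ultimately show ?thesis by simp
qed

text \<open>The Poincare polynomial of the symmetric group in the variable q^2, balanced to quantum
  factorials. Expansion along the first entry produces one factor 1 + q^2 + ... + q^(2m) at a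
  time.\<close>

lemma poincare:
  assumes "finite S"
  shows "asum S (\<lambda>x. (- qpow 1) ^ inv_list x) = qpow (of_nat (card S) * (of_nat (card S) - 1) / 2) * qfact (card S)"
  using assms
proof (induction "card S" arbitrary: S)
  case 0
  then show ?case by (simp add: qfact_def)
next
  case (Suc m)
  have ne: "S \<noteq> {}" using Suc.hyps(2) by auto
  let ?P = "qpow (of_nat m * (of_nat m - 1) / 2) * qfact m"
  have "asum S (\<lambda>x. (- qpow 1) ^ inv_list x) = (\<Sum>a\<in>S. qpow 1 ^ (2 * below S a) * ?P)"
    unfolding asum_rec[OF Suc.prems ne]
  proof (rule sum.cong[OF refl])
    fix a assume a: "a \<in> S"
    have "asum (S - {a}) (\<lambda>x. (- qpow 1) ^ inv_list (a # x)) = asum (S - {a}) (\<lambda>x. (- qpow 1) ^ below S a * (- qpow 1) ^ inv_list x)"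
      unfolding asum_def
    proof (intro sum.cong refl arg_cong2[where f = "(*)"])
      fix x assume x: "x \<in> permutations_of_set (S - {a})"
      have "below (set x) a = below S a"
        using x unfolding below_def by (intro arg_cong[of _ _ card]) (auto simp: permutations_of_set_def)
      then show "(- qpow 1) ^ inv_list (a # x) = (- qpow 1) ^ below S a * (- qpow 1) ^ inv_list x"
        using x length_filter_below[of x a] by (simp add: permutations_of_set_def power_add)
    qed
    also have "\<dots> = (- qpow 1) ^ below S a * ?P"
    proof -
      have c: "card (S - {a}) = m" using Suc.hyps(2) Suc.prems a by simp
      have "asum (S - {a}) (\<lambda>x. (- qpow 1) ^ inv_list x) = ?P"
        using Suc.hyps(1)[OF c[symmetric]] Suc.prems unfolding c by simp
      then show ?thesis unfolding asum_linear by simp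
    qed
    finally show "(- qpow 1) ^ below S a * asum (S - {a}) (\<lambda>x. (- qpow 1) ^ inv_list (a # x)) = qpow 1 ^ (2 * below S a) * ?P"
      by (simp add: power_mult power2_eq_square power_mult_distrib[symmetric] flip: mult.assoc)
  qed
  also have "\<dots> = (\<Sum>t<Suc m. qpow 1 ^ (2 * t)) * ?P"
    using sum.reindex_bij_betw[OF below_bij[OF Suc.prems], of "\<lambda>t. qpow 1 ^ (2 * t) * ?P"]
    by (simp add: Suc.hyps(2) sum_distrib_right del: sum.lessThan_Suc)
  also have "(\<Sum>t<Suc m. qpow 1 ^ (2 * t)) = qpow (of_nat m) * qint (Suc m)"
  proof -
    have "(\<Sum>t<Suc m. qpow 1 ^ (2 * t)) * qpow 1 * qpow (- 1) = qpow (of_nat (Suc m)) * qint (Suc m) * qpow (- 1)"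
      by (simp only: qint_power_sum)
    also have "\<dots> = qpow (of_nat (Suc m)) * qpow (- 1) * qint (Suc m)" by (simp only: mult_ac)
    also have "qpow (of_nat (Suc m)) * qpow (- 1) = qpow (of_nat m)" by (simp add: qpow_mult)
    finally show ?thesis by (simp add: mult.assoc del: sum.lessThan_Suc)
  qed
  also have "qpow (of_nat m) * qint (Suc m) * ?P
      = (qpow (of_nat m) * qpow (of_nat m * (of_nat m - 1) / 2)) * qfact (Suc m)"
    by (simp only: qfact_Suc mult_ac)
  also have "qpow (of_nat m) * qpow (of_nat m * (of_nat m - 1) / 2) = qpow (of_nat (Suc m) * (of_nat (Suc m) - 1) / 2)"
    by (simp add: qpow_mult field_simps)
  finally show ?case by (simp add: Suc.hyps(2)[symmetric])
qed

text \<open>The height of a colour is the number of smaller colours minus the number of larger ones.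
  Summed over the complement of \<open>S\<close>, comparisons inside the complement cancel; adding
  twice the inversions replaces the remaining difference of comparisons with \<open>S\<close> by
  their total number.\<close>

lemma height_sum:
  assumes "S \<subseteq> {1..n}"
  shows "(\<Sum>c\<in>{1..n} - S. height n c) + 2 * of_nat (inv_pairs S ({1..n} - S)) = of_nat (card S) * of_nat (n - card S)"
proof -
  let ?R = "{1..n} - S"
  have fin: "finite S" using assms finite_subset by blast
  have cardR: "card ?R = n - card S" using assms fin by (simp add: card_Diff_subset)
  have sn: "card S \<le> n" using card_mono[OF _ assms] by simp
  define lo hi where "lo T c = card {d \<in> T. d < c}" and "hi T c = card {d \<in> T. c < d}" for T :: "nat set" and c
  have h: "height n c = (of_nat (lo ?R c) - of_nat (hi ?R c)) + (of_nat (lo S c) - of_nat (hi S c))" if "c \<in> ?R" for c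
  proof -
    have "{d \<in> {1..n}. d < c} = {d \<in> ?R. d < c} \<union> {d \<in> S. d < c}" "{d \<in> {1..n}. c < d} = {d \<in> ?R. c < d} \<union> {d \<in> S. c < d}"
      using assms by auto
    moreover have "card ({d \<in> ?R. d < c} \<union> {d \<in> S. d < c}) = lo ?R c + lo S c"
      "card ({d \<in> ?R. c < d} \<union> {d \<in> S. c < d}) = hi ?R c + hi S c"
      unfolding lo_def hi_def using fin by (intro card_Un_disjoint; auto)+
    moreover have "{d \<in> {1..n}. d < c} = {1..<c}" "{d \<in> {1..n}. c < d} = {c<..n}" using that by auto
    ultimately have "lo ?R c + lo S c = c - 1" "hi ?R c + hi S c = n - c" by simp_all
    then have "of_nat (lo ?R c) + of_nat (lo S c) = (of_nat (c - 1) :: rat)" "of_nat (hi ?R c) + of_nat (hi S c) = (of_nat (n - c) :: rat)"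
      by (simp_all flip: of_nat_add)
    then show ?thesis using that by (simp add: height_def of_nat_diff algebra_simps)
  qed
  have swap: "(\<Sum>c\<in>A. lo B c) = (\<Sum>d\<in>B. hi A d)" if "finite A" "finite B" for A B
  proof -
    have "(\<Sum>c\<in>A. lo B c) = card (Sigma A (\<lambda>c. {d \<in> B. d < c}))" using that by (simp add: lo_def)
    also have "\<dots> = card (Sigma B (\<lambda>d. {c \<in> A. d < c}))"
      by (rule bij_betw_same_card[of prod.swap]) (auto simp: bij_betw_def inj_on_def image_iff)
    also have "\<dots> = (\<Sum>d\<in>B. hi A d)" using that by (simp add: hi_def)
    finally show ?thesis .
  qed
  have pi: "inv_pairs S ?R = (\<Sum>c\<in>?R. hi S c)"
    using swap[of S ?R] fin by (simp add: inv_pairs_sum below_def lo_def)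
  have tot: "(\<Sum>c\<in>?R. lo S c) + (\<Sum>c\<in>?R. hi S c) = card S * card ?R"
  proof -
    have "lo S c + hi S c = card S" if "c \<in> ?R" for c
    proof -
      have "{d \<in> S. d < c} \<union> {d \<in> S. c < d} = S" using that by (auto simp: nat_neq_iff) (metis nat_neq_iff)
      moreover have "card ({d \<in> S. d < c} \<union> {d \<in> S. c < d}) = lo S c + hi S c"
        unfolding lo_def hi_def using fin by (intro card_Un_disjoint) auto
      ultimately show ?thesis by simp
    qed
    then show ?thesis by (simp add: sum.distrib[symmetric] mult.commute)
  qed
  have "(\<Sum>c\<in>?R. height n c) = (of_nat (\<Sum>c\<in>?R. lo ?R c) - of_nat (\<Sum>c\<in>?R. hi ?R c)) + (of_nat (\<Sum>c\<in>?R. lo S c) - of_nat (\<Sum>c\<in>?R. hi S c))"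
    using h by (simp add: sum.distrib sum_subtractf)
  also have "\<dots> = of_nat (\<Sum>c\<in>?R. lo S c) - of_nat (inv_pairs S ?R)"
    using swap[of ?R ?R] pi by simp
  also have "\<dots> + 2 * of_nat (inv_pairs S ?R) = of_nat ((\<Sum>c\<in>?R. lo S c) + (\<Sum>c\<in>?R. hi S c))"
    using pi by simp
  finally show ?thesis unfolding tot cardR by simp
qed

text \<open>The product over the returning bands: the first exponent comes from
  \<open>height_sum\<close>, the second one and the factorial from the Poincare polynomial of their
  orderings.\<close>

definition vertex_const :: "nat \<Rightarrow> nat \<Rightarrow> laurent" where
  "vertex_const n s = qpow (of_nat s * of_nat (n - s) + of_nat (n - s) * (of_nat (n - s) - 1) / 2) * qfact (n - s)"

text \<open>Both discs require all colours to occur, so \<open>x\<close> and \<open>y\<close> order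
  the same set and \<open>z\<close> its complement. The inversions between the set and its
  complement occur at both discs and combine with the heights; those inside the complement are
  summed over its orderings.\<close>

lemma vertex_kernel_eq:
  assumes x: "length x = s" "set x \<subseteq> {1..n}" and y: "length y = s" "set y \<subseteq> {1..n}" and s: "s \<le> n"
  shows "vertex_kernel n s x y = (if distinct x \<and> set x = set y
    then vertex_const n s * (- qpow 1) ^ inv_list x * (- qpow 1) ^ inv_list y else 0)"
proof (cases "distinct x \<and> set x = set y")
  case True
  then have dy: "distinct y" using x y by (metis card_distinct distinct_card)
  let ?R = "{1..n} - set x"
  let ?p = "inv_pairs (set x) ?R"
  have cx: "card (set x) = s" using x(1) True distinct_card by metis
  have cardR: "card ?R = n - s" using x cx by (simp add: card_Diff_subset)
  have full: "set x \<union> ?R = {1..n}" using x by auto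
  have an: "anti n (u @ z) = (- qpow 1) ^ (inv_list u + inv_list z + ?p)"
    if "z \<in> permutations_of_set ?R" "u = x \<or> u = y" for u z
    using that True dy full by (auto simp: anti_def permutations_of_set_def inv_list_append_distinct)
  have "vertex_kernel n s x y = (\<Sum>z\<in>permutations_of_set ?R. anti n (x @ z) * anti n (y @ z) * qpow (\<Sum>c\<leftarrow>z. height n c))"
    unfolding vertex_kernel_def
  proof (rule sum.mono_neutral_right)
    show "permutations_of_set ?R \<subseteq> cols n (n - s)"
      using cardR by (auto simp: permutations_of_set_def cols_def distinct_card[symmetric])
    show "\<forall>z\<in>cols n (n - s) - permutations_of_set ?R. anti n (x @ z) * anti n (y @ z) * qpow (\<Sum>c\<leftarrow>z. height n c) = 0"
    proof
      fix z assume z: "z \<in> cols n (n - s) - permutations_of_set ?R"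
      have "set (x @ z) \<noteq> {1..n}"
      proof
        assume f: "set (x @ z) = {1..n}"
        have "length (x @ z) = n" using z x s by (simp add: cols_def)
        then have "distinct (x @ z)" using f by (metis card_atLeastAtMost card_distinct diff_Suc_1)
        then have "z \<in> permutations_of_set ?R" using f by (auto simp: permutations_of_set_def)
        with z show False by simp
      qed
      then show "anti n (x @ z) * anti n (y @ z) * qpow (\<Sum>c\<leftarrow>z. height n c) = 0" by (simp add: anti_def)
    qed
  qed simp
  also have "\<dots> = (\<Sum>z\<in>permutations_of_set ?R. (- qpow 1) ^ inv_list x * (- qpow 1) ^ inv_list y *
      (qpow (\<Sum>c\<in>?R. height n c) * qpow 1 ^ (2 * ?p)) * ((- qpow 1) ^ inv_list z * (- qpow 1) ^ inv_list z))"
  proof (rule sum.cong[OF refl])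
    fix z assume z: "z \<in> permutations_of_set ?R"
    have "(\<Sum>c\<leftarrow>z. height n c) = (\<Sum>c\<in>?R. height n c)"
      using z by (simp add: permutations_of_set_def sum_list_distinct_conv_sum_set)
    moreover have "qpow 1 ^ (2 * ?p) = (- qpow 1) ^ ?p * (- qpow 1) ^ ?p"
      by (simp add: power_mult power2_eq_square flip: power_mult_distrib)
    ultimately show "anti n (x @ z) * anti n (y @ z) * qpow (\<Sum>c\<leftarrow>z. height n c) = (- qpow 1) ^ inv_list x * (- qpow 1) ^ inv_list y *
      (qpow (\<Sum>c\<in>?R. height n c) * qpow 1 ^ (2 * ?p)) * ((- qpow 1) ^ inv_list z * (- qpow 1) ^ inv_list z)"
      using an[OF z] by (simp add: power_add mult_ac)
  qed
  also have "\<dots> = (- qpow 1) ^ inv_list x * (- qpow 1) ^ inv_list y * (qpow (\<Sum>c\<in>?R. height n c) * qpow 1 ^ (2 * ?p)) *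
      asum ?R (\<lambda>z. (- qpow 1) ^ inv_list z)"
    by (simp add: asum_def sum_distrib_left)
  also have "qpow (\<Sum>c\<in>?R. height n c) * qpow 1 ^ (2 * ?p) = qpow (of_nat s * of_nat (n - s))"
    using height_sum[OF x(2)] by (simp add: qpow_power qpow_mult cx mult.commute[of _ 2])
  also have "asum ?R (\<lambda>z. (- qpow 1) ^ inv_list z) = qpow (of_nat (n - s) * (of_nat (n - s) - 1) / 2) * qfact (n - s)"
    using poincare[of ?R] unfolding cardR by simp
  finally show ?thesis using True
    by (simp add: vertex_const_def mult_ac flip: qpow_mult)
next
  case False
  have "anti n (x @ z) * anti n (y @ z) = 0" if z: "z \<in> cols n (n - s)" for z
  proof (rule ccontr)
    assume "anti n (x @ z) * anti n (y @ z) \<noteq> 0"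
    then have f: "set (x @ z) = {1..n}" "set (y @ z) = {1..n}" by (auto simp: anti_def split: if_splits)
    have "length (x @ z) = n" "length (y @ z) = n" using z x y s by (simp_all add: cols_def)
    then have d: "distinct (x @ z)" "distinct (y @ z)" using f by (metis card_atLeastAtMost card_distinct diff_Suc_1)+
    then have "set x = {1..n} - set z" "set y = {1..n} - set z" using f by auto
    with d False show False by simp
  qed
  then have "vertex_kernel n s x y = 0" unfolding vertex_kernel_def by (intro sum.neutral) simp
  then show ?thesis unfolding if_not_P[OF False] .
qed

section \<open>State sums of MOY diagrams\<close>

definition strands :: "(dir \<times> nat) list \<Rightarrow> dir list" where
  "strands ws = concat (map (\<lambda>(d, k). replicate k d) ws)"

lemma strands_simps [simp]: "strands [] = []" "strands ((d, k) # ws) = replicate k d @ strands ws"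
  "strands (ws @ vs) = strands ws @ strands vs"
  by (simp_all add: strands_def)

lemma length_strands: "length (strands ws) = sum_list (map snd ws)"
  by (induction ws) auto

definition seqs :: "nat \<Rightarrow> (dir \<times> nat) list \<Rightarrow> nat list list set" where
  "seqs n ws = {xs. list_all2 (\<lambda>x s. x \<in> cols n (snd s)) xs ws}"

lemma seqs_simps [simp]: "seqs n [] = {[]}" "x # xs \<in> seqs n (s # ws) \<longleftrightarrow> x \<in> cols n (snd s) \<and> xs \<in> seqs n ws"
  by (auto simp: seqs_def)

lemma seqs_append: "length xs = length ws \<Longrightarrow> xs @ ys \<in> seqs n (ws @ vs) \<longleftrightarrow> xs \<in> seqs n ws \<and> ys \<in> seqs n vs"
  by (auto simp: seqs_def list_all2_append)

lemma seqs_length: "xs \<in> seqs n ws \<Longrightarrow> length xs = length ws"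
  by (auto simp: seqs_def list_all2_lengthD)

lemma seqs_nth: "xs \<in> seqs n ws \<longleftrightarrow> length xs = length ws \<and> (\<forall>p < length ws. xs ! p \<in> cols n (snd (ws ! p)))"
  by (auto simp: seqs_def list_all2_conv_all_nth)

lemma seqs_concat: "xs \<in> seqs n ws \<Longrightarrow> length (concat xs) = length (strands ws) \<and> set (concat xs) \<subseteq> {1..n}"
proof (induction ws arbitrary: xs)
  case (Cons s ws)
  then obtain x xs' where "xs = x # xs'" by (cases xs) (auto simp: seqs_def)
  with Cons show ?case by (cases s) (auto simp: cols_def)
qed simp

lemma finite_seqs [simp]: "finite (seqs n ws)"
proof (induction ws)
  case (Cons s ws)
  have "seqs n (s # ws) \<subseteq> (\<lambda>(x, xs). x # xs) ` (cols n (snd s) \<times> seqs n ws)"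
  proof
    fix xs assume xs: "xs \<in> seqs n (s # ws)"
    then obtain x xs' where "xs = x # xs'" by (cases xs) (auto simp: seqs_def)
    with xs show "xs \<in> (\<lambda>(x, xs). x # xs) ` (cols n (snd s) \<times> seqs n ws)" by auto
  qed
  then show ?case by (rule finite_subset) (simp add: Cons)
qed simp

lemma sum_seqs1: "(\<Sum>xs\<in>seqs n [s]. f xs) = (\<Sum>x\<in>cols n (snd s). f [x])"
proof -
  have "seqs n [s] = (\<lambda>x. [x]) ` cols n (snd s)"
    by (auto simp: seqs_def list_all2_Cons2)
  then show ?thesis by (simp add: sum.reindex inj_on_def)
qed

lemma sum_seqs2: "(\<Sum>xs\<in>seqs n [s, s']. f xs) = (\<Sum>(x, y)\<in>cols n (snd s) \<times> cols n (snd s'). f [x, y])"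
proof -
  have "seqs n [s, s'] = (\<lambda>(x, y). [x, y]) ` (cols n (snd s) \<times> cols n (snd s'))"
    by (auto simp: seqs_def list_all2_Cons2)
  then show ?thesis by (simp add: sum.reindex inj_on_def case_prod_beta)
qed

fun piece_kernel :: "nat \<Rightarrow> moy_piece \<Rightarrow> nat list list \<Rightarrow> nat list list \<Rightarrow> laurent" where
  "piece_kernel n (MCap d k) xs ys = (if ys ! 1 = rev (ys ! 0) then cap_wt n d (ys ! 0) else 0)"
| "piece_kernel n (MCup d k) xs ys = (if xs ! 1 = rev (xs ! 0) then cup_wt n d (xs ! 0) else 0)"
| "piece_kernel n (Merge k l) xs ys = vertex_kernel n (k + l) (xs ! 0 @ xs ! 1) (ys ! 0)"
| "piece_kernel n (Split k l) xs ys = vertex_kernel n (k + l) (xs ! 0) (ys ! 0 @ ys ! 1)"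

fun fits_n :: "nat \<Rightarrow> moy_piece \<Rightarrow> bool" where
  "fits_n n (Merge k l) \<longleftrightarrow> k + l \<le> n"
| "fits_n n (Split k l) \<longleftrightarrow> k + l \<le> n"
| "fits_n n _ \<longleftrightarrow> True"

lemma piece_web_shift: "piece_web n i g = shift i (piece_web n 0 g)"
proof -
  have "vertex_web n i s = shift i (vertex_web n 0 s)" for s
    by (simp add: vertex_web_def caps_shift[of "i + s"] cups_shift[of "i + s"] caps_shift[of s] cups_shift[of s])
  then show ?thesis using caps_shift[of i] cups_shift[of i] by (cases g) simp_all
qed

lemma typed_piece_web:
  assumes "fits_n n g"
  shows "typed (web_io n) (strands (fst (moy_io g))) (piece_web n 0 g) (strands (snd (moy_io g)))"
  using assms typed_caps[of n] typed_cups[of n] typed_vertex_web by (cases g) (simp_all flip: replicate_add)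

lemma planar_append_caps: "planar D \<Longrightarrow> planar (D @ caps i d k)"
  by (induction k) (auto simp: caps_Suc planar.Cap simp flip: append_assoc)

lemma planar_append_cups: "planar D \<Longrightarrow> planar (D @ cups i d k)"
proof (induction k arbitrary: D)
  case (Suc k)
  then show ?case using Suc.IH[OF planar.Cup[OF Suc.prems, of "i + k" d]] by (simp add: cups_Suc)
qed simp

lemma planar_append_piece: "planar D \<Longrightarrow> planar (D @ piece_web n i g)"
proof -
  assume D: "planar D"
  have "planar (D @ vertex_web n i s)" for s
    using planar_append_cups[OF planar.Discs[OF planar_append_caps[OF D, of "i + s" Down "n - s"], of i], of "i + s" Down "n - s"]
    by (simp add: vertex_web_def)
  then show ?thesis using D planar_append_caps planar_append_cups by (cases g) simp_all
qed

lemma acts_piece: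
  assumes g: "fits_n n g" and ys: "ys \<in> seqs n (snd (moy_io g))"
  shows "acts n (piece_web n 0 g) G (concat ys) = (\<Sum>xs\<in>seqs n (fst (moy_io g)). piece_kernel n g xs ys * G (concat xs))"
proof (cases g)
  case (MCap d k)
  then obtain y1 y2 where "ys = [y1, y2]" "y1 \<in> cols n k" "y2 \<in> cols n k"
    using ys by (auto simp: seqs_def list_all2_Cons2)
  then show ?thesis using acts_caps[of y1 k y2 n d G] by (simp add: MCap cols_def)
next
  case (MCup d k)
  have "(\<Sum>xs\<in>seqs n (fst (moy_io g)). piece_kernel n g xs ys * G (concat xs))
      = (\<Sum>x\<in>cols n k. \<Sum>y\<in>cols n k. if y = rev x then cup_wt n d x * G (x @ y) else 0)"
    unfolding MCup moy_io.simps fst_conv sum_seqs2 sum.cartesian_product snd_conv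
    by (intro sum.cong) auto
  also have "\<dots> = (\<Sum>x\<in>cols n k. cup_wt n d x * G (x @ rev x))"
  proof (intro sum.cong refl)
    fix x assume "x \<in> cols n k"
    then have "rev x \<in> cols n k" by (simp add: cols_def)
    then show "(\<Sum>y\<in>cols n k. if y = rev x then cup_wt n d x * G (x @ y) else 0) = cup_wt n d x * G (x @ rev x)"
      by simp
  qed
  moreover have "ys = []" using ys MCup by simp
  ultimately show ?thesis by (simp add: MCup acts_cups)
next
  case (Merge k l)
  then obtain y where y: "ys = [y]" "y \<in> cols n (k + l)"
    using ys by (auto simp: seqs_def list_all2_Cons2)
  have "(\<Sum>xs\<in>seqs n (fst (moy_io g)). piece_kernel n g xs ys * G (concat xs))
      = (\<Sum>(x1, x2)\<in>cols n k \<times> cols n l. vertex_kernel n (k + l) (x1 @ x2) y * G (x1 @ x2))"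
    unfolding Merge moy_io.simps fst_conv sum_seqs2 by (simp add: y)
  also have "\<dots> = (\<Sum>x\<in>cols n (k + l). vertex_kernel n (k + l) x y * G x)"
  proof (rule sum.reindex_bij_witness[of _ "\<lambda>x. (take k x, drop k x)" "\<lambda>(x1, x2). x1 @ x2"])
    fix x assume "x \<in> cols n (k + l)"
    then show "(take k x, drop k x) \<in> cols n k \<times> cols n l"
      using set_take_subset[of k x] set_drop_subset[of k x] by (auto simp: cols_def)
  qed (auto simp: cols_def)
  finally show ?thesis
    using y g Merge by (simp add: acts_vertex_web cols_def)
next
  case (Split k l)
  then obtain y1 y2 where y: "ys = [y1, y2]" "y1 \<in> cols n k" "y2 \<in> cols n l"
    using ys by (auto simp: seqs_def list_all2_Cons2)
  then show ?thesis
    using g Split acts_vertex_web[of "k + l" n "y1 @ y2" G] by (simp add: sum_seqs1 cols_def)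
qed

text \<open>The transfer matrix of a layer: the sequences on the strands beside the piece are
  unchanged.\<close>

fun layer_kernel :: "nat \<Rightarrow> nat \<times> moy_piece \<Rightarrow> nat list list \<Rightarrow> nat list list \<Rightarrow> laurent" where
  "layer_kernel n (i, g) xs ys =
     (if take i ys = take i xs \<and> drop (i + length (snd (moy_io g))) ys = drop (i + length (fst (moy_io g))) xs
      then piece_kernel n g (take (length (fst (moy_io g))) (drop i xs)) (take (length (snd (moy_io g))) (drop i ys))
      else 0)"

lemma acts_layer:
  assumes g: "fits_n n g" and ys: "ys \<in> seqs n (p @ snd (moy_io g) @ s)"
    and pos: "i = length p" "j = sum_list (map snd p)"
  shows "acts n (piece_web n j g) F (concat ys)
    = (\<Sum>xs\<in>seqs n (p @ fst (moy_io g) @ s). layer_kernel n (i, g) xs ys * F (concat xs))"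
proof -
  let ?a = "length (fst (moy_io g))" and ?b = "length (snd (moy_io g))"
  define P M S where "P = take i ys" "M = take ?b (drop i ys)" "S = drop ?b (drop i ys)"
  have eq: "ys = P @ M @ S" unfolding P_M_S_def append_take_drop_id ..
  have len: "length P = length p" "length M = ?b"
    using seqs_length[OF ys] pos by (auto simp: P_M_S_def)
  have PMS: "P \<in> seqs n p" "M \<in> seqs n (snd (moy_io g))" "S \<in> seqs n s"
    using ys len unfolding eq by (simp_all add: seqs_append)
  have lP: "length (concat P) = j" using seqs_concat[OF PMS(1)] pos by (simp add: length_strands)
  have "acts n (piece_web n j g) F (concat P @ concat M @ concat S)
      = acts n (piece_web n 0 g) (\<lambda>zs. F (concat P @ zs @ concat S)) (concat M)"
    unfolding piece_web_shift[of n j]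
    by (rule acts_shift[OF typed_piece_web[OF g] _ lP]) (use seqs_concat[OF PMS(2)] in auto)
  also have "\<dots> = (\<Sum>xs\<in>seqs n (fst (moy_io g)). piece_kernel n g xs M * F (concat (P @ xs @ S)))"
    by (simp add: acts_piece[OF g PMS(2)])
  also have "\<dots> = (\<Sum>xs\<in>seqs n (fst (moy_io g)). layer_kernel n (i, g) (P @ xs @ S) ys * F (concat (P @ xs @ S)))"
  proof (intro sum.cong refl)
    fix xs assume "xs \<in> seqs n (fst (moy_io g))"
    then have "length xs = ?a" by (rule seqs_length)
    then show "piece_kernel n g xs M * F (concat (P @ xs @ S)) = layer_kernel n (i, g) (P @ xs @ S) ys * F (concat (P @ xs @ S))"
      using len pos by (simp add: eq)
  qed
  also have "\<dots> = (\<Sum>xs\<in>(\<lambda>xs. P @ xs @ S) ` seqs n (fst (moy_io g)). layer_kernel n (i, g) xs ys * F (concat xs))"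
    by (simp add: sum.reindex inj_on_def)
  also have "\<dots> = (\<Sum>xs\<in>seqs n (p @ fst (moy_io g) @ s). layer_kernel n (i, g) xs ys * F (concat xs))"
  proof (rule sum.mono_neutral_left)
    show "(\<lambda>xs. P @ xs @ S) ` seqs n (fst (moy_io g)) \<subseteq> seqs n (p @ fst (moy_io g) @ s)"
      using PMS len by (auto simp: seqs_append seqs_length)
    show "\<forall>xs\<in>seqs n (p @ fst (moy_io g) @ s) - (\<lambda>xs. P @ xs @ S) ` seqs n (fst (moy_io g)).
        layer_kernel n (i, g) xs ys * F (concat xs) = 0"
    proof
      fix xs assume xs: "xs \<in> seqs n (p @ fst (moy_io g) @ s) - (\<lambda>xs. P @ xs @ S) ` seqs n (fst (moy_io g))"
      have l: "length xs = length p + ?a + length s" using xs seqs_length by fastforce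
      have "\<not> (take i ys = take i xs \<and> drop (i + ?b) ys = drop (i + ?a) xs)"
      proof
        assume *: "take i ys = take i xs \<and> drop (i + ?b) ys = drop (i + ?a) xs"
        then have "P = take i xs" "S = drop ?a (drop i xs)" by (simp_all add: P_M_S_def add.commute)
        then have e: "xs = P @ take ?a (drop i xs) @ S" by (metis append_take_drop_id)
        have "take ?a (drop i xs) \<in> seqs n (fst (moy_io g))"
          using xs l len pos PMS unfolding e[symmetric] by (subst (asm) e) (auto simp: seqs_append)
        with e xs show False by blast
      qed
      then show "layer_kernel n (i, g) xs ys * F (concat xs) = 0" by auto
    qed
  qed simp
  finally show ?thesis by (simp add: eq)
qed

section \<open>Expansion over histories\<close>

locale moy =
  fixes n :: nat and \<Gamma> :: "moy_piece diagram"
  assumes moy: "moy_diagram n \<Gamma>"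
begin

abbreviation "T \<equiv> length \<Gamma>"
abbreviation "sl \<equiv> slice moy_io \<Gamma>"

lemma closed: "closed_diagram moy_io \<Gamma>"
  using moy by (simp add: moy_diagram_def)

lemma sl_0 [simp]: "sl 0 = []"
  by (simp add: slice_def)

lemma sl_T [simp]: "sl T = []"
  using closed by (simp add: closed_diagram_def)

lemma label_range: "t \<le> T \<Longrightarrow> (d, k) \<in> set (sl t) \<Longrightarrow> 1 \<le> k \<and> k \<le> n"
  using moy by (fastforce simp: moy_diagram_def)

lemma layer:
  assumes "t < T" "\<Gamma> ! t = (i, g)"
  obtains p s where "sl t = p @ fst (moy_io g) @ s" "sl (Suc t) = p @ snd (moy_io g) @ s" "i = length p"
proof -
  have "fits moy_io (sl t) (\<Gamma> ! t)" using closed assms(1) by (simp add: closed_diagram_def)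
  moreover have "sl (Suc t) = after moy_io (sl t) (\<Gamma> ! t)"
    using assms(1) by (simp add: slice_def take_Suc_conv_app_nth)
  ultimately have "typed moy_io (sl t) [(i, g)] (sl (Suc t))" using assms(2) by simp
  then show thesis using that unfolding typed_layer by blast
qed

lemma layer_fits: "t < T \<Longrightarrow> \<Gamma> ! t = (i, g) \<Longrightarrow> fits_n n g"
proof -
  assume t: "t < T" "\<Gamma> ! t = (i, g)"
  obtain p s where ps: "sl t = p @ fst (moy_io g) @ s" "sl (Suc t) = p @ snd (moy_io g) @ s" "i = length p"
    using layer[OF t] .
  show "fits_n n g"
    using label_range[of t] label_range[of "Suc t"] t ps by (cases g) auto
qed

definition layer_web :: "nat \<Rightarrow> web_piece diagram" where
  "layer_web t = (case \<Gamma> ! t of (i, g) \<Rightarrow> piece_web n (sum_list (map snd (take i (sl t)))) g)"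

definition prefix :: "nat \<Rightarrow> web_piece diagram" where
  "prefix t = concat (map layer_web [0..<t])"

lemma moy_web_prefix: "moy_web n \<Gamma> = prefix T"
  by (simp add: moy_web_def prefix_def layer_web_def[abs_def])

lemma prefix_simps [simp]: "prefix 0 = []" "prefix (Suc t) = prefix t @ layer_web t"
  by (simp_all add: prefix_def)

lemma planar_prefix: "planar (prefix t)"
  by (induction t) (auto simp: planar.Nil layer_web_def planar_append_piece split: prod.splits)

lemma typed_prefix: "t \<le> T \<Longrightarrow> typed (web_io n) [] (prefix t) (strands (sl t))"
proof (induction t)
  case (Suc t)
  obtain i g where ig: "\<Gamma> ! t = (i, g)" by fastforce
  obtain p s where ps: "sl t = p @ fst (moy_io g) @ s" "sl (Suc t) = p @ snd (moy_io g) @ s" "i = length p"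
    using layer[OF _ ig] Suc.prems by auto
  have "layer_web t = shift (length (strands p)) (piece_web n 0 g)"
    unfolding layer_web_def ig using piece_web_shift[of n "sum_list (map snd p)" g]
    by (simp add: ps length_strands)
  then have "typed (web_io n) (strands (sl t)) (layer_web t) (strands (sl (Suc t)))"
    using typed_shift[OF typed_piece_web[OF layer_fits[OF _ ig]], of "strands p" "strands s"] Suc.prems
    by (simp add: ps)
  with Suc show ?case by (auto simp: typed_append)
qed simp

lemma is_web_moy: "is_web n (moy_web n \<Gamma>)"
  using typed_prefix[of T] by (simp add: moy_web_prefix is_web_typed)

lemma acts_layer_web:
  assumes t: "t < T" and ys: "ys \<in> seqs n (sl (Suc t))"
  shows "acts n (layer_web t) F (concat ys) = (\<Sum>xs\<in>seqs n (sl t). layer_kernel n (\<Gamma> ! t) xs ys * F (concat xs))"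
proof -
  obtain i g where ig: "\<Gamma> ! t = (i, g)" by fastforce
  obtain p s where ps: "sl t = p @ fst (moy_io g) @ s" "sl (Suc t) = p @ snd (moy_io g) @ s" "i = length p"
    using layer[OF t ig] .
  have "layer_web t = piece_web n (sum_list (map snd p)) g" unfolding layer_web_def ig by (simp add: ps)
  then show ?thesis
    using acts_layer[OF layer_fits[OF t ig] ys[unfolded ps(2)] ps(3) refl, of F] unfolding ig ps(1) by simp
qed

definition histories :: "nat \<Rightarrow> (nat \<Rightarrow> nat list list) set" where
  "histories t = PiE {..<t} (\<lambda>t. seqs n (sl t))"

text \<open>The product of the transfer matrices is expanded over all intermediate sequences. A
  history holds the slices before \<open>t\<close> only; the update supplies slice \<open>t\<close>,
  where the value is prescribed.\<close>

lemma prefix_sum: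
  "t \<le> T \<Longrightarrow> ys \<in> seqs n (sl t) \<Longrightarrow>
    acts n (prefix t) delta_nil (concat ys)
    = (\<Sum>X\<in>histories t. \<Prod>t'<t. layer_kernel n (\<Gamma> ! t') (X t') ((X(t := ys)) (Suc t')))"
proof (induction t arbitrary: ys)
  case 0
  then show ?case by (simp add: histories_def delta_nil_def)
next
  case (Suc t)
  let ?f = "\<lambda>X. \<Prod>t'<Suc t. layer_kernel n (\<Gamma> ! t') (X t') ((X(Suc t := ys)) (Suc t'))"
  have "acts n (prefix (Suc t)) delta_nil (concat ys)
      = (\<Sum>xs\<in>seqs n (sl t). layer_kernel n (\<Gamma> ! t) xs ys * acts n (prefix t) delta_nil (concat xs))"
    using Suc.prems by (simp add: acts_append acts_layer_web)
  also have "\<dots> = (\<Sum>xs\<in>seqs n (sl t). \<Sum>X\<in>histories t. layer_kernel n (\<Gamma> ! t) xs ys *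
      (\<Prod>t'<t. layer_kernel n (\<Gamma> ! t') (X t') ((X(t := xs)) (Suc t'))))"
    using Suc by (intro sum.cong) (simp_all add: sum_distrib_left)
  also have "\<dots> = (\<Sum>(xs, X)\<in>seqs n (sl t) \<times> histories t. ?f (X(t := xs)))"
    unfolding sum.cartesian_product
  proof (intro sum.cong refl, clarify)
    fix xs X
    have "(\<Prod>t'<t. layer_kernel n (\<Gamma> ! t') (X t') ((X(t := xs)) (Suc t')))
        = (\<Prod>t'<t. layer_kernel n (\<Gamma> ! t') ((X(t := xs)) t') ((X(t := xs, Suc t := ys)) (Suc t')))"
      by (intro prod.cong) auto
    then show "layer_kernel n (\<Gamma> ! t) xs ys * (\<Prod>t'<t. layer_kernel n (\<Gamma> ! t') (X t') ((X(t := xs)) (Suc t'))) = ?f (X(t := xs))"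
      by (simp add: mult.commute)
  qed
  also have "\<dots> = (\<Sum>X\<in>(\<lambda>(xs, X). X(t := xs)) ` (seqs n (sl t) \<times> histories t). ?f X)"
  proof (subst sum.reindex)
    show "inj_on (\<lambda>(xs, X). X(t := xs)) (seqs n (sl t) \<times> histories t)"
      unfolding histories_def by (rule inj_combinator) simp
  qed (simp add: case_prod_beta comp_def)
  also have "(\<lambda>(xs, X). X(t := xs)) ` (seqs n (sl t) \<times> histories t) = histories (Suc t)"
    unfolding histories_def lessThan_Suc PiE_insert_eq ..
  finally show ?case .
qed

lemma moy_bracket_histories:
  assumes "web_bracket n br" "n > 0"
  shows "moy_bracket n br \<Gamma>
    = (\<Sum>X\<in>histories T. \<Prod>t<T. layer_kernel n (\<Gamma> ! t) (X t) ((X(T := [])) (Suc t)))"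
proof -
  interpret web_invariant n br by unfold_locales (rule assms)
  show ?thesis
    using planar_bracket[OF assms(2) planar_prefix[of T]] is_web_moy prefix_sum[of T "[]"]
    by (simp add: moy_bracket_def moy_web_prefix)
qed

end

section \<open>Edges and annuli\<close>

definition class_rel :: "arc set \<Rightarrow> (arc \<Rightarrow> arc \<Rightarrow> bool) \<Rightarrow> (arc \<times> arc) set" where
  "class_rel A R = {(a, b). a \<in> A \<and> b \<in> A \<and> equivclp (\<lambda>x y. x \<in> A \<and> y \<in> A \<and> R x y) a b}"

lemma classes_quotient: "classes A R = A // class_rel A R"
  by (simp add: classes_def class_rel_def)

lemma equiv_class_rel: "equiv A (class_rel A R)"
  unfolding class_rel_def
  by (intro equivI refl_onI symI transI) (auto intro: equivclp_sym equivclp_trans)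

lemma class_subset: "C \<in> classes A R \<Longrightarrow> C \<subseteq> A"
  unfolding classes_quotient by (rule in_quotient_imp_subset[OF equiv_class_rel])

lemma class_nonempty: "C \<in> classes A R \<Longrightarrow> C \<noteq> {}"
  unfolding classes_quotient by (rule in_quotient_imp_non_empty[OF equiv_class_rel])

lemma class_unique: "C \<in> classes A R \<Longrightarrow> D \<in> classes A R \<Longrightarrow> a \<in> C \<Longrightarrow> a \<in> D \<Longrightarrow> C = D"
  unfolding classes_quotient using quotient_disj[OF equiv_class_rel] by blast

lemma class_exists: "a \<in> A \<Longrightarrow> \<exists>C \<in> classes A R. a \<in> C"
  unfolding classes_quotient by (meson equiv_class_rel equiv_class_self quotientI)

lemma class_step:
  assumes "C \<in> classes A R" "a \<in> C" "b \<in> A" "R a b \<or> R b a"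
  shows "b \<in> C"
proof -
  have "a \<in> A" using class_subset assms by blast
  then have "(a, b) \<in> class_rel A R"
    using assms(3,4) unfolding class_rel_def
    by (auto intro: r_into_equivclp equivclp_sym[OF r_into_equivclp])
  then show ?thesis
    using assms(1,2) unfolding classes_quotient by (rule in_quotient_imp_closed[OF equiv_class_rel, rotated 2])
qed

lemma equivclp_invariant:
  assumes "equivclp R a b" "\<And>x y. R x y \<Longrightarrow> f x = f y"
  shows "f a = f b"
  using assms(1) by (induction rule: equivclp_induct) (use assms(2) in auto)

lemma class_invariant:
  assumes "C \<in> classes A R" "a \<in> C" "b \<in> C" "\<And>x y. x \<in> A \<Longrightarrow> y \<in> A \<Longrightarrow> R x y \<Longrightarrow> f x = f y"
  shows "f a = f b"
proof -
  have "(a, b) \<in> class_rel A R"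
    using assms(1-3) unfolding classes_quotient by (intro quotient_eq_iff[OF equiv_class_rel, THEN iffD1]) auto
  then have "equivclp (\<lambda>x y. x \<in> A \<and> y \<in> A \<and> R x y) a b" by (simp add: class_rel_def)
  then show ?thesis by (rule equivclp_invariant) (use assms(4) in auto)
qed

lemma finite_classes: "finite A \<Longrightarrow> finite (classes A R)"
  unfolding classes_quotient by (rule finite_quotient[OF _ equiv_type[OF equiv_class_rel]])

text \<open>A bundle of bands turned around by an extremum meets the line in the reverse order.
  Reading upward strands backwards makes the sequence constant along an edge or annulus.\<close>

definition along :: "dir \<Rightarrow> 'a list \<Rightarrow> 'a list" where
  "along d x = (if d = Down then x else rev x)"

lemma along_simps [simp]: "along Down x = x" "length (along d x) = length x" "set (along d x) = set x"
  "along d (along d x) = x" "along d (rev x) = rev (along d x)" "along (opp d) x = rev (along d x)" "along d x = along d y \<longleftrightarrow> x = y"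
  by (cases d; simp add: along_def)+

lemma along_cols [simp]: "along d x \<in> cols n k \<longleftrightarrow> x \<in> cols n k"
  by (simp add: cols_def)

lemma along_wt [simp]: "cap_wt n d (along e x) = cap_wt n d x" "cup_wt n d (along e x) = cup_wt n d x"
proof -
  have "(\<Sum>c\<leftarrow>rev x. height n c) = (\<Sum>c\<leftarrow>x. height n c)" by (induction x) simp_all
  then show "cap_wt n d (along e x) = cap_wt n d x" "cup_wt n d (along e x) = cup_wt n d x"
    by (simp_all add: cap_wt_def cup_wt_def along_def)
qed

context moy begin

abbreviation "comps \<equiv> components \<Gamma>"
abbreviation "cmp \<equiv> component \<Gamma>"

lemma finite_arcs: "finite (arcs \<Gamma>)"
proof -
  have "arcs \<Gamma> = Sigma {..T} (\<lambda>t. {..<length (sl t)})" by (auto simp: arcs_def)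
  then show ?thesis by simp
qed

lemma finite_comps [simp]: "finite comps"
  unfolding components_def by (rule finite_classes[OF finite_arcs])

lemma arc_less_T: "(t, p) \<in> arcs \<Gamma> \<Longrightarrow> t < T"
  by (cases "t = T") (auto simp: arcs_def)

lemma joined_strand:
  assumes "joined \<Gamma> a b"
  shows "a \<in> arcs \<Gamma>" "b \<in> arcs \<Gamma>" "snd (strand_at \<Gamma> a) = snd (strand_at \<Gamma> b)"
proof -
  have "a \<in> arcs \<Gamma> \<and> b \<in> arcs \<Gamma> \<and> snd (strand_at \<Gamma> a) = snd (strand_at \<Gamma> b)"
    using assms
  proof (induction rule: joined.induct)
    case (left t i g p)
    then show ?case by (auto elim!: layer simp: arcs_def strand_at_def nth_append)
  next
    case (right t i g p)
    from right(1,2) obtain q s where qs: "sl t = q @ fst (moy_io g) @ s" "sl (Suc t) = q @ snd (moy_io g) @ s" "i = length q"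
      by (rule layer)
    define r where "r = p - (i + length (fst (moy_io g)))"
    have p: "p = i + length (fst (moy_io g)) + r" using right by (simp add: r_def)
    have r: "r < length s" using right(4) p qs by simp
    show ?case using right(1) r qs by (simp add: p arcs_def strand_at_def nth_append)
  next
    case (cap t i d k)
    then show ?case by (auto elim!: layer simp: arcs_def strand_at_def nth_append)
  next
    case (cup t i d k)
    then show ?case by (auto elim!: layer simp: arcs_def strand_at_def nth_append)
  qed
  then show "a \<in> arcs \<Gamma>" "b \<in> arcs \<Gamma>" "snd (strand_at \<Gamma> a) = snd (strand_at \<Gamma> b)" by auto
qed

lemma cmp_props:
  assumes "a \<in> arcs \<Gamma>"
  shows "cmp a \<in> comps" "a \<in> cmp a"
proof -
  have "\<exists>!C. C \<in> comps \<and> a \<in> C"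
    using class_exists[OF assms, of "joined \<Gamma>"] class_unique unfolding components_def by blast
  from theI'[OF this] show "cmp a \<in> comps" "a \<in> cmp a" by (simp_all add: component_def)
qed

lemma cmp_eq: "C \<in> comps \<Longrightarrow> a \<in> C \<Longrightarrow> cmp a = C"
  using cmp_props[of a] class_unique[of "cmp a" "arcs \<Gamma>" "joined \<Gamma>" C a] class_subset
  unfolding components_def by blast

lemma cmp_joined: "joined \<Gamma> a b \<Longrightarrow> cmp a = cmp b"
  using joined_strand(1,2)[of a b] cmp_props cmp_eq class_step[of "cmp a" "arcs \<Gamma>" "joined \<Gamma>" a b]
  unfolding components_def by (metis components_def)

lemma cmp_arc: "C \<in> comps \<Longrightarrow> \<exists>a \<in> arcs \<Gamma>. C = cmp a"
  using class_nonempty[of C "arcs \<Gamma>" "joined \<Gamma>"] class_subset[of C "arcs \<Gamma>" "joined \<Gamma>"] cmp_eq[of C]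
  unfolding components_def[symmetric] by blast

lemma cmp_invariant:
  assumes "C \<in> comps" "a \<in> C" "b \<in> C" "\<And>x y. joined \<Gamma> x y \<Longrightarrow> f x = f y"
  shows "f a = f b"
  using class_invariant[of C "arcs \<Gamma>" "joined \<Gamma>" a b f] assms unfolding components_def by blast

lemma label_comp:
  assumes "a \<in> arcs \<Gamma>"
  shows "label \<Gamma> (cmp a) = snd (strand_at \<Gamma> a)"
proof -
  have c: "snd (strand_at \<Gamma> b) = snd (strand_at \<Gamma> a)" if "b \<in> cmp a" for b
    using cmp_invariant[OF cmp_props(1)[OF assms] that cmp_props(2)[OF assms], of "\<lambda>b. snd (strand_at \<Gamma> b)"]
      joined_strand(3) by blast
  show ?thesis unfolding label_def
  proof (rule the_equality)
    show "\<exists>b\<in>cmp a. snd (strand_at \<Gamma> b) = snd (strand_at \<Gamma> a)" using cmp_props(2)[OF assms] by blast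
  qed (use c in auto)
qed

section \<open>Colourings of the edges and annuli\<close>

definition dir_at :: "arc \<Rightarrow> dir" where
  "dir_at a = fst (strand_at \<Gamma> a)"

definition induced :: "(arc set \<Rightarrow> nat list) \<Rightarrow> nat \<Rightarrow> nat list list" where
  "induced g t = map (\<lambda>p. along (dir_at (t, p)) (g (cmp (t, p)))) [0..<length (sl t)]"

abbreviation "colourings \<equiv> PiE comps (\<lambda>C. cols n (label \<Gamma> C))"

lemma induced_nth: "p < length (sl t) \<Longrightarrow> induced g t ! p = along (dir_at (t, p)) (g (cmp (t, p)))"
  by (simp add: induced_def)

lemma length_induced [simp]: "length (induced g t) = length (sl t)"
  by (simp add: induced_def)

lemma colouring_comp: "g \<in> colourings \<Longrightarrow> a \<in> arcs \<Gamma> \<Longrightarrow> g (cmp a) \<in> cols n (snd (strand_at \<Gamma> a))"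
  using PiE_mem[of g comps "\<lambda>C. cols n (label \<Gamma> C)" "cmp a"] by (simp add: cmp_props label_comp)

lemma induced_seqs: "g \<in> colourings \<Longrightarrow> t \<le> T \<Longrightarrow> induced g t \<in> seqs n (sl t)"
  using colouring_comp[of g] unfolding seqs_nth
  by (fastforce simp: induced_nth arcs_def strand_at_def)

definition weight :: "(arc set \<Rightarrow> nat list) \<Rightarrow> nat \<Rightarrow> laurent" where
  "weight g t = (case \<Gamma> ! t of
      (i, MCap d k) \<Rightarrow> cap_wt n d (g (cmp (Suc t, i)))
    | (i, MCup d k) \<Rightarrow> cup_wt n d (g (cmp (t, i)))
    | (i, _) \<Rightarrow>
        if distinct (g (vertex_edge \<Gamma> t 1) @ g (vertex_edge \<Gamma> t 2))
          \<and> set (g (vertex_edge \<Gamma> t 1) @ g (vertex_edge \<Gamma> t 2)) = set (g (vertex_edge \<Gamma> t 0))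
        then vertex_const n (label \<Gamma> (vertex_edge \<Gamma> t 0))
          * (- qpow 1) ^ inv_list (g (vertex_edge \<Gamma> t 1) @ g (vertex_edge \<Gamma> t 2))
          * (- qpow 1) ^ inv_list (g (vertex_edge \<Gamma> t 0))
        else 0)"

lemma weight_induced:
  assumes g: "g \<in> colourings" and t: "t < T"
  shows "layer_kernel n (\<Gamma> ! t) (induced g t) (induced g (Suc t)) = weight g t"
proof -
  obtain i h where ih: "\<Gamma> ! t = (i, h)" by fastforce
  obtain p s where ps: "sl t = p @ fst (moy_io h) @ s" "sl (Suc t) = p @ snd (moy_io h) @ s" "i = length p"
    using layer[OF t ih] .
  let ?a = "length (fst (moy_io h))" and ?b = "length (snd (moy_io h))"
  have same: "induced g (Suc t) ! q' = induced g t ! q" if "joined \<Gamma> (t, q) (Suc t, q')" "sl (Suc t) ! q' = sl t ! q" for q q'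
    using joined_strand(1,2)[OF that(1)] that(2) cmp_joined[OF that(1)]
    by (simp add: arcs_def induced_nth dir_at_def strand_at_def)
  have l: "take i (induced g (Suc t)) = take i (induced g t)"
  proof (rule nth_equalityI)
    fix q assume "q < length (take i (induced g (Suc t)))"
    then have q: "q < i" by simp
    from joined.left[OF t ih q] show "take i (induced g (Suc t)) ! q = take i (induced g t) ! q"
      using same[of q q] q ps by (simp add: nth_append)
  qed (use ps in simp)
  have r: "drop (i + ?b) (induced g (Suc t)) = drop (i + ?a) (induced g t)"
  proof (rule nth_equalityI)
    fix q assume "q < length (drop (i + ?b) (induced g (Suc t)))"
    then have q: "q < length s" using ps by simp
    have e: "i + ?a + q - ?a + ?b = i + ?b + q" by simp
    have "joined \<Gamma> (t, i + ?a + q) (Suc t, i + ?a + q - ?a + ?b)"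
      by (rule joined.right[OF t ih]) (use q ps in auto)
    then have "joined \<Gamma> (t, i + ?a + q) (Suc t, i + ?b + q)" unfolding e .
    moreover have "sl (Suc t) ! (i + ?b + q) = sl t ! (i + ?a + q)"
      using ps by (simp add: nth_append)
    ultimately have "induced g (Suc t) ! (i + ?b + q) = induced g t ! (i + ?a + q)" by (rule same)
    then show "drop (i + ?b) (induced g (Suc t)) ! q = drop (i + ?a) (induced g t) ! q"
      using q ps by simp
  qed (use ps in simp)
  have tk: "take k (drop i (induced g t')) = map (\<lambda>q. induced g t' ! (i + q)) [0..<k]" if "i + k \<le> length (sl t')" for k t'
    using that by (intro nth_equalityI) auto
  have lk: "layer_kernel n (\<Gamma> ! t) (induced g t) (induced g (Suc t))
      = piece_kernel n h (map (\<lambda>q. induced g t ! (i + q)) [0..<?a]) (map (\<lambda>q. induced g (Suc t) ! (i + q)) [0..<?b])"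
    unfolding ih layer_kernel.simps using l r tk[of ?a t] tk[of ?b "Suc t"] ps by simp
  have D: "dir_at (t', q) = fst (sl t' ! q)" for t' q by (simp add: dir_at_def strand_at_def)
  have arcs: "(t, i + q) \<in> arcs \<Gamma>" if "q < ?a" for q using that ps t by (simp add: arcs_def)
  have arcs': "(Suc t, i + q) \<in> arcs \<Gamma>" if "q < ?b" for q using that ps t by (simp add: arcs_def)
  show ?thesis
  proof (cases h)
    case (MCap d k)
    have "cmp (Suc t, i) = cmp (Suc t, Suc i)"
      by (rule cmp_joined, rule joined.cap) (use t ih MCap in auto)
    then show ?thesis
      unfolding lk using ps by (simp add: MCap weight_def ih induced_nth D nth_append)
  next
    case (MCup d k)
    have "cmp (t, i) = cmp (t, Suc i)"
      by (rule cmp_joined, rule joined.cup) (use t ih MCup in auto)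
    then show ?thesis
      unfolding lk using ps by (simp add: MCup weight_def ih induced_nth D nth_append)
  next
    case (Merge k l)
    have ve: "vertex_edge \<Gamma> t 0 = cmp (Suc t, i)" "vertex_edge \<Gamma> t (Suc 0) = cmp (t, i)" "vertex_edge \<Gamma> t 2 = cmp (t, Suc i)"
      by (simp_all add: vertex_edge_def vertex_arc_def ih Merge numeral_2_eq_2)
    have lab: "label \<Gamma> (cmp (Suc t, i)) = k + l"
      using arcs'[of 0] ps by (simp add: Merge label_comp strand_at_def nth_append)
    have g0: "g (cmp (Suc t, i)) \<in> cols n (k + l)" "g (cmp (t, i)) \<in> cols n k" "g (cmp (t, Suc i)) \<in> cols n l"
      using colouring_comp[OF g arcs'[of 0]] colouring_comp[OF g arcs[of 0]] colouring_comp[OF g arcs[of 1]] ps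
      by (simp_all add: Merge strand_at_def nth_append)
    have kl: "k + l \<le> n" using layer_fits[OF t ih] Merge by simp
    have "layer_kernel n (\<Gamma> ! t) (induced g t) (induced g (Suc t))
        = vertex_kernel n (k + l) (g (cmp (t, i)) @ g (cmp (t, Suc i))) (g (cmp (Suc t, i)))"
      unfolding lk using ps by (simp add: Merge induced_nth D nth_append)
    also have "\<dots> = weight g t"
      using g0 kl by (subst vertex_kernel_eq) (simp_all add: cols_def weight_def ih Merge ve lab)
    finally show ?thesis .
  next
    case (Split k l)
    have ve: "vertex_edge \<Gamma> t 0 = cmp (t, i)" "vertex_edge \<Gamma> t (Suc 0) = cmp (Suc t, i)" "vertex_edge \<Gamma> t 2 = cmp (Suc t, Suc i)"
      by (simp_all add: vertex_edge_def vertex_arc_def ih Split numeral_2_eq_2)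
    have lab: "label \<Gamma> (cmp (t, i)) = k + l"
      using arcs[of 0] ps by (simp add: Split label_comp strand_at_def nth_append)
    have g0: "g (cmp (t, i)) \<in> cols n (k + l)" "g (cmp (Suc t, i)) \<in> cols n k" "g (cmp (Suc t, Suc i)) \<in> cols n l"
      using colouring_comp[OF g arcs[of 0]] colouring_comp[OF g arcs'[of 0]] colouring_comp[OF g arcs'[of 1]] ps
      by (simp_all add: Split strand_at_def nth_append)
    have kl: "k + l \<le> n" using layer_fits[OF t ih] Split by simp
    have eq: "distinct x \<and> set x = set y \<longleftrightarrow> distinct y \<and> set y = set x" if "length x = length y" for x y :: "nat list"
      using that by (metis card_distinct distinct_card)
    have "layer_kernel n (\<Gamma> ! t) (induced g t) (induced g (Suc t))
        = vertex_kernel n (k + l) (g (cmp (t, i))) (g (cmp (Suc t, i)) @ g (cmp (Suc t, Suc i)))"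
      unfolding lk using ps by (simp add: Split induced_nth D nth_append)
    also have "\<dots> = weight g t"
      using g0 kl eq[of "g (cmp (t, i))" "g (cmp (Suc t, i)) @ g (cmp (Suc t, Suc i))"]
      by (subst vertex_kernel_eq) (auto simp add: cols_def weight_def ih Split ve lab mult_ac)
    finally show ?thesis .
  qed
qed

text \<open>A nonzero kernel forces equal sequences on continued strands and reversed sequences on
  the two legs of an extremum; \<open>along\<close> undoes the reversal.\<close>

lemma history_consistent:
  assumes X: "\<And>t. t \<le> T \<Longrightarrow> X t \<in> seqs n (sl t)"
    and nz: "\<And>t. t < T \<Longrightarrow> layer_kernel n (\<Gamma> ! t) (X t) (X (Suc t)) \<noteq> 0"
    and j: "joined \<Gamma> a b"
  shows "along (dir_at a) (X (fst a) ! snd a) = along (dir_at b) (X (fst b) ! snd b)"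
  using j
proof (induction rule: joined.induct)
  case (left t i g p)
  from left(1,2) obtain q s where qs: "sl t = q @ fst (moy_io g) @ s" "sl (Suc t) = q @ snd (moy_io g) @ s" "i = length q"
    by (rule layer)
  have "take i (X (Suc t)) = take i (X t)" using nz[OF left(1)] by (auto simp: left(2) split: if_splits)
  then have "X (Suc t) ! p = X t ! p" using left(3) by (metis nth_take)
  then show ?case using qs left(3) by (simp add: dir_at_def strand_at_def nth_append)
next
  case (right t i g p)
  from right(1,2) obtain q s where qs: "sl t = q @ fst (moy_io g) @ s" "sl (Suc t) = q @ snd (moy_io g) @ s" "i = length q"
    by (rule layer)
  let ?a = "length (fst (moy_io g))" and ?b = "length (snd (moy_io g))"
  define r where "r = p - (i + ?a)"
  have p: "p = i + ?a + r" "r < length s" using right(3,4) qs by (auto simp: r_def)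
  have d: "drop (i + ?b) (X (Suc t)) = drop (i + ?a) (X t)"
    using nz[OF right(1)] by (auto simp: right(2) split: if_splits)
  have len: "length (X t) = length (sl t)" "length (X (Suc t)) = length (sl (Suc t))"
    using X[of t] X[of "Suc t"] right(1) by (auto dest: seqs_length)
  have "X (Suc t) ! (i + ?b + r) = X t ! (i + ?a + r)"
    using arg_cong[OF d, of "\<lambda>z. z ! r"] len qs p(2) by simp
  moreover have m: "p - ?a + ?b = i + ?b + r" using p by simp
  ultimately show ?case unfolding m using qs p by (simp add: dir_at_def strand_at_def nth_append)
next
  case (cap t i d k)
  then obtain q s where qs: "sl t = q @ s" "sl (Suc t) = q @ [(d, k), (opp d, k)] @ s" "i = length q"
    using layer[OF cap] by auto
  have len: "length (X (Suc t)) = length (sl (Suc t))" using X[of "Suc t"] cap(1) by (auto dest: seqs_length)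
  have "X (Suc t) ! Suc i = rev (X (Suc t) ! i)"
    using nz[OF cap(1)] len qs by (auto simp: cap(2) split: if_splits)
  then show ?case using qs by (simp add: dir_at_def strand_at_def nth_append)
next
  case (cup t i d k)
  obtain q s where "sl t = q @ fst (moy_io (MCup d k)) @ s" "sl (Suc t) = q @ snd (moy_io (MCup d k)) @ s" "i = length q"
    by (rule layer[OF cup])
  then have qs: "sl (Suc t) = q @ s" "sl t = q @ [(d, k), (opp d, k)] @ s" "i = length q" by simp_all
  have len: "length (X t) = length (sl t)" using X[of t] cup(1) by (auto dest: seqs_length)
  have "X t ! Suc i = rev (X t ! i)"
    using nz[OF cup(1)] len qs by (auto simp: cup(2) split: if_splits)
  then show ?case using qs by (simp add: dir_at_def strand_at_def nth_append)
qed

text \<open>A history not induced by a colouring of the components contains a vanishing kernel, and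
  different colourings induce different histories because every component has an arc below the last
  layer boundary.\<close>

lemma moy_bracket_colourings:
  assumes "web_bracket n br" "n > 0"
  shows "moy_bracket n br \<Gamma> = (\<Sum>g\<in>colourings. \<Prod>t<T. weight g t)"
proof -
  let ?h = "\<lambda>g. restrict (induced g) {..<T}"
  let ?w = "\<lambda>X. \<Prod>t<T. layer_kernel n (\<Gamma> ! t) (X t) ((X(T := [])) (Suc t))"
  have ind: "((?h g)(T := [])) t = induced g t" if "t \<le> T" for g t
    using that by (auto simp: induced_def)
  have inj: "inj_on ?h colourings"
  proof (rule inj_onI)
    fix g g' assume g: "g \<in> colourings" "g' \<in> colourings" and eq: "?h g = ?h g'"
    show "g = g'"
    proof (rule PiE_ext[OF g])
      fix C assume "C \<in> comps"
      then obtain a where a: "a \<in> arcs \<Gamma>" "C = cmp a" using cmp_arc by blast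
      obtain t p where tp: "a = (t, p)" by fastforce
      then have "t < T" using arc_less_T a by blast
      then have "induced g t = induced g' t" using fun_cong[OF eq, of t] by simp
      then have "induced g t ! p = induced g' t ! p" by simp
      then show "g C = g' C" using a tp by (simp add: induced_nth arcs_def)
    qed
  qed
  have "moy_bracket n br \<Gamma> = (\<Sum>X\<in>histories T. ?w X)"
    by (rule moy_bracket_histories[OF assms])
  also have "\<dots> = (\<Sum>X\<in>?h ` colourings. ?w X)"
  proof (rule sum.mono_neutral_right)
    show "finite (histories T)" unfolding histories_def by (rule finite_PiE) auto
    show "?h ` colourings \<subseteq> histories T"
      unfolding histories_def using induced_seqs by (intro image_subsetI restrict_PiE_iff[THEN iffD2]) simp
    show "\<forall>X\<in>histories T - ?h ` colourings. ?w X = 0"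
    proof (rule ballI, rule ccontr)
      fix X assume X: "X \<in> histories T - ?h ` colourings" and nz: "?w X \<noteq> 0"
      let ?X = "X(T := [])"
      let ?v = "\<lambda>a. along (dir_at a) (?X (fst a) ! snd a)"
      have Xs: "?X t \<in> seqs n (sl t)" if "t \<le> T" for t
        using X that by (cases "t = T") (auto simp: histories_def)
      have "layer_kernel n (\<Gamma> ! t) (?X t) (?X (Suc t)) \<noteq> 0" if "t < T" for t
        using nz that by auto
      from history_consistent[of ?X, OF Xs this] have con: "?v a = ?v b" if "joined \<Gamma> a b" for a b
        using that by blast
      \<comment> \<open>The value is read off an arbitrary arc of the component; by consistency the
        choice does not matter.\<close>
      define g where "g = restrict (\<lambda>C. ?v (SOME a. a \<in> C)) comps"
      have gv: "g (cmp a) = ?v a" if a: "a \<in> arcs \<Gamma>" for a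
      proof -
        note c = cmp_props[OF a]
        have "(SOME b. b \<in> cmp a) \<in> cmp a" using c(2) by (rule someI)
        from cmp_invariant[of "cmp a" _ _ ?v, OF c(1) this c(2) con] show ?thesis using c(1) by (simp add: g_def)
      qed
      have "g \<in> colourings"
      proof (rule PiE_I)
        fix C assume "C \<in> comps"
        then obtain a where a: "a \<in> arcs \<Gamma>" "C = cmp a" using cmp_arc by blast
        obtain t p where tp: "a = (t, p)" by fastforce
        have "?X t ! p \<in> cols n (snd (sl t ! p))"
          using Xs[of t] a(1) by (simp add: tp arcs_def seqs_nth)
        then show "g C \<in> cols n (label \<Gamma> C)"
          using gv[OF a(1)] a tp by (simp add: label_comp strand_at_def)
      qed (simp add: g_def)
      moreover have "?h g = X"
      proof
        fix t show "?h g t = X t"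
        proof (cases "t < T")
          case True
          have "induced g t = X t"
          proof (rule nth_equalityI)
            show "length (induced g t) = length (X t)" using Xs[of t] True by (auto dest!: seqs_length)
            fix p assume "p < length (induced g t)"
            then have "(t, p) \<in> arcs \<Gamma>" using True by (simp add: arcs_def)
            from gv[OF this] show "induced g t ! p = X t ! p" using \<open>p < _\<close> True by (simp add: induced_nth)
          qed
          then show ?thesis using True by simp
        next
          case False
          then show ?thesis using X by (auto simp: histories_def PiE_def extensional_def)
        qed
      qed
      ultimately show False using X by blast
    qed
  qed
  also have "\<dots> = (\<Sum>g\<in>colourings. ?w (?h g))"
    unfolding sum.reindex[OF inj] comp_def ..
  also have "\<dots> = (\<Sum>g\<in>colourings. \<Prod>t<T. weight g t)"
  proof (intro sum.cong prod.cong refl)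
    fix g t assume "g \<in> colourings" "t \<in> {..<T}"
    then show "layer_kernel n (\<Gamma> ! t) (?h g t) (((?h g)(T := [])) (Suc t)) = weight g t"
      using ind[of "Suc t" g] weight_induced[of g t] by simp
  qed
  finally show ?thesis .
qed

end

section \<open>The two ends of an edge\<close>

context moy begin

text \<open>The arc reached through the lower end of an arc. At a minimum it is the other leg, in
  the same slice; at a vertex the walk stops.\<close>

fun bottom :: "arc \<Rightarrow> arc option" where
  "bottom (t, p) = (case \<Gamma> ! t of (i, g) \<Rightarrow>
     if p < i then Some (Suc t, p)
     else if i + length (fst (moy_io g)) \<le> p then Some (Suc t, p - length (fst (moy_io g)) + length (snd (moy_io g)))
     else (case g of MCup d k \<Rightarrow> Some (t, if p = i then Suc i else i) | _ \<Rightarrow> None))"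

fun top :: "arc \<Rightarrow> arc option" where
  "top (t, p) = (case \<Gamma> ! (t - 1) of (i, g) \<Rightarrow>
     if p < i then Some (t - 1, p)
     else if i + length (snd (moy_io g)) \<le> p then Some (t - 1, p - length (snd (moy_io g)) + length (fst (moy_io g)))
     else (case g of MCap d k \<Rightarrow> Some (t, if p = i then Suc i else i) | _ \<Rightarrow> None))"

definition next_arc :: "arc \<Rightarrow> arc option" where
  "next_arc a = (if dir_at a = Down then bottom a else top a)"

definition prev_arc :: "arc \<Rightarrow> arc option" where
  "prev_arc a = (if dir_at a = Down then top a else bottom a)"

lemma dir_at: "dir_at (t, p) = fst (sl t ! p)"
  by (simp add: dir_at_def strand_at_def)

lemma arc_pos: "(t, p) \<in> arcs \<Gamma> \<Longrightarrow> \<exists>s. t = Suc s \<and> s < T"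
  by (cases t) (auto simp: arcs_def)

text \<open>Leaving downwards, one either keeps the direction or turns at a minimum and reverses it.
  In both cases the step can be undone, which makes \<open>next_arc\<close> and
  \<open>prev_arc\<close> inverse to each other along oriented edges.\<close>

lemma bottom_cases:
  assumes a: "(t, p) \<in> arcs \<Gamma>" and b: "bottom (t, p) = Some b"
  shows "joined \<Gamma> (t, p) b \<and> top b = Some (t, p) \<and> dir_at b = dir_at (t, p) \<or>
    (joined \<Gamma> (t, p) b \<or> joined \<Gamma> b (t, p)) \<and> bottom b = Some (t, p) \<and> dir_at b = opp (dir_at (t, p))"
proof -
  have t: "t < T" by (rule arc_less_T[OF a])
  obtain i g where ig: "\<Gamma> ! t = (i, g)" by fastforce
  obtain q s where qs: "sl t = q @ fst (moy_io g) @ s" "sl (Suc t) = q @ snd (moy_io g) @ s" "i = length q"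
    using layer[OF t ig] .
  let ?a = "length (fst (moy_io g))" and ?b = "length (snd (moy_io g))"
  consider "p < i" | "i + ?a \<le> p" | "i \<le> p" "p < i + ?a" by linarith
  then show ?thesis
  proof cases
    case 1
    then have b': "b = (Suc t, p)" using b by (simp add: ig)
    show ?thesis using joined.left[OF t ig 1] 1 qs unfolding b' by (simp add: ig dir_at nth_append)
  next
    case 2
    define r where "r = p - (i + ?a)"
    have p: "p = i + ?a + r" using 2 by (simp add: r_def)
    have r: "r < length s" using a qs p by (simp add: arcs_def)
    have b': "b = (Suc t, i + ?b + r)" using b by (auto simp: ig p)
    have "joined \<Gamma> (t, p) (Suc t, p - ?a + ?b)" by (rule joined.right[OF t ig 2]) (use a in \<open>simp add: arcs_def\<close>)
    moreover have "(Suc t, p - ?a + ?b) = b" by (simp add: b' p add_ac)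
    ultimately have "joined \<Gamma> (t, p) b" by (simp only:)
    moreover have "dir_at b = dir_at (t, p)" using qs r unfolding b' by (simp add: p dir_at nth_append)
    moreover have "top b = Some (t, p)" unfolding b' by (simp add: ig p)
    ultimately show ?thesis by blast
  next
    case 3
    then obtain d k where g: "g = MCup d k" using b by (cases g) (auto simp: ig)
    have p: "p = i \<or> p = Suc i" using 3 by (auto simp: g)
    have "joined \<Gamma> (t, i) (t, Suc i)" by (rule joined.cup) (use t ig g in auto)
    then show ?thesis using p b qs by (auto simp: ig g dir_at nth_append)
  qed
qed

lemma top_cases:
  assumes a: "(t, p) \<in> arcs \<Gamma>" and b: "top (t, p) = Some b"
  shows "joined \<Gamma> b (t, p) \<and> bottom b = Some (t, p) \<and> dir_at b = dir_at (t, p) \<or>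
    (joined \<Gamma> (t, p) b \<or> joined \<Gamma> b (t, p)) \<and> top b = Some (t, p) \<and> dir_at b = opp (dir_at (t, p))"
proof -
  obtain t' where t: "t = Suc t'" "t' < T" using arc_pos[OF a] by auto
  obtain i g where ig: "\<Gamma> ! t' = (i, g)" by fastforce
  obtain q s where qs: "sl t' = q @ fst (moy_io g) @ s" "sl (Suc t') = q @ snd (moy_io g) @ s" "i = length q"
    using layer[OF t(2) ig] .
  let ?a = "length (fst (moy_io g))" and ?b = "length (snd (moy_io g))"
  consider "p < i" | "i + ?b \<le> p" | "i \<le> p" "p < i + ?b" by linarith
  then show ?thesis
  proof cases
    case 1
    then have b': "b = (t', p)" using b by (simp add: ig t(1))
    show ?thesis using joined.left[OF t(2) ig 1] 1 qs unfolding b' t(1) by (simp add: ig dir_at nth_append)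
  next
    case 2
    define r where "r = p - (i + ?b)"
    have p: "p = i + ?b + r" using 2 by (simp add: r_def)
    have r: "r < length s" using a qs p t by (simp add: arcs_def)
    have b': "b = (t', i + ?a + r)" using b by (auto simp: ig p t(1))
    have "joined \<Gamma> (t', i + ?a + r) (Suc t', i + ?a + r - ?a + ?b)"
      by (rule joined.right[OF t(2) ig]) (use r qs in auto)
    moreover have "(Suc t', i + ?a + r - ?a + ?b) = (t, p)" by (simp add: p t(1))
    ultimately have "joined \<Gamma> b (t, p)" by (simp only: b')
    moreover have "dir_at b = dir_at (t, p)" using qs r unfolding b' by (simp add: p t(1) dir_at nth_append)
    moreover have "bottom b = Some (t, p)" unfolding b' by (simp add: ig p t(1))
    ultimately show ?thesis by blast
  next
    case 3
    then obtain d k where g: "g = MCap d k" using b by (cases g) (auto simp: ig t(1))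
    have p: "p = i \<or> p = Suc i" using 3 by (auto simp: g)
    have "joined \<Gamma> (Suc t', i) (Suc t', Suc i)" by (rule joined.cap) (use t ig g in auto)
    then show ?thesis using p b qs by (auto simp: ig g t(1) dir_at nth_append)
  qed
qed

lemma joined_neighbour:
  assumes "joined \<Gamma> a b"
  shows "bottom a = Some b \<and> dir_at a = dir_at b \<and> top b = Some a \<or> top a = Some b \<and> dir_at a = opp (dir_at b) \<and> top b = Some a \<or>
    bottom a = Some b \<and> dir_at a = opp (dir_at b) \<and> bottom b = Some a"
  using assms
proof (induction rule: joined.induct)
  case (left t i g p)
  from left(1,2) obtain q s where qs: "sl t = q @ fst (moy_io g) @ s" "sl (Suc t) = q @ snd (moy_io g) @ s" "i = length q"
    by (rule layer)
  with left show ?case by (simp add: dir_at nth_append)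
next
  case (right t i g p)
  from right(1,2) obtain q s where qs: "sl t = q @ fst (moy_io g) @ s" "sl (Suc t) = q @ snd (moy_io g) @ s" "i = length q"
    by (rule layer)
  let ?a = "length (fst (moy_io g))" and ?b = "length (snd (moy_io g))"
  define r where "r = p - (i + ?a)"
  have p: "p = i + ?a + r" using right(3) by (simp add: r_def)
  have r: "r < length s" using right(4) qs p by simp
  have m: "p - ?a + ?b = i + ?b + r" using p by simp
  show ?case unfolding m using right(2) qs r by (simp add: p dir_at nth_append)
next
  case (cap t i d k)
  obtain q s where "sl t = q @ fst (moy_io (MCap d k)) @ s" "sl (Suc t) = q @ snd (moy_io (MCap d k)) @ s" "i = length q"
    by (rule layer[OF cap])
  then show ?case using cap by (simp add: dir_at nth_append)
next
  case (cup t i d k)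
  obtain q s where "sl t = q @ fst (moy_io (MCup d k)) @ s" "sl (Suc t) = q @ snd (moy_io (MCup d k)) @ s" "i = length q"
    by (rule layer[OF cup])
  then show ?case using cup by (simp add: dir_at nth_append)
qed

lemma dir_cases: "d = Down \<or> d = Up" "opp d = Up \<longleftrightarrow> d = Down" "opp d = Down \<longleftrightarrow> d = Up" "d \<noteq> Down \<longleftrightarrow> d = Up"
  by (cases d; simp)+

lemma next_prev:
  assumes "a \<in> arcs \<Gamma>" "next_arc a = Some b"
  shows "prev_arc b = Some a" "joined \<Gamma> a b \<or> joined \<Gamma> b a"
  using assms bottom_cases[of "fst a" "snd a" b] top_cases[of "fst a" "snd a" b]
  by (auto simp: next_arc_def prev_arc_def dir_cases split: if_splits)

lemma prev_next:
  assumes "a \<in> arcs \<Gamma>" "prev_arc a = Some b"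
  shows "next_arc b = Some a" "joined \<Gamma> a b \<or> joined \<Gamma> b a"
  using assms bottom_cases[of "fst a" "snd a" b] top_cases[of "fst a" "snd a" b]
  by (auto simp: next_arc_def prev_arc_def dir_cases split: if_splits)

lemma joined_next: "joined \<Gamma> a b \<Longrightarrow> next_arc a = Some b \<or> next_arc b = Some a"
  using joined_neighbour[of a b] dir_cases(1)[of "dir_at a"] dir_cases(1)[of "dir_at b"]
  by (auto simp: next_arc_def prev_arc_def)

lemma next_cmp: "a \<in> arcs \<Gamma> \<Longrightarrow> next_arc a = Some b \<Longrightarrow> b \<in> arcs \<Gamma> \<and> cmp b = cmp a"
  using next_prev(2)[of a b] joined_strand cmp_joined by metis

lemma prev_cmp: "a \<in> arcs \<Gamma> \<Longrightarrow> prev_arc a = Some b \<Longrightarrow> b \<in> arcs \<Gamma> \<and> cmp b = cmp a"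
  using prev_next(2)[of a b] joined_strand cmp_joined by metis

text \<open>An edge is the orbit of its first arc.\<close>

lemma reach_class:
  assumes a: "a \<in> arcs \<Gamma>" and start: "prev_arc a = None" and b: "b \<in> arcs \<Gamma>" "cmp b = cmp a"
  shows "(\<lambda>x y. x \<in> arcs \<Gamma> \<and> next_arc x = Some y)\<^sup>*\<^sup>* a b"
proof -
  let ?N = "\<lambda>x y. x \<in> arcs \<Gamma> \<and> next_arc x = Some y"
  have step: "?N\<^sup>*\<^sup>* a x \<longleftrightarrow> ?N\<^sup>*\<^sup>* a y" if x: "x \<in> arcs \<Gamma>" "next_arc x = Some y" for x y
  proof
    assume "?N\<^sup>*\<^sup>* a y"
    then show "?N\<^sup>*\<^sup>* a x"
    proof (cases rule: rtranclp.cases)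
      case rtrancl_refl
      then show ?thesis using next_prev(1)[OF x] start by simp
    next
      case (rtrancl_into_rtrancl z)
      then have "z = x" using next_prev(1)[OF x] next_prev(1)[of z y] by simp
      with rtrancl_into_rtrancl show ?thesis by simp
    qed
  qed (use x in \<open>auto intro: rtranclp.rtrancl_into_rtrancl\<close>)
  have "?N\<^sup>*\<^sup>* a b = ?N\<^sup>*\<^sup>* a a"
  proof (rule cmp_invariant[of "cmp a" b a "\<lambda>x. ?N\<^sup>*\<^sup>* a x"])
    fix x y assume j: "joined \<Gamma> x y"
    show "?N\<^sup>*\<^sup>* a x = ?N\<^sup>*\<^sup>* a y"
      using joined_next[OF j] step[OF joined_strand(1)[OF j], of y] step[OF joined_strand(2)[OF j], of x] by blast
  qed (use cmp_props[OF a] cmp_props[OF b(1)] b(2) in simp_all)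
  then show ?thesis by simp
qed

lemma unique_start:
  assumes "a \<in> arcs \<Gamma>" "prev_arc a = None" "b \<in> arcs \<Gamma>" "prev_arc b = None" "cmp a = cmp b"
  shows "a = b"
  using reach_class[OF assms(1,2,3) assms(5)[symmetric]]
proof (cases rule: rtranclp.cases)
  case (rtrancl_into_rtrancl z)
  then show ?thesis using next_prev(1)[of z b] assms by simp
qed simp

text \<open>The walk along \<open>next_arc\<close> is deterministic, and both ends are reached from
  the same start.\<close>

lemma unique_end:
  assumes "a \<in> arcs \<Gamma>" "prev_arc a = None" "b \<in> arcs \<Gamma>" "next_arc b = None" "c \<in> arcs \<Gamma>" "next_arc c = None"
    "cmp b = cmp a" "cmp c = cmp a"
  shows "b = c"
proof -
  let ?N = "\<lambda>x y. x \<in> arcs \<Gamma> \<and> next_arc x = Some y"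
  have "?N\<^sup>*\<^sup>* x z \<Longrightarrow> ?N\<^sup>*\<^sup>* x y \<Longrightarrow> next_arc y = None \<Longrightarrow> ?N\<^sup>*\<^sup>* z y" for x y z
  proof (induction rule: rtranclp_induct)
    case (step u v)
    then have "?N\<^sup>*\<^sup>* u y" by simp
    then show ?case
      by (cases rule: converse_rtranclpE) (use step in auto)
  qed
  from this[OF reach_class[OF assms(1,2,3,7)] reach_class[OF assms(1,2,5,8)] assms(6)]
  have "?N\<^sup>*\<^sup>* b c" .
  then show ?thesis by (cases rule: converse_rtranclpE) (use assms in auto)
qed

text \<open>Otherwise \<open>prev_arc\<close> would be an injection of the finite component into
  itself, hence onto; then \<open>b\<close> would be a predecessor and have a successor.\<close>

lemma has_start:
  assumes b: "b \<in> arcs \<Gamma>" "next_arc b = None"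
  shows "\<exists>a \<in> arcs \<Gamma>. prev_arc a = None \<and> cmp a = cmp b"
proof (rule ccontr)
  assume none: "\<not> ?thesis"
  let ?C = "{a \<in> arcs \<Gamma>. cmp a = cmp b}"
  have p: "\<exists>x. prev_arc a = Some x" if "a \<in> ?C" for a using none that by auto
  let ?f = "\<lambda>a. the (prev_arc a)"
  have "?f ` ?C \<subseteq> ?C" using p prev_cmp by fastforce
  moreover have "inj_on ?f ?C"
  proof (rule inj_onI)
    fix x y assume xy: "x \<in> ?C" "y \<in> ?C" "?f x = ?f y"
    then obtain z where "prev_arc x = Some z" "prev_arc y = Some z" using p[of x] p[of y] by auto
    then show "x = y" using prev_next(1)[of x z] prev_next(1)[of y z] xy by simp
  qed
  moreover have "finite ?C" using finite_arcs by simp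
  ultimately have "?f ` ?C = ?C" by (simp add: endo_inj_surj)
  then obtain c where "c \<in> ?C" "?f c = b" using b by (metis (mono_tags, lifting) imageE mem_Collect_eq)
  then show False using p[of c] prev_next(1)[of c b] b by auto
qed

lemma has_end:
  assumes b: "b \<in> arcs \<Gamma>" "prev_arc b = None"
  shows "\<exists>a \<in> arcs \<Gamma>. next_arc a = None \<and> cmp a = cmp b"
proof (rule ccontr)
  assume none: "\<not> ?thesis"
  let ?C = "{a \<in> arcs \<Gamma>. cmp a = cmp b}"
  have p: "\<exists>x. next_arc a = Some x" if "a \<in> ?C" for a using none that by auto
  let ?f = "\<lambda>a. the (next_arc a)"
  have "?f ` ?C \<subseteq> ?C" using p next_cmp by fastforce
  moreover have "inj_on ?f ?C"
  proof (rule inj_onI)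
    fix x y assume xy: "x \<in> ?C" "y \<in> ?C" "?f x = ?f y"
    then obtain z where "next_arc x = Some z" "next_arc y = Some z" using p[of x] p[of y] by auto
    then show "x = y" using next_prev(1)[of x z] next_prev(1)[of y z] xy by simp
  qed
  moreover have "finite ?C" using finite_arcs by simp
  ultimately have "?f ` ?C = ?C" by (simp add: endo_inj_surj)
  then obtain c where "c \<in> ?C" "?f c = b" using b by (metis (mono_tags, lifting) imageE mem_Collect_eq)
  then show False using p[of c] next_prev(1)[of c b] b by auto
qed

text \<open>The pairs of a vertex and an edge leaving it. As vertices point downwards, these are the
  edges below: \<open>e_0\<close> for a merge, \<open>e_1\<close> and \<open>e_2\<close> for a
  split.\<close>

definition out_ends :: "(nat \<times> nat) set" where
  "out_ends = {(v, j). v < T \<and> ((\<exists>i k l. \<Gamma> ! v = (i, Merge k l)) \<and> j = 0 \<or> (\<exists>i k l. \<Gamma> ! v = (i, Split k l)) \<and> j \<in> {1, 2})}"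

definition in_ends :: "(nat \<times> nat) set" where
  "in_ends = {(v, j). v < T \<and> ((\<exists>i k l. \<Gamma> ! v = (i, Merge k l)) \<and> j \<in> {1, 2} \<or> (\<exists>i k l. \<Gamma> ! v = (i, Split k l)) \<and> j = 0)}"

lemma vertices_iff: "v \<in> vertices \<Gamma> \<longleftrightarrow> v < T \<and> (\<exists>i k l. \<Gamma> ! v = (i, Merge k l) \<or> \<Gamma> ! v = (i, Split k l))"
  by (cases "\<Gamma> ! v") (auto simp: vertices_def)

lemma ends_partition: "vertices \<Gamma> \<times> {0, 1, 2} = out_ends \<union> in_ends" "out_ends \<inter> in_ends = {}"
  by (auto simp: out_ends_def in_ends_def vertices_iff)

lemma finite_ends: "finite out_ends" "finite in_ends"
proof -
  have "finite (vertices \<Gamma>)" by (rule finite_subset[of _ "{..<T}"]) (auto simp: vertices_def)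
  then have "finite (out_ends \<union> in_ends)" unfolding ends_partition(1)[symmetric] by simp
  then show "finite out_ends" "finite in_ends" by auto
qed

lemma out_end_arc:
  assumes "(v, j) \<in> out_ends"
  shows "vertex_arc \<Gamma> v j \<in> arcs \<Gamma>" "prev_arc (vertex_arc \<Gamma> v j) = None" "fst (vertex_arc \<Gamma> v j) = Suc v"
proof -
  obtain i g where ig: "\<Gamma> ! v = (i, g)" by fastforce
  have v: "v < T" using assms by (simp add: out_ends_def)
  obtain q s where "sl v = q @ fst (moy_io g) @ s" "sl (Suc v) = q @ snd (moy_io g) @ s" "i = length q"
    using layer[OF v ig] .
  then show "vertex_arc \<Gamma> v j \<in> arcs \<Gamma>" "prev_arc (vertex_arc \<Gamma> v j) = None" "fst (vertex_arc \<Gamma> v j) = Suc v"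
    using assms v by (auto simp: out_ends_def ig vertex_arc_def arcs_def prev_arc_def dir_at nth_append)
qed

lemma in_end_arc:
  assumes "(v, j) \<in> in_ends"
  shows "vertex_arc \<Gamma> v j \<in> arcs \<Gamma>" "next_arc (vertex_arc \<Gamma> v j) = None" "fst (vertex_arc \<Gamma> v j) = v"
proof -
  obtain i g where ig: "\<Gamma> ! v = (i, g)" by fastforce
  have v: "v < T" using assms by (simp add: in_ends_def)
  obtain q s where "sl v = q @ fst (moy_io g) @ s" "sl (Suc v) = q @ snd (moy_io g) @ s" "i = length q"
    using layer[OF v ig] .
  then show "vertex_arc \<Gamma> v j \<in> arcs \<Gamma>" "next_arc (vertex_arc \<Gamma> v j) = None" "fst (vertex_arc \<Gamma> v j) = v"
    using assms v by (auto simp: in_ends_def ig vertex_arc_def arcs_def next_arc_def dir_at nth_append)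
qed

lemma vertex_arc_inj: "(v, j) \<in> vertices \<Gamma> \<times> {0, 1, 2} \<Longrightarrow> (v, j') \<in> vertices \<Gamma> \<times> {0, 1, 2} \<Longrightarrow>
    vertex_arc \<Gamma> v j = vertex_arc \<Gamma> v j' \<Longrightarrow> j = j'"
  by (auto simp: vertices_iff vertex_arc_def)

lemma start_is_out_end:
  assumes a: "a \<in> arcs \<Gamma>" "prev_arc a = None"
  shows "\<exists>(v, j) \<in> out_ends. vertex_arc \<Gamma> v j = a"
proof -
  obtain t p where tp: "a = (t, p)" by fastforce
  show ?thesis
  proof (cases "dir_at a")
    case Down
    obtain t' where t: "t = Suc t'" "t' < T" using arc_pos a tp by blast
    obtain i g where ig: "\<Gamma> ! t' = (i, g)" by fastforce
    have p: "i \<le> p" "p < i + length (snd (moy_io g))"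
      using a(2) Down by (auto simp: prev_arc_def tp t ig split: if_splits)
    show ?thesis
    proof (cases g)
      case (Merge k l)
      then show ?thesis using t p ig tp by (intro bexI[of _ "(t', 0)"]) (auto simp: out_ends_def vertex_arc_def)
    next
      case (Split k l)
      then have "p = i \<or> p = Suc i" using p by auto
      then show ?thesis
      proof
        assume "p = i"
        then show ?thesis using t ig tp Split by (intro bexI[of _ "(t', 1)"]) (auto simp: out_ends_def vertex_arc_def)
      next
        assume "p = Suc i"
        then show ?thesis using t ig tp Split by (intro bexI[of _ "(t', 2)"]) (auto simp: out_ends_def vertex_arc_def)
      qed
    qed (use a(2) Down p in \<open>auto simp: prev_arc_def tp t ig\<close>)
  next
    case Up
    have t: "t < T" using arc_less_T a tp by blast
    obtain i g where ig: "\<Gamma> ! t = (i, g)" by fastforce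
    obtain q s where qs: "sl t = q @ fst (moy_io g) @ s" "i = length q"
      using layer[OF t ig] .
    have p: "i \<le> p" "p < i + length (fst (moy_io g))"
      using a(2) Up by (auto simp: prev_arc_def tp ig split: if_splits)
    then have "p = i \<or> p = Suc i" by (cases g) auto
    then have False using a(2) Up p qs by (cases g) (auto simp: prev_arc_def tp ig dir_at nth_append)
    then show ?thesis ..
  qed
qed

lemma end_is_in_end:
  assumes a: "a \<in> arcs \<Gamma>" "next_arc a = None"
  shows "\<exists>(v, j) \<in> in_ends. vertex_arc \<Gamma> v j = a"
proof -
  obtain t p where tp: "a = (t, p)" by fastforce
  show ?thesis
  proof (cases "dir_at a")
    case Down
    have t: "t < T" using arc_less_T a tp by blast
    obtain i g where ig: "\<Gamma> ! t = (i, g)" by fastforce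
    have p: "i \<le> p" "p < i + length (fst (moy_io g))"
      using a(2) Down by (auto simp: next_arc_def tp ig split: if_splits)
    show ?thesis
    proof (cases g)
      case (Split k l)
      then show ?thesis using t p ig tp by (intro bexI[of _ "(t, 0)"]) (auto simp: in_ends_def vertex_arc_def)
    next
      case (Merge k l)
      then have "p = i \<or> p = Suc i" using p by auto
      then show ?thesis
      proof
        assume "p = i"
        then show ?thesis using t ig tp Merge by (intro bexI[of _ "(t, 1)"]) (auto simp: in_ends_def vertex_arc_def)
      next
        assume "p = Suc i"
        then show ?thesis using t ig tp Merge by (intro bexI[of _ "(t, 2)"]) (auto simp: in_ends_def vertex_arc_def)
      qed
    qed (use a(2) Down p in \<open>auto simp: next_arc_def tp ig\<close>)
  next
    case Up
    obtain t' where t: "t = Suc t'" "t' < T" using arc_pos a tp by blast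
    obtain i g where ig: "\<Gamma> ! t' = (i, g)" by fastforce
    obtain q s where qs: "sl (Suc t') = q @ snd (moy_io g) @ s" "i = length q"
      using layer[OF t(2) ig] .
    have p: "i \<le> p" "p < i + length (snd (moy_io g))"
      using a(2) Up by (auto simp: next_arc_def tp t ig split: if_splits)
    then have "p = i \<or> p = Suc i" by (cases g) auto
    then have False using a(2) Up p qs by (cases g) (auto simp: next_arc_def tp t ig dir_at nth_append)
    then show ?thesis ..
  qed
qed

lemma edges_iff: "C \<in> edges \<Gamma> \<longleftrightarrow> (\<exists>(v, j) \<in> out_ends \<union> in_ends. C = cmp (vertex_arc \<Gamma> v j))"
  unfolding ends_partition(1)[symmetric] by (auto simp: edges_def vertex_edge_def)

text \<open>Outgoing ends are exactly the arcs without a predecessor. An edge has at most one of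
  them by \<open>unique_start\<close>, and at least one because it meets a vertex.\<close>

lemma out_ends_bij: "bij_betw (\<lambda>(v, j). vertex_edge \<Gamma> v j) out_ends (edges \<Gamma>)"
proof (rule bij_betwI')
  fix x y assume xy: "x \<in> out_ends" "y \<in> out_ends"
  obtain v j w k where v: "x = (v, j)" "y = (w, k)" by fastforce
  have "x = y" if "cmp (vertex_arc \<Gamma> v j) = cmp (vertex_arc \<Gamma> w k)"
  proof -
    have eq: "vertex_arc \<Gamma> v j = vertex_arc \<Gamma> w k"
      using unique_start[OF _ _ _ _ that] out_end_arc xy v by auto
    then have "v = w" using out_end_arc(3) xy v by (metis nat.inject)
    moreover have "j = k" using vertex_arc_inj[of v j k] eq \<open>v = w\<close> xy v ends_partition(1) by blast
    ultimately show ?thesis by (simp add: v)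
  qed
  then show "((case x of (v, j) \<Rightarrow> vertex_edge \<Gamma> v j) = (case y of (v, j) \<Rightarrow> vertex_edge \<Gamma> v j)) = (x = y)"
    by (auto simp: v vertex_edge_def)
next
  fix x assume "x \<in> out_ends"
  then show "(case x of (v, j) \<Rightarrow> vertex_edge \<Gamma> v j) \<in> edges \<Gamma>"
    by (cases x) (auto simp: edges_iff vertex_edge_def)
next
  fix C assume "C \<in> edges \<Gamma>"
  then obtain v j where vj: "(v, j) \<in> out_ends \<union> in_ends" "C = cmp (vertex_arc \<Gamma> v j)" by (auto simp: edges_iff)
  show "\<exists>x\<in>out_ends. C = (case x of (v, j) \<Rightarrow> vertex_edge \<Gamma> v j)"
  proof (cases "(v, j) \<in> out_ends")
    case False
    then have "(v, j) \<in> in_ends" using vj by simp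
    then obtain a where a: "a \<in> arcs \<Gamma>" "prev_arc a = None" "cmp a = C"
      using has_start in_end_arc vj(2) by metis
    then show ?thesis using start_is_out_end[OF a(1,2)] by (auto simp: vertex_edge_def)
  qed (use vj in \<open>auto simp: vertex_edge_def\<close>)
qed

lemma in_ends_bij: "bij_betw (\<lambda>(v, j). vertex_edge \<Gamma> v j) in_ends (edges \<Gamma>)"
proof (rule bij_betwI')
  fix x y assume xy: "x \<in> in_ends" "y \<in> in_ends"
  obtain v j w k where v: "x = (v, j)" "y = (w, k)" by fastforce
  have "x = y" if c: "cmp (vertex_arc \<Gamma> v j) = cmp (vertex_arc \<Gamma> w k)"
  proof -
    note i = in_end_arc[OF xy(1)[unfolded v]] in_end_arc[OF xy(2)[unfolded v]]
    obtain a where a: "a \<in> arcs \<Gamma>" "prev_arc a = None" "cmp a = cmp (vertex_arc \<Gamma> v j)"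
      using has_start[OF i(1,2)] by blast
    have eq: "vertex_arc \<Gamma> v j = vertex_arc \<Gamma> w k"
      by (rule unique_end[OF a(1,2) i(1,2) i(4,5)]) (simp_all only: a(3) c)
    then have "v = w" using i(3,6) by simp
    moreover have "j = k" using vertex_arc_inj[of v j k] eq \<open>v = w\<close> xy v ends_partition(1) by blast
    ultimately show ?thesis by (simp add: v)
  qed
  then show "((case x of (v, j) \<Rightarrow> vertex_edge \<Gamma> v j) = (case y of (v, j) \<Rightarrow> vertex_edge \<Gamma> v j)) = (x = y)"
    by (auto simp: v vertex_edge_def)
next
  fix x assume "x \<in> in_ends"
  then show "(case x of (v, j) \<Rightarrow> vertex_edge \<Gamma> v j) \<in> edges \<Gamma>"
    by (cases x) (auto simp: edges_iff vertex_edge_def)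
next
  fix C assume "C \<in> edges \<Gamma>"
  then obtain v j where vj: "(v, j) \<in> out_ends \<union> in_ends" "C = cmp (vertex_arc \<Gamma> v j)" by (auto simp: edges_iff)
  show "\<exists>x\<in>in_ends. C = (case x of (v, j) \<Rightarrow> vertex_edge \<Gamma> v j)"
  proof (cases "(v, j) \<in> in_ends")
    case False
    then have "(v, j) \<in> out_ends" using vj by simp
    then obtain a where a: "a \<in> arcs \<Gamma>" "next_arc a = None" "cmp a = C"
      using has_end out_end_arc vj(2) by metis
    then show ?thesis using end_is_in_end[OF a(1,2)] by (auto simp: vertex_edge_def)
  qed (use vj in \<open>auto simp: vertex_edge_def\<close>)
qed

text \<open>Each edge leaves one vertex end and enters one, so it occurs twice among the ends at all
  vertices. This holds for an edge with both ends at the same vertex as well.\<close>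

lemma edge_ends:
  fixes w :: "arc set \<Rightarrow> laurent"
  shows "(\<Prod>v\<in>vertices \<Gamma>. w (vertex_edge \<Gamma> v 0) * w (vertex_edge \<Gamma> v 1) * w (vertex_edge \<Gamma> v 2)) = (\<Prod>C\<in>edges \<Gamma>. w C * w C)"
proof -
  have "(\<Prod>v\<in>vertices \<Gamma>. w (vertex_edge \<Gamma> v 0) * w (vertex_edge \<Gamma> v 1) * w (vertex_edge \<Gamma> v 2))
      = (\<Prod>v\<in>vertices \<Gamma>. \<Prod>j\<in>{0, 1, 2}. w (vertex_edge \<Gamma> v j))"
    by (intro prod.cong) (auto simp: mult.assoc)
  also have "\<dots> = (\<Prod>(v, j)\<in>out_ends \<union> in_ends. w (vertex_edge \<Gamma> v j))"
    unfolding ends_partition(1)[symmetric] by (rule prod.cartesian_product)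
  also have "\<dots> = (\<Prod>(v, j)\<in>out_ends. w (vertex_edge \<Gamma> v j)) * (\<Prod>(v, j)\<in>in_ends. w (vertex_edge \<Gamma> v j))"
    by (rule prod.union_disjoint[OF finite_ends ends_partition(2)])
  also have "(\<Prod>(v, j)\<in>out_ends. w (vertex_edge \<Gamma> v j)) = (\<Prod>C\<in>edges \<Gamma>. w C)"
    using prod.reindex_bij_betw[OF out_ends_bij, of w] by (simp add: case_prod_beta)
  also have "(\<Prod>(v, j)\<in>in_ends. w (vertex_edge \<Gamma> v j)) = (\<Prod>C\<in>edges \<Gamma>. w C)"
    using prod.reindex_bij_betw[OF in_ends_bij, of w] by (simp add: case_prod_beta)
  finally show ?thesis by (simp add: prod.distrib)
qed

end

section \<open>From colourings to states\<close>

context moy begin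

lemma finite_vertices [simp]: "finite (vertices \<Gamma>)"
  by (rule finite_subset[of _ "{..<T}"]) (auto simp: vertices_def)

lemma vertex_edge_comps:
  assumes "v \<in> vertices \<Gamma>" "j \<in> {0, 1, 2}"
  shows "vertex_edge \<Gamma> v j \<in> comps"
proof -
  have "(v, j) \<in> out_ends \<union> in_ends" unfolding ends_partition(1)[symmetric] using assms by simp
  then have "vertex_arc \<Gamma> v j \<in> arcs \<Gamma>" using out_end_arc(1) in_end_arc(1) by blast
  then show ?thesis unfolding vertex_edge_def by (rule cmp_props)
qed

lemma edges_comps: "edges \<Gamma> \<subseteq> comps"
  using vertex_edge_comps unfolding edges_def by blast

lemma vertex_labels:
  assumes "v \<in> vertices \<Gamma>"
  shows "label \<Gamma> (vertex_edge \<Gamma> v 0) = label \<Gamma> (vertex_edge \<Gamma> v 1) + label \<Gamma> (vertex_edge \<Gamma> v 2)"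
    "label \<Gamma> (vertex_edge \<Gamma> v 0) \<le> n"
proof -
  obtain i g where ig: "\<Gamma> ! v = (i, g)" by fastforce
  have v: "v < T" using assms by (simp add: vertices_def)
  obtain p s where ps: "sl v = p @ fst (moy_io g) @ s" "sl (Suc v) = p @ snd (moy_io g) @ s" "i = length p"
    using layer[OF v ig] .
  have lab: "label \<Gamma> (vertex_edge \<Gamma> v j) = snd (strand_at \<Gamma> (vertex_arc \<Gamma> v j))" if "j \<in> {0, 1, 2}" for j
  proof -
    have "(v, j) \<in> out_ends \<union> in_ends" unfolding ends_partition(1)[symmetric] using assms that by simp
    then have "vertex_arc \<Gamma> v j \<in> arcs \<Gamma>" using out_end_arc(1) in_end_arc(1) by blast
    then show ?thesis unfolding vertex_edge_def by (rule label_comp)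
  qed
  have "label \<Gamma> (vertex_edge \<Gamma> v 0) = label \<Gamma> (vertex_edge \<Gamma> v 1) + label \<Gamma> (vertex_edge \<Gamma> v 2)
      \<and> label \<Gamma> (vertex_edge \<Gamma> v 0) \<le> n"
    using assms ps layer_fits[OF v ig] ig
    by (auto simp: lab vertices_iff vertex_arc_def strand_at_def nth_append)
  then show "label \<Gamma> (vertex_edge \<Gamma> v 0) = label \<Gamma> (vertex_edge \<Gamma> v 1) + label \<Gamma> (vertex_edge \<Gamma> v 2)"
    "label \<Gamma> (vertex_edge \<Gamma> v 0) \<le> n" by auto
qed

definition turn_weight :: "(arc set \<Rightarrow> nat set) \<Rightarrow> nat \<Rightarrow> laurent" where
  "turn_weight s t = (case \<Gamma> ! t of
      (i, MCap d k) \<Rightarrow> if d = Down then qpow (\<Sum>c\<in>s (cmp (Suc t, i)). height n c) else 1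
    | (i, MCup d k) \<Rightarrow> if d = Up then qpow (- (\<Sum>c\<in>s (cmp (t, i)). height n c)) else 1
    | _ \<Rightarrow> 1)"

abbreviation "vertex_sign s v \<equiv> (- qpow 1) ^ inv_pairs (s (vertex_edge \<Gamma> v 1)) (s (vertex_edge \<Gamma> v 2))"

definition orderings :: "(arc set \<Rightarrow> nat set) \<Rightarrow> (arc set \<Rightarrow> nat list) set" where
  "orderings s = PiE comps (\<lambda>C. permutations_of_set (s C))"

lemma orderings_comp: "g \<in> orderings s \<Longrightarrow> C \<in> comps \<Longrightarrow> distinct (g C) \<and> set (g C) = s C"
  unfolding orderings_def by (auto dest!: PiE_mem simp: permutations_of_set_def)

text \<open>The inversions of the concatenated sequence at a vertex are those inside the two edges
  and those between their colour sets; the latter depend on the state alone and form the sign of the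
  vertex.\<close>

lemma weight_ordering:
  assumes s: "s \<in> states n \<Gamma>" and g: "g \<in> orderings s" and t: "t < T"
  defines "w \<equiv> \<lambda>C. (- qpow 1) ^ inv_list (g C)"
  shows "weight g t = turn_weight s t * (if t \<in> vertices \<Gamma> then
      vertex_const n (label \<Gamma> (vertex_edge \<Gamma> t 0)) * vertex_sign s t
        * (w (vertex_edge \<Gamma> t 0) * w (vertex_edge \<Gamma> t 1) * w (vertex_edge \<Gamma> t 2)) else 1)"
proof (cases "t \<in> vertices \<Gamma>")
  case True
  note e = vertex_edge_comps[OF True]
  have d: "distinct (g (vertex_edge \<Gamma> t j)) \<and> set (g (vertex_edge \<Gamma> t j)) = s (vertex_edge \<Gamma> t j)" if "j \<in> {0, 1, 2}" for j
    using orderings_comp[OF g e[OF that]] .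
  have "s (vertex_edge \<Gamma> t 1) \<inter> s (vertex_edge \<Gamma> t 2) = {}"
    "s (vertex_edge \<Gamma> t 1) \<union> s (vertex_edge \<Gamma> t 2) = s (vertex_edge \<Gamma> t 0)"
    using s True by (auto simp: states_def)
  then have "distinct (g (vertex_edge \<Gamma> t 1) @ g (vertex_edge \<Gamma> t 2))
      \<and> set (g (vertex_edge \<Gamma> t 1) @ g (vertex_edge \<Gamma> t 2)) = set (g (vertex_edge \<Gamma> t 0))"
    using d[of 0] d[of 1] d[of 2] by simp
  moreover have "inv_list (g (vertex_edge \<Gamma> t 1) @ g (vertex_edge \<Gamma> t 2))
      = inv_list (g (vertex_edge \<Gamma> t 1)) + inv_list (g (vertex_edge \<Gamma> t 2))
        + inv_pairs (s (vertex_edge \<Gamma> t 1)) (s (vertex_edge \<Gamma> t 2))"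
    using d[of 1] d[of 2] by (simp add: inv_list_append_distinct)
  moreover obtain i k l where "\<Gamma> ! t = (i, Merge k l) \<or> \<Gamma> ! t = (i, Split k l)"
    using True by (auto simp: vertices_iff)
  ultimately show ?thesis
    using True by (auto simp: weight_def turn_weight_def w_def power_add mult_ac)
next
  case False
  obtain i h where ih: "\<Gamma> ! t = (i, h)" by fastforce
  obtain p r where ps: "sl t = p @ fst (moy_io h) @ r" "sl (Suc t) = p @ snd (moy_io h) @ r" "i = length p"
    using layer[OF t ih] .
  have sum: "(\<Sum>c\<leftarrow>g C. height n c) = (\<Sum>c\<in>s C. height n c)" if "C \<in> comps" for C
    using orderings_comp[OF g that] by (auto simp: sum_list_distinct_conv_sum_set)
  show ?thesis
  proof (cases h)
    case (MCap d k)
    then have "cmp (Suc t, i) \<in> comps" using ps t by (intro cmp_props) (simp add: arcs_def)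
    then show ?thesis using False MCap by (simp add: weight_def turn_weight_def ih cap_wt_def sum)
  next
    case (MCup d k)
    then have "cmp (t, i) \<in> comps" using ps t by (intro cmp_props) (simp add: arcs_def)
    then show ?thesis using False MCup by (simp add: weight_def turn_weight_def ih cup_wt_def sum)
  qed (use False t ih in \<open>auto simp: vertices_iff\<close>)
qed

lemma prod_weight_ordering:
  assumes s: "s \<in> states n \<Gamma>" and g: "g \<in> orderings s"
  shows "(\<Prod>t<T. weight g t) = (\<Prod>t<T. turn_weight s t)
    * (\<Prod>v\<in>vertices \<Gamma>. vertex_const n (label \<Gamma> (vertex_edge \<Gamma> v 0)) * vertex_sign s v)
    * (\<Prod>C\<in>edges \<Gamma>. (- qpow 1) ^ inv_list (g C) * (- qpow 1) ^ inv_list (g C))"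
proof -
  let ?w = "\<lambda>C. (- qpow 1) ^ inv_list (g C)"
  let ?u = "\<lambda>v. vertex_const n (label \<Gamma> (vertex_edge \<Gamma> v 0)) * vertex_sign s v
        * (?w (vertex_edge \<Gamma> v 0) * ?w (vertex_edge \<Gamma> v 1) * ?w (vertex_edge \<Gamma> v 2))"
  have "(\<Prod>t<T. weight g t) = (\<Prod>t<T. turn_weight s t * (if t \<in> vertices \<Gamma> then ?u t else 1))"
    by (rule prod.cong) (simp_all add: weight_ordering[OF s g])
  also have "\<dots> = (\<Prod>t<T. turn_weight s t) * (\<Prod>t<T. if t \<in> vertices \<Gamma> then ?u t else 1)"
    by (rule prod.distrib)
  also have "(\<Prod>t<T. if t \<in> vertices \<Gamma> then ?u t else 1) = prod ?u ({..<T} \<inter> vertices \<Gamma>)"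
    by (rule prod.inter_restrict[symmetric]) simp
  also have "{..<T} \<inter> vertices \<Gamma> = vertices \<Gamma>" by (auto simp: vertices_def)
  also have "prod ?u (vertices \<Gamma>) = (\<Prod>v\<in>vertices \<Gamma>. vertex_const n (label \<Gamma> (vertex_edge \<Gamma> v 0)) * vertex_sign s v)
      * (\<Prod>v\<in>vertices \<Gamma>. ?w (vertex_edge \<Gamma> v 0) * ?w (vertex_edge \<Gamma> v 1) * ?w (vertex_edge \<Gamma> v 2))"
    by (rule prod.distrib)
  finally show ?thesis unfolding edge_ends[of ?w] by (simp only: mult_ac)
qed

text \<open>At a vertex the nonzero kernel makes the colours of all three edges distinct. An annulus
  meets no vertex, and its colours are distinct because there is only one.\<close>

lemma colouring_state:
  assumes ann: "\<forall>C \<in> annuli \<Gamma>. label \<Gamma> C = 1"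
    and g: "g \<in> colourings" and nz: "\<And>t. t < T \<Longrightarrow> weight g t \<noteq> 0"
  shows "\<exists>s \<in> states n \<Gamma>. g \<in> orderings s"
proof -
  have len: "length (g C) = label \<Gamma> C" "set (g C) \<subseteq> {1..n}" if "C \<in> comps" for C
    using PiE_mem[OF g that] by (auto simp: cols_def)
  have vd: "distinct (g (vertex_edge \<Gamma> v 1) @ g (vertex_edge \<Gamma> v 2))
          \<and> set (g (vertex_edge \<Gamma> v 1) @ g (vertex_edge \<Gamma> v 2)) = set (g (vertex_edge \<Gamma> v 0))"
    if "v \<in> vertices \<Gamma>" for v
    using nz[of v] that by (auto simp: vertices_iff weight_def split: if_splits)
  have v0: "distinct (g (vertex_edge \<Gamma> v 0))" if v: "v \<in> vertices \<Gamma>" for v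
  proof -
    have "length (g (vertex_edge \<Gamma> v 1) @ g (vertex_edge \<Gamma> v 2)) = length (g (vertex_edge \<Gamma> v 0))"
      using vertex_labels(1)[OF v] vertex_edge_comps[OF v] by (simp add: len)
    then show ?thesis using vd[OF v] by (metis card_distinct distinct_card)
  qed
  have dist: "distinct (g C)" if C: "C \<in> comps" for C
  proof (cases "C \<in> edges \<Gamma>")
    case True
    then obtain v j where "v \<in> vertices \<Gamma>" "j \<in> {0, 1, 2}" "C = vertex_edge \<Gamma> v j" by (auto simp: edges_def)
    then show ?thesis using vd[of v] v0[of v] by auto
  next
    case False
    then have "length (g C) = 1" using C ann len(1) by (simp add: annuli_def)
    then show ?thesis by (auto simp: length_Suc_conv)
  qed
  let ?s = "restrict (\<lambda>C. set (g C)) comps"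
  have "?s \<in> states n \<Gamma>"
    using len dist vd vertex_edge_comps by (auto simp: states_def distinct_card)
  moreover have "g \<in> orderings ?s"
    unfolding orderings_def using g dist by (intro PiE_I) (auto simp: permutations_of_set_def PiE_def extensional_def)
  ultimately show ?thesis by blast
qed

lemma state_comp: "s \<in> states n \<Gamma> \<Longrightarrow> C \<in> comps \<Longrightarrow> s C \<subseteq> {1..n} \<and> card (s C) = label \<Gamma> C \<and> finite (s C)"
  unfolding states_def by (auto dest!: PiE_mem intro: finite_subset)

lemma finite_states [simp]: "finite (states n \<Gamma>)"
  by (rule finite_subset[of _ "comps \<rightarrow>\<^sub>E Pow {1..n}"]) (auto simp: states_def intro!: finite_PiE)

lemma finite_orderings: "s \<in> states n \<Gamma> \<Longrightarrow> finite (orderings s)"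
  unfolding orderings_def by (rule finite_PiE) (use state_comp in auto)

lemma sum_colourings:
  assumes ann: "\<forall>C \<in> annuli \<Gamma>. label \<Gamma> C = 1"
  shows "(\<Sum>g\<in>colourings. \<Prod>t<T. weight g t) = (\<Sum>s\<in>states n \<Gamma>. \<Sum>g\<in>orderings s. \<Prod>t<T. weight g t)"
proof -
  have "(\<Sum>g\<in>colourings. \<Prod>t<T. weight g t) = (\<Sum>g\<in>(\<Union>s\<in>states n \<Gamma>. orderings s). \<Prod>t<T. weight g t)"
  proof (rule sum.mono_neutral_right)
    show "finite colourings" by (rule finite_PiE) auto
    show "(\<Union>s\<in>states n \<Gamma>. orderings s) \<subseteq> colourings"
    proof (rule UN_least, rule subsetI, rule PiE_I)
      fix s g C assume s: "s \<in> states n \<Gamma>" and g: "g \<in> orderings s"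
      show "g C \<in> cols n (label \<Gamma> C)" if "C \<in> comps"
        using orderings_comp[OF g that] state_comp[OF s that] distinct_card[of "g C"] by (auto simp: cols_def)
      show "g C = undefined" if "C \<notin> comps"
        using g that by (auto simp: orderings_def)
    qed
    show "\<forall>g\<in>colourings - (\<Union>s\<in>states n \<Gamma>. orderings s). (\<Prod>t<T. weight g t) = 0"
    proof (rule ballI, rule ccontr)
      fix g assume g: "g \<in> colourings - (\<Union>s\<in>states n \<Gamma>. orderings s)" and nz: "(\<Prod>t<T. weight g t) \<noteq> 0"
      then have "weight g t \<noteq> 0" if "t < T" for t using that by auto
      from colouring_state[OF ann _ this] show False using g by blast
    qed
  qed
  also have "\<dots> = (\<Sum>s\<in>states n \<Gamma>. \<Sum>g\<in>orderings s. \<Prod>t<T. weight g t)"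
  proof (rule sum.UNION_disjoint)
    show "\<forall>s\<in>states n \<Gamma>. \<forall>s'\<in>states n \<Gamma>. s \<noteq> s' \<longrightarrow> orderings s \<inter> orderings s' = {}"
    proof (intro ballI impI, rule ccontr)
      fix s s' assume s: "s \<in> states n \<Gamma>" "s' \<in> states n \<Gamma>" "s \<noteq> s'" "orderings s \<inter> orderings s' \<noteq> {}"
      then obtain g where g: "g \<in> orderings s" "g \<in> orderings s'" by blast
      have "s = s'"
      proof (rule PiE_ext)
        show "s \<in> comps \<rightarrow>\<^sub>E Pow {1..n}" "s' \<in> comps \<rightarrow>\<^sub>E Pow {1..n}" using s by (auto simp: states_def)
        show "s C = s' C" if "C \<in> comps" for C using orderings_comp[OF g(1) that] orderings_comp[OF g(2) that] by simp
      qed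
      then show False using s by simp
    qed
  qed (simp_all add: finite_orderings)
  finally show ?thesis .
qed

text \<open>The orderings of different components are independent, so the sum factors. An edge
  carries its inversions once for each end and yields a Poincare polynomial in q^2; an annulus with
  one colour has one ordering.\<close>

lemma sum_orderings:
  assumes ann: "\<forall>C \<in> annuli \<Gamma>. label \<Gamma> C = 1" and s: "s \<in> states n \<Gamma>"
  shows "(\<Sum>g\<in>orderings s. \<Prod>C\<in>edges \<Gamma>. (- qpow 1) ^ inv_list (g C) * (- qpow 1) ^ inv_list (g C))
    = (\<Prod>C\<in>edges \<Gamma>. qpow (of_nat (label \<Gamma> C) * (of_nat (label \<Gamma> C) - 1) / 2) * qfact (label \<Gamma> C))"
proof -
  let ?f = "\<lambda>x :: nat list. (- qpow 1) ^ inv_list x * (- qpow 1) ^ inv_list x"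
  let ?w = "\<lambda>C x. if C \<in> edges \<Gamma> then ?f x else 1"
  have e: "(\<Prod>C\<in>edges \<Gamma>. F C) = (\<Prod>C\<in>comps. if C \<in> edges \<Gamma> then F C else 1)" for F :: "arc set \<Rightarrow> laurent"
    using prod.inter_restrict[OF finite_comps, of F "edges \<Gamma>"] edges_comps by (simp add: Int_absorb1)
  have "(\<Sum>g\<in>orderings s. \<Prod>C\<in>edges \<Gamma>. ?f (g C)) = (\<Sum>g\<in>orderings s. \<Prod>C\<in>comps. ?w C (g C))"
    unfolding e ..
  also have "\<dots> = (\<Prod>C\<in>comps. \<Sum>x\<in>permutations_of_set (s C). ?w C x)"
    unfolding orderings_def by (rule prod_sum_PiE[symmetric]) (use state_comp[OF s] in auto)
  also have "\<dots> = (\<Prod>C\<in>comps. if C \<in> edges \<Gamma>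
      then qpow (of_nat (label \<Gamma> C) * (of_nat (label \<Gamma> C) - 1) / 2) * qfact (label \<Gamma> C) else 1)"
  proof (rule prod.cong[OF refl])
    fix C assume C: "C \<in> comps"
    note sC = state_comp[OF s C]
    show "(\<Sum>x\<in>permutations_of_set (s C). ?w C x) = (if C \<in> edges \<Gamma>
      then qpow (of_nat (label \<Gamma> C) * (of_nat (label \<Gamma> C) - 1) / 2) * qfact (label \<Gamma> C) else 1)"
    proof (cases "C \<in> edges \<Gamma>")
      case True
      then show ?thesis using poincare[of "s C"] sC by (simp add: asum_def)
    next
      case False
      then have "card (s C) = 1" using C ann sC by (simp add: annuli_def)
      then show ?thesis using False sC by simp
    qed
  qed
  also have "\<dots> = (\<Prod>C\<in>edges \<Gamma>. qpow (of_nat (label \<Gamma> C) * (of_nat (label \<Gamma> C) - 1) / 2) * qfact (label \<Gamma> C))"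
    unfolding e ..
  finally show ?thesis .
qed

text \<open>The powers of \<open>q\<close> contributed by the orderings of an edge are distributed evenly to its two
  ends.\<close>

lemma normalization_eq:
  "(\<Prod>v\<in>vertices \<Gamma>. vertex_const n (label \<Gamma> (vertex_edge \<Gamma> v 0)))
     * (\<Prod>C\<in>edges \<Gamma>. qpow (of_nat (label \<Gamma> C) * (of_nat (label \<Gamma> C) - 1) / 2) * qfact (label \<Gamma> C))
   = normalization n \<Gamma>"
proof -
  let ?l = "\<lambda>v j. rat_of_nat (label \<Gamma> (vertex_edge \<Gamma> v j))"
  let ?w = "\<lambda>C. qpow (of_nat (label \<Gamma> C) * (of_nat (label \<Gamma> C) - 1) / 4)"
  have "(\<Prod>C\<in>edges \<Gamma>. qpow (of_nat (label \<Gamma> C) * (of_nat (label \<Gamma> C) - 1) / 2) * qfact (label \<Gamma> C))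
      = (\<Prod>C\<in>edges \<Gamma>. ?w C * ?w C) * (\<Prod>C\<in>edges \<Gamma>. qfact (label \<Gamma> C))"
    unfolding prod.distrib[symmetric] qpow_mult
    by (intro prod.cong refl arg_cong2[of _ _ _ _ "(*)"] arg_cong[of _ _ qpow]) simp
  also have "(\<Prod>C\<in>edges \<Gamma>. ?w C * ?w C)
      = (\<Prod>v\<in>vertices \<Gamma>. ?w (vertex_edge \<Gamma> v 0) * ?w (vertex_edge \<Gamma> v 1) * ?w (vertex_edge \<Gamma> v 2))"
    by (rule edge_ends[of ?w, symmetric])
  finally have "(\<Prod>v\<in>vertices \<Gamma>. vertex_const n (label \<Gamma> (vertex_edge \<Gamma> v 0)))
     * (\<Prod>C\<in>edges \<Gamma>. qpow (of_nat (label \<Gamma> C) * (of_nat (label \<Gamma> C) - 1) / 2) * qfact (label \<Gamma> C))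
     = (\<Prod>C\<in>edges \<Gamma>. qfact (label \<Gamma> C)) * (\<Prod>v\<in>vertices \<Gamma>. vertex_const n (label \<Gamma> (vertex_edge \<Gamma> v 0))
        * (?w (vertex_edge \<Gamma> v 0) * ?w (vertex_edge \<Gamma> v 1) * ?w (vertex_edge \<Gamma> v 2)))"
    by (simp only: prod.distrib mult_ac)
  also have "(\<Prod>v\<in>vertices \<Gamma>. vertex_const n (label \<Gamma> (vertex_edge \<Gamma> v 0))
        * (?w (vertex_edge \<Gamma> v 0) * ?w (vertex_edge \<Gamma> v 1) * ?w (vertex_edge \<Gamma> v 2)))
      = (\<Prod>v\<in>vertices \<Gamma>. qpow ((of_nat n * (of_nat n - 1) - ?l v 1 * ?l v 2) / 2)
          * qfact (n - label \<Gamma> (vertex_edge \<Gamma> v 0)))"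
  proof (rule prod.cong[OF refl])
    fix v assume v: "v \<in> vertices \<Gamma>"
    have m: "rat_of_nat (n - label \<Gamma> (vertex_edge \<Gamma> v 0)) = of_nat n - (?l v 1 + ?l v 2)" "?l v 0 = ?l v 1 + ?l v 2"
      using vertex_labels[OF v] by (simp_all add: of_nat_diff)
    have q: "qpow x * b * (qpow y * qpow z * qpow u) = qpow (x + (y + z + u)) * b" for x y z u b
      by (simp add: qpow_mult[symmetric] mult_ac)
    have "vertex_const n (label \<Gamma> (vertex_edge \<Gamma> v 0))
        * (?w (vertex_edge \<Gamma> v 0) * ?w (vertex_edge \<Gamma> v 1) * ?w (vertex_edge \<Gamma> v 2))
      = qpow ((?l v 0 * of_nat (n - label \<Gamma> (vertex_edge \<Gamma> v 0))
          + of_nat (n - label \<Gamma> (vertex_edge \<Gamma> v 0)) * (of_nat (n - label \<Gamma> (vertex_edge \<Gamma> v 0)) - 1) / 2)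
          + (?l v 0 * (?l v 0 - 1) / 4 + ?l v 1 * (?l v 1 - 1) / 4 + ?l v 2 * (?l v 2 - 1) / 4))
        * qfact (n - label \<Gamma> (vertex_edge \<Gamma> v 0))"
      unfolding vertex_const_def by (rule q)
    \<comment> \<open>With s the label of \<open>e_0\<close>, the vertex contributes (n(n - 1) - s(s
      - 1))/2 and the three edge ends contribute s(s - 1)/2 minus half the product of the labels of
      \<open>e_1\<close> and \<open>e_2\<close>.\<close>
    also have "(?l v 0 * of_nat (n - label \<Gamma> (vertex_edge \<Gamma> v 0))
          + of_nat (n - label \<Gamma> (vertex_edge \<Gamma> v 0)) * (of_nat (n - label \<Gamma> (vertex_edge \<Gamma> v 0)) - 1) / 2)
          + (?l v 0 * (?l v 0 - 1) / 4 + ?l v 1 * (?l v 1 - 1) / 4 + ?l v 2 * (?l v 2 - 1) / 4)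
        = (of_nat n * (of_nat n - 1) - ?l v 1 * ?l v 2) / 2"
      unfolding m by (simp add: field_simps)
    finally show "vertex_const n (label \<Gamma> (vertex_edge \<Gamma> v 0))
        * (?w (vertex_edge \<Gamma> v 0) * ?w (vertex_edge \<Gamma> v 1) * ?w (vertex_edge \<Gamma> v 2))
      = qpow ((of_nat n * (of_nat n - 1) - ?l v 1 * ?l v 2) / 2) * qfact (n - label \<Gamma> (vertex_edge \<Gamma> v 0))" .
  qed
  finally show ?thesis unfolding normalization_def .
qed

lemma moy_bracket_states:
  assumes "web_bracket n br" "n > 0" and ann: "\<forall>C \<in> annuli \<Gamma>. label \<Gamma> C = 1"
  shows "moy_bracket n br \<Gamma> = normalization n \<Gamma> *
    (\<Sum>s\<in>states n \<Gamma>. (\<Prod>t<T. turn_weight s t) * (\<Prod>v\<in>vertices \<Gamma>. vertex_sign s v))"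
proof -
  have "(\<Sum>g\<in>orderings s. \<Prod>t<T. weight g t)
      = normalization n \<Gamma> * ((\<Prod>t<T. turn_weight s t) * (\<Prod>v\<in>vertices \<Gamma>. vertex_sign s v))"
    if s: "s \<in> states n \<Gamma>" for s
  proof -
    have "(\<Sum>g\<in>orderings s. \<Prod>t<T. weight g t) = (\<Prod>t<T. turn_weight s t)
        * (\<Prod>v\<in>vertices \<Gamma>. vertex_const n (label \<Gamma> (vertex_edge \<Gamma> v 0)) * vertex_sign s v)
        * (\<Sum>g\<in>orderings s. \<Prod>C\<in>edges \<Gamma>. (- qpow 1) ^ inv_list (g C) * (- qpow 1) ^ inv_list (g C))"
      unfolding sum_distrib_left by (rule sum.cong[OF refl]) (rule prod_weight_ordering[OF s])
    then show ?thesis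
      unfolding sum_orderings[OF ann s] normalization_eq[symmetric] prod.distrib[of _ _ "vertices \<Gamma>"]
      by (simp only: mult_ac)
  qed
  then show ?thesis
    unfolding moy_bracket_colourings[OF assms(1,2)] sum_colourings[OF ann] sum_distrib_left
    by (rule sum.cong[OF refl])
qed

end

section \<open>Sweeping simple closed curves\<close>

text \<open>The part of a family of disjoint simple closed curves above a horizontal line consists of
  closed curves and of arches with two ends on the line. A curve or arch is named by the left leg
  of its highest maximum. In \<open>matched \<delta> b d Q m\<close> the line meets the arches at the points of \<open>Q\<close>,
  \<open>m\<close> exchanges the two ends of an arch, \<open>b p\<close> is the name of the arch ending at \<open>p\<close>, and \<open>d p\<close> and
  \<open>\<delta> a\<close> are the directions at \<open>p\<close> and at the arc \<open>a\<close>.\<close>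

definition matched :: "(arc \<Rightarrow> dir) \<Rightarrow> (nat \<Rightarrow> arc) \<Rightarrow> (nat \<Rightarrow> dir) \<Rightarrow> nat set \<Rightarrow> (nat \<Rightarrow> nat) \<Rightarrow> bool" where
  "matched \<delta> b d Q m \<longleftrightarrow>
    (\<forall>p \<in> Q. m p \<in> Q \<and> m p \<noteq> p \<and> m (m p) = p \<and> d (m p) = opp (d p) \<and> b (m p) = b p \<and>
       (p < m p \<longrightarrow> \<delta> (b p) = d p)) \<and>
    (\<forall>p \<in> Q. \<forall>q \<in> Q. b p = b q \<longrightarrow> q = p \<or> q = m p) \<and>
    (\<forall>p \<in> Q. \<forall>q \<in> Q. p < q \<and> q < m p \<longrightarrow> p < m q \<and> m q < m p \<and> fst (b p) < fst (b q))"

lemma matchedD: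
  assumes "matched \<delta> b d Q m" "p \<in> Q"
  shows "m p \<in> Q" "m p \<noteq> p" "m (m p) = p" "d (m p) = opp (d p)" "b (m p) = b p" "p < m p \<Longrightarrow> \<delta> (b p) = d p"
    "q \<in> Q \<Longrightarrow> b p = b q \<Longrightarrow> q = p \<or> q = m p"
    "q \<in> Q \<Longrightarrow> p < q \<Longrightarrow> q < m p \<Longrightarrow> p < m q" "q \<in> Q \<Longrightarrow> p < q \<Longrightarrow> q < m p \<Longrightarrow> m q < m p"
    "q \<in> Q \<Longrightarrow> p < q \<Longrightarrow> q < m p \<Longrightarrow> fst (b p) < fst (b q)"
  using assms unfolding matched_def by blast+

lemma opp_simps [simp]: "opp d \<noteq> d" "d \<noteq> opp d" "opp d = Up \<longleftrightarrow> d = Down" "opp d = Down \<longleftrightarrow> d = Up"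
  by (cases d; simp)+

section \<open>The matching under passages, maxima and minima\<close>

lemma matched_reindex:
  assumes M: "matched \<delta> b d Q m" and f: "strict_mono_on Q f"
    and b': "\<And>p. p \<in> Q \<Longrightarrow> b' (f p) = b p" and d': "\<And>p. p \<in> Q \<Longrightarrow> d' (f p) = d p"
  shows "\<exists>m'. matched \<delta> b' d' (f ` Q) m'"
proof -
  have inj: "inj_on f Q" using f by (rule strict_mono_on_imp_inj_on)
  have less: "f p < f q \<longleftrightarrow> p < q" if "p \<in> Q" "q \<in> Q" for p q
    using f that by (rule strict_mono_on_less)
  have eq: "f p = f q \<longleftrightarrow> p = q" if "p \<in> Q" "q \<in> Q" for p q
    using inj that by (rule inj_on_eq_iff)
  define m' where "m' = (\<lambda>p. f (m (inv_into Q f p)))"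
  have m': "m' (f p) = f (m p)" if "p \<in> Q" for p using that inj by (simp add: m'_def)
  note D = matchedD[OF M]
  have "matched \<delta> b' d' (f ` Q) m'"
    unfolding matched_def ball_simps
  proof (intro conjI ballI impI)
    fix p assume p: "p \<in> Q"
    note Dp = D(1-6)[OF p]
    show "m' (f p) \<in> f ` Q" "m' (f p) \<noteq> f p" "m' (m' (f p)) = f p" "d' (m' (f p)) = opp (d' (f p))" "b' (m' (f p)) = b' (f p)"
      using Dp p by (simp_all add: m' eq b' d')
    show "\<delta> (b' (f p)) = d' (f p)" if "f p < m' (f p)" using that Dp p by (simp add: m' less b' d')
    fix q assume q: "q \<in> Q"
    show "f q = f p \<or> f q = m' (f p)" if "b' (f p) = b' (f q)"
      using that D(7)[OF p q] p q by (auto simp: b' m')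
    note Dq = D(1-6)[OF q]
    assume a: "f p < f q \<and> f q < m' (f p)"
    then have "p < q" "q < m p" using Dp p q by (simp_all add: m' less)
    from D(8-10)[OF p q this] show "f p < m' (f q)" "m' (f q) < m' (f p)" "fst (b' (f p)) < fst (b' (f q))"
      using p q Dp Dq by (simp_all add: m' less b')
  qed
  then show ?thesis by blast
qed

lemma matched_cap:
  assumes M: "matched \<delta> b d Q m" and i: "i \<notin> Q" "Suc i \<notin> Q"
    and new: "\<And>p. p \<in> Q \<Longrightarrow> fst (b p) < fst x" "\<delta> x = d i" "d (Suc i) = opp (d i)"
  shows "\<exists>m'. matched \<delta> (b(i := x, Suc i := x)) d (insert i (insert (Suc i) Q)) m'"
proof -
  let ?m = "m(i := Suc i, Suc i := i)"
  let ?b = "b(i := x, Suc i := x)"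
  note D = matchedD[OF M]
  have ne: "p \<noteq> i" "p \<noteq> Suc i" "m p \<noteq> i" "m p \<noteq> Suc i" if "p \<in> Q" for p using i D(1)[OF that] that by auto
  have neb: "b p \<noteq> x" "x \<noteq> b p" if "p \<in> Q" for p using new(1)[OF that] by auto
  have old: "?m p = m p" "?b p = b p" if "p \<in> Q" for p using ne[OF that] by simp_all
  have "matched \<delta> ?b d (insert i (insert (Suc i) Q)) ?m"
    unfolding matched_def
  proof (intro conjI ballI impI)
    fix p assume "p \<in> insert i (insert (Suc i) Q)"
    then consider "p = i" | "p = Suc i" | "p \<in> Q" by blast
    note p = this
    show "?m p \<in> insert i (insert (Suc i) Q)" "?m p \<noteq> p" "?m (?m p) = p" "d (?m p) = opp (d p)" "?b (?m p) = ?b p"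
      using new D(1-5)[of p] ne[of p] by (cases rule: p; simp)+
    show "\<delta> (?b p) = d p" if "p < ?m p"
      using that new D(6)[of p] ne[of p] by (cases rule: p; simp)
    fix q assume "q \<in> insert i (insert (Suc i) Q)"
    then consider "q = i" | "q = Suc i" | "q \<in> Q" by blast
    note q = this
    show "q = p \<or> q = ?m p" if "?b p = ?b q"
      using that D(7)[of p q] ne[of p] ne[of q] neb[of p] neb[of q] by (cases rule: p; cases rule: q; simp)
    assume a: "p < q \<and> q < ?m p"
    have "p < ?m q \<and> ?m q < ?m p \<and> fst (?b p) < fst (?b q)"
      using a D(8-10)[of p q] ne[of p] ne[of q] new(1)[of p] D(1)[of q] by (cases rule: p; cases rule: q; simp; linarith)
    then show "p < ?m q" "?m q < ?m p" "fst (?b p) < fst (?b q)" by auto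
  qed
  then show ?thesis by blast
qed

lemma matched_close:
  assumes M: "matched \<delta> b d Q m" and i: "i \<in> Q" "m i = j"
  shows "matched \<delta> b d (Q - {i, j}) m"
proof -
  note D = matchedD[OF M]
  have j: "j \<in> Q" "m j = i" using D(1,3)[OF i(1)] i(2) by auto
  have "m p \<in> Q - {i, j}" if "p \<in> Q - {i, j}" for p
    using D(1,3)[of p] i j that by auto
  then show ?thesis using M unfolding matched_def by (auto simp del: Diff_insert)
qed

text \<open>A minimum with legs \<open>i\<close> and \<open>j\<close> joins two different arches; no
  other end lies between the legs. The far ends \<open>m i\<close> and \<open>m j\<close> become the
  ends of one arch, which keeps the name of the higher maximum.\<close>

locale merging =
  fixes \<delta> :: "arc \<Rightarrow> dir" and b :: "nat \<Rightarrow> arc" and d :: "nat \<Rightarrow> dir" and Q m i j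
  assumes M: "matched \<delta> b d Q m"
    and ij: "i \<in> Q" "j \<in> Q" "i < j" "m i \<noteq> j" "d j = opp (d i)"
    and between: "\<And>p. p \<in> Q \<Longrightarrow> i < p \<Longrightarrow> p < j \<Longrightarrow> False"
    and inj: "inj_on fst (b ` Q)"
begin

abbreviation "i' \<equiv> m i"
abbreviation "j' \<equiv> m j"

definition kept :: arc where "kept = (if fst (b i) < fst (b j) then b i else b j)"
definition lost :: arc where "lost = (if fst (b i) < fst (b j) then b j else b i)"

definition b' :: "nat \<Rightarrow> arc" where "b' p = (if b p = lost then kept else b p)"
definition m' :: "nat \<Rightarrow> nat" where "m' = m(i' := j', j' := i')"

lemmas D = matchedD[OF M]

lemma partners: "i' \<in> Q" "j' \<in> Q" "m i' = i" "m j' = j" "b i' = b i" "b j' = b j" "d i' = opp (d i)" "d j' = d i"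
    "i' \<noteq> i" "i' \<noteq> j" "j' \<noteq> i" "j' \<noteq> j" "i' \<noteq> j'"
proof -
  show "i' \<in> Q" "j' \<in> Q" "m i' = i" "m j' = j" "b i' = b i" "b j' = b j" "d i' = opp (d i)" "d j' = d i" "i' \<noteq> i" "i' \<noteq> j" "j' \<noteq> j"
    using D(1-5)[OF ij(1)] D(1-5)[OF ij(2)] ij by auto
  then show "j' \<noteq> i" "i' \<noteq> j'" using ij(3) by auto
qed

lemma fst_ne: "fst (b i) \<noteq> fst (b j)"
proof
  assume "fst (b i) = fst (b j)"
  then have "b i = b j" using inj ij(1,2) by (auto dest: inj_onD)
  then show False using D(7)[OF ij(1,2)] ij by simp
qed

lemma kept_lost: "fst kept \<le> fst (b i)" "fst kept \<le> fst (b j)" "fst kept < fst lost" "{kept, lost} = {b i, b j}" "kept \<noteq> lost"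
  using fst_ne by (auto simp: kept_def lost_def)

lemma other:
  assumes "p \<in> Q - {i, j}" "p \<noteq> i'" "p \<noteq> j'"
  shows "m p \<in> Q" "m p \<notin> {i, j, i', j'}" "m' p = m p" "b p \<noteq> b i" "b p \<noteq> b j" "b' p = b p"
proof -
  show "m p \<in> Q" using D(1) assms by simp
  show "m p \<notin> {i, j, i', j'}" using D(3)[of p] assms partners by auto
  show "m' p = m p" using assms by (simp add: m'_def)
  show "b p \<noteq> b i" "b p \<noteq> b j" using D(7)[OF ij(1), of p] D(7)[OF ij(2), of p] assms by auto
  then show "b' p = b p" using kept_lost(4) by (auto simp: b'_def)
qed

lemma new_values: "m' i' = j'" "m' j' = i'" "b' i' = kept" "b' j' = kept"
  using partners kept_lost(4) fst_ne by (auto simp: m'_def b'_def kept_def lost_def)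

text \<open>Disjoint arches with neighbouring ends \<open>i\<close> and \<open>j\<close> lie side by
  side or one inside the other. An inner arch has the lower maximum, so in the nested cases its name
  is the one lost.\<close>

lemma orders: "i' < i \<and> j < j' \<or> j < j' \<and> j' < i' \<and> kept = b i \<and> lost = b j \<or> j' < i' \<and> i' < i \<and> kept = b j \<and> lost = b i"
proof -
  have i: "i' < i \<or> j < i'" using between[OF partners(1)] partners(9,10) by (meson linorder_neqE_nat)
  have j: "j' < i \<or> j < j'" using between[OF partners(2)] partners(11,12) by (meson linorder_neqE_nat)
  have 1: "j' < i' \<and> fst (b i) < fst (b j)" if "j < i'" using D(9,10)[OF ij(1,2,3) that] by simp
  have 2: "j' < i' \<and> fst (b j) < fst (b i)" if "j' < i"
    using D(8,10)[OF partners(2) ij(1) that] partners(4,6) ij(3) by simp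
  have 3: "i < j'" if "j < i'" using D(8)[OF ij(1,2,3) that] .
  show ?thesis using i j 1 2 3 ij(3) by (auto simp: kept_def lost_def)
qed

text \<open>In each of the three configurations the lost maximum is the one cancelled by the minimum
  when the curve is pulled tight: its left leg and that of the minimum have opposite directions. The
  kept name points as the left end of the joined arch.\<close>

lemma lost_dir: "\<delta> lost = opp (d i)" and kept_dir: "i' < j' \<Longrightarrow> \<delta> kept = d i'" "j' < i' \<Longrightarrow> \<delta> kept = d j'"
proof -
  have x: "i < i' \<Longrightarrow> \<delta> (b i) = d i" "i' < i \<Longrightarrow> \<delta> (b i) = opp (d i)" "j < j' \<Longrightarrow> \<delta> (b j) = opp (d i)" "j' < j \<Longrightarrow> \<delta> (b j) = d i"
    using D(6)[OF ij(1)] D(6)[OF partners(1)] D(6)[OF ij(2)] D(6)[OF partners(2)] partners ij by simp_all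
  have k: "kept = b i \<or> kept = b j" "lost = b i \<or> lost = b j" by (auto simp: kept_def lost_def)
  show "\<delta> lost = opp (d i)" using orders x k ij(3) by fastforce
  show "\<delta> kept = d i'" if "i' < j'" using orders x k ij(3) that partners(7) by fastforce
  show "\<delta> kept = d j'" if "j' < i'" using orders x k ij(3) that partners(8) by fastforce
qed

text \<open>An arch enclosing one of the far ends encloses \<open>i\<close> or \<open>j\<close>
  since arches do not cross, hence both since no end lies between them, and hence both
  arches.\<close>

lemma nested_old:
  assumes p: "p \<in> Q - {i, j}" "p \<noteq> i'" "p \<noteq> j'" and q: "q = i' \<or> q = j'" "p < q" "q < m p"
  shows "p < i' \<and> i' < m p \<and> p < j' \<and> j' < m p \<and> fst (b p) < fst kept"
proof -
  note o = other[OF p]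
  have Qp: "p \<in> Q" using p by simp
  have "p < i \<and> i < m p \<or> p < j \<and> j < m p"
    using D(8,9)[OF Qp partners(1)] D(8,9)[OF Qp partners(2)] q partners(3,4) by auto
  then have "p < i \<and> i < m p" "p < j \<and> j < m p"
    using between[OF Qp] between[OF o(1)] o(2) p(1) ij(3) by (fastforce simp: not_less_iff_gr_or_eq)+
  then show ?thesis
    using D(8-10)[OF Qp ij(1)] D(8-10)[OF Qp ij(2)] by (auto simp: kept_def)
qed

text \<open>If the arches lie side by side, \<open>q\<close> is under one of them. If they are
  nested, \<open>q\<close> is under the outer one and its partner cannot pass to the other side of
  the inner one.\<close>

lemma nested_new:
  assumes q: "q \<in> Q - {i, j}" "q \<noteq> i'" "q \<noteq> j'" and p: "p < q" "q < p'" "p = i' \<and> p' = j' \<or> p = j' \<and> p' = i'"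
  shows "p < m q \<and> m q < p' \<and> fst kept < fst (b q)"
proof -
  note o = other[OF q]
  have Qq: "q \<in> Q" "q \<noteq> i" "q \<noteq> j" using q by auto
  have mm: "m (m q) = q" by (rule D(3)[OF Qq(1)])
  have mq: "m q < i \<or> j < m q" "q < i \<or> j < q"
    using between[OF o(1)] between[OF Qq(1)] o(2) Qq by (metis insertCI linorder_neqE_nat)+
  note n = D(8-10)[OF ij(1)] D(8-10)[OF ij(2)] D(8-10)[OF partners(1), unfolded partners(3,5)] D(8-10)[OF partners(2), unfolded partners(4,6)]
  consider "i' < i" "j < j'" "p = i'" "p' = j'" | "j < j'" "j' < i'" "p = j'" "p' = i'" | "j' < i'" "i' < i" "p = j'" "p' = i'"
    using orders p(3)
  proof (elim disjE conjE)
    assume "i' < i" "j < j'" "p = j'" "p' = i'"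
    then have False using p(1,2) ij(3) by linarith
    then show thesis ..
  next
    assume "j' < i'" "p = i'" "p' = j'"
    then have False using p(1,2) by linarith
    then show thesis ..
  next
    assume "j' < i'" "p = i'" "p' = j'"
    then have False using p(1,2) by linarith
    then show thesis ..
  qed (rule that; assumption)+
  then show ?thesis
  proof cases
    case 1
    from mq(2) have "p < m q \<and> m q < p' \<and> (fst (b i) < fst (b q) \<or> fst (b j) < fst (b q))"
    proof
      assume "q < i"
      then show ?thesis using n(7-9)[OF Qq(1)] p(1) 1 ij(3) by simp
    next
      assume "j < q"
      then show ?thesis using n(4-6)[OF Qq(1)] p(2) 1 ij(3) by simp
    qed
    then show ?thesis using kept_lost(1,2) by auto
  next
    case 2
    have a: "i < m q" "m q < i'" "fst (b i) < fst (b q)" using n(1-3)[OF Qq(1)] 2 p ij(3) by auto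
    have "\<not> m q < j'"
    proof
      assume "m q < j'"
      then have "m (m q) < j'" using n(5)[OF o(1)] a mq by auto
      then show False using mm p 2 by simp
    qed
    then show ?thesis using a o(2) 2 kept_lost(1) by auto
  next
    case 3
    have a: "j' < m q" "m q < j" "fst (b j) < fst (b q)" using n(10-12)[OF Qq(1)] 3 p ij(3) by auto
    have "\<not> i' < m q"
    proof
      assume "i' < m q"
      then have "i' < m (m q)" using n(7)[OF o(1)] a mq by auto
      then show False using mm p 3 by simp
    qed
    then show ?thesis using a o(2) 3 kept_lost(2) by auto
  qed
qed

lemma matched_merge: "matched \<delta> b' d (Q - {i, j}) m'"
  unfolding matched_def
proof (intro conjI ballI impI)
  fix p assume p: "p \<in> Q - {i, j}"
  consider "p = i'" | "p = j'" | "p \<noteq> i'" "p \<noteq> j'" by blast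
  note pc = this
  have oth: "m p \<noteq> i'" "m p \<noteq> j'" "m p \<in> Q - {i, j}" if "p \<noteq> i'" "p \<noteq> j'" using other[OF p that] by auto
  have "m' p \<in> Q - {i, j} \<and> m' p \<noteq> p \<and> m' (m' p) = p \<and> d (m' p) = opp (d p) \<and> b' (m' p) = b' p"
  proof (cases rule: pc)
    case 3
    have Qp: "p \<in> Q" using p by simp
    show ?thesis using oth[OF 3] other[OF p 3] other(3,6)[OF oth(3)[OF 3] oth(1,2)[OF 3]] D(2-5)[OF Qp] by simp
  qed (use partners new_values in simp_all)
  then show "m' p \<in> Q - {i, j}" "m' p \<noteq> p" "m' (m' p) = p" "d (m' p) = opp (d p)" "b' (m' p) = b' p"
    by auto
  show "\<delta> (b' p) = d p" if "p < m' p"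
    using that kept_dir new_values other[OF p] D(6)[of p] p by (cases rule: pc) auto
  fix q assume q: "q \<in> Q - {i, j}"
  consider "q = i'" | "q = j'" | "q \<noteq> i'" "q \<noteq> j'" by blast
  note qc = this
  have k: "kept = b i \<or> kept = b j" by (auto simp: kept_def)
  show "q = p \<or> q = m' p" if "b' p = b' q"
  proof (cases rule: pc)
    case 3
    note o = other[OF p 3]
    show ?thesis
    proof (cases rule: qc)
      case 3
      then show ?thesis using that o other[OF q 3] D(7)[of p q] p q by simp
    qed (use that o k new_values in auto)
  next
    case 1
    then show ?thesis using that new_values other[OF q] k by (cases rule: qc) auto
  next
    case 2
    then show ?thesis using that new_values other[OF q] k by (cases rule: qc) auto
  qed
  assume a: "p < q \<and> q < m' p"
  have "p < m' q \<and> m' q < m' p \<and> fst (b' p) < fst (b' q)"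
  proof (cases "p = i' \<or> p = j'")
    case True
    then have q': "q \<noteq> i'" "q \<noteq> j'" using a new_values by auto
    show ?thesis using nested_new[OF q q', of p "m' p"] True a new_values other[OF q q'] by auto
  next
    case False
    then have p': "p \<noteq> i'" "p \<noteq> j'" by auto
    note o = other[OF p p']
    show ?thesis
    proof (cases "q = i' \<or> q = j'")
      case True
      then show ?thesis using nested_old[OF p p', of q] a o new_values by auto
    next
      case False
      then show ?thesis using other[OF q] o D(8-10)[of p q] a p q by auto
    qed
  qed
  then show "p < m' q" "m' q < m' p" "fst (b' p) < fst (b' q)" by auto
qed

end

text \<open>Names are the first arcs of their classes in the order of slices and positions.
  Injectivity of \<open>fst\<close> on names reflects that a layer contains at most one maximum; it
  makes the comparison of heights strict.\<close>

definition labelled :: "(arc \<Rightarrow> arc \<Rightarrow> bool) \<Rightarrow> arc set \<Rightarrow> (arc \<Rightarrow> arc) \<Rightarrow> bool" where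
  "labelled E A \<beta> \<longleftrightarrow> (\<forall>a \<in> A. \<beta> a \<in> A \<and> \<beta> (\<beta> a) = \<beta> a \<and> fst (\<beta> a) \<le> fst a
      \<and> (fst (\<beta> a) = fst a \<longrightarrow> snd (\<beta> a) \<le> snd a) \<and> equivclp E a (\<beta> a)) \<and> inj_on fst (\<beta> ` A)"

lemma labelledD:
  assumes "labelled E A \<beta>" "a \<in> A"
  shows "\<beta> a \<in> A" "\<beta> (\<beta> a) = \<beta> a" "fst (\<beta> a) \<le> fst a" "fst (\<beta> a) = fst a \<Longrightarrow> snd (\<beta> a) \<le> snd a" "equivclp E a (\<beta> a)"
  using assms unfolding labelled_def by blast+

text \<open>The arcs in \<open>A\<close> are those above the line; \<open>\<beta> a\<close> is the name of the curve or arch through \<open>a\<close>.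
  The surplus counts a curve or arch \<open>+1\<close> if its name points down, and \<open>-1\<close> if it is closed and its
  name points up.\<close>

definition surplus :: "(arc \<Rightarrow> dir) \<Rightarrow> arc set \<Rightarrow> arc set \<Rightarrow> int" where
  "surplus \<delta> X F = int (card {x \<in> X. \<delta> x = Down}) - int (card {x \<in> X - F. \<delta> x = Up})"

definition swept :: "(arc \<Rightarrow> dir) \<Rightarrow> (arc \<Rightarrow> arc \<Rightarrow> bool) \<Rightarrow> arc set \<Rightarrow> (arc \<Rightarrow> arc) \<Rightarrow> nat \<Rightarrow> nat set \<Rightarrow> int \<Rightarrow> bool" where
  "swept \<delta> E A \<beta> t Q k \<longleftrightarrow> finite A \<and> (\<forall>a \<in> A. fst a \<le> t) \<and> labelled E A \<beta> \<and> (\<forall>p \<in> Q. (t, p) \<in> A)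
    \<and> (\<exists>m. matched \<delta> (\<lambda>p. \<beta> (t, p)) (\<lambda>p. \<delta> (t, p)) Q m) \<and> surplus \<delta> (\<beta> ` A) ((\<lambda>p. \<beta> (t, p)) ` Q) = k"

lemma sweptI:
  assumes "finite A" "\<And>a. a \<in> A \<Longrightarrow> fst a \<le> t" "labelled E A \<beta>" "\<And>p. p \<in> Q \<Longrightarrow> (t, p) \<in> A"
    "\<exists>m. matched \<delta> (\<lambda>p. \<beta> (t, p)) (\<lambda>p. \<delta> (t, p)) Q m" "surplus \<delta> (\<beta> ` A) ((\<lambda>p. \<beta> (t, p)) ` Q) = k"
  shows "swept \<delta> E A \<beta> t Q k"
  unfolding swept_def by (intro conjI ballI) (fact assms)+

lemma swept_advance:
  assumes S: "swept \<delta> E A \<beta> t Q k" and f: "strict_mono_on Q f"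
    and \<delta>: "\<And>p. p \<in> Q \<Longrightarrow> \<delta> (Suc t, f p) = \<delta> (t, p)"
    and E: "\<And>p. p \<in> Q \<Longrightarrow> E (t, p) (Suc t, f p) \<or> E (Suc t, f p) (t, p)"
  shows "\<exists>\<beta>'. swept \<delta> E (A \<union> (\<lambda>p. (Suc t, f p)) ` Q) \<beta>' (Suc t) (f ` Q) k \<and> (\<forall>a \<in> A. \<beta>' a = \<beta> a)
    \<and> (\<forall>p \<in> Q. \<beta>' (Suc t, f p) = \<beta> (t, p)) \<and> (\<forall>a \<in> A \<union> (\<lambda>p. (Suc t, f p)) ` Q. fst (\<beta>' a) < Suc t)"
proof -
  have inj: "inj_on f Q" using f by (rule strict_mono_on_imp_inj_on)
  have A: "finite A" "\<And>a. a \<in> A \<Longrightarrow> fst a \<le> t" "labelled E A \<beta>" "\<And>p. p \<in> Q \<Longrightarrow> (t, p) \<in> A"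
    using S by (auto simp: swept_def)
  obtain m where M: "matched \<delta> (\<lambda>p. \<beta> (t, p)) (\<lambda>p. \<delta> (t, p)) Q m" using S by (auto simp: swept_def)
  note L = labelledD[OF A(3)]
  have Q: "finite Q"
  proof (rule finite_imageD[of "Pair t"])
    show "finite (Pair t ` Q)" using A(4) by (intro finite_subset[OF _ A(1)]) auto
  qed (auto simp: inj_on_def)
  let ?N = "(\<lambda>p. (Suc t, f p)) ` Q"
  define \<beta>' where "\<beta>' = (\<lambda>a. if a \<in> A then \<beta> a else \<beta> (t, inv_into Q f (snd a)))"
  have old: "\<beta>' a = \<beta> a" if "a \<in> A" for a using that by (simp add: \<beta>'_def)
  have new: "\<beta>' (Suc t, f p) = \<beta> (t, p)" if "p \<in> Q" for p
    using that inj A(2)[of "(Suc t, f p)"] by (auto simp: \<beta>'_def)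
  have "\<beta>' ` A = \<beta> ` A" using old by (rule image_cong[OF refl])
  moreover have "\<beta>' ` ?N \<subseteq> \<beta> ` A" using new A(4) by auto
  ultimately have im: "\<beta>' ` (A \<union> ?N) = \<beta> ` A" by (auto simp: image_Un)
  have lab: "labelled E (A \<union> ?N) \<beta>'"
    unfolding labelled_def im
  proof (rule conjI, rule ballI)
    fix a assume "a \<in> A \<union> ?N"
    then show "\<beta>' a \<in> A \<union> ?N \<and> \<beta>' (\<beta>' a) = \<beta>' a \<and> fst (\<beta>' a) \<le> fst a
      \<and> (fst (\<beta>' a) = fst a \<longrightarrow> snd (\<beta>' a) \<le> snd a) \<and> equivclp E a (\<beta>' a)"
    proof
      assume "a \<in> A"
      then show ?thesis using L by (simp add: old)
    next
      assume "a \<in> ?N"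
      then obtain p where p: "p \<in> Q" "a = (Suc t, f p)" by blast
      note L' = L[OF A(4)[OF p(1)]]
      have "equivclp E a (t, p)" using E[OF p(1)] p(2) by (auto intro: r_into_equivclp equivclp_sym[OF r_into_equivclp])
      then have "equivclp E a (\<beta> (t, p))" using L'(5) by (rule equivclp_trans)
      then show ?thesis using L'(1-3) p by (simp add: new old)
    qed
  next
    show "inj_on fst (\<beta> ` A)" using A(3) by (simp add: labelled_def)
  qed
  have mat: "\<exists>m'. matched \<delta> (\<lambda>p. \<beta>' (Suc t, p)) (\<lambda>p. \<delta> (Suc t, p)) (f ` Q) m'"
    by (rule matched_reindex[OF M f]) (simp_all add: new \<delta>)
  have open_im: "(\<lambda>p. \<beta>' (Suc t, p)) ` f ` Q = (\<lambda>p. \<beta> (t, p)) ` Q"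
    unfolding image_image by (rule image_cong[OF refl new])
  have swept': "swept \<delta> E (A \<union> ?N) \<beta>' (Suc t) (f ` Q) k"
    unfolding swept_def im open_im
  proof (intro conjI)
    show "\<forall>a\<in>A \<union> ?N. fst a \<le> Suc t"
      using le_SucI[OF A(2)] by (auto simp del: split_paired_All split_paired_Ball_Sigma)
    show "surplus \<delta> (\<beta> ` A) ((\<lambda>p. \<beta> (t, p)) ` Q) = k" using S by (simp add: swept_def)
    show "\<exists>m'. matched \<delta> (\<lambda>p. \<beta>' (Suc t, p)) (\<lambda>p. \<delta> (Suc t, p)) (f ` Q) m'" by (rule mat)
    show "labelled E (A \<union> ?N) \<beta>'" by (rule lab)
    show "\<forall>p\<in>f ` Q. (Suc t, p) \<in> A \<union> ?N" by blast
    show "finite (A \<union> ?N)" using A(1) Q by blast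
  qed
  have early: "fst (\<beta>' a) < Suc t" if "a \<in> A \<union> ?N" for a
  proof -
    have "\<beta>' a \<in> \<beta> ` A" unfolding im[symmetric] using that by (rule imageI)
    then obtain c where "c \<in> A" "\<beta>' a = \<beta> c" by blast
    then show ?thesis using A(2)[OF L(1)] by (simp add: less_Suc_eq_le)
  qed
  show ?thesis by (intro exI[of _ \<beta>'] conjI ballI) (rule swept', rule old, assumption, rule new, assumption, rule early)
qed

lemma swept_cap:
  assumes S: "swept \<delta> E A \<beta> t Q k" and i: "(t, i) \<notin> A" "(t, Suc i) \<notin> A"
    and early: "\<And>a. a \<in> A \<Longrightarrow> fst (\<beta> a) < t"
    and \<delta>: "\<delta> (t, Suc i) = opp (\<delta> (t, i))" and E: "E (t, i) (t, Suc i)"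
  shows "\<exists>\<beta>'. swept \<delta> E (insert (t, i) (insert (t, Suc i) A)) \<beta>' t (insert i (insert (Suc i) Q))
      (k + (if \<delta> (t, i) = Down then 1 else 0)) \<and> (\<forall>a \<in> A. \<beta>' a = \<beta> a) \<and> \<beta>' (t, i) = \<beta>' (t, Suc i)"
proof -
  have A: "finite A" "\<And>a. a \<in> A \<Longrightarrow> fst a \<le> t" "labelled E A \<beta>" "\<And>p. p \<in> Q \<Longrightarrow> (t, p) \<in> A"
    "surplus \<delta> (\<beta> ` A) ((\<lambda>p. \<beta> (t, p)) ` Q) = k"
    using S by (auto simp: swept_def)
  obtain m where M: "matched \<delta> (\<lambda>p. \<beta> (t, p)) (\<lambda>p. \<delta> (t, p)) Q m" using S by (auto simp: swept_def)
  note L = labelledD[OF A(3)]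
  let ?x = "(t, i)"
  let ?A = "insert (t, i) (insert (t, Suc i) A)"
  define \<beta>' where "\<beta>' = \<beta>((t, i) := ?x, (t, Suc i) := ?x)"
  have old: "\<beta>' a = \<beta> a" if "a \<in> A" for a using that i by (auto simp: \<beta>'_def)
  have new: "\<beta>' (t, i) = ?x" "\<beta>' (t, Suc i) = ?x" by (simp_all add: \<beta>'_def)
  have "\<beta>' ` A = \<beta> ` A" using old by (rule image_cong[OF refl])
  then have im: "\<beta>' ` ?A = insert ?x (\<beta> ` A)" using new by simp
  have Q: "i \<notin> Q" "Suc i \<notin> Q" using A(4) i by auto
  have xn: "?x \<notin> \<beta> ` A" using early by (metis fst_conv imageE less_irrefl)
  have lab: "labelled E ?A \<beta>'"
    unfolding labelled_def im
  proof (rule conjI, rule ballI)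
    fix a assume "a \<in> ?A"
    then consider "a = (t, i)" | "a = (t, Suc i)" | "a \<in> A" by blast
    then show "\<beta>' a \<in> ?A \<and> \<beta>' (\<beta>' a) = \<beta>' a \<and> fst (\<beta>' a) \<le> fst a
      \<and> (fst (\<beta>' a) = fst a \<longrightarrow> snd (\<beta>' a) \<le> snd a) \<and> equivclp E a (\<beta>' a)"
    proof cases
      case 2
      then show ?thesis using new E by (auto intro: equivclp_sym[OF r_into_equivclp])
    next
      case 3
      then show ?thesis using L old by simp
    qed (use new in simp)
  next
    have "fst ?x \<notin> fst ` (\<beta> ` A)" using early by force
    then show "inj_on fst (insert ?x (\<beta> ` A))" using A(3) by (auto simp: labelled_def)
  qed
  have "(\<lambda>p. \<beta>' (t, p)) = (\<lambda>p. \<beta> (t, p))(i := ?x, Suc i := ?x)" by (auto simp: \<beta>'_def)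
  moreover have "\<exists>m'. matched \<delta> ((\<lambda>p. \<beta> (t, p))(i := ?x, Suc i := ?x)) (\<lambda>p. \<delta> (t, p)) (insert i (insert (Suc i) Q)) m'"
    by (rule matched_cap[OF M Q]) (use early A(4) \<delta> in auto)
  ultimately have mat: "\<exists>m'. matched \<delta> (\<lambda>p. \<beta>' (t, p)) (\<lambda>p. \<delta> (t, p)) (insert i (insert (Suc i) Q)) m'" by simp
  have open_im: "(\<lambda>p. \<beta>' (t, p)) ` insert i (insert (Suc i) Q) = insert ?x ((\<lambda>p. \<beta> (t, p)) ` Q)"
  proof -
    have "(\<lambda>p. \<beta>' (t, p)) ` Q = (\<lambda>p. \<beta> (t, p)) ` Q" using old A(4) by (intro image_cong) auto
    then show ?thesis using new by simp
  qed
  have fin: "finite {x \<in> \<beta> ` A. \<delta> x = Down}" using A(1) by simp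
  have "{x \<in> insert ?x (\<beta> ` A). \<delta> x = Down}
      = (if \<delta> ?x = Down then insert ?x {x \<in> \<beta> ` A. \<delta> x = Down} else {x \<in> \<beta> ` A. \<delta> x = Down})" by auto
  moreover have "insert ?x (\<beta> ` A) - insert ?x ((\<lambda>p. \<beta> (t, p)) ` Q) = \<beta> ` A - (\<lambda>p. \<beta> (t, p)) ` Q" using xn by auto
  ultimately have surp: "surplus \<delta> (\<beta>' ` ?A) ((\<lambda>p. \<beta>' (t, p)) ` insert i (insert (Suc i) Q)) = k + (if \<delta> (t, i) = Down then 1 else 0)"
    unfolding im open_im A(5)[symmetric] surplus_def using fin xn by simp
  have "swept \<delta> E ?A \<beta>' t (insert i (insert (Suc i) Q)) (k + (if \<delta> (t, i) = Down then 1 else 0))"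
  proof (rule sweptI[OF _ _ lab _ mat surp])
    show "finite ?A" using A(1) by simp
    show "fst a \<le> t" if "a \<in> ?A" for a using that A(2)[of a] by auto
    show "(t, p) \<in> ?A" if "p \<in> insert i (insert (Suc i) Q)" for p using that A(4)[of p] by auto
  qed
  then show ?thesis using old new by (intro exI[of _ \<beta>'] conjI ballI) simp_all
qed

text \<open>Whether the minimum closes a curve or joins two arches, the surplus drops by one exactly
  if its left leg points up; the two reasons differ.\<close>

lemma swept_cup:
  assumes S: "swept \<delta> E A \<beta> t Q k" and i: "i \<in> Q" "Suc i \<in> Q"
    and \<delta>: "\<delta> (t, Suc i) = opp (\<delta> (t, i))" and E: "E (t, i) (t, Suc i)"
  shows "\<exists>\<beta>'. swept \<delta> E A \<beta>' t (Q - {i, Suc i}) (k - (if \<delta> (t, i) = Up then 1 else 0))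
    \<and> (\<forall>a \<in> A. \<forall>b \<in> A. \<beta> a = \<beta> b \<longrightarrow> \<beta>' a = \<beta>' b) \<and> \<beta>' (t, i) = \<beta>' (t, Suc i)"
proof -
  have A: "finite A" "\<And>a. a \<in> A \<Longrightarrow> fst a \<le> t" "labelled E A \<beta>" "\<And>p. p \<in> Q \<Longrightarrow> (t, p) \<in> A"
    "surplus \<delta> (\<beta> ` A) ((\<lambda>p. \<beta> (t, p)) ` Q) = k"
    using S by (auto simp: swept_def)
  obtain m where M: "matched \<delta> (\<lambda>p. \<beta> (t, p)) (\<lambda>p. \<delta> (t, p)) Q m" using S by (auto simp: swept_def)
  note L = labelledD[OF A(3)] and D = matchedD[OF M]
  let ?b = "\<lambda>p. \<beta> (t, p)"
  let ?Q = "Q - {i, Suc i}"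
  show ?thesis
  proof (cases "m i = Suc i")
    case True
    \<comment> \<open>The arch being closed has \<open>i\<close> as its left end, so its name points
      as \<open>i\<close> does. A name pointing up starts to count negatively once the curve is
      closed.\<close>
    have x: "\<delta> (?b i) = \<delta> (t, i)" "?b (Suc i) = ?b i" using D(5,6)[OF i(1)] True by simp_all
    have n: "?b p \<noteq> ?b i" if "p \<in> ?Q" for p using D(7)[OF i(1), of p] that True by auto
    have open_im: "?b ` ?Q = ?b ` Q - {?b i}"
    proof
      show "?b ` ?Q \<subseteq> ?b ` Q - {?b i}"
      proof (rule image_subsetI)
        fix p assume "p \<in> ?Q"
        then show "?b p \<in> ?b ` Q - {?b i}" using n[of p] by simp
      qed
      show "?b ` Q - {?b i} \<subseteq> ?b ` ?Q"
      proof
        fix y assume "y \<in> ?b ` Q - {?b i}"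
        then obtain p where p: "p \<in> Q" "y = ?b p" "y \<noteq> ?b i" by blast
        then have "p \<in> ?Q" using x(2) by auto
        then show "y \<in> ?b ` ?Q" unfolding p(2) by (rule imageI)
      qed
    qed
    have xm: "?b i \<in> \<beta> ` A" "?b i \<in> ?b ` Q" using A(4) i by auto
    have "{x \<in> \<beta> ` A - (?b ` Q - {?b i}). \<delta> x = Up}
        = (if \<delta> (t, i) = Up then insert (?b i) {x \<in> \<beta> ` A - ?b ` Q. \<delta> x = Up} else {x \<in> \<beta> ` A - ?b ` Q. \<delta> x = Up})"
      using xm x by auto
    then have "surplus \<delta> (\<beta> ` A) (?b ` ?Q) = k - (if \<delta> (t, i) = Up then 1 else 0)"
      unfolding open_im A(5)[symmetric] surplus_def using A(1) xm(2) by simp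
    moreover have "matched \<delta> ?b (\<lambda>p. \<delta> (t, p)) ?Q m" by (rule matched_close[OF M i(1) True])
    ultimately have "swept \<delta> E A \<beta> t ?Q (k - (if \<delta> (t, i) = Up then 1 else 0))"
      by (intro sweptI) (use A in auto)
    then show ?thesis using x(2) by (intro exI[of _ \<beta>]) simp
  next
    case False
    have sub: "?b ` Q \<subseteq> \<beta> ` A" using A(4) by auto
    interpret merging \<delta> ?b "\<lambda>p. \<delta> (t, p)" Q m i "Suc i"
      using M i False \<delta> A(3) sub by unfold_locales (auto simp: labelled_def intro: inj_on_subset)
    define \<beta>' where "\<beta>' a = (if \<beta> a = lost then kept else \<beta> a)" for a
    have x: "?b i \<in> \<beta> ` A" "?b (Suc i) \<in> \<beta> ` A" "(t, i) \<in> A" "(t, Suc i) \<in> A" using A(4) i by auto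
    have kl: "kept \<in> \<beta> ` A" "lost \<in> \<beta> ` A" "kept \<in> ?b ` Q" "lost \<in> ?b ` Q" using x i by (auto simp: kept_def lost_def)
    have fixed: "\<beta> y = y" "y \<in> A" if "y \<in> \<beta> ` A" for y using that L by auto
    have im: "\<beta>' ` A = \<beta> ` A - {lost}"
    proof
      show "\<beta>' ` A \<subseteq> \<beta> ` A - {lost}" using kl kept_lost(5) by (auto simp: \<beta>'_def)
      show "\<beta> ` A - {lost} \<subseteq> \<beta>' ` A"
      proof
        fix y assume "y \<in> \<beta> ` A - {lost}"
        then obtain a where "a \<in> A" "y = \<beta>' a" by (auto simp: \<beta>'_def)
        then show "y \<in> \<beta>' ` A" by blast
      qed
    qed
    have "equivclp E (?b i) (?b (Suc i))"
      using equivclp_sym[OF L(5)[OF x(3)]] r_into_equivclp[of E, OF E] L(5)[OF x(4)] by (meson equivclp_trans)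
    then have conn: "equivclp E lost kept"
      using kept_lost(4) by (auto simp: doubleton_eq_iff intro: equivclp_sym)
    have lab: "labelled E A \<beta>'"
      unfolding labelled_def im
    proof (intro conjI ballI)
      show "inj_on fst (\<beta> ` A - {lost})" using A(3) by (auto simp: labelled_def intro: inj_on_diff)
      fix a assume a: "a \<in> A"
      show "\<beta>' a \<in> A"
        using a L(1) fixed(2)[OF kl(1)] by (simp add: \<beta>'_def)
      show "\<beta>' (\<beta>' a) = \<beta>' a"
        using a L(2) fixed(1)[OF kl(1)] kept_lost(5) by (simp add: \<beta>'_def)
      show "fst (\<beta>' a) \<le> fst a"
        using L(3)[OF a] kept_lost(3) by (auto simp: \<beta>'_def)
      show "fst (\<beta>' a) = fst a \<longrightarrow> snd (\<beta>' a) \<le> snd a"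
        using L(3,4)[OF a] kept_lost(3) by (auto simp: \<beta>'_def)
      show "equivclp E a (\<beta>' a)"
        using L(5)[OF a] conn by (auto simp: \<beta>'_def intro: equivclp_trans)
    qed
    have b': "(\<lambda>p. \<beta>' (t, p)) = b'" by (auto simp: \<beta>'_def b'_def)
    have mat: "\<exists>m. matched \<delta> (\<lambda>p. \<beta>' (t, p)) (\<lambda>p. \<delta> (t, p)) ?Q m"
      using matched_merge unfolding b' by blast
    have "b' ` ?Q = ?b ` Q - {lost}"
    proof
      show "b' ` ?Q \<subseteq> ?b ` Q - {lost}"
      proof (rule image_subsetI)
        fix p assume "p \<in> ?Q"
        then show "b' p \<in> ?b ` Q - {lost}" using kl(3) kept_lost(5) by (simp add: b'_def)
      qed
      show "?b ` Q - {lost} \<subseteq> b' ` ?Q"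
      proof
        fix y assume "y \<in> ?b ` Q - {lost}"
        then obtain p where p: "p \<in> Q" "y = ?b p" "y \<noteq> lost" by blast
        show "y \<in> b' ` ?Q"
        proof (cases "p = i \<or> p = Suc i")
          case True
          then have "y = kept" using p kept_lost(4) by auto
          moreover have "kept = b' (m i)" "m i \<in> ?Q" using new_values partners by auto
          ultimately show ?thesis by blast
        next
          case False
          then have "p \<in> ?Q" "y = b' p" using p by (auto simp: b'_def)
          then show ?thesis by blast
        qed
      qed
    qed
    then have open_im: "(\<lambda>p. \<beta>' (t, p)) ` ?Q = ?b ` Q - {lost}" unfolding b' .
    \<comment> \<open>By \<open>lost_dir\<close> the vanishing name pointed down, and thus was
      counted, exactly if the left leg of the minimum points up.\<close>
    have "{x \<in> \<beta> ` A. \<delta> x = Down} = (if \<delta> (t, i) = Up then insert lost {x \<in> \<beta> ` A - {lost}. \<delta> x = Down} else {x \<in> \<beta> ` A - {lost}. \<delta> x = Down})"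
      using lost_dir kl(2) by (cases "\<delta> (t, i)") auto
    moreover have "\<beta> ` A - {lost} - (?b ` Q - {lost}) = \<beta> ` A - ?b ` Q"
      using kl(4) unfolding Diff_eq by blast
    ultimately have "surplus \<delta> (\<beta>' ` A) ((\<lambda>p. \<beta>' (t, p)) ` ?Q) = k - (if \<delta> (t, i) = Up then 1 else 0)"
      unfolding im open_im A(5)[symmetric] surplus_def using A(1) by simp
    then have "swept \<delta> E A \<beta>' t ?Q (k - (if \<delta> (t, i) = Up then 1 else 0))"
      by (intro sweptI lab mat) (use A(1,2,4) in auto)
    moreover have "\<beta>' (t, i) = \<beta>' (t, Suc i)" using kept_lost(4) by (auto simp: \<beta>'_def doubleton_eq_iff)
    moreover have "\<beta>' a = \<beta>' b" if "\<beta> a = \<beta> b" for a b using that by (simp add: \<beta>'_def)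
    ultimately show ?thesis by (intro exI[of _ \<beta>'] conjI ballI impI)
  qed
qed

text \<open>Once all curves are closed, their names are the arcs that determine their orientation.\<close>

lemma surplus_rotation:
  assumes S: "swept \<delta> (\<lambda>x y. x \<in> A \<and> y \<in> A \<and> R x y) A \<beta> t {} k"
    and R: "\<And>x y. x \<in> A \<Longrightarrow> y \<in> A \<Longrightarrow> R x y \<Longrightarrow> \<beta> x = \<beta> y"
  shows "(\<Sum>C\<in>classes A R. if \<delta> (top_arc C) = Down then 1 else - 1) = k"
proof -
  have A: "finite A" "labelled (\<lambda>x y. x \<in> A \<and> y \<in> A \<and> R x y) A \<beta>" "surplus \<delta> (\<beta> ` A) {} = k"
    using S by (auto simp: swept_def)
  note L = labelledD[OF A(2)]
  have cls: "C = {a \<in> A. \<beta> a = \<beta> c}" if C: "C \<in> classes A R" "c \<in> C" for C c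
  proof -
    have CA: "C \<subseteq> A" using C(1) by (rule class_subset)
    have "\<beta> a = \<beta> c" if "a \<in> C" for a
      by (rule class_invariant[OF C(1) that C(2), of \<beta>]) (rule R)
    moreover have "a \<in> C" if a: "a \<in> A" "\<beta> a = \<beta> c" for a
    proof -
      have c: "c \<in> A" using CA C(2) by blast
      have "equivclp (\<lambda>x y. x \<in> A \<and> y \<in> A \<and> R x y) c a"
        using equivclp_trans[OF L(5)[OF c] equivclp_sym[OF L(5)[OF a(1), unfolded a(2)]]] .
      then show ?thesis
      proof (induction rule: equivclp_induct)
        case (step y z)
        then show ?case using class_step[OF C(1), of y z] by blast
      qed (rule C(2))
    qed
    ultimately show ?thesis using CA by blast
  qed
  have top: "top_arc C = \<beta> c" if C: "C \<in> classes A R" "c \<in> C" for C c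
  proof -
    have c: "c \<in> A" using class_subset C by blast
    have x: "\<beta> c \<in> C" using cls[OF C] L(1,2)[OF c] by auto
    have fin: "finite C" using finite_subset[OF class_subset[OF C(1)] A(1)] .
    have low: "fst (\<beta> c) \<le> fst a" "fst a = fst (\<beta> c) \<Longrightarrow> snd (\<beta> c) \<le> snd a" if "a \<in> C" for a
      using that cls[OF C] L(3,4)[of a] by auto
    have m: "Min (fst ` C) = fst (\<beta> c)"
      by (rule Min_eqI) (use fin low x in auto)
    have "finite {p. (fst (\<beta> c), p) \<in> C}"
      by (rule finite_subset[of _ "snd ` C"]) (use fin in \<open>force+\<close>)
    then have "Min {p. (fst (\<beta> c), p) \<in> C} = snd (\<beta> c)"
      by (rule Min_eqI) (use low x in auto)
    then show ?thesis by (simp add: top_arc_def m)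
  qed
  have bij: "bij_betw top_arc (classes A R) (\<beta> ` A)"
  proof (rule bij_betwI')
    fix C D assume CD: "C \<in> classes A R" "D \<in> classes A R"
    then obtain c d where cd: "c \<in> C" "d \<in> D" using class_nonempty by blast
    show "(top_arc C = top_arc D) = (C = D)"
      unfolding top[OF CD(1) cd(1)] top[OF CD(2) cd(2)] using cls[OF CD(1) cd(1)] cls[OF CD(2) cd(2)] cd by auto
  next
    fix C assume C: "C \<in> classes A R"
    then obtain c where "c \<in> C" "c \<in> A" using class_nonempty class_subset by blast
    then show "top_arc C \<in> \<beta> ` A" using top[OF C] by simp
  next
    fix x assume "x \<in> \<beta> ` A"
    then obtain a where a: "a \<in> A" "x = \<beta> a" by blast
    from class_exists[OF a(1), of R] show "\<exists>C\<in>classes A R. x = top_arc C" using top a by metis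
  qed
  have "(\<Sum>C\<in>classes A R. if \<delta> (top_arc C) = Down then 1 else - 1 :: int) = (\<Sum>x\<in>\<beta> ` A. if \<delta> x = Down then 1 else - 1)"
    by (rule sum.reindex_bij_betw[OF bij, of "\<lambda>x. if \<delta> x = Down then 1 else - 1"])
  also have "\<dots> = (\<Sum>x\<in>\<beta> ` A. (if \<delta> x = Down then 1 else 0) - (if \<delta> x = Up then 1 else 0))"
  proof (rule sum.cong[OF refl])
    show "(if \<delta> x = Down then 1 else - 1 :: int) = (if \<delta> x = Down then 1 else 0) - (if \<delta> x = Up then 1 else 0)" for x
      by (cases "\<delta> x") simp_all
  qed
  also have "\<dots> = surplus \<delta> (\<beta> ` A) {}"
    using A(1) by (simp add: surplus_def sum_subtractf sum.If_cases Int_def)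
  finally show ?thesis using A(3) by simp
qed

section \<open>Rotation numbers\<close>

locale coloured_moy = moy +
  fixes s :: "arc set \<Rightarrow> nat set" and c :: nat
  assumes state: "s \<in> states n \<Gamma>"
begin

definition coloured_arcs :: "arc set" where
  "coloured_arcs = {a \<in> arcs \<Gamma>. c \<in> s (cmp a)}"

definition coloured_at :: "nat \<Rightarrow> nat set" where
  "coloured_at t = {p. (t, p) \<in> coloured_arcs}"

abbreviation linked :: "arc \<Rightarrow> arc \<Rightarrow> bool" where
  "linked x y \<equiv> joined \<Gamma> x y \<or> (\<exists>v \<in> vertices \<Gamma>. y = vertex_arc \<Gamma> v 0 \<and> (\<exists>j \<in> {1, 2}. x = vertex_arc \<Gamma> v j))"

abbreviation E :: "arc \<Rightarrow> arc \<Rightarrow> bool" where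
  "E x y \<equiv> x \<in> coloured_arcs \<and> y \<in> coloured_arcs \<and> linked x y"

lemma joined_coloured: "joined \<Gamma> x y \<Longrightarrow> x \<in> coloured_arcs \<longleftrightarrow> y \<in> coloured_arcs"
  using joined_strand(1,2)[of x y] cmp_joined[of x y] by (simp add: coloured_arcs_def)

lemma vertex_coloured:
  assumes v: "v \<in> vertices \<Gamma>"
  shows "vertex_arc \<Gamma> v 0 \<in> coloured_arcs \<longleftrightarrow> vertex_arc \<Gamma> v 1 \<in> coloured_arcs \<or> vertex_arc \<Gamma> v 2 \<in> coloured_arcs"
    "\<not> (vertex_arc \<Gamma> v 1 \<in> coloured_arcs \<and> vertex_arc \<Gamma> v 2 \<in> coloured_arcs)"
    "j \<in> {0, 1, 2} \<Longrightarrow> dir_at (vertex_arc \<Gamma> v j) = Down"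
proof -
  have arc: "vertex_arc \<Gamma> v j \<in> arcs \<Gamma>" if "j \<in> {0, 1, 2}" for j
  proof -
    have "(v, j) \<in> out_ends \<union> in_ends" unfolding ends_partition(1)[symmetric] using v that by simp
    then show ?thesis using out_end_arc(1) in_end_arc(1) by blast
  qed
  have "s (vertex_edge \<Gamma> v 1) \<inter> s (vertex_edge \<Gamma> v 2) = {}" "s (vertex_edge \<Gamma> v 1) \<union> s (vertex_edge \<Gamma> v 2) = s (vertex_edge \<Gamma> v 0)"
    using state v by (auto simp: states_def)
  then show "vertex_arc \<Gamma> v 0 \<in> coloured_arcs \<longleftrightarrow> vertex_arc \<Gamma> v 1 \<in> coloured_arcs \<or> vertex_arc \<Gamma> v 2 \<in> coloured_arcs"
    "\<not> (vertex_arc \<Gamma> v 1 \<in> coloured_arcs \<and> vertex_arc \<Gamma> v 2 \<in> coloured_arcs)"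
    using arc by (auto simp: coloured_arcs_def vertex_edge_def)
  obtain i g where ig: "\<Gamma> ! v = (i, g)" by fastforce
  have t: "v < T" using v by (simp add: vertices_def)
  obtain p r where "sl v = p @ fst (moy_io g) @ r" "sl (Suc v) = p @ snd (moy_io g) @ r" "i = length p"
    using layer[OF t ig] .
  then show "dir_at (vertex_arc \<Gamma> v j) = Down" if "j \<in> {0, 1, 2}"
    using v that ig by (auto simp: vertices_iff vertex_arc_def dir_at nth_append)
qed

definition cap_pos :: "nat \<Rightarrow> nat option" where
  "cap_pos t = (case \<Gamma> ! t of (i, MCap d k) \<Rightarrow> if i \<in> coloured_at (Suc t) then Some i else None | _ \<Rightarrow> None)"

definition cup_pos :: "nat \<Rightarrow> nat option" where
  "cup_pos t = (case \<Gamma> ! t of (i, MCup d k) \<Rightarrow> if i \<in> coloured_at t then Some i else None | _ \<Rightarrow> None)"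

definition continuing :: "nat \<Rightarrow> nat set" where
  "continuing t = coloured_at t - (case cup_pos t of Some i \<Rightarrow> {i, Suc i} | None \<Rightarrow> {})"

text \<open>For a single colour a vertex is a mere passage: the colour of \<open>e_0\<close>
  continues in exactly one of \<open>e_1\<close> and \<open>e_2\<close>. At a split the lower slice
  decides which one.\<close>

definition moved :: "nat \<Rightarrow> nat \<Rightarrow> nat" where
  "moved t p = (case \<Gamma> ! t of (i, g) \<Rightarrow>
     if p < i then p
     else if i + length (fst (moy_io g)) \<le> p then p - length (fst (moy_io g)) + length (snd (moy_io g))
     else (case g of Split k l \<Rightarrow> if i \<in> coloured_at (Suc t) then i else Suc i | _ \<Rightarrow> i))"

definition turn :: "nat \<Rightarrow> int" where
  "turn t = (case cap_pos t of Some i \<Rightarrow> if dir_at (Suc t, i) = Down then 1 else 0 | None \<Rightarrow> 0)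
    - (case cup_pos t of Some i \<Rightarrow> if dir_at (t, i) = Up then 1 else 0 | None \<Rightarrow> 0)"

definition step :: "nat \<Rightarrow> arc \<Rightarrow> arc \<Rightarrow> bool" where
  "step t x y \<longleftrightarrow> (\<exists>p \<in> continuing t. x = (t, p) \<and> y = (Suc t, moved t p))
    \<or> (\<exists>i. cap_pos t = Some i \<and> x = (Suc t, i) \<and> y = (Suc t, Suc i))
    \<or> (\<exists>i. cup_pos t = Some i \<and> x = (t, i) \<and> y = (t, Suc i))"

lemma left_strand:
  assumes "t < T" "\<Gamma> ! t = (i, g)" "p < i"
  shows "p \<in> coloured_at (Suc t) \<longleftrightarrow> p \<in> coloured_at t" "dir_at (Suc t, p) = dir_at (t, p)" "linked (t, p) (Suc t, p)"
proof -
  have j: "joined \<Gamma> (t, p) (Suc t, p)" by (rule joined.left) (use assms in auto)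
  then show "p \<in> coloured_at (Suc t) \<longleftrightarrow> p \<in> coloured_at t" "linked (t, p) (Suc t, p)" using joined_coloured by (auto simp: coloured_at_def)
  show "dir_at (Suc t, p) = dir_at (t, p)" using assms by (auto elim!: layer simp: dir_at nth_append)
qed

lemma right_strand:
  fixes r :: nat
  assumes "t < T" "\<Gamma> ! t = (i, g)"
  defines "p \<equiv> i + length (fst (moy_io g)) + r" and "q \<equiv> i + length (snd (moy_io g)) + r"
  shows "q \<in> coloured_at (Suc t) \<longleftrightarrow> p \<in> coloured_at t" "p \<in> coloured_at t \<Longrightarrow> dir_at (Suc t, q) = dir_at (t, p)" "p \<in> coloured_at t \<Longrightarrow> linked (t, p) (Suc t, q)"
proof -
  obtain u w where ps: "sl t = u @ fst (moy_io g) @ w" "sl (Suc t) = u @ snd (moy_io g) @ w" "i = length u"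
    using layer[OF assms(1,2)] .
  have r: "r < length w" if "p \<in> coloured_at t \<or> q \<in> coloured_at (Suc t)" using that ps by (auto simp: coloured_at_def coloured_arcs_def arcs_def p_def q_def)
  have j: "joined \<Gamma> (t, p) (Suc t, q)" if "r < length w"
  proof -
    have "joined \<Gamma> (t, p) (Suc t, p - length (fst (moy_io g)) + length (snd (moy_io g)))"
      by (rule joined.right[OF assms(1,2)]) (use that ps in \<open>auto simp: p_def\<close>)
    moreover have "p - length (fst (moy_io g)) + length (snd (moy_io g)) = q" by (simp add: p_def q_def)
    ultimately show ?thesis by (simp only:)
  qed
  show "q \<in> coloured_at (Suc t) \<longleftrightarrow> p \<in> coloured_at t" using r j joined_coloured by (auto simp: coloured_at_def)
  show "dir_at (Suc t, q) = dir_at (t, p)" if "p \<in> coloured_at t"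
    using r that ps by (simp add: dir_at p_def q_def nth_append)
  show "linked (t, p) (Suc t, q)" if "p \<in> coloured_at t" using r j that by blast
qed

lemma cap_cup:
  assumes "t < T"
  shows "cap_pos t = Some i \<Longrightarrow> dir_at (Suc t, Suc i) = opp (dir_at (Suc t, i)) \<and> E (Suc t, i) (Suc t, Suc i)"
    "cup_pos t = Some i \<Longrightarrow> dir_at (t, Suc i) = opp (dir_at (t, i)) \<and> E (t, i) (t, Suc i)"
proof -
  show "dir_at (Suc t, Suc i) = opp (dir_at (Suc t, i)) \<and> E (Suc t, i) (Suc t, Suc i)" if c: "cap_pos t = Some i"
  proof -
    obtain d k where g: "\<Gamma> ! t = (i, MCap d k)" "i \<in> coloured_at (Suc t)"
      using c by (auto simp: cap_pos_def split: prod.splits moy_piece.splits if_splits)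
    obtain u w where "sl t = u @ fst (moy_io (MCap d k)) @ w" "sl (Suc t) = u @ snd (moy_io (MCap d k)) @ w" "i = length u"
      using layer[OF assms g(1)] .
    then show ?thesis using joined.cap[OF assms g(1)] joined_coloured g(2) by (simp add: dir_at nth_append coloured_at_def)
  qed
  show "dir_at (t, Suc i) = opp (dir_at (t, i)) \<and> E (t, i) (t, Suc i)" if c: "cup_pos t = Some i"
  proof -
    obtain d k where g: "\<Gamma> ! t = (i, MCup d k)" "i \<in> coloured_at t"
      using c by (auto simp: cup_pos_def split: prod.splits moy_piece.splits if_splits)
    obtain u w where "sl t = u @ fst (moy_io (MCup d k)) @ w" "sl (Suc t) = u @ snd (moy_io (MCup d k)) @ w" "i = length u"
      using layer[OF assms g(1)] .
    then show ?thesis using joined.cup[OF assms g(1)] joined_coloured g(2) by (simp add: dir_at nth_append coloured_at_def)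
  qed
qed

lemma merge_strand:
  assumes "t < T" "\<Gamma> ! t = (i, Merge k l)"
  shows "i \<in> coloured_at (Suc t) \<longleftrightarrow> i \<in> coloured_at t \<or> Suc i \<in> coloured_at t" "\<not> (i \<in> coloured_at t \<and> Suc i \<in> coloured_at t)"
    "p \<in> {i, Suc i} \<Longrightarrow> dir_at (Suc t, i) = dir_at (t, p) \<and> linked (t, p) (Suc t, i)"
proof -
  have v: "t \<in> vertices \<Gamma>" using assms by (auto simp: vertices_iff)
  have va: "vertex_arc \<Gamma> t 0 = (Suc t, i)" "vertex_arc \<Gamma> t (Suc 0) = (t, i)" "vertex_arc \<Gamma> t 2 = (t, Suc i)"
    using assms by (simp_all add: vertex_arc_def numeral_2_eq_2)
  show "i \<in> coloured_at (Suc t) \<longleftrightarrow> i \<in> coloured_at t \<or> Suc i \<in> coloured_at t" "\<not> (i \<in> coloured_at t \<and> Suc i \<in> coloured_at t)"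
    using vertex_coloured(1,2)[OF v] by (simp_all add: va coloured_at_def)
  have "linked (t, i) (Suc t, i)" "linked (t, Suc i) (Suc t, i)" using v va by force+
  then show "p \<in> {i, Suc i} \<Longrightarrow> dir_at (Suc t, i) = dir_at (t, p) \<and> linked (t, p) (Suc t, i)"
    using vertex_coloured(3)[OF v, of 0] vertex_coloured(3)[OF v, of 1] vertex_coloured(3)[OF v, of 2] by (auto simp: va)
qed

lemma split_strand:
  assumes "t < T" "\<Gamma> ! t = (i, Split k l)"
  shows "i \<in> coloured_at t \<longleftrightarrow> i \<in> coloured_at (Suc t) \<or> Suc i \<in> coloured_at (Suc t)" "\<not> (i \<in> coloured_at (Suc t) \<and> Suc i \<in> coloured_at (Suc t))"
    "p \<in> {i, Suc i} \<Longrightarrow> dir_at (Suc t, p) = dir_at (t, i) \<and> linked (Suc t, p) (t, i)"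
proof -
  have v: "t \<in> vertices \<Gamma>" using assms by (auto simp: vertices_iff)
  have va: "vertex_arc \<Gamma> t 0 = (t, i)" "vertex_arc \<Gamma> t (Suc 0) = (Suc t, i)" "vertex_arc \<Gamma> t 2 = (Suc t, Suc i)"
    using assms by (simp_all add: vertex_arc_def numeral_2_eq_2)
  show "i \<in> coloured_at t \<longleftrightarrow> i \<in> coloured_at (Suc t) \<or> Suc i \<in> coloured_at (Suc t)" "\<not> (i \<in> coloured_at (Suc t) \<and> Suc i \<in> coloured_at (Suc t))"
    using vertex_coloured(1,2)[OF v] by (simp_all add: va coloured_at_def)
  have "linked (Suc t, i) (t, i)" "linked (Suc t, Suc i) (t, i)" using v va by force+
  then show "p \<in> {i, Suc i} \<Longrightarrow> dir_at (Suc t, p) = dir_at (t, i) \<and> linked (Suc t, p) (t, i)"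
    using vertex_coloured(3)[OF v, of 0] vertex_coloured(3)[OF v, of 1] vertex_coloured(3)[OF v, of 2] by (auto simp: va)
qed

lemma continuing_cases:
  assumes t: "t < T" "\<Gamma> ! t = (i, g)" and p: "p \<in> continuing t"
  obtains "p < i" "moved t p = p"
  | r where "p = i + length (fst (moy_io g)) + r" "moved t p = i + length (snd (moy_io g)) + r"
  | k l where "g = Merge k l" "p \<in> {i, Suc i}" "moved t p = i"
  | k l where "g = Split k l" "p = i" "moved t p \<in> {i, Suc i}" "moved t p \<in> coloured_at (Suc t)"
proof -
  have pQ: "p \<in> coloured_at t" using p by (simp add: continuing_def)
  consider "p < i" | r where "p = i + length (fst (moy_io g)) + r" | "i \<le> p" "p < i + length (fst (moy_io g))"
    by (meson not_le le_Suc_ex)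
  then show thesis
  proof cases
    case 1
    then show thesis using that(1) t by (simp add: moved_def)
  next
    case (2 r)
    then show thesis using that(2)[of r] t by (simp add: moved_def)
  next
    case 3
    show thesis
    proof (cases g)
      case (MCap d k)
      then show thesis using 3 by simp
    next
      case (MCup d k)
      have "joined \<Gamma> (t, i) (t, Suc i)" by (rule joined.cup) (use t MCup in auto)
      then have "i \<in> coloured_at t \<longleftrightarrow> Suc i \<in> coloured_at t" using joined_coloured by (simp add: coloured_at_def)
      moreover have "p = i \<or> p = Suc i" using 3 MCup by auto
      ultimately have False using p t MCup by (auto simp: continuing_def cup_pos_def split: if_splits)
      then show thesis ..
    next
      case (Merge k l)
      then have "p = i \<or> p = Suc i" using 3 by auto
      then show thesis using that(3)[of k l] Merge t by (auto simp: moved_def)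
    next
      case (Split k l)
      then have "p = i" using 3 by simp
      moreover have "moved t p \<in> {i, Suc i} \<and> moved t p \<in> coloured_at (Suc t)"
        using split_strand(1)[of t i k l] t Split pQ \<open>p = i\<close> by (auto simp: moved_def)
      ultimately show thesis using that(4)[of k l] Split by simp
    qed
  qed
qed

text \<open>Only a merge could identify two positions, and there at most one of the two upper
  strands carries the colour.\<close>

lemma moved_strict_mono: "t < T \<Longrightarrow> strict_mono_on (continuing t) (moved t)"
proof (rule strict_mono_onI)
  fix p q assume t: "t < T" and p: "p \<in> continuing t" and q: "q \<in> continuing t" and less: "p < q"
  obtain i g where ig: "\<Gamma> ! t = (i, g)" by fastforce
  have pq: "p \<in> coloured_at t" "q \<in> coloured_at t" using p q by (auto simp: continuing_def)
  from t ig p show "moved t p < moved t q"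
  proof (cases rule: continuing_cases)
    case 1
    from t ig q show ?thesis by (cases rule: continuing_cases) (use 1 less in auto)
  next
    case (2 r)
    from t ig q show ?thesis by (cases rule: continuing_cases) (use 2 less in auto)
  next
    case (3 k l)
    from t ig q show ?thesis by (cases rule: continuing_cases) (use 3 less merge_strand(2)[of t i k l] t ig pq in auto)
  next
    case (4 k l)
    from t ig q show ?thesis by (cases rule: continuing_cases) (use 4 less in auto)
  qed
qed

lemma moved_strand:
  assumes t: "t < T" and p: "p \<in> continuing t"
  shows "moved t p \<in> coloured_at (Suc t)" "dir_at (Suc t, moved t p) = dir_at (t, p)" "E (t, p) (Suc t, moved t p) \<or> E (Suc t, moved t p) (t, p)"
proof -
  obtain i g where ig: "\<Gamma> ! t = (i, g)" by fastforce
  have pQ: "p \<in> coloured_at t" using p by (simp add: continuing_def)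
  have "moved t p \<in> coloured_at (Suc t) \<and> dir_at (Suc t, moved t p) = dir_at (t, p) \<and> (linked (t, p) (Suc t, moved t p) \<or> linked (Suc t, moved t p) (t, p))"
    using t ig p
  proof (cases rule: continuing_cases)
    case 1
    then show ?thesis using left_strand[OF t ig 1(1)] pQ by simp
  next
    case (2 r)
    show ?thesis using right_strand[OF t ig, of r] pQ unfolding 2(2) unfolding 2(1) by blast
  next
    case (3 k l)
    then show ?thesis using merge_strand(1)[of t i k l] merge_strand(3)[of t i k l p] t ig pQ by auto
  next
    case (4 k l)
    show ?thesis using split_strand(3)[of t i k l "moved t p"] t ig 4 by auto
  qed
  then show "moved t p \<in> coloured_at (Suc t)" "dir_at (Suc t, moved t p) = dir_at (t, p)" "E (t, p) (Suc t, moved t p) \<or> E (Suc t, moved t p) (t, p)"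
    using pQ by (auto simp: coloured_at_def)
qed

lemma coloured_at_Suc:
  assumes t: "t < T"
  shows "coloured_at (Suc t) = moved t ` continuing t \<union> (case cap_pos t of Some i \<Rightarrow> {i, Suc i} | None \<Rightarrow> {})"
    "cap_pos t = Some i \<Longrightarrow> i \<notin> moved t ` continuing t \<and> Suc i \<notin> moved t ` continuing t"
proof -
  obtain i g where ig: "\<Gamma> ! t = (i, g)" by fastforce
  show "coloured_at (Suc t) = moved t ` continuing t \<union> (case cap_pos t of Some i \<Rightarrow> {i, Suc i} | None \<Rightarrow> {})"
  proof
    show "moved t ` continuing t \<union> (case cap_pos t of Some i \<Rightarrow> {i, Suc i} | None \<Rightarrow> {}) \<subseteq> coloured_at (Suc t)"
      using moved_strand(1)[OF t] cap_cup(1)[OF t] by (auto simp: coloured_at_def split: option.splits)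
    show "coloured_at (Suc t) \<subseteq> moved t ` continuing t \<union> (case cap_pos t of Some i \<Rightarrow> {i, Suc i} | None \<Rightarrow> {})"
    proof
      fix q assume q: "q \<in> coloured_at (Suc t)"
      let ?R = "q \<in> moved t ` continuing t \<union> (case cap_pos t of Some i \<Rightarrow> {i, Suc i} | None \<Rightarrow> {})"
      have im: ?R if "p \<in> continuing t" "moved t p = q" for p using that by blast
      have cup: "cup_pos t = None \<or> (\<exists>d k. g = MCup d k) \<and> cup_pos t = Some i"
        by (cases g) (auto simp: cup_pos_def ig)
      consider "q < i" | r where "q = i + length (snd (moy_io g)) + r" | "i \<le> q" "q < i + length (snd (moy_io g))"
        by (meson not_le le_Suc_ex)
      then show ?R
      proof cases
        case 1
        have "q \<in> continuing t" using left_strand(1)[OF t ig 1] q cup 1 by (auto simp: continuing_def)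
        then show ?thesis by (rule im) (use 1 in \<open>simp add: moved_def ig\<close>)
      next
        case (2 r)
        have "i + length (fst (moy_io g)) + r \<in> continuing t" using right_strand(1)[OF t ig, of r] q cup 2 by (auto simp: continuing_def)
        then show ?thesis by (rule im) (use 2 in \<open>simp add: moved_def ig\<close>)
      next
        case 3
        show ?thesis
        proof (cases g)
          case (MCap d k)
          have "joined \<Gamma> (Suc t, i) (Suc t, Suc i)" by (rule joined.cap) (use t ig MCap in auto)
          then have "i \<in> coloured_at (Suc t) \<longleftrightarrow> Suc i \<in> coloured_at (Suc t)" using joined_coloured by (simp add: coloured_at_def)
          moreover have "q = i \<or> q = Suc i" using 3 MCap by auto
          ultimately show ?thesis using q by (auto simp: cap_pos_def ig MCap)
        next
          case (MCup d k)
          then show ?thesis using 3 by simp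
        next
          case (Merge k l)
          then have "q = i" using 3 by simp
          then obtain p where "p \<in> {i, Suc i}" "p \<in> coloured_at t" using merge_strand(1)[of t i k l] t ig Merge q by auto
          then show ?thesis using im[of p] \<open>q = i\<close> Merge cup by (auto simp: continuing_def moved_def ig)
        next
          case (Split k l)
          then have q': "q = i \<or> q = Suc i" using 3 by auto
          have "i \<in> continuing t" using split_strand(1)[of t i k l] t ig Split q q' cup by (auto simp: continuing_def)
          moreover have "moved t i = q"
            using split_strand(2)[of t i k l] t ig Split q q' by (auto simp: moved_def)
          ultimately show ?thesis by (rule im)
        qed
      qed
    qed
  qed
  show "i \<notin> moved t ` continuing t \<and> Suc i \<notin> moved t ` continuing t" if c: "cap_pos t = Some i" for i
  proof -
    obtain d k where g: "\<Gamma> ! t = (i, MCap d k)"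
      using c by (auto simp: cap_pos_def split: prod.splits moy_piece.splits if_splits)
    have "moved t p \<noteq> i \<and> moved t p \<noteq> Suc i" for p using g by (auto simp: moved_def)
    then show ?thesis by (metis imageE)
  qed
qed

text \<open>All links that define a loop arise in the sweep. At a split they are directed upwards,
  against the sweep, hence the two alternatives.\<close>

lemma link_step:
  assumes xy: "x \<in> coloured_arcs" "y \<in> coloured_arcs" and l: "linked x y"
  shows "\<exists>t < T. step t x y \<or> step t y x"
proof -
  have cup: "cup_pos t = None \<or> (\<exists>i d k. \<Gamma> ! t = (i, MCup d k) \<and> cup_pos t = Some i)" for t
    by (cases "\<Gamma> ! t"; cases "snd (\<Gamma> ! t)") (auto simp: cup_pos_def)
  show ?thesis using l
  proof
    assume "joined \<Gamma> x y"
    then show ?thesis using xy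
    proof (induction rule: joined.induct)
      case (left t i g p)
      then have "p \<in> continuing t" using cup[of t] by (auto simp: continuing_def coloured_at_def)
      moreover have "moved t p = p" using left by (simp add: moved_def)
      ultimately show ?case using left(1) by (auto simp: step_def)
    next
      case (right t i g p)
      then have "p \<in> continuing t" using cup[of t] by (auto simp: continuing_def coloured_at_def)
      moreover have "moved t p = p - length (fst (moy_io g)) + length (snd (moy_io g))" using right by (simp add: moved_def)
      ultimately show ?case using right(1) by (auto simp: step_def)
    next
      case (cap t i d k)
      then have "cap_pos t = Some i" by (simp add: cap_pos_def coloured_at_def)
      then show ?case using cap(1) by (auto simp: step_def)
    next
      case (cup t i d k)
      then have "cup_pos t = Some i" by (simp add: cup_pos_def coloured_at_def)
      then show ?case using cup(1) by (auto simp: step_def)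
    qed
  next
    assume "\<exists>v\<in>vertices \<Gamma>. y = vertex_arc \<Gamma> v 0 \<and> (\<exists>j\<in>{1, 2}. x = vertex_arc \<Gamma> v j)"
    then obtain v j where v: "v \<in> vertices \<Gamma>" "y = vertex_arc \<Gamma> v 0" "j \<in> {1, 2}" "x = vertex_arc \<Gamma> v j" by blast
    then obtain i k l where t: "v < T" and g: "\<Gamma> ! v = (i, Merge k l) \<or> \<Gamma> ! v = (i, Split k l)"
      by (auto simp: vertices_iff)
    have continuing: "continuing v = coloured_at v" using cup[of v] g by (auto simp: continuing_def)
    from g show ?thesis
    proof
      assume g: "\<Gamma> ! v = (i, Merge k l)"
      then have "y = (Suc v, i)" "x = (v, i) \<or> x = (v, Suc i)" using v by (auto simp: vertex_arc_def)
      then have "step v x y" using xy g continuing by (auto simp: step_def coloured_at_def moved_def)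
      then show ?thesis using t by blast
    next
      assume g: "\<Gamma> ! v = (i, Split k l)"
      then have "y = (v, i)" "x = (Suc v, i) \<or> x = (Suc v, Suc i)" using v by (auto simp: vertex_arc_def)
      then have "step v y x" using xy g continuing split_strand(2)[OF t g] by (auto simp: step_def coloured_at_def moved_def)
      then show ?thesis using t by blast
    qed
  qed
qed

lemma step_coloured:
  assumes "t < T" "step t x y"
  shows "x \<in> coloured_arcs" "y \<in> coloured_arcs" "fst x \<le> Suc t" "fst y \<le> Suc t"
  using assms(2) cap_cup[OF assms(1)] moved_strand(1)[OF assms(1)]
  by (auto simp: step_def continuing_def coloured_at_def)

text \<open>A layer is processed as a minimum in slice \<open>t\<close>, a passage to slice
  \<open>t + 1\<close> and a maximum in slice \<open>t + 1\<close>, any of which may be vacuous.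
  Before the maximum all names lie in earlier slices, so the new name is fresh.\<close>

lemma sweep_moy:
  assumes "t \<le> T"
  shows "\<exists>\<beta>. swept dir_at E {a \<in> coloured_arcs. fst a \<le> t} \<beta> t (coloured_at t) (\<Sum>u<t. turn u)
    \<and> (\<forall>u<t. \<forall>x y. step u x y \<longrightarrow> \<beta> x = \<beta> y)"
  using assms
proof (induction t)
  case 0
  have e: "{a \<in> coloured_arcs. fst a \<le> 0} = {}" "coloured_at 0 = {}" by (auto simp: coloured_arcs_def coloured_at_def arcs_def intro!: gr0I)
  have "swept dir_at E {a \<in> coloured_arcs. fst a \<le> 0} id 0 (coloured_at 0) 0"
    unfolding e swept_def labelled_def matched_def surplus_def by simp
  then show ?case by auto
next
  case (Suc t)
  let ?A = "{a \<in> coloured_arcs. fst a \<le> t}"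
  let ?k = "\<Sum>u<t. turn u"
  have t: "t < T" using Suc.prems by simp
  obtain \<beta> where S: "swept dir_at E ?A \<beta> t (coloured_at t) ?k" and lk: "\<And>u x y. u < t \<Longrightarrow> step u x y \<Longrightarrow> \<beta> x = \<beta> y"
    using Suc by auto
  let ?cup = "(case cup_pos t of Some i \<Rightarrow> if dir_at (t, i) = Up then 1 else 0 | None \<Rightarrow> 0) :: int"
  have "\<exists>\<beta>1. swept dir_at E ?A \<beta>1 t (continuing t) (?k - ?cup) \<and> (\<forall>a\<in>?A. \<forall>b\<in>?A. \<beta> a = \<beta> b \<longrightarrow> \<beta>1 a = \<beta>1 b)
      \<and> (\<forall>i. cup_pos t = Some i \<longrightarrow> \<beta>1 (t, i) = \<beta>1 (t, Suc i))"
  proof (cases "cup_pos t")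
    case None
    then have "continuing t = coloured_at t" by (simp add: continuing_def)
    then show ?thesis using S None by (intro exI[of _ \<beta>]) simp
  next
    case (Some i)
    note c = cap_cup(2)[OF t Some]
    then have "i \<in> coloured_at t" "Suc i \<in> coloured_at t" by (simp_all add: coloured_at_def)
    from swept_cup[OF S this, of] c show ?thesis using Some by (simp add: continuing_def)
  qed
  then obtain \<beta>1 where S1: "swept dir_at E ?A \<beta>1 t (continuing t) (?k - ?cup)"
    and l1: "\<And>a b. a \<in> ?A \<Longrightarrow> b \<in> ?A \<Longrightarrow> \<beta> a = \<beta> b \<Longrightarrow> \<beta>1 a = \<beta>1 b"
      "\<And>i. cup_pos t = Some i \<Longrightarrow> \<beta>1 (t, i) = \<beta>1 (t, Suc i)" by blast
  let ?B = "?A \<union> (\<lambda>p. (Suc t, moved t p)) ` continuing t"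
  obtain \<beta>2 where S2: "swept dir_at E ?B \<beta>2 (Suc t) (moved t ` continuing t) (?k - ?cup)"
    and l2: "\<And>a. a \<in> ?A \<Longrightarrow> \<beta>2 a = \<beta>1 a" "\<And>p. p \<in> continuing t \<Longrightarrow> \<beta>2 (Suc t, moved t p) = \<beta>1 (t, p)"
      "\<And>a. a \<in> ?B \<Longrightarrow> fst (\<beta>2 a) < Suc t"
    using swept_advance[OF S1 moved_strict_mono[OF t] moved_strand(2,3)[OF t]] by blast
  let ?cap = "(case cap_pos t of Some i \<Rightarrow> if dir_at (Suc t, i) = Down then 1 else 0 | None \<Rightarrow> 0) :: int"
  let ?C = "{a \<in> coloured_arcs. fst a \<le> Suc t}"
  have C: "?C = ?A \<union> (\<lambda>q. (Suc t, q)) ` coloured_at (Suc t)" by (auto simp: coloured_at_def le_Suc_eq)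
  have "\<exists>\<beta>3. swept dir_at E ?C \<beta>3 (Suc t) (coloured_at (Suc t)) (?k - ?cup + ?cap) \<and> (\<forall>a\<in>?B. \<beta>3 a = \<beta>2 a)
      \<and> (\<forall>i. cap_pos t = Some i \<longrightarrow> \<beta>3 (Suc t, i) = \<beta>3 (Suc t, Suc i))"
  proof (cases "cap_pos t")
    case None
    then have coloured_at: "coloured_at (Suc t) = moved t ` continuing t" using coloured_at_Suc(1)[OF t] by simp
    have "?C = ?B" unfolding C coloured_at by (simp add: image_image)
    then show ?thesis using S2 coloured_at None by (intro exI[of _ \<beta>2]) simp
  next
    case (Some i)
    note c = cap_cup(1)[OF t Some]
    have coloured_at: "coloured_at (Suc t) = insert i (insert (Suc i) (moved t ` continuing t))" using coloured_at_Suc(1)[OF t] Some by auto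
    have CB: "?C = insert (Suc t, i) (insert (Suc t, Suc i) ?B)" unfolding C coloured_at by (simp add: image_image)
    have "(Suc t, i) \<notin> ?B" "(Suc t, Suc i) \<notin> ?B" using coloured_at_Suc(2)[OF t Some] by auto
    from swept_cap[OF S2 this l2(3)] c show ?thesis unfolding CB coloured_at using Some by simp
  qed
  then obtain \<beta>3 where S3: "swept dir_at E ?C \<beta>3 (Suc t) (coloured_at (Suc t)) (?k - ?cup + ?cap)"
    and l3: "\<And>a. a \<in> ?B \<Longrightarrow> \<beta>3 a = \<beta>2 a" "\<And>i. cap_pos t = Some i \<Longrightarrow> \<beta>3 (Suc t, i) = \<beta>3 (Suc t, Suc i)" by blast
  have old: "\<beta>3 a = \<beta>1 a" if "a \<in> ?A" for a using that l3(1)[of a] l2(1)[of a] by simp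
  have KA: "(t, p) \<in> ?A" if "p \<in> continuing t" for p using that by (simp add: continuing_def coloured_at_def)
  have "\<beta>3 x = \<beta>3 y" if u: "u < Suc t" and st: "step u x y" for u x y
  proof (cases "u = t")
    case True
    from st show ?thesis unfolding True step_def
    proof (elim disjE exE bexE conjE)
      fix p assume p: "p \<in> continuing t" "x = (t, p)" "y = (Suc t, moved t p)"
      have "\<beta>3 y = \<beta>2 y" using p by (intro l3) blast
      then show ?thesis using l2(2)[OF p(1)] old[OF KA[OF p(1)]] p by simp
    next
      fix i assume "cap_pos t = Some i" "x = (Suc t, i)" "y = (Suc t, Suc i)"
      then show ?thesis using l3(2) by simp
    next
      fix i assume i: "cup_pos t = Some i" "x = (t, i)" "y = (t, Suc i)"
      then have "x \<in> ?A" "y \<in> ?A" using cap_cup(2)[OF t i(1)] by simp_all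
      then show ?thesis using old l1(2)[OF i(1)] i by simp
    qed
  next
    case False
    then have ut: "u < t" using u by simp
    then have "u < T" using t by simp
    note sp = step_coloured[OF this st]
    have "fst x \<le> t" "fst y \<le> t" using sp(3,4) ut by linarith+
    then have "x \<in> ?A" "y \<in> ?A" using sp(1,2) by simp_all
    then show ?thesis using old[of x] old[of y] l1(1)[of x y] lk[OF ut st] by simp
  qed
  moreover have "?k - ?cup + ?cap = (\<Sum>u<Suc t. turn u)" by (simp add: turn_def)
  then have "swept dir_at E ?C \<beta>3 (Suc t) (coloured_at (Suc t)) (\<Sum>u<Suc t. turn u)" using S3 by (simp only:)
  ultimately show ?case by blast
qed

lemma loops_turn: "(\<Sum>C\<in>loops \<Gamma> s c. loop_rot \<Gamma> C) = of_int (\<Sum>t<T. turn t)"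
proof -
  obtain \<beta> where S: "swept dir_at E {a \<in> coloured_arcs. fst a \<le> T} \<beta> T (coloured_at T) (\<Sum>u<T. turn u)"
    and lk: "\<And>u x y. u < T \<Longrightarrow> step u x y \<Longrightarrow> \<beta> x = \<beta> y"
    using sweep_moy[of T] by auto
  have "{a \<in> coloured_arcs. fst a \<le> T} = coloured_arcs" "coloured_at T = {}" by (auto simp: coloured_arcs_def coloured_at_def arcs_def)
  then have S: "swept dir_at E coloured_arcs \<beta> T {} (\<Sum>u<T. turn u)" using S by simp
  have "(\<Sum>C\<in>classes coloured_arcs linked. if dir_at (top_arc C) = Down then 1 else - 1) = (\<Sum>u<T. turn u)"
  proof (rule surplus_rotation[OF S])
    fix x y assume "x \<in> coloured_arcs" "y \<in> coloured_arcs" "linked x y"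
    from link_step[OF this] show "\<beta> x = \<beta> y" using lk by metis
  qed
  moreover have "loops \<Gamma> s c = classes coloured_arcs linked" by (simp add: loops_def coloured_arcs_def)
  moreover have "loop_rot \<Gamma> C = of_int (if dir_at (top_arc C) = Down then 1 else - 1)" for C
    by (simp add: loop_rot_def anticlockwise_def dir_at_def)
  ultimately show ?thesis by (simp only: of_int_sum[symmetric])
qed

end

section \<open>From turns to the exponent of q\<close>

lemma qpow_sum: "(\<Prod>x\<in>A. qpow (f x)) = qpow (\<Sum>x\<in>A. f x)"
  by (induction A rule: infinite_finite_induct) (simp_all add: qpow_mult)

definition (in moy) turning :: "(arc set \<Rightarrow> nat set) \<Rightarrow> nat \<Rightarrow> nat \<Rightarrow> rat" where
  "turning s c t = (case \<Gamma> ! t of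
      (i, MCap d k) \<Rightarrow> if d = Down \<and> c \<in> s (cmp (Suc t, i)) then 1 else 0
    | (i, MCup d k) \<Rightarrow> if d = Up \<and> c \<in> s (cmp (t, i)) then - 1 else 0
    | _ \<Rightarrow> 0)"

lemma (in coloured_moy) turn_turning:
  assumes t: "t < T"
  shows "of_int (turn t) = turning s c t"
proof -
  obtain i g where ig: "\<Gamma> ! t = (i, g)" by fastforce
  obtain u w where ps: "sl t = u @ fst (moy_io g) @ w" "sl (Suc t) = u @ snd (moy_io g) @ w" "i = length u"
    using layer[OF t ig] .
  then show ?thesis
    using t by (cases g) (auto simp: turn_def turning_def cap_pos_def cup_pos_def coloured_at_def coloured_arcs_def arcs_def ig dir_at nth_append)
qed

context moy begin

lemma turn_weight_turning:
  assumes s: "s \<in> states n \<Gamma>" and t: "t < T"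
  shows "turn_weight s t = qpow (\<Sum>c = 1..n. height n c * turning s c t)"
proof -
  obtain i g where ig: "\<Gamma> ! t = (i, g)" by fastforce
  obtain u w where ps: "sl t = u @ fst (moy_io g) @ w" "sl (Suc t) = u @ snd (moy_io g) @ w" "i = length u"
    using layer[OF t ig] .
  have sum: "(\<Sum>c = 1..n. height n c * (if b \<and> c \<in> s C then e else 0)) = (if b then e * (\<Sum>c\<in>s C. height n c) else 0)"
    if "C \<in> comps" for b C and e :: rat
  proof -
    have "s C \<subseteq> {1..n}" using state_comp[OF s that] by simp
    then have "(\<Sum>c\<in>s C. height n c) = (\<Sum>c = 1..n. if c \<in> s C then height n c else 0)"
      by (simp add: sum.inter_restrict[symmetric] Int_absorb1)
    then show ?thesis by (auto simp: sum_distrib_left mult.commute intro!: sum.cong)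
  qed
  show ?thesis
  proof (cases g)
    case (MCap d k)
    then have "cmp (Suc t, i) \<in> comps" using ps t by (intro cmp_props) (simp add: arcs_def)
    from sum[OF this, of "d = Down" 1] show ?thesis using MCap by (simp add: turn_weight_def turning_def ig)
  next
    case (MCup d k)
    then have "cmp (t, i) \<in> comps" using ps t by (intro cmp_props) (simp add: arcs_def)
    from sum[OF this, of "d = Up" "- 1"] show ?thesis using MCup by (simp add: turn_weight_def turning_def ig)
  qed (simp_all add: turn_weight_def turning_def ig)
qed

text \<open>The exponent is a double sum over layers and colours. For a fixed colour the layers sum
  to the rotation numbers of its loops; the factor 2 appears because \<open>height\<close> is twice
  the coefficient used in \<open>rot\<close>.\<close>

lemma prod_turn_weight:
  assumes s: "s \<in> states n \<Gamma>"
  shows "(\<Prod>t<T. turn_weight s t) = qpow (2 * rot n \<Gamma> s)"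
proof -
  have loops: "(\<Sum>C\<in>loops \<Gamma> s c. loop_rot \<Gamma> C) = (\<Sum>t<T. turning s c t)" for c
  proof -
    interpret coloured_moy n \<Gamma> s c by unfold_locales (rule s)
    show ?thesis unfolding loops_turn of_int_sum by (rule sum.cong) (simp_all add: turn_turning)
  qed
  have "(\<Prod>t<T. turn_weight s t) = qpow (\<Sum>t<T. \<Sum>c = 1..n. height n c * turning s c t)"
    unfolding qpow_sum[symmetric] by (rule prod.cong) (simp_all add: turn_weight_turning[OF s] qpow_sum)
  also have "(\<Sum>t<T. \<Sum>c = 1..n. height n c * turning s c t) = (\<Sum>c = 1..n. \<Sum>t<T. height n c * turning s c t)"
    by (rule sum.swap)
  also have "\<dots> = (\<Sum>c = 1..n. 2 * (\<Sum>C\<in>loops \<Gamma> s c. (of_nat c - (of_nat n + 1) / 2) * loop_rot \<Gamma> C))"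
  proof (rule sum.cong[OF refl])
    show "(\<Sum>t<T. height n c * turning s c t) = 2 * (\<Sum>C\<in>loops \<Gamma> s c. (of_nat c - (of_nat n + 1) / 2) * loop_rot \<Gamma> C)" for c
      unfolding sum_distrib_left[symmetric] loops by (simp add: height_def field_simps)
  qed
  also have "\<dots> = 2 * rot n \<Gamma> s"
    unfolding rot_def by (rule sum_distrib_left[symmetric])
  finally show ?thesis .
qed

end

theorem proposition12:
  fixes n :: nat
    and br :: "web_piece diagram \<Rightarrow> laurent"
    and \<Gamma> :: "moy_piece diagram"
  assumes "n \<ge> 2"
    and "web_bracket n br"
    and "moy_diagram n \<Gamma>"
    and "\<forall>C \<in> annuli \<Gamma>. label \<Gamma> C = 1"
  shows "moy_bracket n br \<Gamma> = normalization n \<Gamma> *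
    (\<Sum>s \<in> states n \<Gamma>. qpow (2 * rot n \<Gamma> s) *
      (\<Prod>v \<in> vertices \<Gamma>.
        (- qpow 1) ^ inv_pairs (s (vertex_edge \<Gamma> v 1)) (s (vertex_edge \<Gamma> v 2))))"
proof -
  interpret moy n \<Gamma> by unfold_locales (rule assms(3))
  have "n > 0" using assms(1) by simp
  from moy_bracket_states[OF assms(2) this assms(4)] show ?thesis by (simp add: prod_turn_weight)
qed

end
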